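(* Let $\mathcal Y$ be a finite graph of groups with finite edge groups and $G=\pi_1(\mathcal Y)$. The bijection $\psi\mapsto[L_\psi]$ from regular deployments onto $\mathfrak A(G)$ restricts to a bijection between the set of regular deployments whose image lies in $\coprod_{V}S\mathfrak A(G_V)$ and the subset $S\mathfrak A(G)\subset\mathfrak A(G)$ of classes containing a synchronous automatic structure.
   Context: Automatic structures: for a group $G$ with alphabet $A$ (finite set with involution, map to $G$ respecting inverses with generating image), word metric $d$, paths $w(t)$ (unit speed from $1$ along the word, constant after its end), an asynchronous (synchronous) automatic structure is a regular $L\subset A^*$ with $\bar L=G$ such that for some $K$ all $w,w'\in L$ with $d(\bar w,\bar w')\le1$ stay within distance $K$ after monotone surjective reparametrizations of $[0,\infty)$ (resp. without reparametrizing). $L\sim L'$ iff $L\cup L'$ has the asynchronous property. $\mathfrak A(G)$: classes of asynchronous automatic structures; $S\mathfrak A(G)\subset\mathfrak A(G)$: classes containing a synchronous automatic structure. $g[L]:=[uL]$ for a word $u$ with $\bar u=g$. Graph of groups $\mathcal Y$: finite connected graph $Y$ with oriented edges $E,E^{-1}$, vertex groups $G_V$, finite edge groups $F_E=F_{E^{-1}}$, injections $\partial_0:F_E\to G_{\partial_0E}$, $\partial_1:F_E\to G_{\partial_1E}$; maximal tree $T$, base vertex $V_0$, $t_E$ (stable letter if $E\notin T$, else $1$); normal form $g_0t_{E_1}g_1\cdots t_{E_m}g_m$ ($E_1\cdots E_m$ a path from $V_0$, $g_0\in G_{V_0}$, $g_i\in G_{\partial_1E_i}$, $g_i\notin\partial_1F_{E_i}$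 if $E_{i+1}=E_i^{-1}$). $\widehat{\mathcal Y}$ adds base edge $E_0$ into $V_0$ with trivial group; $\mathcal G_{E_0}=\{1\}$ and for $E\neq E_0$, $\mathcal G_E$ = elements with a normal form having $m\ge1$, $E_m=E$, $g_m\in\partial_1F_E$ (sets treated as disjoint). Convenient alphabet $A$: union of generating alphabets for vertex groups ($A_V$ = letters evaluating into $G_V$) plus letters $t_E$ for $E\notin T$; letters evaluating into $\partial_1F_E$ biject onto it; a unique letter $e$ evaluates to $1$; $t_E$ is empty in words for $E\in T$. Deployment: $\psi:\coprod_E\mathcal G_E\to\coprod_V\mathfrak A(G_V)$ with finite image, $\mathcal G_E\to\mathfrak A(G_{\partial_1E})$, $\psi(h)=\partial_1(f)\psi(h\partial_1(f))$ for $f\in F_E$. Given choices $L_{\psi(h)}\in\psi(h)$ over $A_V$, $L_\psi$ = words $u_0t_{E_1}u_1\cdots t_{E_m}u_m$ with $E_1\cdots E_m$ a path from $V_0$, $u_0\in L_{\psi(1)}$, $u_i\in L_{\psi(\overline{u_0t_{E_1}\cdots t_{E_i}})}$ (element of $\mathcal G_{E_i}$), $\bar u_i\notin\partial_1F_{E_i}$ if $E_{i+1}=E_i^{-1}$. $\psi$ is regular if $L_\psi$ is regular for some (equivalently every) such choice; then $[L_\psi]\in\mathfrak A(G)$, and $\psi\mapsto[L_\psi]$ is a bijection from regular deployments onto $\mathfrak A(G)$. *)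

theory Defs
  imports "HOL-Algebra.Algebra"
begin

definition regular_lang :: "'a set \<Rightarrow> 'a list set \<Rightarrow> bool" where
  "regular_lang A L \<longleftrightarrow>
     (\<exists>(Q::nat set) (q0::nat) (\<delta>::nat \<Rightarrow> 'a \<Rightarrow> nat) (F::nat set).
        finite Q \<and> q0 \<in> Q \<and> F \<subseteq> Q \<and> (\<forall>q\<in>Q. \<forall>a\<in>A. \<delta> q a \<in> Q) \<and>
        L = {w \<in> lists A. foldl \<delta> q0 w \<in> F})"

definition word_eval :: "('x,'b) monoid_scheme \<Rightarrow> ('a \<Rightarrow> 'x) \<Rightarrow> 'a list \<Rightarrow> 'x" where
  "word_eval G ev w = foldr (\<lambda>a x. ev a \<otimes>\<^bsub>G\<^esub> x) w \<one>\<^bsub>G\<^esub>"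

definition is_alphabet :: "('x,'b) monoid_scheme \<Rightarrow> 'a set \<Rightarrow> ('a \<Rightarrow> 'a) \<Rightarrow> ('a \<Rightarrow> 'x) \<Rightarrow> bool" where
  "is_alphabet G A ainv ev \<longleftrightarrow> finite A \<and>
     (\<forall>a\<in>A. ainv a \<in> A \<and> ainv (ainv a) = a \<and> ev a \<in> carrier G \<and> ev (ainv a) = inv\<^bsub>G\<^esub> (ev a)) \<and>
     generate G (ev ` A) = carrier G"

definition word_dist :: "('x,'b) monoid_scheme \<Rightarrow> 'a set \<Rightarrow> ('a \<Rightarrow> 'x) \<Rightarrow> 'x \<Rightarrow> 'x \<Rightarrow> nat" where
  "word_dist G A ev g h = (LEAST n. \<exists>w\<in>lists A. length w = n \<and> g \<otimes>\<^bsub>G\<^esub> word_eval G ev w = h)"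

text \<open>Path w(t) of a word, sampled at integer times (constant after the end of the word).\<close>
definition word_path :: "('x,'b) monoid_scheme \<Rightarrow> ('a \<Rightarrow> 'x) \<Rightarrow> 'a list \<Rightarrow> nat \<Rightarrow> 'x" where
  "word_path G ev w t = word_eval G ev (take t w)"

definition reparam :: "(nat \<Rightarrow> nat) \<Rightarrow> bool" where
  "reparam \<phi> \<longleftrightarrow> mono \<phi> \<and> surj \<phi>"

definition async_fellow :: "('x,'b) monoid_scheme \<Rightarrow> 'a set \<Rightarrow> ('a \<Rightarrow> 'x) \<Rightarrow> nat \<Rightarrow> 'a list \<Rightarrow> 'a list \<Rightarrow> bool" where
  "async_fellow G A ev K w w' \<longleftrightarrow> (\<exists>\<phi> \<phi>'. reparam \<phi> \<and> reparam \<phi>' \<and>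
     (\<forall>n. word_dist G A ev (word_path G ev w (\<phi> n)) (word_path G ev w' (\<phi>' n)) \<le> K))"

definition sync_fellow :: "('x,'b) monoid_scheme \<Rightarrow> 'a set \<Rightarrow> ('a \<Rightarrow> 'x) \<Rightarrow> nat \<Rightarrow> 'a list \<Rightarrow> 'a list \<Rightarrow> bool" where
  "sync_fellow G A ev K w w' \<longleftrightarrow>
     (\<forall>n. word_dist G A ev (word_path G ev w n) (word_path G ev w' n) \<le> K)"

definition async_prop :: "('x,'b) monoid_scheme \<Rightarrow> 'a set \<Rightarrow> ('a \<Rightarrow> 'x) \<Rightarrow> 'a list set \<Rightarrow> bool" where
  "async_prop G A ev L \<longleftrightarrow> (\<exists>K. \<forall>w\<in>L. \<forall>w'\<in>L.
     word_dist G A ev (word_eval G ev w) (word_eval G ev w') \<le> 1 \<longrightarrow> async_fellow G A ev K w w')"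

definition sync_prop :: "('x,'b) monoid_scheme \<Rightarrow> 'a set \<Rightarrow> ('a \<Rightarrow> 'x) \<Rightarrow> 'a list set \<Rightarrow> bool" where
  "sync_prop G A ev L \<longleftrightarrow> (\<exists>K. \<forall>w\<in>L. \<forall>w'\<in>L.
     word_dist G A ev (word_eval G ev w) (word_eval G ev w') \<le> 1 \<longrightarrow> sync_fellow G A ev K w w')"

definition async_aut :: "('x,'b) monoid_scheme \<Rightarrow> 'a set \<Rightarrow> ('a \<Rightarrow> 'x) \<Rightarrow> 'a list set \<Rightarrow> bool" where
  "async_aut G A ev L \<longleftrightarrow> L \<subseteq> lists A \<and> regular_lang A L \<and>
     word_eval G ev ` L = carrier G \<and> async_prop G A ev L"

definition sync_aut :: "('x,'b) monoid_scheme \<Rightarrow> 'a set \<Rightarrow> ('a \<Rightarrow> 'x) \<Rightarrow> 'a list set \<Rightarrow> bool" where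
  "sync_aut G A ev L \<longleftrightarrow> L \<subseteq> lists A \<and> regular_lang A L \<and>
     word_eval G ev ` L = carrier G \<and> sync_prop G A ev L"

definition aclass :: "('x,'b) monoid_scheme \<Rightarrow> 'a set \<Rightarrow> ('a \<Rightarrow> 'x) \<Rightarrow> 'a list set \<Rightarrow> 'a list set set" where
  "aclass G A ev L = {L'. async_aut G A ev L' \<and> async_prop G A ev (L \<union> L')}"

definition AClasses :: "('x,'b) monoid_scheme \<Rightarrow> 'a set \<Rightarrow> ('a \<Rightarrow> 'x) \<Rightarrow> 'a list set set set" where
  "AClasses G A ev = aclass G A ev ` {L. async_aut G A ev L}"

definition SAClasses :: "('x,'b) monoid_scheme \<Rightarrow> 'a set \<Rightarrow> ('a \<Rightarrow> 'x) \<Rightarrow> 'a list set set set" where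
  "SAClasses G A ev = {c \<in> AClasses G A ev. \<exists>L\<in>c. sync_aut G A ev L}"

definition act_class :: "('x,'b) monoid_scheme \<Rightarrow> 'a set \<Rightarrow> ('a \<Rightarrow> 'x) \<Rightarrow> 'x \<Rightarrow> 'a list set set \<Rightarrow> 'a list set set" where
  "act_class G A ev g c = aclass G A ev
     ((\<lambda>w. (SOME u. u \<in> lists A \<and> word_eval G ev u = g) @ w) ` (SOME L. L \<in> c))"

record ('v,'e,'g,'f) gog =
  verts :: "'v set"
  edges :: "'e set"
  erev :: "'e \<Rightarrow> 'e"
  esrc :: "'e \<Rightarrow> 'v"
  etgt :: "'e \<Rightarrow> 'v"
  vgrp :: "'v \<Rightarrow> 'g monoid"
  egrp :: "'e \<Rightarrow> 'f monoid"
  bd0 :: "'e \<Rightarrow> 'f \<Rightarrow> 'g"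
  bd1 :: "'e \<Rightarrow> 'f \<Rightarrow> 'g"
  tree :: "'e set"
  base :: "'v"

definition edge_path :: "('v,'e,'g,'f) gog \<Rightarrow> 'v \<Rightarrow> 'e list \<Rightarrow> bool" where
  "edge_path Y V es \<longleftrightarrow> set es \<subseteq> edges Y \<and> (es \<noteq> [] \<longrightarrow> esrc Y (hd es) = V) \<and>
     (\<forall>i. Suc i < length es \<longrightarrow> esrc Y (es ! Suc i) = etgt Y (es ! i))"

definition path_end :: "('v,'e,'g,'f) gog \<Rightarrow> 'v \<Rightarrow> 'e list \<Rightarrow> 'v" where
  "path_end Y V es = (if es = [] then V else etgt Y (last es))"

definition reduced_path :: "('v,'e,'g,'f) gog \<Rightarrow> 'e list \<Rightarrow> bool" where
  "reduced_path Y es \<longleftrightarrow> (\<forall>i. Suc i < length es \<longrightarrow> es ! Suc i \<noteq> erev Y (es ! i))"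

definition graph_of_groups :: "('v,'e,'g,'f) gog \<Rightarrow> bool" where
  "graph_of_groups Y \<longleftrightarrow>
     finite (verts Y) \<and> finite (edges Y) \<and> base Y \<in> verts Y \<and>
     (\<forall>V\<in>verts Y. group (vgrp Y V)) \<and>
     (\<forall>E\<in>edges Y. erev Y E \<in> edges Y \<and> erev Y (erev Y E) = E \<and> erev Y E \<noteq> E \<and>
        esrc Y E \<in> verts Y \<and> etgt Y E \<in> verts Y \<and> esrc Y (erev Y E) = etgt Y E \<and>
        group (egrp Y E) \<and> finite (carrier (egrp Y E)) \<and> egrp Y (erev Y E) = egrp Y E \<and>
        bd0 Y E \<in> hom (egrp Y E) (vgrp Y (esrc Y E)) \<and> inj_on (bd0 Y E) (carrier (egrp Y E)) \<and>
        bd1 Y E \<in> hom (egrp Y E) (vgrp Y (etgt Y E)) \<and> inj_on (bd1 Y E) (carrier (egrp Y E)) \<and>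
        (\<forall>f\<in>carrier (egrp Y E). bd0 Y (erev Y E) f = bd1 Y E f)) \<and>
     \<comment> \<open>connected\<close>
     (\<forall>V\<in>verts Y. \<exists>es. edge_path Y (base Y) es \<and> path_end Y (base Y) es = V) \<and>
     \<comment> \<open>maximal (= spanning) tree T\<close>
     tree Y \<subseteq> edges Y \<and> (\<forall>E\<in>tree Y. erev Y E \<in> tree Y) \<and>
     (\<forall>V\<in>verts Y. \<forall>W\<in>verts Y. \<exists>!es. set es \<subseteq> tree Y \<and> edge_path Y V es \<and>
        reduced_path Y es \<and> path_end Y V es = W)"

type_synonym ('v,'e,'g) pi1elt = "('v \<times> 'g + 'e) list set"

inductive pi1_rel :: "('v,'e,'g,'f) gog \<Rightarrow> ('v \<times> 'g + 'e) list \<Rightarrow> ('v \<times> 'g + 'e) list \<Rightarrow> bool"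
  for Y :: "('v,'e,'g,'f) gog" where
  refl: "pi1_rel Y w w"
| sym: "pi1_rel Y w w' \<Longrightarrow> pi1_rel Y w' w"
| trans: "pi1_rel Y w w' \<Longrightarrow> pi1_rel Y w' w'' \<Longrightarrow> pi1_rel Y w w''"
| ctx: "pi1_rel Y w w' \<Longrightarrow> pi1_rel Y (u @ w @ v) (u @ w' @ v)"
| vmul: "V \<in> verts Y \<Longrightarrow> g \<in> carrier (vgrp Y V) \<Longrightarrow> h \<in> carrier (vgrp Y V) \<Longrightarrow>
     pi1_rel Y [Inl (V, g), Inl (V, h)] [Inl (V, g \<otimes>\<^bsub>vgrp Y V\<^esub> h)]"
| vone: "V \<in> verts Y \<Longrightarrow> pi1_rel Y [Inl (V, \<one>\<^bsub>vgrp Y V\<^esub>)] []"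
| einv: "E \<in> edges Y \<Longrightarrow> pi1_rel Y [Inr E, Inr (erev Y E)] []"
| etree: "E \<in> tree Y \<Longrightarrow> pi1_rel Y [Inr E] []"
| econj: "E \<in> edges Y \<Longrightarrow> f \<in> carrier (egrp Y E) \<Longrightarrow>
     pi1_rel Y [Inl (esrc Y E, bd0 Y E f), Inr E] [Inr E, Inl (etgt Y E, bd1 Y E f)]"

definition pi1_letters :: "('v,'e,'g,'f) gog \<Rightarrow> ('v \<times> 'g + 'e) set" where
  "pi1_letters Y = {Inl (V, g) | V g. V \<in> verts Y \<and> g \<in> carrier (vgrp Y V)} \<union> Inr ` edges Y"

definition pi1 :: "('v,'e,'g,'f) gog \<Rightarrow> ('v,'e,'g) pi1elt monoid" where
  "pi1 Y = \<lparr> carrier = {{w'. pi1_rel Y w w'} | w. w \<in> lists (pi1_letters Y)},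
            Group.monoid.mult = (\<lambda>P Q. {w. \<exists>x\<in>P. \<exists>z\<in>Q. pi1_rel Y (x @ z) w}),
            Group.monoid.one = {w. pi1_rel Y [] w} \<rparr>"

definition vincl :: "('v,'e,'g,'f) gog \<Rightarrow> 'v \<Rightarrow> 'g \<Rightarrow> ('v,'e,'g) pi1elt" where
  "vincl Y V g = {w. pi1_rel Y [Inl (V, g)] w}"

definition stab :: "('v,'e,'g,'f) gog \<Rightarrow> 'e \<Rightarrow> ('v,'e,'g) pi1elt" where
  "stab Y E = {w. pi1_rel Y [Inr E] w}"

definition is_normal_form :: "('v,'e,'g,'f) gog \<Rightarrow> 'g \<Rightarrow> ('e \<times> 'g) list \<Rightarrow> bool" where
  "is_normal_form Y g0 xs \<longleftrightarrow> edge_path Y (base Y) (map fst xs) \<and>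
     g0 \<in> carrier (vgrp Y (base Y)) \<and>
     (\<forall>(E, g)\<in>set xs. g \<in> carrier (vgrp Y (etgt Y E))) \<and>
     (\<forall>i. Suc i < length xs \<longrightarrow> fst (xs ! Suc i) = erev Y (fst (xs ! i)) \<longrightarrow>
        snd (xs ! i) \<notin> bd1 Y (fst (xs ! i)) ` carrier (egrp Y (fst (xs ! i))))"

definition nf_value :: "('v,'e,'g,'f) gog \<Rightarrow> 'g \<Rightarrow> ('e \<times> 'g) list \<Rightarrow> ('v,'e,'g) pi1elt" where
  "nf_value Y g0 xs = vincl Y (base Y) g0 \<otimes>\<^bsub>pi1 Y\<^esub>
     foldr (\<lambda>(E, g) x. stab Y E \<otimes>\<^bsub>pi1 Y\<^esub> (vincl Y (etgt Y E) g \<otimes>\<^bsub>pi1 Y\<^esub> x)) xs \<one>\<^bsub>pi1 Y\<^esub>"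

definition Gcal :: "('v,'e,'g,'f) gog \<Rightarrow> 'e \<Rightarrow> ('v,'e,'g) pi1elt set" where
  "Gcal Y E = {h. \<exists>g0 xs. is_normal_form Y g0 xs \<and> nf_value Y g0 xs = h \<and> xs \<noteq> [] \<and>
       fst (last xs) = E \<and> snd (last xs) \<in> bd1 Y E ` carrier (egrp Y E)}"

text \<open>Disjoint union of the \<open>\<G>\<^sub>E\<close>, E ranging over the edges of \<open>\<hat>\<Y>\<close>; None stands for the base edge E0.\<close>
definition deploy_dom :: "('v,'e,'g,'f) gog \<Rightarrow> ('e option \<times> ('v,'e,'g) pi1elt) set" where
  "deploy_dom Y = {(None, \<one>\<^bsub>pi1 Y\<^esub>)} \<union> {(Some E, h) | E h. E \<in> edges Y \<and> h \<in> Gcal Y E}"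

definition dtv :: "('v,'e,'g,'f) gog \<Rightarrow> 'e option \<Rightarrow> 'v" where
  "dtv Y x = (case x of None \<Rightarrow> base Y | Some E \<Rightarrow> etgt Y E)"

definition vletters :: "('v,'e,'g,'f) gog \<Rightarrow> 'a set \<Rightarrow> ('a \<Rightarrow> ('v,'e,'g) pi1elt) \<Rightarrow> 'v \<Rightarrow> 'a set" where
  "vletters Y A ev V = {a \<in> A. ev a \<in> vincl Y V ` carrier (vgrp Y V)}"

definition vev :: "('v,'e,'g,'f) gog \<Rightarrow> ('a \<Rightarrow> ('v,'e,'g) pi1elt) \<Rightarrow> 'v \<Rightarrow> 'a \<Rightarrow> 'g" where
  "vev Y ev V a = (THE g. g \<in> carrier (vgrp Y V) \<and> vincl Y V g = ev a)"

definition tword :: "('v,'e,'g,'f) gog \<Rightarrow> ('e \<Rightarrow> 'a) \<Rightarrow> 'e \<Rightarrow> 'a list" where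
  "tword Y tlet E = (if E \<in> tree Y then [] else [tlet E])"

definition convenient_alphabet ::
  "('v,'e,'g,'f) gog \<Rightarrow> 'a set \<Rightarrow> ('a \<Rightarrow> 'a) \<Rightarrow> ('a \<Rightarrow> ('v,'e,'g) pi1elt) \<Rightarrow> ('e \<Rightarrow> 'a) \<Rightarrow> bool" where
  "convenient_alphabet Y A ainv ev tlet \<longleftrightarrow>
     is_alphabet (pi1 Y) A ainv ev \<and>
     (\<forall>V\<in>verts Y. is_alphabet (vgrp Y V) (vletters Y A ev V) ainv (vev Y ev V)) \<and>
     A = (\<Union>V\<in>verts Y. vletters Y A ev V) \<union> tlet ` (edges Y - tree Y) \<and>
     inj_on tlet (edges Y - tree Y) \<and>
     (\<forall>E\<in>edges Y - tree Y. ev (tlet E) = stab Y E \<and> ainv (tlet E) = tlet (erev Y E)) \<and>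
     (\<forall>E\<in>edges Y. bij_betw ev
        {a \<in> A. ev a \<in> vincl Y (etgt Y E) ` bd1 Y E ` carrier (egrp Y E)}
        (vincl Y (etgt Y E) ` bd1 Y E ` carrier (egrp Y E))) \<and>
     (\<exists>!a. a \<in> A \<and> ev a = \<one>\<^bsub>pi1 Y\<^esub>)"

definition deployment ::
  "('v,'e,'g,'f) gog \<Rightarrow> 'a set \<Rightarrow> ('a \<Rightarrow> ('v,'e,'g) pi1elt)
     \<Rightarrow> ('e option \<Rightarrow> ('v,'e,'g) pi1elt \<Rightarrow> 'a list set set) \<Rightarrow> bool" where
  "deployment Y A ev \<psi> \<longleftrightarrow>
     (\<forall>(x, h)\<in>deploy_dom Y. \<psi> x h \<in>
        AClasses (vgrp Y (dtv Y x)) (vletters Y A ev (dtv Y x)) (vev Y ev (dtv Y x))) \<and>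
     (\<forall>x h. (x, h) \<notin> deploy_dom Y \<longrightarrow> \<psi> x h = {}) \<and>
     finite ((\<lambda>(x, h). \<psi> x h) ` deploy_dom Y) \<and>
     (\<forall>E\<in>edges Y. \<forall>h\<in>Gcal Y E. \<forall>f\<in>carrier (egrp Y E).
        \<psi> (Some E) h = act_class (vgrp Y (etgt Y E)) (vletters Y A ev (etgt Y E)) (vev Y ev (etgt Y E))
          (bd1 Y E f) (\<psi> (Some E) (h \<otimes>\<^bsub>pi1 Y\<^esub> vincl Y (etgt Y E) (bd1 Y E f))))"

definition lpsi_ok ::
  "('v,'e,'g,'f) gog \<Rightarrow> ('a \<Rightarrow> ('v,'e,'g) pi1elt) \<Rightarrow> ('e \<Rightarrow> 'a)
     \<Rightarrow> ('e option \<Rightarrow> ('v,'e,'g) pi1elt \<Rightarrow> 'a list set) \<Rightarrow> 'a list \<Rightarrow> ('e \<times> 'a list) list \<Rightarrow> bool" where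
  "lpsi_ok Y ev tlet Lc u0 xs \<longleftrightarrow>
     edge_path Y (base Y) (map fst xs) \<and>
     u0 \<in> Lc None \<one>\<^bsub>pi1 Y\<^esub> \<and>
     (\<forall>i<length xs. snd (xs ! i) \<in> Lc (Some (fst (xs ! i)))
        (word_eval (pi1 Y) ev (u0 @ concat (map (\<lambda>(E, u). tword Y tlet E @ u) (take i xs))
                                 @ tword Y tlet (fst (xs ! i))))) \<and>
     (\<forall>i. Suc i < length xs \<longrightarrow> fst (xs ! Suc i) = erev Y (fst (xs ! i)) \<longrightarrow>
        word_eval (pi1 Y) ev (snd (xs ! i)) \<notin>
          vincl Y (etgt Y (fst (xs ! i))) ` bd1 Y (fst (xs ! i)) ` carrier (egrp Y (fst (xs ! i))))"

definition Lpsi ::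
  "('v,'e,'g,'f) gog \<Rightarrow> ('a \<Rightarrow> ('v,'e,'g) pi1elt) \<Rightarrow> ('e \<Rightarrow> 'a)
     \<Rightarrow> ('e option \<Rightarrow> ('v,'e,'g) pi1elt \<Rightarrow> 'a list set) \<Rightarrow> 'a list set" where
  "Lpsi Y ev tlet Lc = {u0 @ concat (map (\<lambda>(E, u). tword Y tlet E @ u) xs) | u0 xs. lpsi_ok Y ev tlet Lc u0 xs}"

definition regular_deployment ::
  "('v,'e,'g,'f) gog \<Rightarrow> 'a set \<Rightarrow> ('a \<Rightarrow> ('v,'e,'g) pi1elt) \<Rightarrow> ('e \<Rightarrow> 'a)
     \<Rightarrow> ('e option \<Rightarrow> ('v,'e,'g) pi1elt \<Rightarrow> 'a list set set) \<Rightarrow> bool" where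
  "regular_deployment Y A ev tlet \<psi> \<longleftrightarrow> deployment Y A ev \<psi> \<and>
     (\<exists>Lc. (\<forall>(x, h)\<in>deploy_dom Y. Lc x h \<in> \<psi> x h) \<and> regular_lang A (Lpsi Y ev tlet Lc))"

definition deploy_class ::
  "('v,'e,'g,'f) gog \<Rightarrow> 'a set \<Rightarrow> ('a \<Rightarrow> ('v,'e,'g) pi1elt) \<Rightarrow> ('e \<Rightarrow> 'a)
     \<Rightarrow> ('e option \<Rightarrow> ('v,'e,'g) pi1elt \<Rightarrow> 'a list set set) \<Rightarrow> 'a list set set" where
  "deploy_class Y A ev tlet \<psi> = aclass (pi1 Y) A ev (Lpsi Y ev tlet (\<lambda>x h. SOME L. L \<in> \<psi> x h))"

end

theory Submission
 imports Defs "HOL-Library.Sublist"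
begin

text \<open>
 The fundamental group acts on reduced stacks of coset representatives (van der Waerden's trick), and
 an entry coset \<open>Cs \<rho>\<close> consists of the finitely many elements at which a path can enter the part of the
 Bass-Serre tree beyond the stack \<open>\<rho>\<close>. Edge groups are finite, so entry cosets are bottlenecks: a word
 leading beyond \<open>\<rho>\<close> has a prefix with value in \<open>Cs \<rho>\<close>. Two words of \<open>L\<^sub>\<psi>\<close> with neighbouring end
 points therefore fellow-travel up to their last common vertex segment, where the fellow-traveller
 property of the vertex languages takes over; conversely \<open>\<psi>\<close> is recovered from \<open>L\<^sub>\<psi>\<close> by deleting
 prefixes, which gives injectivity.

 If all classes of a regular deployment are synchronous, choose synchronous languages in which words
 with values in a finite set have bounded length, and cross-sections of them modulo the edge groups.
 Two words built from these choices agree literally until their stacks diverge, which makes the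
 resulting language synchronous. It is regular because the class \<open>\<psi>(h)\<close> can be read off the quotient
 of \<open>L\<^sub>\<psi>\<close> by any word with value \<open>h\<close>.

 Conversely let \<open>L\<close> be synchronous. By the bottleneck property vertex groups are quasi-convex for \<open>L\<close>.
 The words of a vertex group that follow the continuations of prefixes of \<open>L\<close> with a constant number of
 letters per letter form synchronous structures, which depend only on the finitely many quotients of
 \<open>L\<close> by words ending in an entry coset. They define the deployment that is mapped to the class of \<open>L\<close>.
\<close>

section \<open>Regular languages\<close>

text \<open>Fellow-traveller constants become finite subsets of the group (\<open>af\<close>,
  \<open>fel\<close>, \<open>sfel\<close>): finiteness survives products, inverses and the passage
  between a vertex group and the fundamental group, and it makes bounded wandering a finite-state
  condition. The reference language in \<open>deploy_class\<close> comes from an arbitrary choice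
  and is never shown to be regular, so the fellow-traveller half of automaticity
  (\<open>apre\<close>) is separated from regularity. Cross-sections are forced by synchronicity:
  with a merely bounded discrepancy in each vertex segment the delays would add up over the number
  of segments, whereas literal agreement of the common parts produces no delay; bounded fibres then
  control what follows. In the converse direction all blocks must have the same length
  \<open>N\<close>, since only then is the new word at time \<open>n\<close> near the old one at
  time \<open>n div N\<close>. A further obstacle is that tree edges have no letters, so that a word
  does not show its stack; states of automata therefore combine a guessed edge with quotients of
  languages.\<close>

definition quot :: "'a list => 'a list set => 'a list set" where
 "quot w L = {v. w @ v : L}"

lemma quot_Nil [simp]: "quot [] L = L"
 and quot_append: "quot (u @ v) L = quot v (quot u L)"
 and quot_iff: "v : quot w L \<longleftrightarrow> w @ v : L"
 by (auto simp: quot_def)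

text \<open>The subset construction over a finite family \<open>\<B>\<close> whose derivatives are
  unions of members: a state is a subfamily and stands for its union. It serves the closure
  properties in which the derivative of a piece breaks up into several pieces.\<close>

lemma regular_UnionI:
 fixes \<B> :: "'a list set set"
 assumes fin: "finite \<B>" and sub: "!!M. M : \<B> ==> M <= lists A"
  and der: "!!M a. M : \<B> ==> a : A ==> \<exists>\<S>\<subseteq>\<B>. quot [a] M = \<Union>\<S>"
  and S0: "\<S>0 <= \<B>"
 shows "regular_lang A (\<Union>\<S>0)"
proof -
 \<comment> \<open>\<open>regular_lang\<close> asks for natural numbers as states, hence this
   encoding of subfamilies.\<close>
 obtain enc :: "'a list set set => nat" where inj: "inj_on enc (Pow \<B>)"
  using finite_imp_inj_to_nat_seg[of "Pow \<B>"] fin by auto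
 have derU: "\<exists>\<T>\<subseteq>\<B>. quot [a] (\<Union>\<S>) = \<Union>\<T>" if "\<S> <= \<B>" "a : A" for \<S> a
 proof -
  have "\<forall>M\<in>\<S>. \<exists>\<T>\<subseteq>\<B>. quot [a] M = \<Union>\<T>" using der that by blast
  then obtain t where t: "!!M. M : \<S> ==> t M <= \<B> & quot [a] M = \<Union>(t M)" by metis
  have "quot [a] (\<Union>\<S>) = (\<Union>M\<in>\<S>. quot [a] M)" by (auto simp: quot_def)
  also have "\<dots> = \<Union>(\<Union>M\<in>\<S>. t M)" using t by auto
  finally show ?thesis using t by (intro exI[of _ "\<Union>M\<in>\<S>. t M"]) auto
 qed
 define nx where "nx \<S> a = (SOME \<T>. \<T> <= \<B> & quot [a] (\<Union>\<S>) = \<Union>\<T>)" for \<S> a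
 have nx: "nx \<S> a <= \<B> & quot [a] (\<Union>\<S>) = \<Union>(nx \<S> a)" if "\<S> <= \<B>" "a : A" for \<S> a
  unfolding nx_def using derU[OF that] by (rule someI_ex)
 define dec where "dec = inv_into (Pow \<B>) enc"
 have dec: "dec (enc \<S>) = \<S>" if "\<S> <= \<B>" for \<S>
  unfolding dec_def using that inj by simp
 define \<delta> where "\<delta> q a = enc (nx (dec q) a)" for q a
 define F where "F = enc ` {\<S>. \<S> <= \<B> & [] : \<Union>\<S>}"
 have run: "foldl \<delta> (enc \<S>) w : F \<longleftrightarrow> w : \<Union>\<S>" if "\<S> <= \<B>" "w : lists A" for \<S> w
  using that
 proof (induction w arbitrary: \<S>)
  case Nil
  have "enc \<S> : F \<longleftrightarrow> [] : \<Union>\<S>"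
   unfolding F_def using Nil(1) inj by (auto simp: inj_on_def image_iff)
  thus ?case by simp
 next
  case (Cons a w)
  hence a: "a : A" "w : lists A" by auto
  have "foldl \<delta> (enc \<S>) (a # w) = foldl \<delta> (enc (nx \<S> a)) w"
   by (simp add: \<delta>_def dec Cons.prems(1))
  hence "foldl \<delta> (enc \<S>) (a # w) : F \<longleftrightarrow> w : \<Union>(nx \<S> a)"
   using Cons.IH[of "nx \<S> a"] nx[OF Cons.prems(1) a(1)] a by simp
  also have "\<dots> \<longleftrightarrow> w : quot [a] (\<Union>\<S>)" using nx[OF Cons.prems(1) a(1)] by simp
  also have "\<dots> \<longleftrightarrow> a # w : \<Union>\<S>" by (simp add: quot_def)
  finally show ?case .
 qed
 have U: "\<Union>\<S>0 = {w : lists A. foldl \<delta> (enc \<S>0) w : F}"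
 proof -
  have "w : lists A" if "w : \<Union>\<S>0" for w using that S0 sub by blast
  thus ?thesis using run[OF S0] by blast
 qed
 have 4: "\<forall>q\<in>enc ` Pow \<B>. \<forall>a\<in>A. \<delta> q a : enc ` Pow \<B>"
  using nx dec by (auto simp: \<delta>_def)
 show ?thesis
  unfolding regular_lang_def
  by (rule exI[of _ "enc ` Pow \<B>"], rule exI[of _ "enc \<S>0"], rule exI[of _ \<delta>], rule exI[of _ F])
   (use fin S0 U 4 in \<open>auto simp: F_def\<close>)
qed

text \<open>Myhill-Nerode. The quotients form a finite family closed under derivatives, so
  \<open>regular_UnionI\<close> applies with singletons; from here on regularity is a count of
  quotients.\<close>

lemma regular_iff:
 "regular_lang A L \<longleftrightarrow> L <= lists A & finite ((%w. quot w L) ` lists A)"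
proof
 assume "regular_lang A L"
 then obtain Q q0 \<delta> F where Q: "finite (Q::nat set)" "q0 : Q" "\<forall>q\<in>Q. \<forall>a\<in>A. \<delta> q a : Q"
  and L: "L = {w : lists A. foldl \<delta> q0 w : F}"
  unfolding regular_lang_def by auto
 have inQ: "foldl \<delta> q w : Q" if "w : lists A" "q : Q" for w q
  using that Q(3) by (induction w arbitrary: q) auto
 have "(%w. quot w L) ` lists A <= (%q. {v : lists A. foldl \<delta> q v : F}) ` Q"
 proof
  fix Xa assume "Xa : (%w. quot w L) ` lists A"
  then obtain w where w: "w : lists A" "Xa = quot w L" by auto
  hence "Xa = {v : lists A. foldl \<delta> (foldl \<delta> q0 w) v : F}"
   by (auto simp: L quot_def)
  thus "Xa : (%q. {v : lists A. foldl \<delta> q v : F}) ` Q" using inQ[OF w(1) Q(2)] by blast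
 qed
 thus "L <= lists A & finite ((%w. quot w L) ` lists A)"
  using Q(1) L finite_surj by blast
next
 assume a: "L <= lists A & finite ((%w. quot w L) ` lists A)"
 let ?B = "(%w. quot w L) ` lists A"
 have "regular_lang A (\<Union>{L})"
 proof (rule regular_UnionI[of ?B])
  show "\<exists>\<S>\<subseteq>?B. quot [x] M = \<Union>\<S>" if M: "M : ?B" and "x : A" for M x
  proof -
   obtain w where w: "w : lists A" "M = quot w L" using M by blast
   hence "quot [x] M = quot (w @ [x]) L" by (simp add: quot_append)
   thus ?thesis using w that by (intro exI[of _ "{quot (w @ [x]) L}"]) auto
  qed
  show "{L} <= ?B" by (auto intro!: image_eqI[of _ _ "[]"])
  show "M <= lists A" if M: "M : ?B" for M
  proof -
   obtain w where w: "w : lists A" "M = quot w L" using M by blast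
   thus ?thesis using a by (auto simp: quot_def)
  qed
 qed (use a in auto)
 thus "regular_lang A L" by simp
qed

lemma regular_subset: "regular_lang A L ==> L <= lists A"
 and regular_finite_quots: "regular_lang A L ==> finite ((%w. quot w L) ` lists A)"
 by (auto simp: regular_iff)

text \<open>Quotients commute with Boolean operations, so a quotient of a combination is a function
  \<open>k\<close> of two quotients; this bounds their number.\<close>

lemma finite_image_by_pair:
 assumes "finite (f ` A)" "finite (g ` A)" "!!x. x : A ==> h x = k (f x) (g x)"
 shows "finite (h ` A)"
proof -
 have "h ` A <= (%(a, b). k a b) ` (f ` A \<times> g ` A)" using assms(3) by auto
 thus ?thesis using assms(1,2) finite_subset by blast
qed

lemma finite_image_by:
 assumes "finite (f ` A)" "!!x. x : A ==> h x = k (f x)"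
 shows "finite (h ` A)"
proof -
 have "h ` A = k ` f ` A" using assms(2) by (force simp: image_iff)
 thus ?thesis using assms(1) by simp
qed

lemma quot_Int: "quot w (L \<inter> M) = quot w L \<inter> quot w M" by (auto simp: quot_def)

lemma regular_Int:
 assumes "regular_lang A L" "regular_lang A M" shows "regular_lang A (L \<inter> M)"
 using assms finite_image_by_pair[of "%w. quot w L" "lists A" "%w. quot w M" "%w. quot w (L \<inter> M)" "(\<inter>)"]
 unfolding regular_iff by (auto simp: quot_Int)

lemma regular_Un:
 assumes "regular_lang A L" "regular_lang A M" shows "regular_lang A (L \<union> M)"
proof -
 have "quot w (L \<union> M) = quot w L \<union> quot w M" for w by (auto simp: quot_def)
 thus ?thesis
  using assms finite_image_by_pair[of "%w. quot w L" "lists A" "%w. quot w M" "%w. quot w (L \<union> M)" "(\<union>)"]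
  unfolding regular_iff by auto
qed

lemma regular_Diff:
 assumes "regular_lang A L" "regular_lang A M" shows "regular_lang A (L - M)"
proof -
 have "quot w (L - M) = quot w L - quot w M" for w by (auto simp: quot_def)
 thus ?thesis
  using assms finite_image_by_pair[of "%w. quot w L" "lists A" "%w. quot w M" "%w. quot w (L - M)" "(-)"]
  unfolding regular_iff by auto
qed

lemma regular_empty [simp]: "regular_lang A {}"
 unfolding regular_iff by (auto simp: quot_def intro: finite_subset[of _ "{{}}"])

lemma regular_lists [simp]: "regular_lang A (lists A)"
proof -
 have "(%w. quot w (lists A)) ` lists A <= {lists A}" by (auto simp: quot_def)
 thus ?thesis unfolding regular_iff using finite_subset by blast
qed

lemma regular_UN:
 assumes "finite I" "!!i. i : I ==> regular_lang A (f i)" shows "regular_lang A (\<Union>i\<in>I. f i)"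
 using assms by (induction I rule: finite_induct) (auto intro: regular_Un)

lemma regular_INT:
 assumes "finite I" "!!i. i : I ==> regular_lang A (f i)" "regular_lang A L"
 shows "regular_lang A (L \<inter> (\<Inter>i\<in>I. f i))"
 using assms
proof (induction I rule: finite_induct)
 case (insert x I)
 have "regular_lang A (L \<inter> (\<Inter>i\<in>I. f i))" "regular_lang A (f x)"
  using insert by blast+
 hence "regular_lang A (f x \<inter> (L \<inter> (\<Inter>i\<in>I. f i)))" using regular_Int by blast
 thus ?case by (simp add: Int_ac)
qed auto

lemma regular_sublists:
 assumes L: "regular_lang A L" and "B <= A" shows "regular_lang B (L \<inter> lists B)"
proof -
 have "finite ((%w. quot w L) ` lists B)"
  using regular_finite_quots[OF L] assms(2) by (meson finite_subset image_mono lists_mono)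
 hence "finite ((%w. quot w (L \<inter> lists B)) ` lists B)"
  by (rule finite_image_by[where k = "%Xa. Xa \<inter> lists B"]) (auto simp: quot_def)
 thus ?thesis unfolding regular_iff by auto
qed

lemma regular_mono_alphabet:
 assumes L: "regular_lang B L" and "B <= A" shows "regular_lang A L"
proof -
 have "quot w L : insert {} ((%w. quot w L) ` lists B)" if "w : lists A" for w
 proof (cases "w : lists B")
  case False
  hence "quot w L = {}" using regular_subset[OF L] by (auto simp: quot_def)
  thus ?thesis by simp
 qed auto
 hence "(%w. quot w L) ` lists A <= insert {} ((%w. quot w L) ` lists B)" by auto
 moreover have "L <= lists A" using regular_subset[OF L] assms(2) lists_mono by blast
 ultimately show ?thesis using regular_finite_quots[OF L]
  unfolding regular_iff by (meson finite.insertI finite_subset)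
qed

text \<open>Lets the label of an automaton prescribe which quotient of \<open>q\<close> is reached
  after an additional word \<open>t\<close>, here the letter of an edge.\<close>

lemma regular_quot_eq:
 assumes L: "regular_lang A q" and t: "t : lists A"
 shows "regular_lang A {v : lists A. quot (v @ t) q = q'}"
proof -
 have "quot w {v : lists A. quot (v @ t) q = q'} = {v : lists A. quot (v @ t) (quot w q) = q'}"
  if "w : lists A" for w
  using that by (auto simp: quot_def)
 hence "finite ((%w. quot w {v : lists A. quot (v @ t) q = q'}) ` lists A)"
  by (rule finite_image_by[OF regular_finite_quots[OF L]])
 thus ?thesis unfolding regular_iff by auto
qed

lemma regular_quot: "regular_lang A L ==> w : lists A ==> regular_lang A (quot w L)"
proof -
 assume L: "regular_lang A L" and w: "w : lists A"
 have "(%v. quot v (quot w L)) ` lists A <= (%v. quot v L) ` lists A"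
  using w by (force simp: quot_append[symmetric])
 moreover have "quot w L <= lists A" using regular_subset[OF L] by (auto simp: quot_def)
 ultimately show ?thesis unfolding regular_iff using finite_subset[OF _ regular_finite_quots[OF L]] by simp
qed

lemma regular_hom_inverse:
 assumes L: "regular_lang A L" and \<alpha>: "!!p. p : P ==> \<alpha> p : lists A"
 shows "regular_lang P {z : lists P. concat (map \<alpha> z) : L}"
proof -
 have cl: "concat (map \<alpha> z) : lists A" if "z : lists P" for z
  using that \<alpha> by (induction z) auto
 have "quot w {z : lists P. concat (map \<alpha> z) : L} = {z : lists P. concat (map \<alpha> z) : quot (concat (map \<alpha> w)) L}"
  if "w : lists P" for w
  using that by (auto simp: quot_def)
 moreover have "finite ((%w. quot (concat (map \<alpha> w)) L) ` lists P)"
  using cl by (intro finite_subset[OF _ regular_finite_quots[OF L]]) auto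
 ultimately have "finite ((%w. quot w {z : lists P. concat (map \<alpha> z) : L}) ` lists P)"
  using finite_image_by[of "%w. quot (concat (map \<alpha> w)) L" "lists P"
    "%w. quot w {z : lists P. concat (map \<alpha> z) : L}" "%Xa. {z : lists P. concat (map \<alpha> z) : Xa}"]
  by blast
 thus ?thesis unfolding regular_iff by auto
qed

text \<open>Isolates the first letter with non-empty image; \<open>z1\<close> consists of erased
  letters, which a derivative of the image has to skip.\<close>

lemma concat_map_eq_Cons:
 assumes "concat (map \<beta> z) = a # v"
 shows "\<exists>z1 b z2 y. z = z1 @ b # z2 & (\<forall>c\<in>set z1. \<beta> c = []) & \<beta> b = a # y & v = y @ concat (map \<beta> z2)"
 using assms
proof (induction z)
 case (Cons c z)
 show ?case
 proof (cases "\<beta> c")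
  case Nil
  then obtain z1 b z2 y where "z = z1 @ b # z2" "\<forall>c\<in>set z1. \<beta> c = []" "\<beta> b = a # y" "v = y @ concat (map \<beta> z2)"
   using Cons by auto
  thus ?thesis using Nil by (intro exI[of _ "c # z1"] exI[of _ b] exI[of _ z2] exI[of _ y]) auto
 next
  case (Cons a' y)
  thus ?thesis using Cons.prems
   by (intro exI[of _ "[]"] exI[of _ c] exI[of _ z] exI[of _ y]) auto
 qed
qed auto

text \<open>A partial run is described by the unread rest \<open>x\<close> of the image of the last
  letter and by the quotient of \<open>L\<close> reached, both from finite sets. Erased letters make
  a derivative a union of such pieces rather than a single one, which is why
  \<open>regular_UnionI\<close> is used.\<close>

lemma regular_hom_image:
 assumes L: "regular_lang P L" and P: "finite P" and \<beta>: "!!p. p : P ==> \<beta> p : lists B"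
 shows "regular_lang B ((%z. concat (map \<beta> z)) ` L)"
proof -
 define h where "h z = concat (map \<beta> z)" for z
 define pc where "pc = (%(x, M). (%z. x @ h z) ` M)"
 define Sx where "Sx = insert [] (\<Union>p\<in>P. set (suffixes (\<beta> p)))"
 define Q where "Q = (%w. quot w L) ` lists P"
 have fin: "finite Sx" "finite Q" using P regular_finite_quots[OF L] by (auto simp: Sx_def Q_def)
 have hB: "h z : lists B" if "z : lists P" for z
  using that \<beta> by (induction z) (auto simp: h_def)
 have QP: "M <= lists P" if "M : Q" for M
  using that regular_subset[OF L] by (auto simp: Q_def quot_def)
 have SB: "x : lists B" if "x : Sx" for x
  using that \<beta> by (auto simp: Sx_def suffix_def) (metis Un_iff in_listsD set_append)
 have "regular_lang B (\<Union>{pc ([], L)})"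
 proof (rule regular_UnionI[of "pc ` (Sx \<times> Q)"])
  show "M <= lists B" if "M : pc ` (Sx \<times> Q)" for M
   using that SB QP hB by (fastforce simp: pc_def)
  have "[] : Sx" "L : Q" by (auto simp: Sx_def Q_def intro: image_eqI[of _ _ "[]"])
  thus "{pc ([], L)} <= pc ` (Sx \<times> Q)" by blast
  show "\<exists>\<S>\<subseteq>pc ` (Sx \<times> Q). quot [a] M = \<Union>\<S>" if M: "M : pc ` (Sx \<times> Q)" and a: "a : B" for M a
  proof -
   obtain x N where xN: "x : Sx" "N : Q" "M = pc (x, N)" using M by auto
   obtain w where w: "w : lists P" "N = quot w L" using xN by (auto simp: Q_def)
   show ?thesis
   proof (cases x)
    case (Cons b y)
    have ySx: "y : Sx" using xN(1) Cons by (auto simp: Sx_def dest: suffix_ConsD)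
    show ?thesis
    proof (cases "b = a")
     case True
     hence "quot [a] M = pc (y, N)" using xN Cons by (auto simp: quot_def pc_def)
     thus ?thesis using ySx xN by (intro exI[of _ "{pc (y, N)}"]) auto
    next
     case False
     hence "quot [a] M = {}" using xN Cons by (auto simp: quot_def pc_def)
     thus ?thesis by (intro exI[of _ "{}"]) auto
    qed
   next
    case Nil
    define \<S> where "\<S> = {pc (y, quot (z1 @ [b]) N) | y z1 b. z1 : lists P & b : P & (\<forall>c\<in>set z1. \<beta> c = []) & \<beta> b = a # y}"
    have sub: "\<S> <= pc ` (Sx \<times> Q)"
    proof
     fix Xa assume "Xa : \<S>"
     then obtain y z1 b where Xa: "Xa = pc (y, quot (z1 @ [b]) N)" "z1 : lists P" "b : P" "\<beta> b = a # y"
      by (auto simp: \<S>_def)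
     have "quot (z1 @ [b]) N = quot (w @ z1 @ [b]) L" using w by (simp add: quot_append)
     hence "quot (z1 @ [b]) N : Q" unfolding Q_def using w Xa by (intro image_eqI[of _ _ "w @ z1 @ [b]"]) auto
     moreover have "y : Sx" using Xa(3,4) by (auto simp: Sx_def suffix_def intro!: bexI[of _ b])
     ultimately show "Xa : pc ` (Sx \<times> Q)" using Xa(1) by blast
    qed
    have "quot [a] M = \<Union>\<S>"
    proof (intro equalityI subsetI)
     fix v assume "v : quot [a] M"
     then obtain z where z: "z : N" "a # v = h z" using xN Nil by (auto simp: quot_def pc_def)
     then obtain z1 b z2 y where d: "z = z1 @ b # z2" "\<forall>c\<in>set z1. \<beta> c = []" "\<beta> b = a # y" "v = y @ h z2"
      using concat_map_eq_Cons[of \<beta> z a v] by (auto simp: h_def)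
     have "z : lists P" using z QP xN by auto
     hence "pc (y, quot (z1 @ [b]) N) : \<S>" using d by (auto simp: \<S>_def)
     moreover have "v : pc (y, quot (z1 @ [b]) N)" using d z by (auto simp: pc_def quot_def)
     ultimately show "v : \<Union>\<S>" by blast
    next
     fix v assume "v : \<Union>\<S>"
     then obtain y z1 b where Xa: "v : pc (y, quot (z1 @ [b]) N)" "\<forall>c\<in>set z1. \<beta> c = []" "\<beta> b = a # y"
      by (auto simp: \<S>_def)
     then obtain z2 where z2: "z1 @ b # z2 : N" "v = y @ h z2" by (auto simp: pc_def quot_def)
     have "concat (map \<beta> z1) = []" using Xa(2) by auto
     hence "h (z1 @ b # z2) = a # v" using Xa z2 by (simp add: h_def)
     thus "v : quot [a] M" using xN Nil z2 by (force simp: quot_def pc_def)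
    qed
    thus ?thesis using sub by blast
   qed
  qed
 qed (use fin in auto)
 thus ?thesis by (simp add: pc_def h_def)
qed

section \<open>Finite-state walks, transductions and labelled graphs\<close>

fun walk :: "('s => 'p => 's) => 's set => 's set => 's => 'p list => bool" where
 "walk st S Fn s [] \<longleftrightarrow> s : S & s : Fn"
| "walk st S Fn s (a # z) \<longleftrightarrow> s : S & walk st S Fn (st s a) z"

text \<open>Only the finite set \<open>S\<close> supplies states: the step function may act on an
  infinite set, and a run is rejected as soon as it leaves \<open>S\<close>. In this way group
  elements serve as states.\<close>

lemma regular_walk:
 assumes "finite S"
 shows "regular_lang P {z : lists P. walk st S Fn s z}"
proof -
 define W where "W s = {z : lists P. walk st S Fn s z}" for s
 have out: "W s = {}" if "s \<notin> S" for s
 proof -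
  have "\<not> walk st S Fn s z" for z using that by (cases z) auto
  thus ?thesis by (simp add: W_def)
 qed
 have "regular_lang P (\<Union>{W s})"
 proof (rule regular_UnionI[of "insert {} (W ` S)"])
  show "\<exists>\<S>\<subseteq>insert {} (W ` S). quot [a] M = \<Union>\<S>" if M: "M : insert {} (W ` S)" and a: "a : P" for M a
  proof (cases "M = {}")
   case True
   thus ?thesis by (intro exI[of _ "{}"]) (auto simp: quot_def)
  next
   case False
   then obtain s where s: "s : S" "M = W s" using M by auto
   hence "quot [a] M = W (st s a)" using a by (auto simp: quot_def W_def)
   thus ?thesis using out by (intro exI[of _ "{W (st s a)}"]) auto
  qed
  show "{W s} <= insert {} (W ` S)" using out by auto
 qed (use assms in \<open>auto simp: W_def\<close>)
 thus ?thesis by (simp add: W_def)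
qed

text \<open>Every finite-state transduction has this form: a word over an auxiliary alphabet is read
 both as an input word and as an output word, under a finite-state side condition.\<close>

lemma regular_transduction:
 assumes L: "regular_lang A L" and P: "finite P" and \<alpha>: "!!p. p : P ==> \<alpha> p : lists A"
  and \<beta>: "!!p. p : P ==> \<beta> p : lists B" and Z: "regular_lang P Z"
 shows "regular_lang B {concat (map \<beta> z) | z. z : lists P & concat (map \<alpha> z) : L & z : Z}"
proof -
 have "regular_lang B ((%z. concat (map \<beta> z)) ` ({z : lists P. concat (map \<alpha> z) : L} \<inter> Z))"
  by (rule regular_hom_image[OF regular_Int[OF regular_hom_inverse[OF L] Z] P]) (use \<alpha> \<beta> in auto)
 also have "(%z. concat (map \<beta> z)) ` ({z : lists P. concat (map \<alpha> z) : L} \<inter> Z)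
  = {concat (map \<beta> z) | z. z : lists P & concat (map \<alpha> z) : L & z : Z}" by auto
 finally show ?thesis .
qed

text \<open>Generalized automata: a step from \<open>s\<close> to \<open>s'\<close> reads any word
  of the language \<open>Lab s s'\<close>, and the run ends with a word of \<open>Fin s\<close>.
  Here a step is a vertex segment followed by the letter of an edge.\<close>

inductive_set paths :: "('s => 's => 'a list set) => ('s => 'a list set) => 's set => ('s \<times> 'a list) set"
 for Lab Fin \<Sigma> where
 final: "s : \<Sigma> ==> w : Fin s ==> (s, w) : paths Lab Fin \<Sigma>"
| step: "s : \<Sigma> ==> u : Lab s s' ==> (s', w) : paths Lab Fin \<Sigma> ==> (s, u @ w) : paths Lab Fin \<Sigma>"

lemma paths_state: "(s, w) : paths Lab Fin \<Sigma> ==> s : \<Sigma>"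
 by (cases rule: paths.cases) auto

text \<open>The derivatives are unions of derivatives of final languages (\<open>BF\<close>) and of
  products of a derivative of a label with the path language of its target (\<open>BL\<close>).
  Regularity of the labels makes both families finite.\<close>

lemma regular_paths:
 assumes fin: "finite \<Sigma>" and Lab: "!!s s'. s : \<Sigma> ==> s' : \<Sigma> ==> regular_lang A (Lab s s')"
  and Fin: "!!s. s : \<Sigma> ==> regular_lang A (Fin s)" and s0: "s0 : \<Sigma>"
 shows "regular_lang A {w. (s0, w) : paths Lab Fin \<Sigma>}"
proof -
 define P where "P s = {w. (s, w) : paths Lab Fin \<Sigma>}" for s
 define conc :: "'b list set => 'b list set => 'b list set" where
  "conc M N = {u @ w | u w. u : M & w : N}" for M N
 have concI: "x : conc M N" if "u : M" "w : N" "x = u @ w" for u w x M N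
  using that unfolding conc_def by blast
 have PA: "w : lists A" if "(s, w) : paths Lab Fin \<Sigma>" for s w
  using that
 proof (induction rule: paths.induct)
  case (final s w)
  thus ?case using Fin regular_subset by blast
 next
  case (step s u s' w)
  thus ?case using Lab[of s s'] paths_state[of s' w] regular_subset by (metis append_in_lists_conv subsetD)
 qed
 define BF where "BF = (\<Union>s\<in>\<Sigma>. (%w. quot w (Fin s)) ` lists A)"
 define BL where "BL = (\<Union>s\<in>\<Sigma>. \<Union>s'\<in>\<Sigma>. (%w. conc (quot w (Lab s s')) (P s')) ` lists A)"
 have finBL: "finite BL"
 proof -
  have "(%w. conc (quot w (Lab s s')) (P s')) ` lists A = (%M. conc M (P s')) ` (%w. quot w (Lab s s')) ` lists A" for s s'
   by (auto simp: image_image)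
  thus ?thesis unfolding BL_def using regular_finite_quots[OF Lab] fin by (auto intro!: finite_imageI)
 qed
 have finBF: "finite BF" unfolding BF_def using regular_finite_quots Fin fin by auto
 have unfoldP: "P s = Fin s \<union> (\<Union>s'\<in>\<Sigma>. conc (Lab s s') (P s'))" if "s : \<Sigma>" for s
 proof (intro equalityI subsetI)
  fix w assume "w : P s"
  hence "(s, w) : paths Lab Fin \<Sigma>" by (simp add: P_def)
  thus "w : Fin s \<union> (\<Union>s'\<in>\<Sigma>. conc (Lab s s') (P s'))"
  proof cases
   case (step u s' w')
   hence "w : conc (Lab s s') (P s')" by (intro concI[of u _ w']) (auto simp: P_def)
   thus ?thesis using paths_state[OF step(4)] by blast
  qed auto
 next
  fix w assume "w : Fin s \<union> (\<Union>s'\<in>\<Sigma>. conc (Lab s s') (P s'))"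
  thus "w : P s" using that by (auto simp: conc_def P_def intro: paths.intros)
 qed
 have derF: "quot [a] M : BF" if "M : BF" "a : A" for M a
 proof -
  obtain s w where "s : \<Sigma>" "w : lists A" "M = quot w (Fin s)" using \<open>M : BF\<close> by (auto simp: BF_def)
  thus ?thesis using that(2) unfolding BF_def
   by (intro UN_I[of s]) (auto simp: quot_append[symmetric])
 qed
 have LB: "conc (quot w (Lab s s')) (P s') : BL" if "s : \<Sigma>" "s' : \<Sigma>" "w : lists A" for s s' w
  using that by (auto simp: BL_def)
 text \<open>A derivative can pass through empty labels, so it is computed by recursion on the path.\<close>
 have derP: "\<exists>\<S>\<subseteq>BF \<union> BL. \<Union>\<S> <= quot [a] (P s) & v : \<Union>\<S>"
  if "(s, aw) : paths Lab Fin \<Sigma>" "aw = a # v" "a : A" for s aw a v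
  using that
 proof (induction arbitrary: v rule: paths.induct)
  case (final s w)
  have "quot [a] (Fin s) <= quot [a] (P s)" using unfoldP[OF final(1)] by (auto simp: quot_def)
  moreover have "quot [a] (Fin s) : BF" unfolding BF_def using final by (intro UN_I[of s]) auto
  ultimately show ?case using final by (intro exI[of _ "{quot [a] (Fin s)}"]) (auto simp: quot_def)
 next
  case (step s u s' w)
  note s' = paths_state[OF step(3)]
  show ?case
  proof (cases u)
   case Nil
   then obtain \<S> where "\<S> <= BF \<union> BL" "\<Union>\<S> <= quot [a] (P s')" "v : \<Union>\<S>" using step by auto
   moreover have "P s' <= P s" using unfoldP[OF step(1)] s' step(2) Nil by (force simp: conc_def)
   ultimately show ?thesis by (intro exI[of _ \<S>]) (auto simp: quot_def)
  next
   case (Cons b u')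
   hence b: "b = a" "v = u' @ w" using step by auto
   let ?Xa = "conc (quot [a] (Lab s s')) (P s')"
   have "?Xa <= quot [a] (conc (Lab s s') (P s'))" 
   proof
    fix x assume "x : ?Xa"
    then obtain u1 w1 where "x = u1 @ w1" "a # u1 : Lab s s'" "w1 : P s'"
     by (auto simp: conc_def quot_def)
    hence "a # x : conc (Lab s s') (P s')" by (intro concI[of "a # u1" _ w1]) auto
    thus "x : quot [a] (conc (Lab s s') (P s'))" by (simp add: quot_def)
   qed
   hence "?Xa <= quot [a] (P s)" using unfoldP[OF step(1)] s' by (auto simp: quot_def)
   moreover have "v : ?Xa" using b Cons step by (intro concI[of u' _ w]) (auto simp: quot_def P_def)
   moreover have "?Xa : BL" using LB[of s s' "[a]"] step s' by auto
   ultimately show ?thesis by (intro exI[of _ "{?Xa}"]) auto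
  qed
 qed
 have derP': "\<exists>\<S>\<subseteq>BF \<union> BL. quot [a] (P s) = \<Union>\<S>" if "a : A" for a s
 proof -
  define \<S> where "\<S> = {Xa : BF \<union> BL. Xa <= quot [a] (P s)}"
  have "v : \<Union>\<S>" if "v : quot [a] (P s)" for v
   using derP[of s "a # v" a v] that \<open>a : A\<close> by (auto simp: quot_def P_def \<S>_def)
  hence "quot [a] (P s) = \<Union>\<S>" by (auto simp: \<S>_def)
  thus ?thesis by (intro exI[of _ \<S>]) (auto simp: \<S>_def)
 qed
 have "regular_lang A (\<Union>{P s0})"
 proof (rule regular_UnionI[of "BF \<union> BL \<union> P ` \<Sigma>"])
  show "M <= lists A" if M: "M : BF \<union> BL \<union> P ` \<Sigma>" for M
  proof -
   have "M <= lists A" if "M : BF"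
    using that regular_subset[OF regular_quot[OF Fin]] unfolding BF_def by blast
   moreover have "M <= lists A" if "M : BL"
   proof -
    obtain s s' w where *: "s : \<Sigma>" "s' : \<Sigma>" "M = conc (quot w (Lab s s')) (P s')"
     using \<open>M : BL\<close> by (auto simp: BL_def)
    have "u @ v : lists A" if "w @ u : Lab s s'" "(s', v) : paths Lab Fin \<Sigma>" for u v
     using regular_subset[OF Lab[OF *(1,2)]] that PA[OF that(2)] by auto
    thus ?thesis using * by (auto simp only: conc_def quot_def P_def mem_Collect_eq)
   qed
   moreover have "M <= lists A" if "M : P ` \<Sigma>" using that PA by (auto simp: P_def)
   ultimately show ?thesis using M by blast
  qed
  show "\<exists>\<S>\<subseteq>BF \<union> BL \<union> P ` \<Sigma>. quot [a] M = \<Union>\<S>" if M: "M : BF \<union> BL \<union> P ` \<Sigma>" and a: "a : A" for M a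
  proof -
   consider "M : BF" | "M : BL" | "M : P ` \<Sigma>" using M by blast
   thus ?thesis
   proof cases
    case 1
    thus ?thesis using derF[OF 1 a] by (intro exI[of _ "{quot [a] M}"]) auto
   next
    case 2
    then obtain s s' w where *: "s : \<Sigma>" "s' : \<Sigma>" "w : lists A" "M = conc (quot w (Lab s s')) (P s')"
     by (auto simp: BL_def)
    obtain \<S> where \<S>: "\<S> <= BF \<union> BL" "quot [a] (P s') = \<Union>\<S>" using derP'[OF a] by blast
    let ?Xa = "conc (quot (w @ [a]) (Lab s s')) (P s')"
    have Xa: "?Xa : BL" using LB[of s s' "w @ [a]"] * a by auto
    \<comment> \<open>The label may be exhausted exactly at this point; the next letter then belongs
      to the path language of \<open>s'\<close>.\<close>
    have "quot [a] M = ?Xa \<union> (if w : Lab s s' then quot [a] (P s') else {})"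
    proof (intro equalityI subsetI)
     fix v assume "v : quot [a] M"
     then obtain u1 u2 where u: "a # v = u1 @ u2" "w @ u1 : Lab s s'" "u2 : P s'"
      using * by (auto simp: quot_def conc_def)
     thus "v : ?Xa \<union> (if w : Lab s s' then quot [a] (P s') else {})"
      by (cases u1) (auto simp: quot_def conc_def)
    next
     fix v assume v: "v : ?Xa \<union> (if w : Lab s s' then quot [a] (P s') else {})"
     consider u1 u2 where "v = u1 @ u2" "w @ a # u1 : Lab s s'" "u2 : P s'"
      | "w : Lab s s'" "a # v : P s'"
      using v by (auto simp: quot_def conc_def split: if_splits)
     thus "v : quot [a] M"
     proof cases
      case 1
      hence "a # v : M" unfolding *(4) by (intro concI[of "a # u1" _ u2]) (auto simp: quot_def)
      thus ?thesis by (simp add: quot_def)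
     next
      case 2
      hence "a # v : M" unfolding *(4) by (intro concI[of "[]" _ "a # v"]) (auto simp: quot_def)
      thus ?thesis by (simp add: quot_def)
     qed
    qed
    thus ?thesis using Xa \<S>
     by (intro exI[of _ "insert ?Xa (if w : Lab s s' then \<S> else {})"]) auto
   next
    case 3
    then obtain s where "M = P s" by auto
    then obtain \<S> where "\<S> <= BF \<union> BL" "quot [a] M = \<Union>\<S>" using derP'[OF a, of s] by blast
    thus ?thesis by (intro exI[of _ \<S>]) auto
   qed
  qed
 qed (use finBF finBL fin s0 in auto)
 thus ?thesis by (simp add: P_def)
qed

section \<open>Fellow travelling in a lettered group\<close>

locale lettered_group = group G for G :: "('x, 'm) monoid_scheme" (structure) +
 fixes A :: "'a set" and ev :: "'a => 'x"
 assumes ev_closed [simp]: "a : A ==> ev a : carrier G" and finite_A: "finite A"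
begin

abbreviation val :: "'a list => 'x" where "val \<equiv> word_eval G ev"

lemma val_Nil [simp]: "val [] = \<one>" and val_Cons [simp]: "val (a # w) = ev a \<otimes> val w"
 by (simp_all add: word_eval_def)

lemma val_closed [simp]: "w : lists A ==> val w : carrier G"
 by (induction w) auto

lemma val_append [simp]: "u : lists A ==> v : lists A ==> val (u @ v) = val u \<otimes> val v"
 by (induction u) (auto simp: m_assoc)

lemma prefix_lists: "prefix u v ==> v : lists A ==> u : lists A"
 by (auto simp: prefix_def)

lemma inv_cancel1: "x : carrier G ==> y : carrier G ==> inv x \<otimes> (x \<otimes> y) = y"
 and inv_cancel2: "x : carrier G ==> y : carrier G ==> x \<otimes> (inv x \<otimes> y) = y"
 by (simp_all add: m_assoc[symmetric])

lemmas grp_simps = m_assoc inv_mult_group inv_cancel1 inv_cancel2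

lemma inv_mult_eq_iff:
 "x : carrier G ==> y : carrier G ==> z : carrier G ==> inv x \<otimes> y = z \<longleftrightarrow> y = x \<otimes> z"
 using inv_solve_left by force

lemma finite_set_mult: "finite S ==> finite T ==> finite (S <#> T)"
 by (simp add: set_mult_def)

lemma set_multI: "s : S ==> t : T ==> s \<otimes> t : S <#> T"
 by (auto simp: set_mult_def)

text \<open>The paths of \<open>u\<close> from \<open>\<one>\<close> and of \<open>v\<close> from \<open>x\<close> can be traversed, one letter of one of the words
 at a time, so that all differences of the positions reached lie in \<open>S\<close>.\<close>

inductive af :: "'x set => 'x => 'a list => 'a list => bool" for S where
 af_Nil: "x : S ==> x : carrier G ==> af S x [] []"
| af_left: "x : S ==> x : carrier G ==> a : A ==> af S (inv (ev a) \<otimes> x) u v ==> af S x (a # u) v"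
| af_right: "x : S ==> x : carrier G ==> a : A ==> af S (x \<otimes> ev a) u v ==> af S x u (a # v)"

lemma afD:
 assumes "af S x u v" shows "x : S" "x : carrier G" "u : lists A" "v : lists A"
 using assms by (induction) auto

lemma af_mono: "af S x u v ==> S <= T ==> af T x u v"
 by (induction rule: af.induct) (auto intro: af.intros)

lemma af_carrier: "af S x u v ==> af (S \<inter> carrier G) x u v"
 by (induction rule: af.induct) (auto intro: af.intros)

text \<open>The second traversal starts at the difference at which the first one ends.\<close>

lemma af_append:
 assumes "af S x u v" "af S (inv (val u) \<otimes> (x \<otimes> val v)) u' v'"
 shows "af S x (u @ u') (v @ v')"
 using assms
proof (induction rule: af.induct)
 case (af_left x a u v)
 have "inv (val u) \<otimes> ((inv (ev a) \<otimes> x) \<otimes> val v) = inv (val (a # u)) \<otimes> (x \<otimes> val v)"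
  using af_left afD[OF af_left(4)] by (simp add: grp_simps)
 thus ?case using af_left by (auto intro: af.af_left)
next
 case (af_right x a u v)
 have "inv (val u) \<otimes> ((x \<otimes> ev a) \<otimes> val v) = inv (val u) \<otimes> (x \<otimes> val (a # v))"
  using af_right afD[OF af_right(4)] by (simp add: grp_simps)
 thus ?case using af_right by (auto intro: af.af_right)
qed auto

lemma af_sym: "af S x u v ==> af (m_inv G ` S) (inv x) v u"
proof (induction rule: af.induct)
 case (af_left x a u v)
 have "inv (inv (ev a) \<otimes> x) = inv x \<otimes> ev a" using af_left by (simp add: grp_simps)
 thus ?case using af_left by (intro af.af_right) auto
next
 case (af_right x a u v)
 have "inv (x \<otimes> ev a) = inv (ev a) \<otimes> inv x" using af_right by (simp add: grp_simps)
 thus ?case using af_right by (intro af.af_left) auto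
qed (auto intro: af.intros)

text \<open>The middle word \<open>v\<close> is read by both traversals at once, so its letters
  cancel in the product of the two differences; a letter of an outer word is read by one traversal
  while the other waits. Either of them may move, hence the induction on the total length.\<close>

lemma af_trans:
 assumes "af S x u v" "af T y v w" shows "af (S <#> T) (x \<otimes> y) u w"
 using assms
proof (induction "length u + length v + length w" arbitrary: x y u v w rule: less_induct)
 case less
 have xy: "x : carrier G" "y : carrier G" "x \<otimes> y : S <#> T" "x \<otimes> y : carrier G"
  using afD[OF less(2)] afD[OF less(3)] by (auto intro: set_multI)
 note aff = less(2)
 from less(2) show ?case
 proof cases
  case af_Nil
  from less(3) show ?thesis
  proof cases
   case (af_right a w')
   have "af (S <#> T) (x \<otimes> (y \<otimes> ev a)) u w'"
    by (rule less(1)[OF _ aff]) (use af_right in auto)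
   thus ?thesis using af_right xy by (auto intro!: af.af_right simp: m_assoc)
  qed (use af_Nil xy in \<open>auto intro: af.af_Nil\<close>)
 next
  case (af_left a u')
  have "af (S <#> T) ((inv (ev a) \<otimes> x) \<otimes> y) u' w"
   by (rule less(1)[OF _ af_left(5) less(3)]) (use af_left in auto)
  thus ?thesis using af_left xy by (auto intro!: af.af_left simp: m_assoc)
 next
  case (af_right a v')
  from less(3) show ?thesis
  proof cases
   case af_Nil
   thus ?thesis using \<open>v = a # v'\<close> by simp
  next
   case (af_left b v'')
   hence b: "b = a" "v'' = v'" using af_right by auto
   have "af (S <#> T) ((x \<otimes> ev a) \<otimes> (inv (ev a) \<otimes> y)) u w"
    by (rule less(1)[OF _ af_right(5)]) (use af_left b af_right in auto)
   thus ?thesis using xy af_right by (simp add: grp_simps)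
  next
   case (af_right b w')
   have "af (S <#> T) (x \<otimes> (y \<otimes> ev b)) u w'"
    by (rule less(1)[OF _ aff]) (use af_right in auto)
   thus ?thesis using af_right xy by (auto intro!: af.af_right simp: m_assoc)
  qed
 qed
qed

section \<open>Elementary traversals and the deletion of prefixes\<close>

definition step_set :: "'x set" where
 "step_set = insert \<one> ((%a. inv (ev a)) ` A)"

lemma finite_step_set: "finite step_set"
 by (simp add: step_set_def finite_A)

lemma af_refl: "u : lists A ==> af step_set \<one> u u"
proof (induction u)
 case Nil
 thus ?case by (auto intro: af.af_Nil simp: step_set_def)
next
 case (Cons a u)
 have "af step_set (inv (ev a) \<otimes> \<one> \<otimes> ev a) u u" using Cons by (simp add: grp_simps)
 hence "af step_set (inv (ev a) \<otimes> \<one>) u (a # u)"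
  using Cons by (intro af.af_right) (auto simp: step_set_def)
 thus ?case using Cons by (intro af.af_left) (auto simp: step_set_def)
qed

lemma af_prefixL:
 assumes "u : lists A" "x : carrier G" "!!u1. prefix u1 u ==> inv (val u1) \<otimes> x : S"
 shows "af S x u []"
 using assms
proof (induction u arbitrary: x rule: list.induct)
 case Nil
 thus ?case using Nil.prems(2) Nil.prems(3)[of "[]"] by (auto intro: af.af_Nil)
next
 case (Cons a u)
 have "af S (inv (ev a) \<otimes> x) u []"
 proof (rule Cons.IH)
  fix u1 assume p: "prefix u1 u"
  have "u1 : lists A" using prefix_lists[OF p] Cons.prems(1) by simp
  thus "inv (val u1) \<otimes> (inv (ev a) \<otimes> x) : S"
   using Cons.prems(3)[of "a # u1"] p Cons.prems by (simp add: grp_simps)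
 qed (use Cons.prems in auto)
 thus ?case using Cons.prems(3)[of "[]"] Cons.prems by (auto intro!: af.af_left)
qed

lemma af_prefixR:
 assumes "v : lists A" "x : carrier G" "!!v1. prefix v1 v ==> x \<otimes> val v1 : S"
 shows "af S x [] v"
 using assms
proof (induction v arbitrary: x rule: list.induct)
 case Nil
 thus ?case using Nil.prems(2) Nil.prems(3)[of "[]"] by (auto intro: af.af_Nil)
next
 case (Cons a v)
 have "af S (x \<otimes> ev a) [] v"
 proof (rule Cons.IH)
  fix v1 assume p: "prefix v1 v"
  have "v1 : lists A" using prefix_lists[OF p] Cons.prems(1) by simp
  thus "x \<otimes> ev a \<otimes> val v1 : S"
   using Cons.prems(3)[of "a # v1"] p Cons.prems by (simp add: grp_simps)
 qed (use Cons.prems in auto)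
 thus ?case using Cons.prems(3)[of "[]"] Cons.prems by (auto intro!: af.af_right)
qed

text \<open>A traversal reads \<open>u\<close> letter by letter, so it pauses at every prefix of
  \<open>u\<close> opposite some prefix of \<open>v\<close>.\<close>

lemma af_prefixD:
 assumes "af S x u v" "prefix u1 u"
 shows "\<exists>v1. prefix v1 v & inv (val u1) \<otimes> (x \<otimes> val v1) : S"
 using assms
proof (induction arbitrary: u1 rule: af.induct)
 case (af_left x a u v)
 show ?case
 proof (cases u1)
  case Nil
  thus ?thesis using af_left by (intro exI[of _ "[]"]) auto
 next
  case (Cons b u2)
  then obtain v1 where v1: "prefix v1 v" "inv (val u2) \<otimes> ((inv (ev a) \<otimes> x) \<otimes> val v1) : S"
   using af_left by auto
  have "u2 : lists A" "v1 : lists A"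
   using prefix_lists[OF v1(1)] afD[OF af_left(4)] prefix_lists[of u2 u] af_left(6) Cons by auto
  hence "inv (val u1) \<otimes> (x \<otimes> val v1) : S"
   using v1 Cons af_left by (simp add: grp_simps)
  thus ?thesis using v1 by blast
 qed
next
 case (af_right x a u v)
 then obtain v1 where v1: "prefix v1 v" "inv (val u1) \<otimes> ((x \<otimes> ev a) \<otimes> val v1) : S" by blast
 have "u1 : lists A" "v1 : lists A"
  using prefix_lists[OF v1(1)] afD[OF af_right(4)] prefix_lists[OF af_right(6)] by auto
 thus ?case using v1 af_right by (intro exI[of _ "a # v1"]) (auto simp: grp_simps)
qed auto

definition drop_set :: "'a list => 'x set" where
 "drop_set p = step_set \<union> (%p1. inv (val p1) \<otimes> val p) ` set (prefixes p)"

lemma finite_drop_set: "finite (drop_set p)"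
 by (simp add: drop_set_def finite_step_set)

text \<open>\<open>p\<close> is read while the other word waits, then \<open>u\<close> is read
  against itself; the cost depends on \<open>p\<close> only.\<close>

lemma af_drop:
 assumes "p : lists A" "u : lists A" shows "af (drop_set p) (val p) (p @ u) u"
proof -
 have "af (drop_set p) (val p) p []"
  using assms by (intro af_prefixL) (auto simp: drop_set_def)
 moreover have "af (drop_set p) (inv (val p) \<otimes> (val p \<otimes> val [])) u u"
  using assms af_refl[of u] by (auto intro: af_mono simp: drop_set_def)
 ultimately show ?thesis using af_append by fastforce
qed

text \<open>Deleting \<open>p\<close> and \<open>p'\<close> costs finite sets that depend on these
  two words and not on the continuations. This turns bounds for the words of a language into bounds
  for continuations of fixed prefixes.\<close>

lemma af_drop_prefixes:
 assumes "af S x (p @ u) (p' @ u')"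
 shows "af ((m_inv G ` drop_set p <#> S) <#> drop_set p') (inv (val p) \<otimes> (x \<otimes> val p')) u u'"
proof -
 have in_lists: "p : lists A" "u : lists A" "p' : lists A" "u' : lists A" and x: "x : carrier G"
  using afD[OF assms] by auto
 have "af ((m_inv G ` drop_set p <#> S) <#> drop_set p') (inv (val p) \<otimes> x \<otimes> val p') u u'"
  by (rule af_trans[OF af_trans[OF af_sym[OF af_drop] assms] af_drop]) (use in_lists in auto)
 thus ?thesis using in_lists x by (simp add: m_assoc)
qed

text \<open>Compares \<open>L\<close> with the translate of \<open>M\<close> by \<open>x\<close>.
  Admitting every finite set \<open>D\<close> of end-point differences, instead of distance one,
  makes the notion composable; for \<open>x = \<one>\<close> and a language onto the group it is the
  asynchronous property (\<open>async_prop_iff\<close>).\<close>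

definition fel :: "'x => 'a list set => 'a list set => bool" where
 "fel x L M \<longleftrightarrow> (\<forall>D. finite D --> (\<exists>S. finite S \<and>
   (\<forall>u\<in>L. \<forall>v\<in>M. inv (val u) \<otimes> (x \<otimes> val v) : D --> af S x u v)))"

lemma felE:
 assumes "fel x L M" "finite D"
 obtains S where "finite S"
  "!!u v. u : L ==> v : M ==> inv (val u) \<otimes> (x \<otimes> val v) : D ==> af S x u v"
proof -
 have "\<exists>S. finite S & (\<forall>u\<in>L. \<forall>v\<in>M. inv (val u) \<otimes> (x \<otimes> val v) : D --> af S x u v)"
  using assms(1)[unfolded fel_def, rule_format, OF assms(2)] .
 thus ?thesis by (elim exE conjE) (rule that, auto)
qed

lemma fel_mono: "fel x L M ==> L' <= L ==> M' <= M ==> fel x L' M'"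
 unfolding fel_def by (elim all_forward imp_forward ex_forward conj_forward) auto

lemma fel_sym:
 assumes "fel x L M" "L <= lists A" "M <= lists A" "x : carrier G" shows "fel (inv x) M L"
 unfolding fel_def
proof (intro allI impI)
 fix D :: "'x set" assume D: "finite D"
 obtain S where S: "finite S"
  "!!u v. u : L ==> v : M ==> inv (val u) \<otimes> (x \<otimes> val v) : m_inv G ` D ==> af S x u v"
  by (rule felE[OF assms(1) finite_imageI[OF D, of "m_inv G"]]) auto
 show "\<exists>S. finite S & (\<forall>u\<in>M. \<forall>v\<in>L. inv val u \<otimes> (inv x \<otimes> val v) : D --> af S (inv x) u v)"
 proof (intro exI conjI ballI impI)
  fix u v assume uv: "u : M" "v : L" "inv val u \<otimes> (inv x \<otimes> val v) : D"
  have "u : lists A" "v : lists A" using uv assms by auto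
  hence "inv (val v) \<otimes> (x \<otimes> val u) = inv (inv val u \<otimes> (inv x \<otimes> val v))"
   using assms by (simp add: grp_simps)
  hence "inv (val v) \<otimes> (x \<otimes> val u) : m_inv G ` D" using uv by auto
  thus "af (m_inv G ` S) (inv x) u v" using S uv af_sym by blast
 qed (use S in auto)
qed

text \<open>By \<open>cov\<close> some word of \<open>M\<close> ends exactly where \<open>u\<close>
  ends, and the two comparisons are composed at this word.\<close>

lemma fel_trans:
 assumes LM: "fel x L M" and MN: "fel y M N" and sub: "L <= lists A" "M <= lists A" "N <= lists A"
  and xy: "x : carrier G" "y : carrier G"
  and cov: "!!u. u : L ==> \<exists>v\<in>M. val u = x \<otimes> val v"
 shows "fel (x \<otimes> y) L N"
 unfolding fel_def
proof (intro allI impI)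
 fix D :: "'x set" assume D: "finite D"
 obtain S where S: "finite S"
  "!!u v. u : L ==> v : M ==> inv (val u) \<otimes> (x \<otimes> val v) : {\<one>} ==> af S x u v"
  by (rule felE[OF LM, of "{\<one>}"]) auto
 obtain T where T: "finite T"
  "!!u v. u : M ==> v : N ==> inv (val u) \<otimes> (y \<otimes> val v) : D ==> af T y u v"
  by (rule felE[OF MN D]) auto
 show "\<exists>S. finite S & (\<forall>u\<in>L. \<forall>v\<in>N. inv val u \<otimes> (x \<otimes> y \<otimes> val v) : D --> af S (x \<otimes> y) u v)"
 proof (intro exI conjI ballI impI)
  fix u w assume uw: "u : L" "w : N" "inv val u \<otimes> (x \<otimes> y \<otimes> val w) : D"
  obtain v where v: "v : M" "val u = x \<otimes> val v" using cov uw by blast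
  have l: "u : lists A" "v : lists A" "w : lists A" using uw v sub by auto
  have "af S x u v" using S uw v l xy by simp
  moreover have "inv (val v) \<otimes> (y \<otimes> val w) : D" using uw(3) v(2) l xy by (simp add: grp_simps)
  hence "af T y v w" using T v uw by blast
  ultimately show "af (S <#> T) (x \<otimes> y) u w" by (rule af_trans)
 qed (use S T in \<open>auto intro: finite_set_mult\<close>)
qed

lemma fel_Un_left:
 assumes "fel x L N" "fel x M N" shows "fel x (L \<union> M) N"
 unfolding fel_def
proof (intro allI impI)
 fix D :: "'x set" assume D: "finite D"
 obtain S where S: "finite S"
  "!!u v. u : L ==> v : N ==> inv (val u) \<otimes> (x \<otimes> val v) : D ==> af S x u v"
  by (rule felE[OF assms(1) D]) auto
 obtain T where T: "finite T"
  "!!u v. u : M ==> v : N ==> inv (val u) \<otimes> (x \<otimes> val v) : D ==> af T x u v"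
  by (rule felE[OF assms(2) D]) auto
 have "af (S \<union> T) x u v" if "u : L \<union> M" "v : N" "inv (val u) \<otimes> (x \<otimes> val v) : D" for u v
  using that S(2)[of u v] T(2)[of u v] af_mono[of S x u v "S \<union> T"] af_mono[of T x u v "S \<union> T"] by auto
 thus "\<exists>S. finite S & (\<forall>u\<in>L \<union> M. \<forall>v\<in>N. inv val u \<otimes> (x \<otimes> val v) : D --> af S x u v)"
  using S(1) T(1) by (intro exI[of _ "S \<union> T"]) simp
qed

lemma fel_Un_right:
 assumes "fel x N L" "fel x N M" shows "fel x N (L \<union> M)"
 unfolding fel_def
proof (intro allI impI)
 fix D :: "'x set" assume D: "finite D"
 obtain S where S: "finite S"
  "!!u v. u : N ==> v : L ==> inv (val u) \<otimes> (x \<otimes> val v) : D ==> af S x u v"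
  by (rule felE[OF assms(1) D]) auto
 obtain T where T: "finite T"
  "!!u v. u : N ==> v : M ==> inv (val u) \<otimes> (x \<otimes> val v) : D ==> af T x u v"
  by (rule felE[OF assms(2) D]) auto
 have "af (S \<union> T) x u v" if "u : N" "v : L \<union> M" "inv (val u) \<otimes> (x \<otimes> val v) : D" for u v
  using that S(2)[of u v] T(2)[of u v] af_mono[of S x u v "S \<union> T"] af_mono[of T x u v "S \<union> T"] by auto
 thus "\<exists>S. finite S & (\<forall>u\<in>N. \<forall>v\<in>L \<union> M. inv val u \<otimes> (x \<otimes> val v) : D --> af S x u v)"
  using S(1) T(1) by (intro exI[of _ "S \<union> T"]) simp
qed

text \<open>Up to a finite error a prepended word acts through its value alone. This translates the
  action of the group on classes into the parameter \<open>x\<close> of \<open>fel\<close>.\<close>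

lemma fel_prepend:
 assumes L: "L <= lists A" "M <= lists A" and p: "p : lists A" and x: "x : carrier G"
 shows "fel x L ((@) p ` M) \<longleftrightarrow> fel (x \<otimes> val p) L M"
proof
 assume f: "fel x L ((@) p ` M)"
 show "fel (x \<otimes> val p) L M" unfolding fel_def
 proof (intro allI impI)
  fix D :: "'x set" assume D: "finite D"
  obtain S where S: "finite S"
   "!!u v. u : L ==> v : (@) p ` M ==> inv (val u) \<otimes> (x \<otimes> val v) : D ==> af S x u v"
   by (rule felE[OF f D]) auto
  have "af (S <#> drop_set p) (x \<otimes> val p) u v"
   if "u : L" "v : M" "inv (val u) \<otimes> (x \<otimes> val p \<otimes> val v) : D" for u v
  proof (rule af_trans[OF S(2)])
   have "u : lists A" "v : lists A" using that L by auto
   thus "inv (val u) \<otimes> (x \<otimes> val (p @ v)) : D" using that p x by (simp add: m_assoc)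
   show "af (drop_set p) (val p) (p @ v) v" using af_drop p \<open>v : lists A\<close> by blast
  qed (use that in auto)
  thus "\<exists>S. finite S & (\<forall>u\<in>L. \<forall>v\<in>M. inv val u \<otimes> (x \<otimes> val p \<otimes> val v) : D --> af S (x \<otimes> val p) u v)"
   using S(1) by (intro exI[of _ "S <#> drop_set p"]) (simp add: finite_drop_set finite_set_mult)
 qed
next
 assume f: "fel (x \<otimes> val p) L M"
 show "fel x L ((@) p ` M)" unfolding fel_def
 proof (intro allI impI)
  fix D :: "'x set" assume D: "finite D"
  obtain S where S: "finite S"
   "!!u v. u : L ==> v : M ==> inv (val u) \<otimes> (x \<otimes> val p \<otimes> val v) : D ==> af S (x \<otimes> val p) u v"
   by (rule felE[OF f D]) auto
  have "af (S <#> m_inv G ` drop_set p) x u (p @ v)"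
   if "u : L" "v : M" "inv (val u) \<otimes> (x \<otimes> val (p @ v)) : D" for u v
  proof -
   have l: "u : lists A" "v : lists A" using that L by auto
   hence "inv (val u) \<otimes> (x \<otimes> val p \<otimes> val v) : D" using that p x by (simp add: m_assoc)
   hence "af (S <#> m_inv G ` drop_set p) (x \<otimes> val p \<otimes> inv (val p)) u (p @ v)"
    using af_trans[OF S(2) af_sym[OF af_drop]] that l p by blast
   thus ?thesis using p x by (simp add: m_assoc)
  qed
  thus "\<exists>S. finite S & (\<forall>u\<in>L. \<forall>v\<in>(@) p ` M. inv val u \<otimes> (x \<otimes> val v) : D --> af S x u v)"
   using S(1) by (intro exI[of _ "S <#> m_inv G ` drop_set p"]) (simp add: finite_drop_set finite_set_mult)
 qed
qed

text \<open>All words with value \<open>d\<close> follow one representative \<open>r d\<close>; its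
  finitely many prefixes, thickened by \<open>S\<close>, contain their excursions.\<close>

lemma fel_finite_values:
 assumes "fel \<one> L L" "L <= lists A" "finite D"
 shows "\<exists>S. finite S & (\<forall>u\<in>L. \<forall>u1. val u : D --> prefix u1 u --> val u1 : S)"
proof -
 define r where "r d = (SOME u. u : L & val u = d)" for d
 have r: "r (val u) : L & val (r (val u)) = val u" if "u : L" for u
  unfolding r_def using that by (intro someI[of "%v. v : L & val v = val u" u]) auto
 obtain S where S: "finite S"
  "!!u v. u : L ==> v : L ==> inv (val u) \<otimes> (\<one> \<otimes> val v) : {\<one>} ==> af S \<one> u v"
  by (rule felE[OF assms(1), of "{\<one>}"]) auto
 define T where "T = (\<Union>d\<in>D. (\<Union>v1\<in>set (prefixes (r d)). (%s. val v1 \<otimes> inv s) ` S))"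
 have "val u1 : T" if u: "u : L" "val u : D" "prefix u1 u" for u u1
 proof -
  have l: "u : lists A" "u1 : lists A" "r (val u) : lists A"
   using u(1) assms(2) prefix_lists[OF u(3)] r[OF u(1)] by auto
  have "af S \<one> u (r (val u))" using S(2)[of u "r (val u)"] u r[OF u(1)] l by simp
  from af_prefixD[OF this u(3)] obtain v1 where v1: "prefix v1 (r (val u))" "inv (val u1) \<otimes> (\<one> \<otimes> val v1) : S"
   by blast
  have "v1 : lists A" using v1 l prefix_lists by blast
  hence "val u1 = val v1 \<otimes> inv (inv (val u1) \<otimes> (\<one> \<otimes> val v1))" using l by (simp add: grp_simps)
  thus ?thesis using v1 u unfolding T_def by (intro UN_I[of "val u"] UN_I[of v1]) auto
 qed
 moreover have "finite T" using S assms(3) by (auto simp: T_def)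
 ultimately show ?thesis by blast
qed

text \<open>Words of \<open>L\<close> ending in \<open>D\<close> never leave a finite set, so a
  finite automaton can follow their values, although the values of arbitrary words cannot be
  computed in this way.\<close>

lemma regular_val_in:
 assumes "regular_lang A L" "fel \<one> L L" "finite D"
 shows "regular_lang A {u : L. val u : D}"
proof -
 have L: "L <= lists A" using assms regular_subset by blast
 obtain S where S: "finite S" "\<forall>u\<in>L. \<forall>u1. val u : D --> prefix u1 u --> val u1 : S"
  using fel_finite_values[OF assms(2) L assms(3)] by blast
 have walk: "walk (%s a. s \<otimes> ev a) S D x u \<longleftrightarrow> (\<forall>u1. prefix u1 u --> x \<otimes> val u1 : S) & x \<otimes> val u : D"
  if "u : lists A" "x : carrier G" for u x
  using that
 proof (induction u arbitrary: x rule: list.induct)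
  case (Cons a u)
  have "walk (%s a. s \<otimes> ev a) S D x (a # u) \<longleftrightarrow>
   x : S & (\<forall>u1. prefix u1 u --> x \<otimes> ev a \<otimes> val u1 : S) & x \<otimes> ev a \<otimes> val u : D"
   using Cons by simp
  also have "\<dots> \<longleftrightarrow> x : S & (\<forall>u1. prefix u1 u --> x \<otimes> val (a # u1) : S) & x \<otimes> val (a # u) : D"
  proof -
   have "x \<otimes> ev a \<otimes> val u1 = x \<otimes> val (a # u1)" if "prefix u1 u" for u1
    using Cons.prems prefix_lists[OF that] by (simp add: m_assoc)
   thus ?thesis by simp
  qed
  also have "\<dots> \<longleftrightarrow> (\<forall>u1. prefix u1 (a # u) --> x \<otimes> val u1 : S) & x \<otimes> val (a # u) : D"
  proof -
   have "x : S \<longleftrightarrow> x \<otimes> val [] : S" using Cons.prems by simp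
   thus ?thesis unfolding prefix_Cons by metis
  qed
  finally show ?case .
 qed auto
 have "{u : L. val u : D} = L \<inter> {u : lists A. walk (%s a. s \<otimes> ev a) S D \<one> u}"
 proof (intro equalityI subsetI)
  fix u assume u: "u : {u : L. val u : D}"
  hence uA: "u : lists A" using L by auto
  have "\<one> \<otimes> val u1 : S" if "prefix u1 u" for u1
   using that S(2)[rule_format, of u u1] u prefix_lists[OF that uA] by simp
  thus "u : L \<inter> {u : lists A. walk (%s a. s \<otimes> ev a) S D \<one> u}"
   using u uA walk[OF uA one_closed] by simp
 next
  fix u assume u: "u : L \<inter> {u : lists A. walk (%s a. s \<otimes> ev a) S D \<one> u}"
  thus "u : {u : L. val u : D}" using walk[of u \<one>] by simp
 qed
 thus ?thesis using regular_Int[OF assms(1) regular_walk[OF S(1)]] by simp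
qed

text \<open>Words that are tracked by a word of a regular language form a regular language: the two words
 are interleaved into a word over \<open>A + B\<close> along which the difference is a finite-state walk.\<close>

lemma regular_af:
 assumes L: "regular_lang A L" and S: "finite S" and B: "B <= A"
 shows "regular_lang B {v : lists B. \<exists>y\<in>L. af S x y v & inv (val y) \<otimes> (x \<otimes> val v) = z}"
proof (cases "x : carrier G")
 case False
 hence "{v : lists B. \<exists>y\<in>L. af S x y v & inv (val y) \<otimes> (x \<otimes> val v) = z} = {}" using afD(2) by blast
 thus ?thesis by (simp only: regular_empty)
next
 case True
 define P where "P = Inl ` A \<union> Inr ` B"
 define \<alpha> :: "'a + 'a => 'a list" where "\<alpha> = case_sum (%a. [a]) (%b. [])"
 define \<beta> :: "'a + 'a => 'a list" where "\<beta> = case_sum (%a. []) (%b. [b])"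
 define st where "st = (%s. case_sum (%a. inv (ev a) \<otimes> s) (%b. s \<otimes> ev b))"
 define Z where "Z = {p : lists P. walk st (S \<inter> carrier G) {z} x p}"
 have fin: "finite P" using finite_A B finite_subset by (auto simp: P_def)
 have 1: "\<exists>p\<in>lists P. concat (map \<alpha> p) = y & concat (map \<beta> p) = v & walk st (S \<inter> carrier G) {z} x p"
  if "af S x y v" "inv (val y) \<otimes> (x \<otimes> val v) = z" "v : lists B" for x y v
  using that
 proof (induction rule: af.induct)
  case (af_Nil x)
  thus ?case by (intro bexI[of _ "[]"]) auto
 next
  case (af_left x a u v)
  have "inv (val u) \<otimes> ((inv (ev a) \<otimes> x) \<otimes> val v) = inv (val (a # u)) \<otimes> (x \<otimes> val v)"
   using af_left afD[OF af_left(4)] by (simp add: grp_simps)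
  then obtain p where "p : lists P" "concat (map \<alpha> p) = u" "concat (map \<beta> p) = v" "walk st (S \<inter> carrier G) {z} (inv (ev a) \<otimes> x) p"
   using af_left by auto
  thus ?case using af_left by (intro bexI[of _ "Inl a # p"]) (auto simp: \<alpha>_def \<beta>_def st_def P_def)
 next
  case (af_right x a u v)
  have "inv (val u) \<otimes> ((x \<otimes> ev a) \<otimes> val v) = inv (val u) \<otimes> (x \<otimes> val (a # v))"
   using af_right afD[OF af_right(4)] by (simp add: grp_simps)
  then obtain p where "p : lists P" "concat (map \<alpha> p) = u" "concat (map \<beta> p) = v" "walk st (S \<inter> carrier G) {z} (x \<otimes> ev a) p"
   using af_right by auto
  thus ?case using af_right by (intro bexI[of _ "Inr a # p"]) (auto simp: \<alpha>_def \<beta>_def st_def P_def)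
 qed
 have 2: "af S x (concat (map \<alpha> p)) (concat (map \<beta> p)) \<and>
   inv (val (concat (map \<alpha> p))) \<otimes> (x \<otimes> val (concat (map \<beta> p))) = z & concat (map \<beta> p) : lists B"
  if "p : lists P" "walk st (S \<inter> carrier G) {z} x p" for p x
  using that
 proof (induction p arbitrary: x rule: list.induct)
  case Nil
  thus ?case by (auto intro: af.af_Nil)
 next
  case (Cons q p)
  have x: "x : S" "x : carrier G" using Cons.prems by auto
  have w: "walk st (S \<inter> carrier G) {z} (st x q) p" and pP: "p : lists P" "q : P" using Cons.prems by auto
  note IH = Cons.IH[OF pP(1) w]
  show ?case
  proof (cases q)
   case (Inl a)
   hence a: "a : A" using pP by (auto simp: P_def)
   show ?thesis using IH Inl a x afD[OF conjunct1[OF IH]]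
    by (auto simp: \<alpha>_def \<beta>_def st_def grp_simps intro!: af.af_left)
  next
   case (Inr a)
   hence a: "a : B" "a : A" using pP B by (auto simp: P_def)
   show ?thesis using IH Inr a x afD[OF conjunct1[OF IH]]
    by (auto simp: \<alpha>_def \<beta>_def st_def grp_simps intro!: af.af_right)
  qed
 qed
 have "regular_lang B {concat (map \<beta> p) | p. p : lists P & concat (map \<alpha> p) : L & p : Z}"
  by (rule regular_transduction[OF L fin])
   (auto simp: \<alpha>_def \<beta>_def P_def Z_def intro!: regular_walk S)
 also have "{concat (map \<beta> p) | p. p : lists P & concat (map \<alpha> p) : L & p : Z} =
  {v : lists B. \<exists>y\<in>L. af S x y v & inv (val y) \<otimes> (x \<otimes> val v) = z}"
 proof (intro equalityI subsetI)
  fix v assume "v : {concat (map \<beta> p) | p. p : lists P & concat (map \<alpha> p) : L & p : Z}"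
  then obtain p where p: "v = concat (map \<beta> p)" "p : lists P" "concat (map \<alpha> p) : L" "p : Z" by blast
  hence "walk st (S \<inter> carrier G) {z} x p" by (simp add: Z_def)
  from 2[OF p(2) this] show "v : {v : lists B. \<exists>y\<in>L. af S x y v & inv (val y) \<otimes> (x \<otimes> val v) = z}"
   using p by blast
 next
  fix v assume "v : {v : lists B. \<exists>y\<in>L. af S x y v & inv (val y) \<otimes> (x \<otimes> val v) = z}"
  then obtain y where "v : lists B" "y : L" "af S x y v" "inv (val y) \<otimes> (x \<otimes> val v) = z" by blast
  from 1[OF this(3,4,1)] show "v : {concat (map \<beta> p) | p. p : lists P & concat (map \<alpha> p) : L & p : Z}"
   using \<open>y : L\<close> unfolding Z_def by blast
 qed
 finally show ?thesis .
qed

end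

section \<open>Word metrics and classes of automatic structures\<close>

declare in_lists_conv_set [simp del] in_listsD [rule del] in_listsI [rule del]

lemma reparam_0: "reparam \<phi> ==> \<phi> 0 = 0"
proof -
 assume r: "reparam \<phi>"
 then obtain i where "\<phi> i = 0" by (metis reparam_def surjD)
 moreover have "\<phi> 0 <= \<phi> i" using r by (simp add: reparam_def mono_def)
 ultimately show ?thesis by simp
qed

text \<open>A monotone surjection of the natural numbers cannot jump over a value.\<close>

lemma reparam_Suc: "reparam \<phi> ==> \<phi> (Suc n) = \<phi> n \<or> \<phi> (Suc n) = Suc (\<phi> n)"
proof (rule ccontr)
 assume r: "reparam \<phi>" and n: "\<not> (\<phi> (Suc n) = \<phi> n \<or> \<phi> (Suc n) = Suc (\<phi> n))"
 have m: "mono \<phi>" using r by (simp add: reparam_def)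
 obtain i where i: "\<phi> i = Suc (\<phi> n)" using r by (metis reparam_def surjD)
 have "\<phi> n <= \<phi> (Suc n)" using m by (simp add: mono_def)
 moreover have "\<phi> i <= \<phi> n \<or> \<phi> (Suc n) <= \<phi> i"
  using m by (metis mono_def not_less_eq_eq)
 ultimately show False using i n by auto
qed

lemma reparam_id: "reparam (%n. n)"
 by (auto simp: reparam_def mono_def surj_def)

lemma reparam_delay: "reparam \<phi> ==> reparam (%n. case n of 0 => 0 | Suc m => \<phi> m)"
 unfolding reparam_def
proof (intro conjI)
 assume r: "mono \<phi> & surj \<phi>"
 show "mono (%n. case n of 0 => 0 | Suc m => \<phi> m)"
  using r by (auto simp: mono_def split: nat.splits)
 show "surj (%n. case n of 0 => 0 | Suc m => \<phi> m)"
  unfolding surj_def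
 proof
  fix y obtain i where "\<phi> i = y" using r by (metis surjD)
  thus "\<exists>x. y = (case x of 0 => 0 | Suc m => \<phi> m)" by (intro exI[of _ "Suc i"]) auto
 qed
qed

lemma reparam_shift: "reparam \<phi> ==> reparam (%n. case n of 0 => 0 | Suc m => Suc (\<phi> m))"
 unfolding reparam_def
proof (intro conjI)
 assume r: "mono \<phi> & surj \<phi>"
 show "mono (%n. case n of 0 => 0 | Suc m => Suc (\<phi> m))"
  using r by (auto simp: mono_def split: nat.splits)
 show "surj (%n. case n of 0 => 0 | Suc m => Suc (\<phi> m))"
  unfolding surj_def
 proof
  fix y obtain i where i: "\<phi> i = y - 1" using r by (metis surjD)
  show "\<exists>x. y = (case x of 0 => 0 | Suc m => Suc (\<phi> m))"
  proof (cases y)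
   case 0
   thus ?thesis by (intro exI[of _ 0]) auto
  next
   case (Suc k)
   thus ?thesis using i by (intro exI[of _ "Suc i"]) auto
  qed
 qed
qed

section \<open>Traversals and reparametrizations\<close>

context lettered_group
begin

lemma take_lists: "w : lists A ==> take n w : lists A"
 using prefix_lists take_is_prefix by blast

lemma drop_lists: "w : lists A ==> drop n w : lists A"
 by (metis append_in_lists_conv append_take_drop_id)

text \<open>Reading a letter takes one unit of time: the reparametrization of the word read is
  shifted, the other one is delayed.\<close>

lemma af_imp_reparam:
 assumes "af S x u v"
 shows "\<exists>\<phi> \<phi>'. reparam \<phi> & reparam \<phi>' \<and>
  (\<forall>n. inv (val (take (\<phi> n) u)) \<otimes> (x \<otimes> val (take (\<phi>' n) v)) : S)"
 using assms
proof (induction rule: af.induct)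
 case (af_Nil x)
 thus ?case using reparam_id by fastforce
next
 case (af_left x a u v)
 then obtain \<phi> \<phi>' where r: "reparam \<phi>" "reparam \<phi>'"
  "!!n. inv (val (take (\<phi> n) u)) \<otimes> ((inv (ev a) \<otimes> x) \<otimes> val (take (\<phi>' n) v)) : S" by blast
 have l: "take n u : lists A" "take n v : lists A" for n
  using afD[OF af_left(4)] take_lists by auto
 let ?p = "%n. case n of 0 => 0 | Suc m => Suc (\<phi> m)" and ?q = "%n. case n of 0 => 0 | Suc m => \<phi>' m"
 have "inv (val (take (?p n) (a # u))) \<otimes> (x \<otimes> val (take (?q n) v)) : S" for n
 proof (cases n)
  case 0
  thus ?thesis using af_left by simp
 next
  case (Suc m)
  thus ?thesis using r(3)[of m] af_left l by (simp add: grp_simps)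
 qed
 thus ?case using r reparam_shift reparam_delay by blast
next
 case (af_right x a u v)
 then obtain \<phi> \<phi>' where r: "reparam \<phi>" "reparam \<phi>'"
  "!!n. inv (val (take (\<phi> n) u)) \<otimes> ((x \<otimes> ev a) \<otimes> val (take (\<phi>' n) v)) : S" by blast
 have l: "take n u : lists A" "take n v : lists A" for n
  using afD[OF af_right(4)] take_lists by auto
 let ?p = "%n. case n of 0 => 0 | Suc m => \<phi> m" and ?q = "%n. case n of 0 => 0 | Suc m => Suc (\<phi>' m)"
 have "inv (val (take (?p n) u)) \<otimes> (x \<otimes> val (take (?q n) (a # v))) : S" for n
 proof (cases n)
  case 0
  thus ?thesis using af_right by simp
 next
  case (Suc m)
  thus ?thesis using r(3)[of m] af_right l by (simp add: grp_simps)
 qed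
 thus ?case using r reparam_shift reparam_delay by blast
qed

lemma reparam_step:
 assumes "reparam \<phi>" "u : lists A"
 shows "(drop (\<phi> n) u = drop (\<phi> (Suc n)) u & take (\<phi> (Suc n)) u = take (\<phi> n) u) \<or>
  (\<exists>a\<in>A. drop (\<phi> n) u = a # drop (\<phi> (Suc n)) u & take (\<phi> (Suc n)) u = take (\<phi> n) u @ [a])"
proof (cases "\<phi> (Suc n) = \<phi> n \<or> length u <= \<phi> n")
 case True
 thus ?thesis using reparam_Suc[OF assms(1), of n] by auto
next
 case False
 hence "\<phi> (Suc n) = Suc (\<phi> n)" "\<phi> n < length u" using reparam_Suc[OF assms(1), of n] by auto
 thus ?thesis using assms(2)
  by (intro disjI2 bexI[of _ "u ! \<phi> n"]) (auto simp: Cons_nth_drop_Suc take_Suc_conv_app_nth in_lists_conv_set)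
qed

text \<open>Both reparametrizations may advance in the same unit of time, while a traversal reads
  one letter at a time. The second part of the set contains the intermediate difference after the
  letter of \<open>u\<close> alone.\<close>

lemma reparam_imp_af:
 assumes uv: "u : lists A" "v : lists A" and x: "x : carrier G" and r: "reparam \<phi>" "reparam \<phi>'"
  and S: "!!n. inv (val (take (\<phi> n) u)) \<otimes> (x \<otimes> val (take (\<phi>' n) v)) : S"
 shows "af (S \<union> (%(a, s). inv (ev a) \<otimes> s) ` (A \<times> S)) x u v"
proof -
 let ?T = "S \<union> (%(a, s). inv (ev a) \<otimes> s) ` (A \<times> S)"
 define z where "z n = inv (val (take (\<phi> n) u)) \<otimes> (x \<otimes> val (take (\<phi>' n) v))" for n
 have l: "take n u : lists A" "take n v : lists A" for n using uv take_lists by auto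
 have zc: "z n : carrier G" "z n : S" for n using l x S by (auto simp: z_def)
 obtain i j where ij: "\<phi> i = length u" "\<phi>' j = length v" using r by (metis reparam_def surjD)
 \<comment> \<open>Both words are exhausted at time \<open>N\<close>, and the induction descends
   from there.\<close>
 define N where "N = max i j"
 have "\<phi> i <= \<phi> N" "\<phi>' j <= \<phi>' N" using r by (auto simp: reparam_def mono_def N_def)
 hence N: "length u <= \<phi> N" "length v <= \<phi>' N" using ij by auto
 have "af ?T (z n) (drop (\<phi> n) u) (drop (\<phi>' n) v)" if "n <= N" for n
  using that
 proof (induction n rule: inc_induct)
  case base
  thus ?case using N zc by (auto intro: af.af_Nil)
 next
  case (step n)
  note af = step.IH
  have left: "af ?T y (a # u') v'" if "af ?T (inv (ev a) \<otimes> y) u' v'" "a : A" "y : S" "y : carrier G" for y a u' v'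
   using that by (intro af.af_left) auto
  consider "drop (\<phi> n) u = drop (\<phi> (Suc n)) u" "take (\<phi> (Suc n)) u = take (\<phi> n) u"
    "drop (\<phi>' n) v = drop (\<phi>' (Suc n)) v" "take (\<phi>' (Suc n)) v = take (\<phi>' n) v"
   | a where "a : A" "drop (\<phi> n) u = a # drop (\<phi> (Suc n)) u" "take (\<phi> (Suc n)) u = take (\<phi> n) u @ [a]"
    "drop (\<phi>' n) v = drop (\<phi>' (Suc n)) v" "take (\<phi>' (Suc n)) v = take (\<phi>' n) v"
   | b where "b : A" "drop (\<phi> n) u = drop (\<phi> (Suc n)) u" "take (\<phi> (Suc n)) u = take (\<phi> n) u"
    "drop (\<phi>' n) v = b # drop (\<phi>' (Suc n)) v" "take (\<phi>' (Suc n)) v = take (\<phi>' n) v @ [b]"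
   | a b where "a : A" "b : A" "drop (\<phi> n) u = a # drop (\<phi> (Suc n)) u" "take (\<phi> (Suc n)) u = take (\<phi> n) u @ [a]"
    "drop (\<phi>' n) v = b # drop (\<phi>' (Suc n)) v" "take (\<phi>' (Suc n)) v = take (\<phi>' n) v @ [b]"
   using reparam_step[OF r(1) uv(1), of n] reparam_step[OF r(2) uv(2), of n] by metis
  thus ?case
  proof cases
   case 1
   thus ?thesis using af by (simp add: z_def)
  next
   case 2
   hence "z (Suc n) = inv (ev a) \<otimes> z n" using l x by (simp add: z_def grp_simps)
   thus ?thesis using af 2 zc by (auto intro!: left)
  next
   case 3
   hence "z (Suc n) = z n \<otimes> ev b" using l x by (simp add: z_def grp_simps)
   thus ?thesis using af 3 zc by (auto intro!: af.af_right)
  next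
   case 4
   hence "z (Suc n) = inv (ev a) \<otimes> z n \<otimes> ev b" using l x by (simp add: z_def grp_simps)
   moreover have "inv (ev a) \<otimes> z n : ?T" using zc 4 by (intro UnI2 image_eqI[of _ _ "(a, z n)"]) auto
   ultimately have "af ?T (inv (ev a) \<otimes> z n) (drop (\<phi> (Suc n)) u) (drop (\<phi>' n) v)"
    using af 4 zc by (auto intro!: af.af_right)
   thus ?thesis using 4 zc by (auto intro!: left)
  qed
 qed
 from this[of 0] show ?thesis using reparam_0[OF r(1)] reparam_0[OF r(2)] x by (simp add: z_def)
qed

text \<open>Synchronous counterpart of \<open>fel\<close> for a single language, again with
  arbitrary finite sets of end-point differences.\<close>

definition sfel :: "'a list set => bool" where
 "sfel L \<longleftrightarrow> (\<forall>D. finite D --> (\<exists>S. finite S & (\<forall>u\<in>L. \<forall>v\<in>L. inv (val u) \<otimes> val v : D -->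
   (\<forall>n. inv (val (take n u)) \<otimes> val (take n v) : S))))"

lemma sfelE:
 assumes "sfel L" "finite D"
 obtains S where "finite S"
  "!!u v n. u : L ==> v : L ==> inv (val u) \<otimes> val v : D ==> inv (val (take n u)) \<otimes> val (take n v) : S"
proof -
 have "\<exists>S. finite S & (\<forall>u\<in>L. \<forall>v\<in>L. inv (val u) \<otimes> val v : D -->
   (\<forall>n. inv (val (take n u)) \<otimes> val (take n v) : S))"
  using assms(1)[unfolded sfel_def, rule_format, OF assms(2)] .
 thus ?thesis by (elim exE conjE) (rule that, auto)
qed

lemma sfel_imp_fel:
 assumes "sfel L" "L <= lists A" shows "fel \<one> L L"
 unfolding fel_def
proof (intro allI impI)
 fix D :: "'x set" assume D: "finite D"
 obtain S where S: "finite S"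
  "!!u v n. u : L ==> v : L ==> inv (val u) \<otimes> val v : D ==> inv (val (take n u)) \<otimes> val (take n v) : S"
  by (rule sfelE[OF assms(1) D]) auto
 have "af (S \<union> (%(a, s). inv (ev a) \<otimes> s) ` (A \<times> S)) \<one> u v"
  if "u : L" "v : L" "inv (val u) \<otimes> (\<one> \<otimes> val v) : D" for u v
 proof (rule reparam_imp_af[OF _ _ _ reparam_id reparam_id])
  show uv: "u : lists A" "v : lists A" using that assms by auto
  show "inv val (take n u) \<otimes> (\<one> \<otimes> val (take n v)) : S" for n
   using S(2)[OF that(1,2)] that(3) uv take_lists by simp
 qed auto
 thus "\<exists>S. finite S & (\<forall>u\<in>L. \<forall>v\<in>L. inv val u \<otimes> (\<one> \<otimes> val v) : D --> af S \<one> u v)"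
  using S(1) finite_A by (intro exI[of _ "S \<union> (%(a, s). inv (ev a) \<otimes> s) ` (A \<times> S)"]) simp
qed

end

section \<open>The word metric, and classes of structures in terms of \<open>fel\<close>\<close>

locale alphabet_group = group G for G :: "('x, 'm) monoid_scheme" (structure) +
 fixes A :: "'a set" and ainv :: "'a => 'a" and ev :: "'a => 'x"
 assumes alphabet: "is_alphabet G A ainv ev"

sublocale alphabet_group \<subseteq> lettered_group
 using alphabet by unfold_locales (auto simp: is_alphabet_def)

context alphabet_group
begin

lemma val_onto: "x : carrier G ==> \<exists>w\<in>lists A. val w = x"
proof -
 assume "x : carrier G"
 hence "x : generate G (ev ` A)" using alphabet by (simp add: is_alphabet_def)
 thus ?thesis
 proof (induction rule: generate.induct)
  case one
  thus ?case by (intro bexI[of _ "[]"]) auto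
 next
  case (incl h)
  then obtain a where "a : A" "h = ev a" by auto
  thus ?case by (intro bexI[of _ "[a]"]) auto
 next
  case (inv h)
  then obtain a where a: "a : A" "h = ev a" by auto
  hence "ainv a : A" "ev (ainv a) = inv h" using alphabet by (auto simp: is_alphabet_def)
  thus ?case using a by (intro bexI[of _ "[ainv a]"]) auto
 next
  case (eng h1 h2)
  then obtain w1 w2 where "w1 : lists A" "w2 : lists A" "val w1 = h1" "val w2 = h2" by auto
  thus ?case by (intro bexI[of _ "w1 @ w2"]) auto
 qed
qed

definition ball :: "nat => 'x set" where
 "ball n = val ` {w : lists A. length w <= n}"

lemma ballD: "x : ball n ==> \<exists>w\<in>lists A. length w <= n & val w = x"
 by (auto simp: ball_def)

lemma finite_ball: "finite (ball n)"
proof -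
 have "{w : lists A. length w <= n} = {w. set w <= A & length w <= n}" by (auto simp: in_lists_conv_set)
 thus ?thesis using finite_lists_length_le[OF finite_A, of n] by (simp add: ball_def)
qed

lemma ball_mono: "m <= n ==> ball m <= ball n"
 by (auto simp: ball_def)

lemma finite_sub_ball: "finite S ==> S <= carrier G ==> \<exists>n. S <= ball n"
proof (induction S rule: finite_induct)
 case (insert x S)
 then obtain n w where n: "S <= ball n" "w : lists A" "val w = x" using val_onto[of x] by auto
 hence "x : ball (length w)" by (auto simp: ball_def)
 thus ?case using n ball_mono[of n "max n (length w)"] ball_mono[of "length w" "max n (length w)"]
  by (intro exI[of _ "max n (length w)"]) auto
qed auto

lemma word_dist_le_iff:
 assumes "g : carrier G" "h : carrier G"
 shows "word_dist G A ev g h <= n \<longleftrightarrow> inv g \<otimes> h : ball n"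
proof -
 let ?P = "%n. \<exists>w\<in>lists A. length w = n & g \<otimes> val w = h"
 obtain w where w: "w : lists A" "val w = inv g \<otimes> h" using val_onto[of "inv g \<otimes> h"] assms by auto
 hence "?P (length w)" using assms by (intro bexI[of _ w]) (auto simp: grp_simps)
 hence P: "?P (word_dist G A ev g h)" unfolding word_dist_def by (rule LeastI)
 show ?thesis
 proof
  assume n: "word_dist G A ev g h <= n"
  from P obtain w where w: "w : lists A" "length w = word_dist G A ev g h" "g \<otimes> val w = h" by blast
  hence "inv g \<otimes> h = val w" using assms by (auto simp: grp_simps)
  thus "inv g \<otimes> h : ball n" using w n by (auto simp: ball_def)
 next
  assume "inv g \<otimes> h : ball n"
  then obtain w where w: "w : lists A" "length w <= n" "val w = inv g \<otimes> h" using ballD by blast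
  hence "?P (length w)" using assms by (intro bexI[of _ w]) (auto simp: grp_simps)
  hence "word_dist G A ev g h <= length w" unfolding word_dist_def by (rule Least_le)
  thus "word_dist G A ev g h <= n" using w by simp
 qed
qed

text \<open>The end points of \<open>u\<close> and \<open>v\<close> are joined by a short word over
  the alphabet; surjectivity of \<open>L\<close> gives words ending at the intermediate points, and
  \<open>trans\<close> composes the comparisons of neighbours. The relation \<open>R\<close> is left
  open so that the argument covers the asynchronous and the synchronous case.\<close>

lemma chain:
 assumes onto: "val ` L = carrier G" and L: "L <= lists A"
  and base: "\<exists>S. finite S & (\<forall>u\<in>L. \<forall>v\<in>L. inv (val u) \<otimes> val v : ball 1 --> R S u v)"
  and trans: "!!S T u v w. u : L ==> v : L ==> w : L ==> R S u v ==> R T v w ==> R (S <#> T) u w"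
  and D: "finite D"
 shows "\<exists>S. finite S & (\<forall>u\<in>L. \<forall>v\<in>L. inv (val u) \<otimes> val v : D --> R S u v)"
proof -
 have "\<exists>S. finite S & (\<forall>u\<in>L. \<forall>v\<in>L. inv (val u) \<otimes> val v : ball n --> R S u v)" for n
 proof (induction n)
  case 0
  obtain S where "finite S" "\<forall>u\<in>L. \<forall>v\<in>L. inv (val u) \<otimes> val v : ball 1 --> R S u v" using base by blast
  thus ?case using ball_mono[of 0 1] by (intro exI[of _ S]) auto
 next
  case (Suc n)
  then obtain T where T: "finite T" "!!u v. u : L ==> v : L ==> inv (val u) \<otimes> val v : ball n ==> R T u v"
   by auto
  obtain S where S: "finite S" "!!u v. u : L ==> v : L ==> inv (val u) \<otimes> val v : ball 1 ==> R S u v"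
   using base by auto
  have "R (S <#> T) u v" if uv: "u : L" "v : L" "inv (val u) \<otimes> val v : ball (Suc n)" for u v
  proof -
   have l: "u : lists A" "v : lists A" using uv L by auto
   obtain z where z: "z : lists A" "length z <= Suc n" "val z = inv (val u) \<otimes> val v"
    using ballD[OF uv(3)] by blast
   let ?a = "take 1 z" and ?b = "drop 1 z"
   have ab: "?a : lists A" "?b : lists A" using z take_lists drop_lists by auto
   obtain w where w: "w : L" "val w = val u \<otimes> val ?a" using onto l ab
    by (metis (no_types, lifting) image_iff m_closed val_closed)
   have "inv (val u) \<otimes> val w = val ?a" using w l ab by (simp add: grp_simps)
   moreover have "val ?a : ball 1" using ab by (auto simp: ball_def)
   ultimately have 1: "R S u w" using S uv w by simp
   have "val v = val u \<otimes> val (?a @ ?b)" using z l by (simp add: grp_simps)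
   hence "val v = val w \<otimes> val ?b" using w ab l by (simp del: append_take_drop_id add: grp_simps)
   moreover have "w : lists A" using w(1) L by blast
   ultimately have "inv (val w) \<otimes> val v = val ?b" using ab by (simp add: inv_cancel1)
   moreover have "val ?b : ball n" using ab z by (auto simp: ball_def)
   ultimately have "R T w v" using T uv w by simp
   thus ?thesis using trans 1 uv w by blast
  qed
  thus ?case using S(1) T(1) finite_set_mult by (intro exI[of _ "S <#> T"]) auto
 qed
 moreover obtain n where n: "D \<inter> carrier G <= ball n" using finite_sub_ball[of "D \<inter> carrier G"] D by auto
 moreover have car: "inv (val u) \<otimes> val v : carrier G" if "u : L" "v : L" for u v using that subsetD[OF L] by simp
 ultimately obtain S where "finite S" "\<forall>u\<in>L. \<forall>v\<in>L. inv (val u) \<otimes> val v : ball n --> R S u v" by blast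
 thus ?thesis using n car by (intro exI[of _ S]) auto
qed

text \<open>One direction extends distance one to arbitrary finite sets by \<open>chain\<close>; the
  other encloses the finite set given by \<open>fel\<close> in a ball.\<close>

lemma async_prop_iff:
 assumes L: "L <= lists A" and onto: "val ` L = carrier G"
 shows "async_prop G A ev L \<longleftrightarrow> fel \<one> L L"
proof
 assume "async_prop G A ev L"
 then obtain K where K: "!!u v. u : L ==> v : L ==> word_dist G A ev (val u) (val v) <= 1 ==> async_fellow G A ev K u v"
  unfolding async_prop_def by blast
 let ?S = "ball K \<union> (%(a, s). inv (ev a) \<otimes> s) ` (A \<times> ball K)"
 have 1: "af ?S \<one> u v" if uv: "u : L" "v : L" "inv (val u) \<otimes> val v : ball 1" for u v
 proof -
  have l: "u : lists A" "v : lists A" using uv L by auto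
  have "async_fellow G A ev K u v" using K uv word_dist_le_iff l by auto
  then obtain \<phi> \<phi>' where r: "reparam \<phi>" "reparam \<phi>'"
   "!!n. word_dist G A ev (word_path G ev u (\<phi> n)) (word_path G ev v (\<phi>' n)) <= K"
   unfolding async_fellow_def by blast
  show ?thesis
  proof (rule reparam_imp_af[OF l one_closed r(1,2)])
   fix n
   show "inv val (take (\<phi> n) u) \<otimes> (\<one> \<otimes> val (take (\<phi>' n) v)) : ball K"
    using r(3)[of n] l take_lists word_dist_le_iff by (simp add: word_path_def)
  qed
 qed
 show "fel \<one> L L"
  unfolding fel_def
 proof (intro allI impI)
  fix D :: "'x set" assume "finite D"
  have "finite ?S" using finite_ball finite_A by auto
  hence "\<exists>S. finite S & (\<forall>u\<in>L. \<forall>v\<in>L. inv (val u) \<otimes> val v : ball 1 --> af S \<one> u v)"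
   using 1 by (intro exI[of _ ?S]) blast
  moreover have "af (S <#> T) \<one> u w" if "af S \<one> u v" "af T \<one> v w" for S T u v w
   using af_trans[OF that] by simp
  ultimately have "\<exists>S. finite S & (\<forall>u\<in>L. \<forall>v\<in>L. inv (val u) \<otimes> val v : D --> af S \<one> u v)"
   using chain[OF onto L, of "%S. af S \<one>" D] \<open>finite D\<close> by blast
  moreover have "\<one> \<otimes> val v = val v" if "v : L" for v using val_closed[OF subsetD[OF L that]] by simp
  ultimately show "\<exists>S. finite S & (\<forall>u\<in>L. \<forall>v\<in>L. inv val u \<otimes> (\<one> \<otimes> val v) : D --> af S \<one> u v)" by simp
 qed
next
 assume f: "fel \<one> L L"
 obtain S where S: "finite S"
  "!!u v. u : L ==> v : L ==> inv (val u) \<otimes> (\<one> \<otimes> val v) : ball 1 ==> af S \<one> u v"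
  by (rule felE[OF f finite_ball[of 1]]) auto
 obtain K where K: "S \<inter> carrier G <= ball K" using finite_sub_ball[of "S \<inter> carrier G"] S by auto
 show "async_prop G A ev L"
  unfolding async_prop_def
 proof (intro exI[of _ K] ballI impI)
  fix u v assume uv: "u : L" "v : L" "word_dist G A ev (val u) (val v) <= 1"
  have l: "u : lists A" "v : lists A" using uv L by auto
  have "af S \<one> u v" using S(2)[OF uv(1,2)] uv(3) l word_dist_le_iff by auto
  hence "af (ball K) \<one> u v" using af_carrier af_mono K by blast
  then obtain \<phi> \<phi>' where r: "reparam \<phi>" "reparam \<phi>'"
   "!!n. inv (val (take (\<phi> n) u)) \<otimes> (\<one> \<otimes> val (take (\<phi>' n) v)) : ball K"
   using af_imp_reparam by blast
  have "word_dist G A ev (word_path G ev u (\<phi> n)) (word_path G ev v (\<phi>' n)) <= K" for n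
   using r(3)[of n] l take_lists word_dist_le_iff by (simp add: word_path_def)
  thus "async_fellow G A ev K u v" unfolding async_fellow_def using r by blast
 qed
qed

lemma sync_prop_iff:
 assumes L: "L <= lists A" and onto: "val ` L = carrier G"
 shows "sync_prop G A ev L \<longleftrightarrow> sfel L"
proof -
 define R where "R S u v \<longleftrightarrow> (\<forall>n. inv (val (take n u)) \<otimes> val (take n v) : S)" for S u v
 have l: "take n u : lists A" if "u : L" for n u by (rule take_lists[OF subsetD[OF L that]])
 show ?thesis
 proof
  assume "sync_prop G A ev L"
  then obtain K where K: "!!u v. u : L ==> v : L ==> word_dist G A ev (val u) (val v) <= 1 ==> sync_fellow G A ev K u v"
   unfolding sync_prop_def by blast
  have "R (ball K) u v" if uv: "u : L" "v : L" "inv (val u) \<otimes> val v : ball 1" for u v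
  proof -
   have "word_dist G A ev (val u) (val v) <= 1"
    using uv word_dist_le_iff[of "val u" "val v" 1] val_closed[OF subsetD[OF L]] by simp
   hence "sync_fellow G A ev K u v" using K uv by blast
   thus ?thesis unfolding R_def sync_fellow_def word_path_def
    using l[OF uv(1)] l[OF uv(2)] word_dist_le_iff by simp
  qed
  hence 1: "\<exists>S. finite S & (\<forall>u\<in>L. \<forall>v\<in>L. inv (val u) \<otimes> val v : ball 1 --> R S u v)"
   using finite_ball by blast
  have 2: "R (S <#> T) u w" if "u : L" "v : L" "w : L" "R S u v" "R T v w" for S T u v w
   unfolding R_def
  proof
   fix n
   have "inv (val (take n u)) \<otimes> val (take n w) =
    (inv (val (take n u)) \<otimes> val (take n v)) \<otimes> (inv (val (take n v)) \<otimes> val (take n w))"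
    using l[OF that(1), of n] l[OF that(2), of n] l[OF that(3), of n] by (simp add: grp_simps)
   thus "inv (val (take n u)) \<otimes> val (take n w) : S <#> T"
    using that(4,5) unfolding R_def by (simp add: set_multI)
  qed
  show "sfel L" unfolding sfel_def R_def[symmetric]
   by (intro allI impI) (rule chain[OF onto L 1 2])
 next
  assume f: "sfel L"
  obtain S where S: "finite S"
   "!!u v n. u : L ==> v : L ==> inv (val u) \<otimes> val v : ball 1 ==> inv (val (take n u)) \<otimes> val (take n v) : S"
   by (rule sfelE[OF f finite_ball[of 1]]) auto
  obtain K where K: "S \<inter> carrier G <= ball K" using finite_sub_ball[of "S \<inter> carrier G"] S by auto
  show "sync_prop G A ev L"
   unfolding sync_prop_def sync_fellow_def word_path_def
  proof (intro exI[of _ K] ballI impI allI)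
   fix u v n assume uv: "u : L" "v : L" "word_dist G A ev (val u) (val v) <= 1"
   have "inv (val u) \<otimes> val v : ball 1"
    using uv word_dist_le_iff[of "val u" "val v" 1] val_closed[OF subsetD[OF L]] by simp
   hence "inv (val (take n u)) \<otimes> val (take n v) : S" using S(2) uv by blast
   thus "word_dist G A ev (val (take n u)) (val (take n v)) <= K"
    using l[OF uv(1), of n] l[OF uv(2), of n] K word_dist_le_iff by auto
  qed
 qed
qed

text \<open>An asynchronous structure without the demand of regularity. \<open>aclass\<close> is
  well behaved on such languages already, so representatives that are not known to be regular can be
  used.\<close>

definition apre :: "'a list set => bool" where
 "apre L \<longleftrightarrow> L <= lists A & val ` L = carrier G & fel \<one> L L"

lemma apreD: assumes "apre L" shows "L <= lists A" "val ` L = carrier G" "fel \<one> L L"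
 using assms by (auto simp: apre_def)

lemma async_aut_iff: "async_aut G A ev L \<longleftrightarrow> apre L & regular_lang A L"
 unfolding async_aut_def apre_def using async_prop_iff by blast

lemma sync_aut_iff: "sync_aut G A ev L \<longleftrightarrow> L <= lists A & val ` L = carrier G & sfel L & regular_lang A L"
 unfolding sync_aut_def using sync_prop_iff by blast

lemma sync_imp_async: "sync_aut G A ev L ==> async_aut G A ev L"
 by (simp add: sync_aut_iff async_aut_iff apre_def sfel_imp_fel)

lemma onto_ex: "val ` L = carrier G ==> x : carrier G ==> \<exists>v\<in>L. val v = x"
 by (metis imageE)

lemma fel_transG:
 assumes "fel x L M" "fel y M N" "L <= lists A" "M <= lists A" "N <= lists A"
  "x : carrier G" "y : carrier G" "val ` M = carrier G"
 shows "fel (x \<otimes> y) L N"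
proof (rule fel_trans[OF assms(1-7)])
 fix u assume "u : L"
 hence "val u : carrier G" using val_closed assms(3) by blast
 then obtain v where "v : M" "val v = inv x \<otimes> val u" using onto_ex[OF assms(8), of "inv x \<otimes> val u"] assms by auto
 thus "\<exists>v\<in>M. val u = x \<otimes> val v" using assms(6) \<open>val u : carrier G\<close>
  by (intro bexI[of _ v]) (simp_all add: inv_cancel2)
qed

lemma fel_sym1: "fel \<one> L M ==> L <= lists A ==> M <= lists A ==> fel \<one> M L"
 using fel_sym[of \<one> L M] by simp

lemma aclass_iff:
 assumes "apre L" shows "M : aclass G A ev L \<longleftrightarrow> async_aut G A ev M & fel \<one> L M"
proof (cases "async_aut G A ev M")
 case True
 hence M: "apre M" by (simp add: async_aut_iff)
 have "async_prop G A ev (L \<union> M) \<longleftrightarrow> fel \<one> (L \<union> M) (L \<union> M)"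
  using assms M by (intro async_prop_iff) (auto simp: apre_def)
 also have "\<dots> \<longleftrightarrow> fel \<one> L M"
 proof
  assume "fel \<one> (L \<union> M) (L \<union> M)"
  thus "fel \<one> L M" by (rule fel_mono) auto
 next
  assume f: "fel \<one> L M"
  have "fel \<one> M L" by (rule fel_sym1[OF f apreD(1)[OF assms] apreD(1)[OF M]])
  thus "fel \<one> (L \<union> M) (L \<union> M)"
   by (intro fel_Un_left fel_Un_right f apreD(3)[OF assms] apreD(3)[OF M])
 qed
 finally show ?thesis using True by (simp add: aclass_def)
qed (simp add: aclass_def)

lemma aclass_eqI:
 assumes "apre L" "apre M" "fel \<one> L M" shows "aclass G A ev L = aclass G A ev M"
proof -
 have "fel \<one> L N \<longleftrightarrow> fel \<one> M N" if "async_aut G A ev N" for N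
 proof -
  have N: "apre N" using that by (simp add: async_aut_iff)
  have mL: "fel \<one> M L" by (rule fel_sym1[OF assms(3) apreD(1)[OF assms(1)] apreD(1)[OF assms(2)]])
  show ?thesis
   using fel_transG[of \<one> M L \<one> N] fel_transG[of \<one> L M \<one> N] mL assms(3) apreD[OF assms(1)] apreD[OF assms(2)] apreD[OF N]
   by auto
 qed
 thus ?thesis using aclass_iff[OF assms(1)] aclass_iff[OF assms(2)] by blast
qed

lemma aclass_self: "async_aut G A ev L ==> L : aclass G A ev L"
 by (simp add: aclass_iff async_aut_iff apreD)

lemma AClassesD:
 assumes "c : AClasses G A ev" "L : c" shows "async_aut G A ev L" "c = aclass G A ev L"
proof -
 obtain M where M: "async_aut G A ev M" "c = aclass G A ev M" using assms by (auto simp: AClasses_def)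
 have M': "apre M" using M by (simp add: async_aut_iff)
 have L: "async_aut G A ev L" "fel \<one> M L" using aclass_iff[OF M', of L] assms M by simp_all
 thus "async_aut G A ev L" "c = aclass G A ev L" using M aclass_eqI[OF M', of L] by (simp_all add: async_aut_iff)
qed

lemma AClasses_ex: "c : AClasses G A ev ==> \<exists>L. L : c"
 using aclass_self by (auto simp: AClasses_def)

lemma aclass_eqD:
 assumes "async_aut G A ev L" "apre M" "aclass G A ev L = aclass G A ev M" shows "fel \<one> M L"
 using aclass_self[OF assms(1)] aclass_iff[OF assms(2), of L] assms(3) by simp

lemma apre_prepend:
 assumes "apre L" "p : lists A" shows "apre ((@) p ` L)"
proof -
 note L = apreD[OF assms(1)]
 have sub: "(@) p ` L <= lists A" using L assms by auto
 have "carrier G <= val ` (@) p ` L"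
 proof
  fix x assume x: "x : carrier G"
  then obtain v where v: "v : L" "val v = inv (val p) \<otimes> x"
   using onto_ex[OF L(2), of "inv (val p) \<otimes> x"] assms by auto
  moreover have "v : lists A" using v L by auto
  ultimately have "x = val (p @ v)" using x assms by (simp add: grp_simps)
  thus "x : val ` (@) p ` L" using v by auto
 qed
 hence onto: "val ` (@) p ` L = carrier G" using sub by auto
 have p: "val p : carrier G" using assms by simp
 have "fel (inv (val p) \<otimes> val p) L L" using L(3) p by simp
 hence "fel (inv (val p)) L ((@) p ` L)" using fel_prepend L assms p by simp
 hence "fel (inv (inv (val p))) ((@) p ` L) L" by (rule fel_sym) (use L sub p in auto)
 hence "fel (\<one> \<otimes> val p) ((@) p ` L) L" using p by simp
 hence "fel \<one> ((@) p ` L) ((@) p ` L)" using fel_prepend[OF sub] L assms by simp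
 thus ?thesis using sub onto by (simp add: apre_def)
qed

text \<open>The representatives hidden in \<open>act_class\<close> are irrelevant: the languages of
  one class are linked by \<open>fel \<one>\<close>, and the prepended word enters through its value
  only, by \<open>fel_prepend\<close>.\<close>

lemma act_class_eq_iff:
 assumes c: "c : AClasses G A ev" "L : c" and d: "d : AClasses G A ev" "M : d" and g: "g : carrier G"
 shows "c = act_class G A ev g d \<longleftrightarrow> fel g L M"
proof -
 define u where "u = (SOME u. u : lists A & word_eval G ev u = g)"
 define N where "N = (SOME L. L : d)"
 have u: "u : lists A" "val u = g" using someI_ex[of "%u. u : lists A & val u = g"] val_onto[OF g]
  unfolding u_def by auto
 have N: "N : d" unfolding N_def using d by (auto intro: someI)
 note Ld = AClassesD[OF c] and Md = AClassesD[OF d] and Nd = AClassesD[OF d(1) N]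
 have pre: "apre L" "apre M" "apre N" using Ld Md Nd by (auto simp: async_aut_iff)
 have MN: "fel \<one> M N" using aclass_iff[OF pre(2), of N] N Md by simp
 have NM: "fel \<one> N M" by (rule fel_sym1[OF MN apreD(1)[OF pre(2)] apreD(1)[OF pre(3)]])
 have act: "act_class G A ev g d = aclass G A ev ((@) u ` N)"
  by (simp add: act_class_def u_def N_def)
 have uN: "apre ((@) u ` N)" using apre_prepend pre u by blast
 have "c = act_class G A ev g d \<longleftrightarrow> fel \<one> L ((@) u ` N)"
  using act Ld(2) aclass_eqI[OF pre(1) uN] aclass_eqD[OF Ld(1) uN] fel_sym1[OF _ apreD(1)[OF uN] apreD(1)[OF pre(1)]] by auto
 also have "\<dots> \<longleftrightarrow> fel g L N" using fel_prepend[of L N u \<one>] apreD(1)[OF pre(1)] apreD(1)[OF pre(3)] u g by simp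
 also have "\<dots> \<longleftrightarrow> fel g L M"
  using fel_transG[of g L N \<one> M] fel_transG[of g L M \<one> N] MN NM g apreD[OF pre(1)] apreD[OF pre(2)] apreD[OF pre(3)] by auto
 finally show ?thesis .
qed

end

section \<open>The van der Waerden action of the fundamental group\<close>

lemma edge_path_Nil [simp]: "edge_path Y V []"
 by (simp add: edge_path_def)

lemma edge_path_Cons: "edge_path Y V (E # es) \<longleftrightarrow> E : edges Y & esrc Y E = V & edge_path Y (etgt Y E) es"
proof (cases es)
 case (Cons E' es')
 have "(\<forall>i. Suc i < length (E # es) --> esrc Y ((E # es) ! Suc i) = etgt Y ((E # es) ! i)) \<longleftrightarrow>
  esrc Y E' = etgt Y E & (\<forall>i. Suc i < length es --> esrc Y (es ! Suc i) = etgt Y (es ! i))"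
  (is "?l \<longleftrightarrow> ?r")
 proof
  assume l: ?l
  show ?r using l[rule_format, of 0] l[rule_format, of "Suc _"] Cons by fastforce
 next
  assume r: ?r
  show ?l
  proof (intro allI impI)
   fix i assume "Suc i < length (E # es)"
   thus "esrc Y ((E # es) ! Suc i) = etgt Y ((E # es) ! i)" using r Cons by (cases i) auto
  qed
 qed
 thus ?thesis using Cons unfolding edge_path_def by auto
qed (auto simp: edge_path_def)

lemma path_end_Nil [simp]: "path_end Y V [] = V"
 and path_end_Cons: "path_end Y V (E # es) = path_end Y (etgt Y E) es"
 and path_end_snoc [simp]: "path_end Y V (es @ [E]) = etgt Y E"
 by (auto simp: path_end_def)

lemma edge_path_snoc: "edge_path Y V (es @ [E]) \<longleftrightarrow> edge_path Y V es & E : edges Y & esrc Y E = path_end Y V es"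
 by (induction es arbitrary: V) (auto simp: edge_path_Cons path_end_Cons)

lemma reduced_path_snoc: "reduced_path Y (es @ [E]) \<longleftrightarrow> reduced_path Y es & (es ~= [] --> E ~= erev Y (last es))"
proof -
 have "reduced_path Y (es @ [E]) \<longleftrightarrow> (\<forall>i. Suc i < length es --> es ! Suc i ~= erev Y (es ! i)) \<and>
  (\<forall>i. Suc i = length es --> E ~= erev Y (es ! i))"
  unfolding reduced_path_def by (auto simp: nth_append less_Suc_eq)
 moreover have "(\<forall>i. Suc i = length es --> E ~= erev Y (es ! i)) \<longleftrightarrow> (es ~= [] --> E ~= erev Y (last es))"
  by (cases es rule: rev_cases) auto
 ultimately show ?thesis unfolding reduced_path_def by simp
qed

locale gog =
 fixes Y :: "('v,'e,'g,'f) gog"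
 assumes gog: "graph_of_groups Y"
begin

abbreviation "VG V \<equiv> vgrp Y V"
abbreviation vmul ("(_ *[_]/ _)" [70, 0, 71] 70) where "x *[V] y \<equiv> x \<otimes>\<^bsub>VG V\<^esub> y"
abbreviation "FG E \<equiv> carrier (egrp Y E)"

lemma base_in: "base Y : verts Y" and fin_verts: "finite (verts Y)" and fin_edges: "finite (edges Y)"
 and VG_group: "V : verts Y ==> group (VG V)"
 and tree_sub: "E : tree Y ==> E : edges Y" and tree_rev: "E : tree Y ==> erev Y E : tree Y"
 and tree_ex1: "V : verts Y ==> W : verts Y ==>
  \<exists>!es. set es <= tree Y & edge_path Y V es & reduced_path Y es & path_end Y V es = W"
 using gog by (auto simp: graph_of_groups_def)

context
 fixes E assumes E: "E : edges Y"
begin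

lemma edge_facts: "erev Y E : edges Y & erev Y (erev Y E) = E & erev Y E ~= E \<and>
    esrc Y E : verts Y & etgt Y E : verts Y & esrc Y (erev Y E) = etgt Y E \<and>
    group (egrp Y E) & finite (FG E) & egrp Y (erev Y E) = egrp Y E \<and>
    bd0 Y E : hom (egrp Y E) (VG (esrc Y E)) & inj_on (bd0 Y E) (FG E) \<and>
    bd1 Y E : hom (egrp Y E) (VG (etgt Y E)) & inj_on (bd1 Y E) (FG E) \<and>
    (\<forall>f\<in>FG E. bd0 Y (erev Y E) f = bd1 Y E f)"
 using gog E by (simp add: graph_of_groups_def)

lemma rev_in: "erev Y E : edges Y" and rev_rev: "erev Y (erev Y E) = E"
 and src_in: "esrc Y E : verts Y" and tgt_in: "etgt Y E : verts Y"
 and src_rev: "esrc Y (erev Y E) = etgt Y E" and FG_group: "group (egrp Y E)" and FG_finite: "finite (FG E)"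
 and egrp_rev: "egrp Y (erev Y E) = egrp Y E"
 and bd0_rev: "f : FG E ==> bd0 Y (erev Y E) f = bd1 Y E f"
 using edge_facts by auto

lemma bd0_closed: "f : FG E ==> bd0 Y E f : carrier (VG (esrc Y E))"
 and bd1_closed: "f : FG E ==> bd1 Y E f : carrier (VG (etgt Y E))"
 and bd1_mult: "f : FG E ==> f' : FG E ==> bd1 Y E (f \<otimes>\<^bsub>egrp Y E\<^esub> f') = bd1 Y E f *[etgt Y E] bd1 Y E f'"
 using edge_facts by (auto simp: hom_def)

lemma bd0_group_hom: "group_hom (egrp Y E) (VG (esrc Y E)) (bd0 Y E)"
 and bd1_group_hom: "group_hom (egrp Y E) (VG (etgt Y E)) (bd1 Y E)"
 using edge_facts VG_group by (auto simp: group_hom_def group_hom_axioms_def)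

lemma bd0_inj: "f : FG E ==> f' : FG E ==> bd0 Y E f = bd0 Y E f' ==> f = f'"
 using edge_facts by (auto simp: inj_on_def)

end

lemma tgt_rev: "E : edges Y ==> etgt Y (erev Y E) = esrc Y E"
 by (metis rev_in rev_rev src_rev)

lemma bd1_rev: "E : edges Y ==> f : FG E ==> bd1 Y (erev Y E) f = bd0 Y E f"
 by (metis bd0_rev egrp_rev rev_in rev_rev)

section \<open>The group of words modulo the defining relations\<close>

abbreviation "G \<equiv> pi1 Y"
abbreviation "Ltr \<equiv> lists (pi1_letters Y)"

definition cls :: "('v \<times> 'g + 'e) list => ('v,'e,'g) pi1elt" where
 "cls w = {w'. pi1_rel Y w w'}"

lemma cls_eq: "cls w = cls w' \<longleftrightarrow> pi1_rel Y w w'"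
 unfolding cls_def using pi1_rel.refl pi1_rel.sym pi1_rel.trans by (metis mem_Collect_eq Collect_cong)

lemma rel_append: "pi1_rel Y w w' ==> pi1_rel Y v v' ==> pi1_rel Y (w @ v) (w' @ v')"
 using pi1_rel.ctx[of Y w w' "[]" v] pi1_rel.ctx[of Y v v' w' "[]"] pi1_rel.trans by fastforce

lemma carrier_G: "carrier G = cls ` Ltr"
 by (auto simp: pi1_def cls_def)

lemma one_G: "\<one>\<^bsub>G\<^esub> = cls []"
 by (simp add: pi1_def cls_def)

lemma mult_G: "cls w \<otimes>\<^bsub>G\<^esub> cls v = cls (w @ v)"
proof -
 have "pi1_rel Y (x @ z) u \<longleftrightarrow> pi1_rel Y (w @ v) u" if "pi1_rel Y w x" "pi1_rel Y v z" for x z u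
  using rel_append[OF that] pi1_rel.trans pi1_rel.sym by metis
 hence "{u. \<exists>x\<in>cls w. \<exists>z\<in>cls v. pi1_rel Y (x @ z) u} = cls (w @ v)"
  unfolding cls_def using pi1_rel.refl[of Y w] pi1_rel.refl[of Y v] by blast
 thus ?thesis by (simp add: pi1_def)
qed

lemma vincl_cls: "vincl Y V g = cls [Inl (V, g)]" and stab_cls: "stab Y E = cls [Inr E]"
 by (auto simp: vincl_def stab_def cls_def)

lemma letter_Inl [simp]: "Inl (V, g) : pi1_letters Y \<longleftrightarrow> V : verts Y & g : carrier (VG V)"
 and letter_Inr [simp]: "Inr E : pi1_letters Y \<longleftrightarrow> E : edges Y"
 by (auto simp: pi1_letters_def)

definition linv :: "'v \<times> 'g + 'e => 'v \<times> 'g + 'e" where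
 "linv a = (case a of Inl (V, g) => Inl (V, inv\<^bsub>VG V\<^esub> g) | Inr E => Inr (erev Y E))"

lemma linv: assumes "a : pi1_letters Y" shows "linv a : pi1_letters Y" "pi1_rel Y [linv a, a] []"
proof (atomize (full), cases a)
 case (Inl p)
 then obtain V g where a: "a = Inl (V, g)" "V : verts Y" "g : carrier (VG V)" using assms by (cases p) auto
 interpret V: group "VG V" using VG_group a by simp
 have "pi1_rel Y [linv a, a] [Inl (V, \<one>\<^bsub>VG V\<^esub>)]"
  using pi1_rel.vmul[of V Y "inv\<^bsub>VG V\<^esub> g" g] a by (simp add: linv_def)
 thus "linv a : pi1_letters Y & pi1_rel Y [linv a, a] []"
  using pi1_rel.trans[OF _ pi1_rel.vone[OF a(2)]] a by (auto simp: linv_def)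
next
 case (Inr E)
 hence E: "E : edges Y" using assms by simp
 thus "linv a : pi1_letters Y & pi1_rel Y [linv a, a] []"
  using pi1_rel.einv[OF rev_in[OF E]] rev_rev[OF E] rev_in[OF E] Inr by (simp add: linv_def)
qed

lemma group_G: "group G"
proof (rule groupI)
 fix x y assume "x : carrier G" "y : carrier G"
 thus "x \<otimes>\<^bsub>G\<^esub> y : carrier G" by (auto simp: carrier_G mult_G)
next
 show "\<one>\<^bsub>G\<^esub> : carrier G" by (auto simp: carrier_G one_G)
next
 fix x y z assume "x : carrier G" "y : carrier G" "z : carrier G"
 thus "x \<otimes>\<^bsub>G\<^esub> y \<otimes>\<^bsub>G\<^esub> z = x \<otimes>\<^bsub>G\<^esub> (y \<otimes>\<^bsub>G\<^esub> z)" by (auto simp: carrier_G mult_G)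
next
 fix x assume "x : carrier G"
 thus "\<one>\<^bsub>G\<^esub> \<otimes>\<^bsub>G\<^esub> x = x" by (auto simp: carrier_G one_G mult_G)
next
 fix x assume "x : carrier G"
 then obtain w where w: "w : Ltr" "x = cls w" by (auto simp: carrier_G)
 have "rev (map linv w) : Ltr & pi1_rel Y (rev (map linv w) @ w) []" using w(1)
 proof (induction w rule: list.induct)
  case Nil
  thus ?case by (simp add: pi1_rel.refl)
 next
  case (Cons a w)
  hence a: "a : pi1_letters Y" by simp
  have "pi1_rel Y (rev (map linv w) @ [linv a, a] @ w) (rev (map linv w) @ [] @ w)"
   by (rule pi1_rel.ctx[OF linv(2)[OF a]])
  thus ?case using Cons a linv(1)[OF a] pi1_rel.trans by auto
 qed
 thus "\<exists>y\<in>carrier G. y \<otimes>\<^bsub>G\<^esub> x = \<one>\<^bsub>G\<^esub>" using w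
  by (intro bexI[of _ "cls (rev (map linv w))"]) (auto simp: mult_G one_G cls_eq carrier_G)
qed

sublocale G: group G by (rule group_G)

lemma vincl_closed [simp]: "V : verts Y ==> g : carrier (VG V) ==> vincl Y V g : carrier G"
 by (auto simp: vincl_cls carrier_G)

lemma stab_closed [simp]: "E : edges Y ==> stab Y E : carrier G"
 by (auto simp: stab_cls carrier_G)

lemma vincl_mult: "V : verts Y ==> g : carrier (VG V) ==> h : carrier (VG V) ==>
  vincl Y V (g *[V] h) = vincl Y V g \<otimes>\<^bsub>G\<^esub> vincl Y V h"
 using pi1_rel.vmul[of V Y g h] by (simp add: vincl_cls mult_G cls_eq pi1_rel.sym)

lemma vincl_one: "V : verts Y ==> vincl Y V \<one>\<^bsub>VG V\<^esub> = \<one>\<^bsub>G\<^esub>"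
 using pi1_rel.vone[of V Y] by (simp add: vincl_cls one_G cls_eq)

lemma vincl_group_hom: "V : verts Y ==> group_hom (VG V) G (vincl Y V)"
 using VG_group group_G by (auto simp: group_hom_def group_hom_axioms_def hom_def vincl_mult)

lemma stab_tree: "E : tree Y ==> stab Y E = \<one>\<^bsub>G\<^esub>"
 using pi1_rel.etree[of E Y] by (simp add: stab_cls one_G cls_eq)

lemma stab_rev: "E : edges Y ==> stab Y E \<otimes>\<^bsub>G\<^esub> stab Y (erev Y E) = \<one>\<^bsub>G\<^esub>"
 using pi1_rel.einv[of E Y] by (simp add: stab_cls one_G cls_eq mult_G)

lemma stab_conj: "E : edges Y ==> f : FG E ==>
  vincl Y (esrc Y E) (bd0 Y E f) \<otimes>\<^bsub>G\<^esub> stab Y E = stab Y E \<otimes>\<^bsub>G\<^esub> vincl Y (etgt Y E) (bd1 Y E f)"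
 using pi1_rel.econj[of E Y f] by (simp add: stab_cls vincl_cls cls_eq mult_G)

subsection \<open>The action on normal forms\<close>

definition cos :: "'e => 'g => 'g set" where
 "cos E g = (%f. g *[esrc Y E] bd0 Y E f) ` FG E"

text \<open>The trivial coset is represented by the unit, so that backtracking can be recognized
  from the representative.\<close>

definition rp :: "'e => 'g => 'g" where
 "rp E g = (if g : bd0 Y E ` FG E then \<one>\<^bsub>VG (esrc Y E)\<^esub> else SOME s. s : cos E g)"

definition fe :: "'e => 'g => 'f" where
 "fe E g = (THE f. f : FG E & g = rp E g *[esrc Y E] bd0 Y E f)"

context
 fixes E assumes E: "E : edges Y"
begin

interpretation S: group "VG (esrc Y E)" using VG_group src_in E by simp
interpretation F: group "egrp Y E" using FG_group E by simp
interpretation h: group_hom "egrp Y E" "VG (esrc Y E)" "bd0 Y E" using bd0_group_hom E by simp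

text \<open>Injectivity of \<open>bd0 Y E\<close> makes the edge-group component unique, so the
  definite description in \<open>fe\<close> denotes.\<close>

lemma rp_fe:
 assumes g: "g : carrier (VG (esrc Y E))"
 shows "rp E g : carrier (VG (esrc Y E))" "fe E g : FG E" "g = rp E g *[esrc Y E] bd0 Y E (fe E g)"
proof -
 have "\<exists>f\<in>FG E. rp E g : carrier (VG (esrc Y E)) & g = rp E g *[esrc Y E] bd0 Y E f"
 proof (cases "g : bd0 Y E ` FG E")
  case True
  thus ?thesis by (auto simp: rp_def)
 next
  case False
  have "g : cos E g" unfolding cos_def using g by (intro image_eqI[of _ _ "\<one>\<^bsub>egrp Y E\<^esub>"]) auto
  hence "rp E g : cos E g" using False unfolding rp_def by (auto intro: someI)
  then obtain f where f: "f : FG E" "rp E g = g *[esrc Y E] bd0 Y E f" by (auto simp: cos_def)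
  hence "g = rp E g *[esrc Y E] bd0 Y E (inv\<^bsub>egrp Y E\<^esub> f)" using g by (simp add: S.m_assoc)
  thus ?thesis using f g by (intro bexI[of _ "inv\<^bsub>egrp Y E\<^esub> f"]) auto
 qed
 then obtain f where f: "f : FG E" "rp E g : carrier (VG (esrc Y E))" "g = rp E g *[esrc Y E] bd0 Y E f" by blast
 have uniq: "f' = f" if "f' : FG E & g = rp E g *[esrc Y E] bd0 Y E f'" for f'
 proof -
  have "rp E g *[esrc Y E] bd0 Y E f' = rp E g *[esrc Y E] bd0 Y E f" using that f by simp
  hence "bd0 Y E f' = bd0 Y E f" using f(1,2) that[THEN conjunct1] by simp
  thus ?thesis using bd0_inj[OF E] f that by blast
 qed
 have *: "fe E g : FG E & g = rp E g *[esrc Y E] bd0 Y E (fe E g)"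
  unfolding fe_def by (rule theI[where P = "%f. f : FG E & g = rp E g *[esrc Y E] bd0 Y E f" and a = f, OF conjI[OF f(1,3)] uniq])
 show "rp E g : carrier (VG (esrc Y E))" by (fact f(2))
 show "fe E g : FG E" "g = rp E g *[esrc Y E] bd0 Y E (fe E g)"
  by (fact *[THEN conjunct1], fact *[THEN conjunct2])
qed

lemma fe_eqI:
 assumes "g : carrier (VG (esrc Y E))" "f : FG E" "g = rp E g *[esrc Y E] bd0 Y E f"
 shows "fe E g = f"
proof -
 have "rp E g *[esrc Y E] bd0 Y E (fe E g) = rp E g *[esrc Y E] bd0 Y E f"
  using rp_fe(3)[OF assms(1)] assms by simp
 hence "bd0 Y E (fe E g) = bd0 Y E f" using rp_fe(1,2)[OF assms(1)] assms(2) by simp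
 thus ?thesis using bd0_inj[OF E] rp_fe[OF assms(1)] assms by blast
qed

lemma in_bd0_mult:
 assumes g: "g : carrier (VG (esrc Y E))" and f: "f : FG E"
 shows "g *[esrc Y E] bd0 Y E f : bd0 Y E ` FG E \<longleftrightarrow> g : bd0 Y E ` FG E"
proof
 assume "g *[esrc Y E] bd0 Y E f : bd0 Y E ` FG E"
 then obtain f' where f': "f' : FG E" "g *[esrc Y E] bd0 Y E f = bd0 Y E f'" by auto
 hence "g = bd0 Y E f' *[esrc Y E] inv\<^bsub>VG (esrc Y E)\<^esub> (bd0 Y E f)" using g f by (metis S.inv_solve_right h.hom_closed)
 hence "g = bd0 Y E (f' \<otimes>\<^bsub>egrp Y E\<^esub> inv\<^bsub>egrp Y E\<^esub> f)" using f f'(1) by simp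
 thus "g : bd0 Y E ` FG E" using f f'(1) by blast
next
 assume "g : bd0 Y E ` FG E"
 then obtain f' where "f' : FG E" "g = bd0 Y E f'" by auto
 thus "g *[esrc Y E] bd0 Y E f : bd0 Y E ` FG E"
  using f by (intro image_eqI[of _ _ "f' \<otimes>\<^bsub>egrp Y E\<^esub> f"]) auto
qed

lemma rp_mult:
 assumes g: "g : carrier (VG (esrc Y E))" and f: "f : FG E"
 shows "rp E (g *[esrc Y E] bd0 Y E f) = rp E g" "fe E (g *[esrc Y E] bd0 Y E f) = fe E g \<otimes>\<^bsub>egrp Y E\<^esub> f"
proof -
 have "cos E (g *[esrc Y E] bd0 Y E f) = cos E g"
 proof (intro equalityI subsetI)
  fix x assume "x : cos E (g *[esrc Y E] bd0 Y E f)"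
  then obtain f' where "f' : FG E" "x = g *[esrc Y E] bd0 Y E f *[esrc Y E] bd0 Y E f'" by (auto simp: cos_def)
  thus "x : cos E g" using f g unfolding cos_def
   by (intro image_eqI[of _ _ "f \<otimes>\<^bsub>egrp Y E\<^esub> f'"]) (auto simp: S.m_assoc)
 next
  fix x assume "x : cos E g"
  then obtain f' where "f' : FG E" "x = g *[esrc Y E] bd0 Y E f'" by (auto simp: cos_def)
  moreover have "bd0 Y E f *[esrc Y E] (inv\<^bsub>VG (esrc Y E)\<^esub> bd0 Y E f *[esrc Y E] bd0 Y E f') = bd0 Y E f'"
   using f \<open>f' : FG E\<close> by (simp add: S.m_assoc[symmetric])
  ultimately show "x : cos E (g *[esrc Y E] bd0 Y E f)" using f g unfolding cos_def
   by (intro image_eqI[of _ _ "inv\<^bsub>egrp Y E\<^esub> f \<otimes>\<^bsub>egrp Y E\<^esub> f'"]) (auto simp: S.m_assoc)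
 qed
 thus r: "rp E (g *[esrc Y E] bd0 Y E f) = rp E g"
  unfolding rp_def using in_bd0_mult[OF g f] by simp
 have "g *[esrc Y E] bd0 Y E f = rp E g *[esrc Y E] bd0 Y E (fe E g) *[esrc Y E] bd0 Y E f"
  using rp_fe(3)[OF g] by simp
 hence "g *[esrc Y E] bd0 Y E f = rp E g *[esrc Y E] bd0 Y E (fe E g \<otimes>\<^bsub>egrp Y E\<^esub> f)"
  using rp_fe(1,2)[OF g] f by (simp add: S.m_assoc)
 thus "fe E (g *[esrc Y E] bd0 Y E f) = fe E g \<otimes>\<^bsub>egrp Y E\<^esub> f"
  using r rp_fe(1,2)[OF g] f g by (intro fe_eqI) (simp_all add: h.hom_closed)
qed

lemma rp_rp: assumes g: "g : carrier (VG (esrc Y E))" shows "rp E (rp E g) = rp E g"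
proof -
 have "rp E g = rp E (rp E g *[esrc Y E] bd0 Y E (fe E g))" using rp_fe[OF g] by simp
 thus ?thesis using rp_mult(1)[of "rp E g" "fe E g"] rp_fe[OF g] by simp
qed

lemma rp_one_iff: assumes g: "g : carrier (VG (esrc Y E))"
 shows "rp E g = \<one>\<^bsub>VG (esrc Y E)\<^esub> \<longleftrightarrow> g : bd0 Y E ` FG E"
proof
 assume "rp E g = \<one>\<^bsub>VG (esrc Y E)\<^esub>"
 hence "g = bd0 Y E (fe E g)" using rp_fe[OF g] by simp
 thus "g : bd0 Y E ` FG E" using rp_fe(2)[OF g] by blast
qed (simp add: rp_def)

lemma rp_of_rep:
 assumes "s : carrier (VG (esrc Y E))" "rp E s = s" "f : FG E"
 shows "rp E (s *[esrc Y E] bd0 Y E f) = s" "fe E (s *[esrc Y E] bd0 Y E f) = f"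
proof -
 show r: "rp E (s *[esrc Y E] bd0 Y E f) = s" using rp_mult(1)[OF assms(1,3)] assms by simp
 show "fe E (s *[esrc Y E] bd0 Y E f) = f" by (rule fe_eqI) (use assms r in auto)
qed

lemma rp_of_bd0: assumes "f : FG E" shows "rp E (bd0 Y E f) = \<one>\<^bsub>VG (esrc Y E)\<^esub>" "fe E (bd0 Y E f) = f"
proof -
 show r: "rp E (bd0 Y E f) = \<one>\<^bsub>VG (esrc Y E)\<^esub>" using assms by (simp add: rp_def)
 show "fe E (bd0 Y E f) = f" by (rule fe_eqI) (use assms r in auto)
qed

end

section \<open>Stacks, configurations and the action of single letters\<close>

definition endv :: "('g \<times> 'e) list => 'v" where
 "endv st = (case st of [] => base Y | p # _ => etgt Y (snd p))"

lemma endv_simps [simp]: "endv [] = base Y" "endv ((s, E) # st) = etgt Y E"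
 by (simp_all add: endv_def)

text \<open>The head of the list is the last edge of the normal form, so the ancestors of a vertex
  of the Bass-Serre tree are the suffixes of its stack. The last conjunct excludes
  backtracking.\<close>

fun vst :: "('g \<times> 'e) list => bool" where
 "vst [] = True"
| "vst ((s, E) # st) \<longleftrightarrow> vst st & E : edges Y & endv st = esrc Y E & s : carrier (VG (esrc Y E)) & rp E s = s \<and>
   (\<forall>s' E' st'. st = (s', E') # st' --> \<not> (E = erev Y E' & s = \<one>\<^bsub>VG (esrc Y E)\<^esub>))"

text \<open>A stack together with a final element of the vertex group \<open>VG V\<close>: the
  normal forms ending at \<open>V\<close>.\<close>

definition Om :: "'v => (('g \<times> 'e) list \<times> 'g) set" where
 "Om V = {(st, g). vst st & endv st = V & g : carrier (VG V)}"

definition mulv :: "'v => 'g => ('g \<times> 'e) list \<times> 'g => ('g \<times> 'e) list \<times> 'g" where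
 "mulv V k c = (fst c, snd c *[V] k)"

definition pops :: "'e => ('g \<times> 'e) list \<times> 'g => bool" where
 "pops E c \<longleftrightarrow> fst c ~= [] & E = erev Y (snd (hd (fst c))) & snd c : bd0 Y E ` FG E"

text \<open>Right multiplication by the stable letter of \<open>E\<close> on normal forms. The
  edge-group part of the last element is carried across \<open>E\<close>; if this would backtrack,
  the previous edge is removed and the element is absorbed by the earlier vertex group.\<close>

definition tac :: "'e => ('g \<times> 'e) list \<times> 'g => ('g \<times> 'e) list \<times> 'g" where
 "tac E c = (if pops E c
   then (tl (fst c), fst (hd (fst c)) *[etgt Y E] bd1 Y E (fe E (snd c)))
   else ((rp E (snd c), E) # fst c, bd1 Y E (fe E (snd c))))"

lemma mulv_Om: "V : verts Y ==> c : Om V ==> k : carrier (VG V) ==> mulv V k c : Om V"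
 using VG_group[of V] by (auto simp: Om_def mulv_def group.subgroup_self subgroup.m_closed)

lemma endv_verts: "vst st ==> endv st : verts Y"
 by (cases st) (auto simp: base_in tgt_in)

lemma tac_push: assumes E: "E : edges Y" and c: "(st, g) : Om (esrc Y E)" and p: "\<not> pops E (st, g)"
 shows "tac E (st, g) = ((rp E g, E) # st, bd1 Y E (fe E g))" "vst ((rp E g, E) # st)" "fe E g : FG E"
proof -
 have g: "g : carrier (VG (esrc Y E))" "vst st" "endv st = esrc Y E" using c by (auto simp: Om_def)
 show "tac E (st, g) = ((rp E g, E) # st, bd1 Y E (fe E g))" using p by (simp add: tac_def)
 show "vst ((rp E g, E) # st)"
  using g E rp_fe[OF E g(1)] rp_rp[OF E g(1)] rp_one_iff[OF E g(1)] p by (auto simp: pops_def)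
 show "fe E g : FG E" using rp_fe[OF E g(1)] by simp
qed

lemma tac_pop: assumes E: "E : edges Y" and c: "(st, g) : Om (esrc Y E)" and p: "pops E (st, g)"
 obtains s E' st' f where "st = (s, E') # st'" "E = erev Y E'" "E' : edges Y" "erev Y E = E'" "f : FG E'"
  "g = bd0 Y E f" "g = bd1 Y E' f" "vst ((s, E') # st')"
  "tac E (st, g) = (st', s *[esrc Y E'] bd0 Y E' f)"
proof -
 have g: "g : carrier (VG (esrc Y E))" "vst st" "endv st = esrc Y E" using c by (auto simp: Om_def)
 obtain s E' st' where st: "st = (s, E') # st'" "E = erev Y E'" using p by (cases st) (auto simp: pops_def)
 have E': "E' : edges Y" using g st by simp
 obtain f where f: "f : FG E" "g = bd0 Y E f" using p by (auto simp: pops_def)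
 hence f': "f : FG E'" using egrp_rev[OF E'] st by simp
 have "tac E (st, g) = (st', s *[esrc Y E'] bd0 Y E' f)"
  using p st f rp_of_bd0(2)[OF E f(1)] tgt_rev[OF E'] bd1_rev[OF E' f'] by (simp add: tac_def)
 moreover have "erev Y E = E'" "g = bd1 Y E' f" "vst ((s, E') # st')"
  using rev_rev[OF E'] st bd0_rev[OF E' f'] f(2) g(2) by auto
 ultimately show thesis using that[OF st E' _ f' f(2)] by blast
qed

lemma tac_Om: assumes E: "E : edges Y" and c: "c : Om (esrc Y E)" shows "tac E c : Om (etgt Y E)"
proof -
 obtain st g where sg: "c = (st, g)" by (cases c)
 note c = c[unfolded sg]
 show ?thesis
 proof (cases "pops E (st, g)")
  case False
  note t = tac_push[OF E c False]
  thus ?thesis using sg E bd1_closed[OF E] by (auto simp only: Om_def mem_Collect_eq prod.case endv_simps)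
 next
  case True
  from tac_pop[OF E c True] obtain s E' st' f where t: "E = erev Y E'" "E' : edges Y" "f : FG E'" "vst ((s, E') # st')"
   "tac E (st, g) = (st', s *[esrc Y E'] bd0 Y E' f)" by metis
  interpret S: group "VG (esrc Y E')" using VG_group[OF src_in[OF t(2)]] .
  show ?thesis using t sg tgt_rev[OF t(2)] bd0_closed[OF t(2,3)] by (auto simp: Om_def)
 qed
qed

text \<open>A push is undone by a pop and conversely. After a pop the exposed configuration cannot
  be popped once more, because the stack was reduced; hence the removed edge is pushed back.\<close>

lemma tac_rev: assumes E: "E : edges Y" and c: "c : Om (esrc Y E)" shows "tac (erev Y E) (tac E c) = c"
proof -
 obtain st g where sg: "c = (st, g)" by (cases c)
 note c = c[unfolded sg]
 have g: "g : carrier (VG (esrc Y E))" using c by (auto simp: Om_def)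
 show ?thesis
 proof (cases "pops E (st, g)")
  case False
  note t = tac_push[OF E c False]
  have b: "bd1 Y E (fe E g) = bd0 Y (erev Y E) (fe E g)" "fe E g : FG (erev Y E)"
   using bd0_rev[OF E t(3)] t(3) egrp_rev[OF E] by auto
  have "pops (erev Y E) (tac E (st, g))" unfolding t pops_def using b by auto
  hence "tac (erev Y E) (tac E (st, g)) = (st, rp E g *[esrc Y E] bd0 Y E (fe E g))"
   unfolding tac_def[of "erev Y E"]
   using b rp_of_bd0(2)[OF rev_in[OF E] b(2)] tgt_rev[OF E] bd1_rev[OF E t(3)] t(1) by simp
  thus ?thesis using rp_fe(3)[OF E g] sg by simp
 next
  case True
  from tac_pop[OF E c True] obtain s E' st' f where t: "st = (s, E') # st'" "E = erev Y E'" "E' : edges Y" "erev Y E = E'" "f : FG E'"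
   "g = bd1 Y E' f" "vst ((s, E') # st')"
   "tac E (st, g) = (st', s *[esrc Y E'] bd0 Y E' f)" by metis
  have s: "s : carrier (VG (esrc Y E'))" "rp E' s = s" using t by auto
  interpret S: group "VG (esrc Y E')" using VG_group[OF src_in[OF t(3)]] .
  have "\<not> pops E' (tac E (st, g))"
  proof
   assume "pops E' (tac E (st, g))"
   then obtain s2 E2 st2 where "st' = (s2, E2) # st2" "E' = erev Y E2" "s *[esrc Y E'] bd0 Y E' f : bd0 Y E' ` FG E'"
    unfolding t(8) pops_def by (cases st') auto
   moreover from this have "s = \<one>\<^bsub>VG (esrc Y E')\<^esub>"
    using in_bd0_mult[OF t(3) s(1) t(5)] rp_one_iff[OF t(3) s(1)] s by simp
   ultimately show False using t(7) by auto
  qed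
  thus ?thesis unfolding t(4) sg using t rp_of_rep[OF t(3) s t(5)] by (simp add: tac_def)
 qed
qed

text \<open>Makes the conjugation relations of the edge groups hold for the action.\<close>

lemma tac_mulv: assumes E: "E : edges Y" and c: "c : Om (esrc Y E)" and f: "f : FG E"
 shows "tac E (mulv (esrc Y E) (bd0 Y E f) c) = mulv (etgt Y E) (bd1 Y E f) (tac E c)"
proof -
 obtain st g where sg: "c = (st, g)" by (cases c)
 have g: "g : carrier (VG (esrc Y E))" "vst st" using c sg by (auto simp: Om_def)
 interpret T: group "VG (etgt Y E)" using VG_group tgt_in E by simp
 have fe: "fe E g : FG E" using rp_fe[OF E g(1)] by simp
 have p: "pops E (st, g *[esrc Y E] bd0 Y E f) \<longleftrightarrow> pops E (st, g)"
  unfolding pops_def using in_bd0_mult[OF E g(1) f] by simp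
 have hd: "fst (hd st) : carrier (VG (etgt Y E))" if "pops E (st, g)"
  using that g tgt_rev by (cases st) (auto simp: pops_def)
 show ?thesis unfolding sg mulv_def using p hd rp_mult[OF E g(1) f] bd1_mult[OF E fe f] bd1_closed[OF E fe] bd1_closed[OF E f]
  by (simp add: tac_def T.m_assoc)
qed

fun cst :: "('g \<times> 'e) list => ('v,'e,'g) pi1elt" where
 "cst [] = \<one>\<^bsub>G\<^esub>"
| "cst ((s, E) # st) = cst st \<otimes>\<^bsub>G\<^esub> vincl Y (esrc Y E) s \<otimes>\<^bsub>G\<^esub> stab Y E"

definition cval :: "('g \<times> 'e) list \<times> 'g => ('v,'e,'g) pi1elt" where
 "cval c = cst (fst c) \<otimes>\<^bsub>G\<^esub> vincl Y (endv (fst c)) (snd c)"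

lemma cst_closed [simp]: "vst st ==> cst st : carrier G"
 by (induction st rule: vst.induct) (auto simp: src_in)

lemma cval_closed: "c : Om V ==> cval c : carrier G"
 using endv_verts by (auto simp: cval_def Om_def)

lemma cval_mulv: "c : Om V ==> k : carrier (VG V) ==> cval (mulv V k c) = cval c \<otimes>\<^bsub>G\<^esub> vincl Y V k"
 using endv_verts by (auto simp: cval_def mulv_def Om_def vincl_mult G.m_assoc)

lemma cval_tac: assumes E: "E : edges Y" and c: "c : Om (esrc Y E)" shows "cval (tac E c) = cval c \<otimes>\<^bsub>G\<^esub> stab Y E"
proof -
 obtain st g where sg: "c = (st, g)" by (cases c)
 note c = c[unfolded sg]
 have g: "g : carrier (VG (esrc Y E))" "vst st" "endv st = esrc Y E" using c by (auto simp: Om_def)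
 note V = src_in[OF E] tgt_in[OF E]
 show ?thesis
 proof (cases "pops E (st, g)")
  case False
  note t = tac_push[OF E c False]
  note r = rp_fe[OF E g(1)]
  have "cval c \<otimes>\<^bsub>G\<^esub> stab Y E = cst st \<otimes>\<^bsub>G\<^esub> vincl Y (esrc Y E) (rp E g *[esrc Y E] bd0 Y E (fe E g)) \<otimes>\<^bsub>G\<^esub> stab Y E"
   using sg g r(3) by (simp add: cval_def)
  also have "\<dots> = cst st \<otimes>\<^bsub>G\<^esub> vincl Y (esrc Y E) (rp E g) \<otimes>\<^bsub>G\<^esub> (vincl Y (esrc Y E) (bd0 Y E (fe E g)) \<otimes>\<^bsub>G\<^esub> stab Y E)"
   using g(2) r(1) V E bd0_closed[OF E r(2)] by (simp add: vincl_mult G.m_assoc)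
  also have "\<dots> = cst st \<otimes>\<^bsub>G\<^esub> vincl Y (esrc Y E) (rp E g) \<otimes>\<^bsub>G\<^esub> (stab Y E \<otimes>\<^bsub>G\<^esub> vincl Y (etgt Y E) (bd1 Y E (fe E g)))"
   using stab_conj[OF E r(2)] by simp
  also have "\<dots> = cval (tac E c)" using sg t g r V E bd1_closed[OF E r(2)] by (simp add: cval_def G.m_assoc)
  finally show ?thesis ..
 next
  case True
  from tac_pop[OF E c True] obtain s E' st' f where t: "st = (s, E') # st'" "E = erev Y E'" "E' : edges Y" "erev Y E = E'" "f : FG E'"
   "g = bd1 Y E' f" "vst ((s, E') # st')"
   "tac E (st, g) = (st', s *[esrc Y E'] bd0 Y E' f)" by metis
  have s: "s : carrier (VG (esrc Y E'))" "vst st'" "endv st' = esrc Y E'" using t by auto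
  note V' = src_in[OF t(3)] tgt_in[OF t(3)] bd0_closed[OF t(3,5)] bd1_closed[OF t(3,5)]
  let ?x = "cst st' \<otimes>\<^bsub>G\<^esub> vincl Y (esrc Y E') s"
  have x: "?x : carrier G" using s V' by simp
  have "cval c \<otimes>\<^bsub>G\<^esub> stab Y E = ?x \<otimes>\<^bsub>G\<^esub> (stab Y E' \<otimes>\<^bsub>G\<^esub> vincl Y (etgt Y E') (bd1 Y E' f)) \<otimes>\<^bsub>G\<^esub> stab Y E"
   using sg t s V' E x by (simp add: cval_def G.m_assoc)
  also have "\<dots> = ?x \<otimes>\<^bsub>G\<^esub> (vincl Y (esrc Y E') (bd0 Y E' f) \<otimes>\<^bsub>G\<^esub> stab Y E') \<otimes>\<^bsub>G\<^esub> stab Y E"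
   using stab_conj[OF t(3,5)] by simp
  also have "\<dots> = ?x \<otimes>\<^bsub>G\<^esub> vincl Y (esrc Y E') (bd0 Y E' f) \<otimes>\<^bsub>G\<^esub> (stab Y E' \<otimes>\<^bsub>G\<^esub> stab Y E)"
   using x V' t(3) E by (simp add: G.m_assoc)
  also have "\<dots> = ?x \<otimes>\<^bsub>G\<^esub> vincl Y (esrc Y E') (bd0 Y E' f)"
   using stab_rev[OF t(3)] t(2) x V' by simp
  also have "\<dots> = cval (tac E c)" using sg t s V' by (simp add: cval_def vincl_mult G.m_assoc)
  finally show ?thesis ..
 qed
qed

section \<open>Transport along the maximal tree and the action of the group\<close>

definition tpath :: "'v => 'v => 'e list" where
 "tpath V W = (THE es. set es <= tree Y & edge_path Y V es & reduced_path Y es & path_end Y V es = W)"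

definition tpth :: "'v => 'v => 'e list => bool" where
 "tpth V W es \<longleftrightarrow> set es <= tree Y & edge_path Y V es & reduced_path Y es & path_end Y V es = W"

lemma tpath: "V : verts Y ==> W : verts Y ==> tpth V W (tpath V W)"
 using theI'[OF tree_ex1[of V W]] by (simp add: tpath_def tpth_def)

lemma tpath_eq: "V : verts Y ==> W : verts Y ==> tpth V W es ==> tpath V W = es"
 unfolding tpath_def tpth_def using the1_equality[OF tree_ex1[of V W]] by blast

lemma tpath_same: "V : verts Y ==> tpath V V = []"
 by (rule tpath_eq) (auto simp: tpth_def reduced_path_def)

lemma fold_tac_Om: "edge_path Y V es ==> c : Om V ==> fold tac es c : Om (path_end Y V es)"
 by (induction es arbitrary: V c) (auto simp: edge_path_Cons path_end_Cons tac_Om)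

text \<open>Generators of the group need not fit together to paths, since tree letters are trivial.
  Hence one configuration is kept for every vertex, each of them determining the others by transport
  in the tree. The fixed value outside \<open>verts Y\<close> makes coherent families equal as
  functions.\<close>

definition fam :: "'v => ('g \<times> 'e) list \<times> 'g => 'v => ('g \<times> 'e) list \<times> 'g" where
 "fam V c = (%W. if W : verts Y then fold tac (tpath V W) c else undefined)"

definition coh :: "('v => ('g \<times> 'e) list \<times> 'g) => bool" where
 "coh Xf \<longleftrightarrow> (\<forall>W\<in>verts Y. Xf W : Om W) & (\<forall>W. W \<notin> verts Y --> Xf W = undefined) \<and>
   (\<forall>E\<in>tree Y. Xf (etgt Y E) = tac E (Xf (esrc Y E)))"

lemma fam_self: "V : verts Y ==> fam V c V = c"
 by (simp add: fam_def tpath_same)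

lemma fam_coh: assumes V: "V : verts Y" and c: "c : Om V" shows "coh (fam V c)"
 unfolding coh_def
proof (intro conjI ballI allI impI)
 fix W assume W: "W : verts Y"
 hence "tpth V W (tpath V W)" using tpath V by blast
 thus "fam V c W : Om W" using fold_tac_Om[of V "tpath V W" c] c W by (auto simp: fam_def tpth_def)
next
 fix E assume T: "E : tree Y"
 hence E: "E : edges Y" by (rule tree_sub)
 note W = src_in[OF E] tgt_in[OF E]
 define es where "es = tpath V (esrc Y E)"
 have es: "tpth V (esrc Y E) es" unfolding es_def using tpath V W by blast
 show "fam V c (etgt Y E) = tac E (fam V c (esrc Y E))"
 proof (cases "es ~= [] & E = erev Y (last es)")
  case False
  hence "tpth V (etgt Y E) (es @ [E])"
   using es T E by (auto simp: tpth_def edge_path_snoc reduced_path_snoc)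
  hence "tpath V (etgt Y E) = es @ [E]" using tpath_eq V W by blast
  thus ?thesis using W by (simp add: fam_def es_def)
 next
  \<comment> \<open>The tree path to the source of \<open>E\<close> arrives through the reverse of
    \<open>E\<close>, so the path to the target is obtained by removing its last edge.\<close>
  case True
  then obtain es' E' where es': "es = es' @ [E']" by (cases es rule: rev_cases) auto
  hence E': "E = erev Y E'" "E' : tree Y" using True es by (auto simp: tpth_def)
  have E'e: "E' : edges Y" using tree_sub E' by blast
  have "tpth V (etgt Y E) es'"
   using es es' E' tgt_rev[OF E'e] by (auto simp: tpth_def edge_path_snoc reduced_path_snoc)
  hence tp: "tpath V (etgt Y E) = es'" and ep: "edge_path Y V es'" "path_end Y V es' = esrc Y E'"
   using tpath_eq[OF V W(2)] tgt_rev[OF E'e] E'(1) by (simp, simp add: tpth_def, simp add: tpth_def)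
  have "fold tac es' c : Om (esrc Y E')" using fold_tac_Om[OF ep(1) c] ep by simp
  hence "tac (erev Y E') (tac E' (fold tac es' c)) = fold tac es' c" by (rule tac_rev[OF E'e])
  moreover have "fam V c (esrc Y E) = fold tac es c" "fam V c (etgt Y E) = fold tac es' c"
   using W tp by (simp_all add: fam_def es_def)
  ultimately show ?thesis using es' E'(1) by simp
 qed
qed (simp add: fam_def)

lemma coh_fold: "coh Xf ==> set es <= tree Y ==> edge_path Y V es ==> Xf (path_end Y V es) = fold tac es (Xf V)"
 by (induction es arbitrary: V) (auto simp: edge_path_Cons path_end_Cons coh_def)

lemma coh_eq_fam: assumes c: "coh Xf" and V: "V : verts Y" shows "Xf = fam V (Xf V)"
proof
 fix W show "Xf W = fam V (Xf V) W"
 proof (cases "W : verts Y")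
  case True
  hence "tpth V W (tpath V W)" using tpath V by blast
  thus ?thesis using coh_fold[OF c, of "tpath V W" V] True by (auto simp: fam_def tpth_def)
 next
  case False
  thus ?thesis using c by (simp add: coh_def fam_def)
 qed
qed

definition lact :: "('v => ('g \<times> 'e) list \<times> 'g) => 'v \<times> 'g + 'e => 'v => ('g \<times> 'e) list \<times> 'g" where
 "lact Xf a = (if a : pi1_letters Y then
   (case a of Inl (V, k) => fam V (mulv V k (Xf V)) | Inr E => fam (etgt Y E) (tac E (Xf (esrc Y E)))) else Xf)"

lemma coh_Om: "coh Xf ==> W : verts Y ==> Xf W : Om W"
 by (simp add: coh_def)

lemma lact_coh: "coh Xf ==> coh (lact Xf a)"
proof -
 assume c: "coh Xf"
 show ?thesis
 proof (cases "a : pi1_letters Y")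
  case True
  thus ?thesis using c
   by (cases a) (auto simp: lact_def coh_Om mulv_Om tac_Om src_in tgt_in intro!: fam_coh)
 qed (simp add: lact_def c)
qed

lemma foldl_lact_coh: "coh Xf ==> coh (foldl lact Xf w)"
 by (induction w arbitrary: Xf) (auto simp: lact_coh)

text \<open>Every defining relation acts trivially on coherent families: multiplication in vertex
  groups by \<open>mulv\<close>, inverse edges by \<open>tac_rev\<close>, tree edges by coherence,
  conjugation by \<open>tac_mulv\<close>.\<close>

lemma rel_lact: "pi1_rel Y w w' ==> coh Xf ==> foldl lact Xf w = foldl lact Xf w'"
proof (induction arbitrary: Xf rule: pi1_rel.induct)
 case (ctx w w' u v)
 thus ?case using foldl_lact_coh by simp
next
 case (vmul V g h)
 interpret V: group "VG V" using VG_group vmul by simp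
 obtain st x where x: "Xf V = (st, x)" "x : carrier (VG V)" using coh_Om[OF vmul(4,1)] by (auto simp: Om_def)
 thus ?case using vmul by (simp add: lact_def fam_self mulv_def V.m_assoc)
next
 case (vone V)
 interpret V: group "VG V" using VG_group vone by simp
 obtain st x where x: "Xf V = (st, x)" "x : carrier (VG V)" using coh_Om[OF vone(2,1)] by (auto simp: Om_def)
 hence "mulv V \<one>\<^bsub>VG V\<^esub> (Xf V) = Xf V" by (simp add: mulv_def)
 thus ?case using vone(1) coh_eq_fam[OF vone(2,1), symmetric] by (simp add: lact_def)
next
 case (einv E)
 have "tac (erev Y E) (tac E (Xf (esrc Y E))) = Xf (esrc Y E)"
  by (rule tac_rev[OF einv(1) coh_Om[OF einv(2) src_in[OF einv(1)]]])
 thus ?case using einv(1) coh_eq_fam[OF einv(2) src_in[OF einv(1)], symmetric] rev_in src_rev tgt_rev tgt_in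
  by (simp add: lact_def fam_self)
next
 case (etree E)
 note E = tree_sub[OF etree(1)]
 have "tac E (Xf (esrc Y E)) = Xf (etgt Y E)" using etree by (simp add: coh_def)
 thus ?case using E coh_eq_fam[OF etree(2) tgt_in[OF E], symmetric] by (simp add: lact_def)
next
 case (econj E f)
 have "tac E (mulv (esrc Y E) (bd0 Y E f) (Xf (esrc Y E))) = mulv (etgt Y E) (bd1 Y E f) (tac E (Xf (esrc Y E)))"
  by (rule tac_mulv[OF econj(1) coh_Om[OF econj(3) src_in[OF econj(1)]] econj(2)])
 thus ?case using econj bd0_closed bd1_closed src_in tgt_in by (simp add: lact_def fam_self)
qed auto

text \<open>The image of the base family; by \<open>rel_lact\<close> it does not depend on the
  representing word picked by \<open>SOME\<close>.\<close>

definition Fam :: "('v,'e,'g) pi1elt => 'v => ('g \<times> 'e) list \<times> 'g" where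
 "Fam x = foldl lact (fam (base Y) ([], \<one>\<^bsub>VG (base Y)\<^esub>)) (SOME w. w : x)"

lemma start_Om: "([], \<one>\<^bsub>VG (base Y)\<^esub>) : Om (base Y)"
 using VG_group[OF base_in] by (simp add: Om_def group.is_monoid monoid.one_closed)

lemma Fam_cls: "Fam (cls w) = foldl lact (fam (base Y) ([], \<one>\<^bsub>VG (base Y)\<^esub>)) w"
proof -
 have "(SOME w'. w' : cls w) : cls w" by (rule someI[of _ w]) (simp add: cls_def pi1_rel.refl)
 hence "pi1_rel Y w (SOME w'. w' : cls w)" by (simp add: cls_def)
 thus ?thesis unfolding Fam_def using rel_lact fam_coh[OF base_in start_Om] by simp
qed

lemma Fam_coh: "x : carrier G ==> coh (Fam x)"
 using Fam_cls foldl_lact_coh fam_coh[OF base_in start_Om] by (auto simp: carrier_G)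

lemma Fam_Om: "x : carrier G ==> V : verts Y ==> Fam x V : Om V"
 using Fam_coh coh_Om by blast

lemma Fam_one: "Fam \<one>\<^bsub>G\<^esub> (base Y) = ([], \<one>\<^bsub>VG (base Y)\<^esub>)"
 using Fam_cls[of "[]"] base_in by (simp add: one_G fam_self)

lemma Fam_vincl:
 assumes "x : carrier G" "V : verts Y" "k : carrier (VG V)"
 shows "Fam (x \<otimes>\<^bsub>G\<^esub> vincl Y V k) V = mulv V k (Fam x V)"
proof -
 obtain w where "x = cls w" using assms by (auto simp: carrier_G)
 thus ?thesis using assms by (simp add: vincl_cls mult_G Fam_cls lact_def fam_self)
qed

lemma Fam_stab:
 assumes "x : carrier G" "E : edges Y"
 shows "Fam (x \<otimes>\<^bsub>G\<^esub> stab Y E) (etgt Y E) = tac E (Fam x (esrc Y E))"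
proof -
 obtain w where "x = cls w" using assms by (auto simp: carrier_G)
 thus ?thesis using assms tgt_in by (simp add: stab_cls mult_G Fam_cls lact_def fam_self)
qed

lemma Fam_tree: "x : carrier G ==> E : tree Y ==> Fam x (etgt Y E) = tac E (Fam x (esrc Y E))"
 using Fam_coh by (simp add: coh_def)

lemma fold_tac_cval:
 "set es <= tree Y ==> edge_path Y V es ==> c : Om V ==> cval (fold tac es c) = cval c"
proof (induction es arbitrary: V c)
 case (Cons E es)
 hence E: "E : edges Y" "E : tree Y" "c : Om (esrc Y E)" by (auto simp: edge_path_Cons)
 hence "cval (fold tac es (tac E c)) = cval (tac E c)" 
  using Cons.IH[of "etgt Y E" "tac E c"] Cons.prems tac_Om[OF E(1,3)] by (simp add: edge_path_Cons)
 also have "\<dots> = cval c" using cval_tac[OF E(1,3)] stab_tree[OF E(2)] cval_closed[OF E(3)] by simp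
 finally show ?case by simp
qed simp

lemma fam_cval:
 assumes "V : verts Y" "W : verts Y" "c : Om V" shows "cval (fam V c W) = cval c"
 using tpath[OF assms(1,2)] fold_tac_cval[of "tpath V W" V c] assms by (simp add: fam_def tpth_def)

lemma coh_cval: assumes "coh Xf" "V : verts Y" "W : verts Y" shows "cval (Xf W) = cval (Xf V)"
 using fam_cval[OF assms(2,3) coh_Om[OF assms(1,2)]] coh_eq_fam[OF assms(1,2), symmetric] by simp

text \<open>Evaluating any configuration of the family gives the element back. Distinct elements
  therefore have distinct configurations at every vertex (\<open>Fam_inj\<close>), which is the
  uniqueness of normal forms.\<close>

lemma cval_Fam: assumes x: "x : carrier G" and V: "V : verts Y" shows "cval (Fam x V) = x"
proof -
 obtain w where w: "w : Ltr" "x = cls w" using x by (auto simp: carrier_G)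
 have "\<forall>W\<in>verts Y. cval (Fam (cls w) W) = cls w" using w(1)
 proof (induction w rule: rev_induct)
  case Nil
  have "Fam (cls []) (base Y) = ([], \<one>\<^bsub>VG (base Y)\<^esub>)" using Fam_one by (simp add: one_G)
  hence "cval (Fam (cls []) (base Y)) = cls []" using vincl_one[OF base_in] by (simp add: cval_def one_G[symmetric])
  moreover have "coh (Fam (cls []))" by (rule Fam_coh) (auto simp: carrier_G)
  ultimately show ?case using coh_cval[OF _ base_in] by simp
 next
  case (snoc a w)
  hence IH: "\<forall>W\<in>verts Y. cval (Fam (cls w) W) = cls w" and a: "a : pi1_letters Y" and w: "cls w : carrier G"
   by (auto simp: carrier_G)
  have c: "coh (Fam (cls (w @ [a])))" by (rule Fam_coh) (use snoc in \<open>auto simp: carrier_G\<close>)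
  show ?case
  proof (cases a)
   case (Inl p)
   then obtain V k where Vk: "a = Inl (V, k)" "V : verts Y" "k : carrier (VG V)" using a by (cases p) auto
   have eq: "cls (w @ [a]) = cls w \<otimes>\<^bsub>G\<^esub> vincl Y V k" using Vk by (simp add: vincl_cls mult_G)
   have "cval (Fam (cls (w @ [a])) V) = cls (w @ [a])"
    unfolding eq Fam_vincl[OF w Vk(2,3)] using cval_mulv[OF Fam_Om[OF w Vk(2)] Vk(3)] IH Vk by simp
   thus ?thesis using coh_cval[OF c Vk(2)] by simp
  next
   case (Inr E)
   hence E: "E : edges Y" using a by simp
   have eq: "cls (w @ [a]) = cls w \<otimes>\<^bsub>G\<^esub> stab Y E" using Inr by (simp add: stab_cls mult_G)
   have "cval (Fam (cls (w @ [a])) (etgt Y E)) = cls (w @ [a])"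
    unfolding eq Fam_stab[OF w E] using cval_tac[OF E Fam_Om[OF w src_in[OF E]]] IH src_in[OF E] by simp
   thus ?thesis using coh_cval[OF c tgt_in[OF E]] by simp
  qed
 qed
 thus ?thesis using w(2) V by simp
qed

lemma Fam_inj: "x : carrier G ==> y : carrier G ==> V : verts Y ==> Fam x V = Fam y V ==> x = y"
 using cval_Fam by metis

end

section \<open>Stacks, entry cosets and bottlenecks\<close>

locale cgog = gog Y for Y :: "('v,'e,'g,'f) gog" +
 fixes A :: "'a set" and ainv :: "'a => 'a" and ev :: "'a => ('v,'e,'g) pi1elt" and tlet :: "'e => 'a"
 assumes conv: "convenient_alphabet Y A ainv ev tlet"
begin

sublocale alphabet_group "pi1 Y" A ainv ev
 using conv by unfold_locales (simp add: convenient_alphabet_def)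

abbreviation gmul :: "('v,'e,'g) pi1elt => ('v,'e,'g) pi1elt => ('v,'e,'g) pi1elt" (infixl "**" 70) where
 "x ** y \<equiv> x \<otimes>\<^bsub>pi1 Y\<^esub> y"
abbreviation "gcar \<equiv> carrier (pi1 Y)"
abbreviation gset_mult (infixl "##" 60) where "S ## T \<equiv> S <#>\<^bsub>pi1 Y\<^esub> T"
abbreviation iv :: "('v,'e,'g) pi1elt => ('v,'e,'g) pi1elt" where
 "iv x \<equiv> inv\<^bsub>pi1 Y\<^esub> x"
abbreviation gone :: "('v,'e,'g) pi1elt" where
 "gone \<equiv> \<one>\<^bsub>pi1 Y\<^esub>"
abbreviation "VA V \<equiv> vletters Y A ev V"
abbreviation "GV V \<equiv> vincl Y V ` carrier (VG V)"

lemma VA_sub: "VA V <= A"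
 by (auto simp: vletters_def)

lemma VA_lists: "w : lists (VA V) ==> w : lists A"
 using lists_mono[OF VA_sub] by blast

text \<open>Different elements of a vertex group move the configuration of the unit at
  \<open>V\<close> to different places.\<close>

lemma vincl_inj: assumes "V : verts Y" "g : carrier (VG V)" "g' : carrier (VG V)" "vincl Y V g = vincl Y V g'" shows "g = g'"
proof -
 interpret V: group "VG V" using VG_group[OF assms(1)] .
 obtain st b where b: "Fam gone V = (st, b)" "b : carrier (VG V)" using Fam_Om[OF G.one_closed assms(1)] by (auto simp: Om_def)
 have "mulv V g (Fam gone V) = mulv V g' (Fam gone V)"
  using Fam_vincl[OF G.one_closed assms(1,2)] Fam_vincl[OF G.one_closed assms(1,3)] assms(4) by simp
 thus ?thesis using b assms by (simp add: mulv_def)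
qed

lemma vev: assumes "V : verts Y" "a : VA V"
 shows "vev Y ev V a : carrier (VG V)" "vincl Y V (vev Y ev V a) = ev a"
proof -
 obtain g where g: "g : carrier (VG V)" "vincl Y V g = ev a" using assms by (force simp: vletters_def)
 have "vev Y ev V a : carrier (VG V) & vincl Y V (vev Y ev V a) = ev a"
  unfolding vev_def by (rule theI[of _ g]) (use g vincl_inj[OF assms(1)] in auto)
 thus "vev Y ev V a : carrier (VG V)" "vincl Y V (vev Y ev V a) = ev a" by auto
qed

lemma V_alphabet: "V : verts Y ==> alphabet_group (VG V) (VA V) ainv (vev Y ev V)"
 using conv VG_group by (auto simp: alphabet_group_def alphabet_group_axioms_def convenient_alphabet_def)

lemma vincl_val:
 assumes V: "V : verts Y" and w: "w : lists (VA V)"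
 shows "word_eval (VG V) (vev Y ev V) w : carrier (VG V)" "vincl Y V (word_eval (VG V) (vev Y ev V) w) = val w"
proof -
 interpret Vg: alphabet_group "VG V" "VA V" ainv "vev Y ev V" by (rule V_alphabet[OF V])
 have "Vg.val w : carrier (VG V) & vincl Y V (Vg.val w) = val w"
  using w
 proof (induction w rule: list.induct)
  case Nil
  thus ?case using vincl_one[OF V] by simp
 next
  case (Cons a w)
  thus ?case using vev[OF V] vincl_mult[OF V] by simp
 qed
 thus "Vg.val w : carrier (VG V)" "vincl Y V (Vg.val w) = val w" by auto
qed

lemma val_GV: "V : verts Y ==> w : lists (VA V) ==> val w : GV V"
 by (metis vincl_val imageI)

lemma GV_closed: "V : verts Y ==> x : GV V ==> x : gcar"
 by auto

lemma GV_subgroup: "V : verts Y ==> subgroup (GV V) (pi1 Y)"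
 using group_hom.img_is_subgroup[OF vincl_group_hom] by simp

lemma GV_ops: assumes "V : verts Y"
 shows "gone : GV V" "x : GV V ==> y : GV V ==> x ** y : GV V" "x : GV V ==> iv x : GV V"
 using GV_subgroup[OF assms] by (auto simp: subgroup.one_closed subgroup.m_closed subgroup.m_inv_closed)

lemma GV_onto: assumes "V : verts Y" "x : GV V" shows "\<exists>w\<in>lists (VA V). val w = x"
proof -
 interpret Vg: alphabet_group "VG V" "VA V" ainv "vev Y ev V" by (rule V_alphabet[OF assms(1)])
 obtain k where k: "k : carrier (VG V)" "x = vincl Y V k" using assms by auto
 obtain w where "w : lists (VA V)" "Vg.val w = k" using Vg.val_onto[OF k(1)] by auto
 thus ?thesis using vincl_val[OF assms(1)] k by auto
qed

abbreviation "tw E \<equiv> tword Y tlet E"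

lemma letter_cases:
 assumes "a : A"
 obtains V where "V : verts Y" "a : VA V" | E where "E : edges Y" "a = tlet E" "ev a = stab Y E"
proof -
 have "A = (\<Union>V\<in>verts Y. VA V) \<union> tlet ` (edges Y - tree Y)"
  and t: "\<forall>E\<in>edges Y - tree Y. ev (tlet E) = stab Y E"
  using conv unfolding convenient_alphabet_def by (fast, fast)
 hence "a : (\<Union>V\<in>verts Y. VA V) \<union> tlet ` (edges Y - tree Y)" using assms by blast
 thus ?thesis using that t by blast
qed

lemma tw_facts: assumes E: "E : edges Y" shows "tw E : lists A" "val (tw E) = stab Y E" "length (tw E) <= 1"
proof -
 have "tlet E : A & ev (tlet E) = stab Y E" if "E \<notin> tree Y"
  using conv E that unfolding convenient_alphabet_def by blast
 thus "tw E : lists A" "val (tw E) = stab Y E" "length (tw E) <= 1" using stab_tree[of E] E by (auto simp: tword_def)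
qed

lemma e_letter: "\<exists>a\<in>A. ev a = gone & (\<forall>V\<in>verts Y. a : VA V)"
proof -
 obtain a where a: "a : A" "ev a = gone" using conv unfolding convenient_alphabet_def by blast
 thus ?thesis using GV_ops(1) by (intro bexI[of _ a]) (auto simp: vletters_def)
qed

text \<open>The stack is a name for the vertex \<open>x GV V\<close> of the Bass-Serre tree, as
  \<open>stk_GV\<close> and \<open>stk_eq\<close> confirm.\<close>

definition stk :: "('v,'e,'g) pi1elt => 'v => ('g \<times> 'e) list" where
 "stk x V = fst (Fam x V)"

lemma Fam_stk: assumes "x : gcar" "V : verts Y"
 shows "vst (stk x V)" "endv (stk x V) = V" "snd (Fam x V) : carrier (VG V)" "Fam x V = (stk x V, snd (Fam x V))"
 using Fam_Om[OF assms] by (auto simp: Om_def stk_def)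

lemma stk_GV: assumes "x : gcar" "V : verts Y" "y : GV V" shows "stk (x ** y) V = stk x V"
 using assms Fam_vincl by (auto simp: stk_def mulv_def)

lemma stk_eq: assumes "x : gcar" "y : gcar" "V : verts Y" "stk x V = stk y V"
 shows "iv x ** y : GV V"
proof -
 interpret V: group "VG V" using VG_group[OF assms(3)] .
 note x = Fam_stk[OF assms(1,3)] and y = Fam_stk[OF assms(2,3)]
 let ?k = "inv\<^bsub>VG V\<^esub> (snd (Fam x V)) *[V] snd (Fam y V)"
 have k: "?k : carrier (VG V)" using x y by simp
 have "Fam (x ** vincl Y V ?k) V = (stk x V, snd (Fam x V) *[V] ?k)"
  unfolding Fam_vincl[OF assms(1,3) k] mulv_def by (simp add: stk_def)
 also have "\<dots> = Fam y V" using y(4) assms(4) x(3) y(3) by (simp add: V.m_assoc[symmetric])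
 finally have "x ** vincl Y V ?k = y" using Fam_inj assms k by simp
 moreover have "iv x ** (x ** vincl Y V ?k) = vincl Y V ?k" using inv_cancel1[OF assms(1)] assms(3) k by simp
 ultimately have "iv x ** y = vincl Y V ?k" by simp
 thus ?thesis using k by blast
qed

section \<open>Edge groups and entry cosets\<close>

definition EO :: "'e option set" where "EO = insert None (Some ` edges Y)"

text \<open>The edge group inside its terminal vertex group; the added base edge \<open>None\<close>
  carries the trivial group.\<close>

definition Fb :: "'e option => 'g set" where
 "Fb x = (case x of None => {\<one>\<^bsub>VG (base Y)\<^esub>} | Some E => bd1 Y E ` FG E)"

definition Fs :: "'e option => ('v,'e,'g) pi1elt set" where
 "Fs x = vincl Y (dtv Y x) ` Fb x"

definition topo :: "('g \<times> 'e) list => 'e option" where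
 "topo st = (case st of [] => None | p # _ => Some (snd p))"

lemma topo_simps [simp]: "topo [] = None" "topo ((s, E) # st) = Some E"
 by (auto simp: topo_def)

lemma dtv_simps [simp]: "dtv Y None = base Y" "dtv Y (Some E) = etgt Y E" "dtv Y (topo st) = endv st"
 by (auto simp: dtv_def topo_def endv_def split: list.splits)

lemma EO_iff [simp]: "None : EO" "Some E : EO \<longleftrightarrow> E : edges Y"
 by (auto simp: EO_def)

lemma EO_verts: "x : EO ==> dtv Y x : verts Y"
 by (auto simp: EO_def base_in tgt_in)

lemma finite_EO: "finite EO" by (simp add: EO_def fin_edges)

lemma vst_topo: "vst st ==> topo st : EO"
 by (cases st) auto

lemma Fb_subgroup: "x : EO ==> subgroup (Fb x) (VG (dtv Y x))"
proof (cases x)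
 case None
 interpret V: group "VG (base Y)" using VG_group[OF base_in] .
 show ?thesis using V.triv_subgroup None by (simp add: Fb_def)
next
 case (Some E)
 assume "x : EO"
 thus ?thesis using group_hom.img_is_subgroup[OF bd1_group_hom, of E] Some by (simp add: Fb_def)
qed

lemma Fs_subgroup: assumes "x : EO" shows "subgroup (Fs x) (pi1 Y)"
 unfolding Fs_def
 by (rule group_hom.subgroup_img_is_subgroup[OF vincl_group_hom[OF EO_verts[OF assms]] Fb_subgroup[OF assms]])

lemma Fs_ops: assumes "x : EO"
 shows "gone : Fs x" "y : Fs x ==> z : Fs x ==> y ** z : Fs x" "y : Fs x ==> iv y : Fs x" "y : Fs x ==> y : gcar"
 using Fs_subgroup[OF assms] by (auto simp: subgroup.one_closed subgroup.m_closed subgroup.m_inv_closed subgroup.mem_carrier)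

lemma Fs_GV: "x : EO ==> y : Fs x ==> y : GV (dtv Y x)"
 using subgroup.subset[OF Fb_subgroup] by (auto simp: Fs_def)

lemma finite_Fs: "x : EO ==> finite (Fs x)"
 by (auto simp: EO_def Fs_def Fb_def FG_finite)

lemma Fs_None [simp]: "Fs None = {gone}"
 by (simp add: Fs_def Fb_def vincl_one base_in)

lemma vincl_Fs_iff: assumes "x : EO" "k : carrier (VG (dtv Y x))" shows "vincl Y (dtv Y x) k : Fs x \<longleftrightarrow> k : Fb x"
 using vincl_inj[OF EO_verts[OF assms(1)]] subgroup.mem_carrier[OF Fb_subgroup[OF assms(1)]] assms(2)
 by (auto simp: Fs_def)

text \<open>By \<open>Cs_mult\<close> and \<open>Cs_diff\<close> it is empty or a left coset of the
  finite group \<open>Fs (topo st)\<close>: the positions just after crossing the last edge of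
  \<open>st\<close>.\<close>

definition Cs :: "('g \<times> 'e) list => ('v,'e,'g) pi1elt set" where
 "Cs st = {x : gcar. stk x (endv st) = st & endv st : verts Y & snd (Fam x (endv st)) : Fb (topo st)}"

lemma CsD: assumes "x : Cs st"
 shows "x : gcar" "stk x (endv st) = st" "vst st" "topo st : EO" "endv st : verts Y"
  "Fam x (endv st) = (st, snd (Fam x (endv st)))" "snd (Fam x (endv st)) : Fb (topo st)"
proof -
 show x: "x : gcar" "stk x (endv st) = st" "endv st : verts Y" "snd (Fam x (endv st)) : Fb (topo st)"
  using assms by (auto simp: Cs_def)
 show v: "vst st" using Fam_stk(1)[OF x(1,3)] x(2) by simp
 show "topo st : EO" using vst_topo[OF v] .
 show "Fam x (endv st) = (st, snd (Fam x (endv st)))" using Fam_stk(4)[OF x(1,3)] x(2) by simp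
qed

lemma Cs_I: "x : gcar ==> endv st : verts Y ==> Fam x (endv st) = (st, b) ==> b : Fb (topo st) ==> x : Cs st"
 by (simp add: Cs_def stk_def)

lemma Cs_Nil: "Cs [] = {gone}"
proof
 show "{gone} <= Cs []" using Fam_one base_in by (auto intro!: Cs_I simp: Fb_def)
 show "Cs [] <= {gone}"
 proof
  fix x assume x: "x : Cs []"
  hence "Fam x (base Y) = Fam gone (base Y)" using CsD(6,7)[OF x] Fam_one by (simp add: Fb_def)
  thus "x : {gone}" using Fam_inj CsD(1)[OF x] base_in G.one_closed by blast
 qed
qed

lemma Cs_mult: assumes x: "x : Cs st" and f: "f : Fs (topo st)" shows "x ** f : Cs st"
proof -
 note c = CsD[OF x]
 obtain b where b: "b : Fb (topo st)" "f = vincl Y (endv st) b" using f by (auto simp: Fs_def)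
 have bc: "b : carrier (VG (endv st))" using subgroup.mem_carrier[OF Fb_subgroup[OF c(4)]] b by simp
 have "Fam (x ** f) (endv st) = (st, snd (Fam x (endv st)) *[endv st] b)"
  unfolding b Fam_vincl[OF c(1,5) bc] mulv_def using c(2) by (simp add: stk_def)
 moreover have "snd (Fam x (endv st)) *[endv st] b : Fb (topo st)"
  using subgroup.m_closed[OF Fb_subgroup[OF c(4)] c(7) b(1)] by simp
 ultimately show ?thesis using c(1,5) Fs_ops(4)[OF c(4) f] by (intro Cs_I) auto
qed

lemma Cs_diff: assumes x: "x : Cs st" and y: "y : Cs st" shows "iv x ** y : Fs (topo st)"
proof -
 note c = CsD[OF x] and d = CsD[OF y]
 interpret V: group "VG (endv st)" using VG_group[OF c(5)] .
 have "iv x ** y : GV (endv st)" using stk_eq c d by simp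
 then obtain k where k: "k : carrier (VG (endv st))" "iv x ** y = vincl Y (endv st) k" by auto
 hence "y = x ** vincl Y (endv st) k" using inv_cancel2[OF c(1) d(1)] by simp
 hence "Fam y (endv st) = mulv (endv st) k (Fam x (endv st))" using Fam_vincl[OF c(1,5) k(1)] by simp
 hence e: "snd (Fam y (endv st)) = snd (Fam x (endv st)) *[endv st] k" by (simp add: mulv_def)
 have xc: "snd (Fam x (endv st)) : carrier (VG (endv st))" using Fam_stk(3)[OF c(1,5)] .
 have "k = inv\<^bsub>VG (endv st)\<^esub> (snd (Fam x (endv st))) *[endv st] snd (Fam y (endv st))"
  unfolding e using xc k by (simp add: V.m_assoc[symmetric])
 hence "k : Fb (topo st)"
  using c(7) d(7) Fb_subgroup[OF c(4)] by (simp add: subgroup.m_closed subgroup.m_inv_closed)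
 thus ?thesis using k by (auto simp: Fs_def)
qed

lemma finite_Cs: "finite (Cs st)"
proof (cases "Cs st = {}")
 case False
 then obtain x where x: "x : Cs st" by auto
 have "Cs st <= (%f. x ** f) ` Fs (topo st)"
 proof
  fix y assume y: "y : Cs st"
  have "y = x ** (iv x ** y)" using CsD(1)[OF x] CsD(1)[OF y] by (simp add: inv_cancel2)
  thus "y : (%f. x ** f) ` Fs (topo st)" using Cs_diff[OF x y] by blast
 qed
 thus ?thesis using finite_Fs[OF CsD(4)[OF x]] finite_subset by blast
qed simp

text \<open>No backtracking: the side condition on a segment \<open>g\<close> entered through
  \<open>x\<close> and left through \<open>E\<close>.\<close>

definition nbt :: "'e option => ('v,'e,'g) pi1elt => 'e => bool" where
 "nbt x g E \<longleftrightarrow> \<not> (\<exists>E1. x = Some E1 & E = erev Y E1 & g : Fs x)"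

text \<open>Under \<open>nbt\<close> the action of the stable letter is a push, since a pop would
  put \<open>g\<close> into the edge group.\<close>

lemma Cs_push:
 assumes h: "h : Cs rho" and g: "g : GV (endv rho)" and E: "E : edges Y" "esrc Y E = endv rho" and nb: "nbt (topo rho) g E"
 shows "\<exists>s. h ** g ** stab Y E : Cs ((s, E) # rho)"
proof -
 note c = CsD[OF h]
 let ?b = "snd (Fam h (endv rho))"
 interpret V: group "VG (endv rho)" using VG_group[OF c(5)] .
 obtain k where k: "k : carrier (VG (endv rho))" "g = vincl Y (endv rho) k" using g by auto
 have bc: "?b : carrier (VG (endv rho))" using Fam_stk(3)[OF c(1,5)] .
 have F: "Fam (h ** g) (endv rho) = (rho, ?b *[endv rho] k)"
  unfolding k Fam_vincl[OF c(1,5) k(1)] mulv_def using c(2) by (simp add: stk_def)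
 have hg: "h ** g : gcar" using c k by simp
 have Om: "(rho, ?b *[endv rho] k) : Om (esrc Y E)" using Fam_Om[OF hg c(5)] F E by simp
 have np: "\<not> pops E (rho, ?b *[endv rho] k)"
 proof
  assume p: "pops E (rho, ?b *[endv rho] k)"
  from tac_pop[OF E(1) Om p] obtain s E' st' f where t: "rho = (s, E') # st'" "E = erev Y E'" "f : FG E'"
   "?b *[endv rho] k = bd1 Y E' f" by metis
  hence "?b *[endv rho] k : Fb (topo rho)" by (simp add: Fb_def)
  hence "inv\<^bsub>VG (endv rho)\<^esub> ?b *[endv rho] (?b *[endv rho] k) : Fb (topo rho)"
   using c(7) Fb_subgroup[OF c(4)] by (simp add: subgroup.m_closed subgroup.m_inv_closed)
  hence "k : Fb (topo rho)" using bc k by (simp add: V.m_assoc[symmetric])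
  hence "g : Fs (topo rho)" using k by (auto simp: Fs_def)
  thus False using nb t by (auto simp: nbt_def)
 qed
 note t = tac_push[OF E(1) Om np]
 have "Fam (h ** g ** stab Y E) (etgt Y E) = tac E (rho, ?b *[endv rho] k)"
  using Fam_stab[OF hg E(1)] F E by simp
 hence "h ** g ** stab Y E : Cs ((rp E (?b *[endv rho] k), E) # rho)"
  unfolding t(1) using t(3) hg E tgt_in by (intro Cs_I) (auto simp: Fb_def)
 thus ?thesis by blast
qed

lemma inv_stab: assumes "E : edges Y" shows "iv (stab Y E) = stab Y (erev Y E)"
 by (rule G.inv_equality) (use assms stab_rev[OF rev_in[OF assms]] rev_rev[OF assms] rev_in[OF assms] in simp_all)

text \<open>Undoes the last push. The last fact is the converse of \<open>Cs_push\<close>: a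
  backtracking segment would make the coset representative \<open>s\<close> the unit, which valid
  stacks exclude.\<close>

lemma Cs_parent:
 assumes h1: "h1 : Cs ((s, E) # rho)"
 shows "E : edges Y" "esrc Y E = endv rho" "endv rho : verts Y" "stk (h1 ** stab Y (erev Y E)) (endv rho) = rho"
  "h : Cs rho ==> \<exists>g\<in>GV (endv rho). h1 = h ** g ** stab Y E & nbt (topo rho) g E"
proof -
 note c1 = CsD[OF h1]
 have v: "vst rho" "E : edges Y" "endv rho = esrc Y E" "s : carrier (VG (esrc Y E))" "rp E s = s"
  "!!s' E' st'. rho = (s', E') # st' ==> E = erev Y E' ==> s ~= \<one>\<^bsub>VG (esrc Y E)\<^esub>"
  using c1(3) by auto
 note E = v(2)
 show "E : edges Y" "esrc Y E = endv rho" "endv rho : verts Y" using v src_in by auto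
 obtain f where f: "f : FG E" "Fam h1 (etgt Y E) = ((s, E) # rho, bd1 Y E f)"
  using c1(6,7) by (auto simp: Fb_def)
 let ?y = "h1 ** stab Y (erev Y E)"
 have y: "?y : gcar" using c1 rev_in[OF E] by simp
 have Fy: "Fam ?y (esrc Y E) = (rho, s *[esrc Y E] bd0 Y E f)"
 proof -
  have "Fam ?y (esrc Y E) = tac (erev Y E) ((s, E) # rho, bd1 Y E f)"
   using Fam_stab[OF c1(1) rev_in[OF E]] src_rev[OF E] tgt_rev[OF E] f by simp
  moreover have "pops (erev Y E) ((s, E) # rho, bd1 Y E f)"
   using bd0_rev[OF E f(1)] f(1) egrp_rev[OF E] by (auto simp: pops_def intro!: image_eqI[of _ _ f])
  moreover have "fe (erev Y E) (bd1 Y E f) = f"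
   using rp_of_bd0(2)[OF rev_in[OF E], of f] bd0_rev[OF E f(1)] f(1) egrp_rev[OF E] by simp
  ultimately show ?thesis using tgt_rev[OF E] bd1_rev[OF E f(1)] by (simp add: tac_def)
 qed
 thus st: "stk ?y (endv rho) = rho" using v(3) by (simp add: stk_def)
 assume h: "h : Cs rho"
 note c = CsD[OF h]
 interpret V: group "VG (esrc Y E)" using VG_group[OF src_in[OF E]] .
 have g: "iv h ** ?y : GV (endv rho)" using stk_eq[OF c(1) y c(5)] c(2) st by simp
 have "h ** (iv h ** ?y) = ?y" using inv_cancel2[OF c(1) y] .
 hence "h1 = h ** (iv h ** ?y) ** stab Y E"
  using c1(1) stab_closed[OF E] by (simp add: G.m_assoc inv_stab[OF E, symmetric])
 moreover have "nbt (topo rho) (iv h ** ?y) E" unfolding nbt_def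
 proof
  assume "\<exists>E1. topo rho = Some E1 & E = erev Y E1 & iv h ** ?y : Fs (topo rho)"
  then obtain E1 where E1: "topo rho = Some E1" "E = erev Y E1" "iv h ** ?y : Fs (topo rho)" by auto
  then obtain s1 st1 where rho: "rho = (s1, E1) # st1" by (cases rho) (auto simp: topo_def)
  have "?y : Cs rho" using Cs_mult[OF h E1(3)] inv_cancel2[OF c(1) y] by simp
  hence "s *[esrc Y E] bd0 Y E f : Fb (topo rho)" using CsD(7)[of ?y rho] Fy v(3) by simp
  hence "s *[esrc Y E] bd0 Y E f : bd1 Y E1 ` FG E1" using E1 by (simp add: Fb_def)
  moreover have "E1 : edges Y" using v(1) rho by simp
  hence "bd1 Y E1 ` FG E1 = bd0 Y E ` FG E" using bd0_rev E1(2) egrp_rev by (metis image_cong)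
  ultimately have "s : bd0 Y E ` FG E" using in_bd0_mult[OF E v(4) f(1)] by simp
  hence "s = \<one>\<^bsub>VG (esrc Y E)\<^esub>" using rp_one_iff[OF E v(4)] v(5) by simp
  thus False using v(6)[OF rho E1(2)] by simp
 qed
 ultimately show "\<exists>g\<in>GV (endv rho). h1 = h ** g ** stab Y E & nbt (topo rho) g E" using g by blast
qed

lemma Cs_entry:
 assumes "x : gcar" "V : verts Y"
 shows "\<exists>h\<in>Cs (stk x V). \<exists>g\<in>GV V. x = h ** g"
proof -
 interpret V: group "VG V" using VG_group[OF assms(2)] .
 note x = Fam_stk[OF assms]
 let ?b = "snd (Fam x V)"
 have ib: "inv\<^bsub>VG V\<^esub> ?b : carrier (VG V)" using x by simp
 let ?h = "x ** vincl Y V (inv\<^bsub>VG V\<^esub> ?b)"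
 have "Fam ?h V = (stk x V, \<one>\<^bsub>VG V\<^esub>)" unfolding Fam_vincl[OF assms ib] mulv_def using x(3) by (simp add: stk_def)
 moreover have "\<one>\<^bsub>VG V\<^esub> : Fb (topo (stk x V))"
  using subgroup.one_closed[OF Fb_subgroup[OF vst_topo[OF x(1)]]] x(2) by simp
 ultimately have "?h : Cs (stk x V)" using x assms ib by (intro Cs_I) auto
 moreover have "x = ?h ** vincl Y V ?b"
  using assms x(3) ib vincl_mult[OF assms(2) ib x(3)] vincl_one[OF assms(2)] by (simp add: G.m_assoc)
 ultimately show ?thesis using x(3) by blast
qed

lemma Cs_parent_ex: "h1 : Cs ((s, E) # rho) ==> \<exists>h. h : Cs rho"
 using Cs_parent(3,4)[of h1 s E rho] Cs_entry[of "h1 ** stab Y (erev Y E)" "endv rho"] CsD(1)[of h1] rev_in Cs_parent(1)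
 by (metis G.m_closed stab_closed)

text \<open>The action alters a stack at its head only, so the suffix \<open>rho\<close> can appear
  or disappear only when the last edge of \<open>rho\<close> is pushed or popped; at that moment a
  configuration in the entry coset occurs.\<close>

lemma tac_toggle:
 assumes E: "E : edges Y" and c: "c : Om (esrc Y E)" and ne: "rho ~= []"
  and t: "suffix rho (fst (tac E c)) ~= suffix rho (fst c)"
 shows "(fst (tac E c) = rho & topo rho = Some E & snd (tac E c) : Fb (topo rho)) \<or>
  (fst c = rho & topo rho = Some (erev Y E) & snd c : Fb (topo rho))"
proof -
 obtain st g where sg: "c = (st, g)" by (cases c)
 note c = c[unfolded sg]
 show ?thesis
 proof (cases "pops E (st, g)")
  case False
  note p = tac_push[OF E c False]
  hence "rho = (rp E g, E) # st" using t unfolding sg by (auto simp: suffix_Cons)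
  thus ?thesis using p unfolding sg by (simp add: Fb_def)
 next
  case True
  from tac_pop[OF E c True] obtain s E' st' f where p: "st = (s, E') # st'" "E = erev Y E'" "E' : edges Y" "erev Y E = E'" "f : FG E'"
   "g = bd1 Y E' f" "tac E (st, g) = (st', s *[esrc Y E'] bd0 Y E' f)" by metis
  hence "rho = (s, E') # st'" using t unfolding sg by (auto simp: suffix_Cons)
  thus ?thesis using p unfolding sg by (simp add: Fb_def)
 qed
qed

lemma stab_toggle:
 assumes x: "x : gcar" "y : gcar" and E: "E : edges Y" and ne: "rho ~= []"
  and y: "Fam y (etgt Y E) = tac E (Fam x (esrc Y E))"
  and t: "suffix rho (stk y (etgt Y E)) ~= suffix rho (stk x (esrc Y E))"
 shows "x : Cs rho \<or> y : Cs rho"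
proof -
 note V = src_in[OF E] tgt_in[OF E]
 have "suffix rho (fst (tac E (Fam x (esrc Y E)))) ~= suffix rho (fst (Fam x (esrc Y E)))"
  using t y by (simp add: stk_def)
 from tac_toggle[OF E Fam_Om[OF x(1) V(1)] ne this] show ?thesis
 proof
  assume a: "fst (tac E (Fam x (esrc Y E))) = rho & topo rho = Some E & snd (tac E (Fam x (esrc Y E))) : Fb (topo rho)"
  hence "endv rho = etgt Y E" using dtv_simps(2,3) by metis
  hence "y : Cs rho" using a y V x by (intro Cs_I[of y rho "snd (Fam y (etgt Y E))"]) auto
  thus ?thesis ..
 next
  assume a: "fst (Fam x (esrc Y E)) = rho & topo rho = Some (erev Y E) & snd (Fam x (esrc Y E)) : Fb (topo rho)"
  hence "endv rho = esrc Y E" using dtv_simps(2,3) tgt_rev[OF E] by metis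
  hence "x : Cs rho" using a V x by (intro Cs_I[of x rho "snd (Fam x (esrc Y E))"]) auto
  thus ?thesis ..
 qed
qed

text \<open>Changing the viewing vertex means walking along tree edges with \<open>x\<close>
  unchanged, so both ends of the crossed edge carry the same element.\<close>

lemma tree_toggle:
 assumes x: "x : gcar" and W: "W : verts Y" "W' : verts Y" and ne: "rho ~= []"
  and t: "suffix rho (stk x W) ~= suffix rho (stk x W')"
 shows "x : Cs rho"
proof -
 have "x : Cs rho" if "set es <= tree Y" "edge_path Y W es" "suffix rho (stk x W) ~= suffix rho (stk x (path_end Y W es))" for es W
  using that
 proof (induction es arbitrary: W)
  case (Cons E es)
  hence E: "E : tree Y" "E : edges Y" "esrc Y E = W" using tree_sub by (auto simp: edge_path_Cons)
  show ?case
  proof (cases "suffix rho (stk x W) = suffix rho (stk x (etgt Y E))")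
   case True
   thus ?thesis using Cons by (auto simp: edge_path_Cons path_end_Cons)
  next
   case False
   thus ?thesis using stab_toggle[OF x x E(2) ne Fam_tree[OF x E(1)]] E by auto
  qed
 qed auto
 from this[of "tpath W W'" W] show ?thesis using tpath[OF W] t by (auto simp: tpth_def)
qed

text \<open>A vertex letter preserves the stack at its own vertex and an edge letter acts by
  \<open>tac\<close>; everything else is a change of the viewing vertex.\<close>

lemma letter_toggle:
 assumes x: "x : gcar" and a: "a : A" and W: "W : verts Y" "W' : verts Y" and ne: "rho ~= []"
  and t: "suffix rho (stk x W) ~= suffix rho (stk (x ** ev a) W')"
 shows "x : Cs rho \<or> x ** ev a : Cs rho"
proof (rule ccontr)
 assume n: "\<not> (x : Cs rho \<or> x ** ev a : Cs rho)"
 have y: "x ** ev a : gcar" using x a by simp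
 have 1: "suffix rho (stk x U) = suffix rho (stk x W)" if "U : verts Y" for U
  using tree_toggle[OF x that W(1) ne] n by blast
 have 2: "suffix rho (stk (x ** ev a) U) = suffix rho (stk (x ** ev a) W')" if "U : verts Y" for U
  using tree_toggle[OF y that W(2) ne] n by blast
 from a show False
 proof (cases rule: letter_cases)
  case (1 V)
  hence "ev a : GV V" by (auto simp: vletters_def)
  hence "stk (x ** ev a) V = stk x V" using stk_GV x 1 by blast
  thus False using t \<open>V : verts Y\<close> 2[of V] \<open>!!U. U : verts Y ==> suffix rho (stk x U) = suffix rho (stk x W)\<close>[of V] by simp
 next
  case e: (2 E)
  have "suffix rho (stk (x ** ev a) (etgt Y E)) = suffix rho (stk x (esrc Y E))"
   using stab_toggle[OF x y e(1) ne] Fam_stab[OF x e(1)] e n by auto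
  thus False using t 1[OF src_in[OF e(1)]] 2[OF tgt_in[OF e(1)]] by simp
 qed
qed

text \<open>\<open>suffix rho\<close> tells on which side of the last edge of \<open>rho\<close> a
  position lies. If the two ends of a word are on different sides, \<open>letter_toggle\<close>
  locates the letter at which the side changes.\<close>

lemma bottleneck:
 assumes "x : gcar" "w : lists A" "W : verts Y" "W' : verts Y" "rho ~= []"
  "suffix rho (stk x W) ~= suffix rho (stk (x ** val w) W')"
 shows "\<exists>w1 w2. w = w1 @ w2 & x ** val w1 : Cs rho"
 using assms
proof (induction w arbitrary: x rule: list.induct)
 case Nil
 hence "x : Cs rho" using tree_toggle[of x W W' rho] by simp
 thus ?case using Nil by simp
next
 case (Cons a w)
 have a: "a : A" "w : lists A" using Cons.prems by auto
 have y: "x ** ev a : gcar" using Cons.prems a by simp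
 have e: "x ** val (a # w) = x ** ev a ** val w" using Cons.prems a by (simp add: G.m_assoc)
 show ?case
 proof (cases "x : Cs rho")
  case True
  thus ?thesis using Cons.prems by (intro exI[of _ "[]"] exI[of _ "a # w"]) simp
 next
  case False
  have "\<exists>w1 w2. w = w1 @ w2 & x ** ev a ** val w1 : Cs rho"
  proof (cases "x ** ev a : Cs rho")
   case True
   thus ?thesis using y by (intro exI[of _ "[]"] exI[of _ w]) simp
  next
   case False2: False
   have "suffix rho (stk x W) = suffix rho (stk (x ** ev a) W)"
    using letter_toggle[OF Cons.prems(1) a(1) Cons.prems(3) Cons.prems(3) Cons.prems(5)] False False2 by blast
   thus ?thesis using Cons.IH[OF y a(2) Cons.prems(3-5)] Cons.prems(6) e by simp
  qed
  then obtain w1 w2 where w: "w = w1 @ w2" "x ** ev a ** val w1 : Cs rho" by blast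
  hence "x ** val (a # w1) : Cs rho" using Cons.prems a by (simp add: G.m_assoc)
  thus ?thesis using w by (intro exI[of _ "a # w1"] exI[of _ w2]) simp
 qed
qed

lemma stk_one: "stk gone (base Y) = []"
 using Fam_one by (simp add: stk_def)

lemma bottleneck_from_one:
 assumes "w : lists A" "W : verts Y" "suffix rho (stk (val w) W)"
 shows "\<exists>w1 w2. w = w1 @ w2 & val w1 : Cs rho"
proof (cases "rho = []")
 case True
 thus ?thesis by (intro exI[of _ "[]"] exI[of _ w]) (simp add: Cs_Nil)
next
 case False
 have "suffix rho (stk gone (base Y)) ~= suffix rho (stk (gone ** val w) W)" using assms False stk_one by simp
 from bottleneck[OF G.one_closed assms(1) base_in assms(2) False this] obtain w1 w2 where "w = w1 @ w2" "gone ** val w1 : Cs rho"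
  by blast
 thus ?thesis using assms(1) by auto
qed

text \<open>An element of both groups fixes two distinct vertices of the Bass-Serre tree, and an
  edge separating them forces it into one of two finite entry cosets.\<close>

lemma finite_GV_Int: assumes "V : verts Y" "W : verts Y" "V ~= W" shows "finite (GV V \<inter> GV W)"
proof -
 define \<sigma> tau where "\<sigma> = stk gone V" and "tau = stk gone W"
 have ne: "\<sigma> ~= tau" using Fam_stk(2)[OF G.one_closed] assms unfolding \<sigma>_def tau_def by metis
 have "x : Cs \<sigma> \<union> Cs tau" if x: "x : GV V" "x : GV W" for x
 proof -
  have xc: "x : gcar" using GV_closed assms x by blast
  have st: "stk x V = \<sigma>" "stk x W = tau"
   using stk_GV[OF G.one_closed assms(1) x(1)] stk_GV[OF G.one_closed assms(2) x(2)] xc by (auto simp: \<sigma>_def tau_def)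
  show ?thesis
  proof (cases "suffix \<sigma> tau")
   case True
   hence n: "\<not> suffix tau \<sigma>" using ne suffix_order.antisym by blast
   hence "tau ~= []" by auto
   thus ?thesis using tree_toggle[OF xc assms(1,2)] st n by auto
  next
   case False
   hence "\<sigma> ~= []" by auto
   thus ?thesis using tree_toggle[OF xc assms(1,2)] st False by auto
  qed
 qed
 hence "GV V \<inter> GV W <= Cs \<sigma> \<union> Cs tau" by blast
 thus ?thesis by (rule finite_subset) (simp add: finite_Cs)
qed

subsection \<open>The sets \<open>\<G>\<^sub>E\<close>\<close>

lemma is_normal_form_snoc:
 "is_normal_form Y g0 (xs @ [(E, g)]) \<longleftrightarrow> is_normal_form Y g0 xs & E : edges Y \<and>
   esrc Y E = path_end Y (base Y) (map fst xs) & g : carrier (VG (etgt Y E)) \<and>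
   (xs ~= [] --> E = erev Y (fst (last xs)) --> snd (last xs) \<notin> bd1 Y (fst (last xs)) ` FG (fst (last xs)))"
proof -
 let ?P = "%xs. \<forall>i. Suc i < length xs --> fst (xs ! Suc i) = erev Y (fst (xs ! i)) -->
    snd (xs ! i) \<notin> bd1 Y (fst (xs ! i)) ` FG (fst (xs ! i))"
 have "?P (xs @ [(E, g)]) \<longleftrightarrow> ?P xs & (xs ~= [] --> E = erev Y (fst (last xs)) --> snd (last xs) \<notin> bd1 Y (fst (last xs)) ` FG (fst (last xs)))"
  (is "?l \<longleftrightarrow> ?r1 & ?r2")
 proof
  assume l: ?l
  show "?r1 & ?r2"
  proof
   show ?r1
   proof (intro allI impI)
    fix i assume "Suc i < length xs" "fst (xs ! Suc i) = erev Y (fst (xs ! i))"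
    thus "snd (xs ! i) \<notin> bd1 Y (fst (xs ! i)) ` FG (fst (xs ! i))"
     using l[rule_format, of i] by (simp add: nth_append)
   qed
   show ?r2
   proof (intro impI)
    assume "xs ~= []" "E = erev Y (fst (last xs))"
    thus "snd (last xs) \<notin> bd1 Y (fst (last xs)) ` FG (fst (last xs))"
     using l[rule_format, of "length xs - 1"] by (simp add: nth_append last_conv_nth)
   qed
  qed
 next
  assume r: "?r1 & ?r2"
  show ?l
  proof (intro allI impI)
   fix i assume i: "Suc i < length (xs @ [(E, g)])" "fst ((xs @ [(E, g)]) ! Suc i) = erev Y (fst ((xs @ [(E, g)]) ! i))"
   show "snd ((xs @ [(E, g)]) ! i) \<notin> bd1 Y (fst ((xs @ [(E, g)]) ! i)) ` FG (fst ((xs @ [(E, g)]) ! i))"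
   proof (cases "Suc i < length xs")
    case True
    thus ?thesis using i r by (simp add: nth_append)
   next
    case False
    hence "Suc i = length xs" using i by simp
    hence "xs ~= []" "i = length xs - 1" "i < length xs" by auto
    thus ?thesis using i r by (simp add: nth_append last_conv_nth)
   qed
  qed
 qed
 thus ?thesis unfolding is_normal_form_def by (auto simp: edge_path_snoc)
qed

lemma nf_fold_closed:
 assumes "!!E g. (E, g) : set xs ==> E : edges Y & g : carrier (VG (etgt Y E))"
 shows "foldr (%(E, g) x. stab Y E ** (vincl Y (etgt Y E) g ** x)) xs gone : gcar"
 using assms
proof (induction xs)
 case (Cons p xs)
 obtain E g where p: "p = (E, g)" by (cases p)
 have "E : edges Y" "g : carrier (VG (etgt Y E))" using Cons.prems[of E g] p by auto
 moreover have "foldr (%(E, g) x. stab Y E ** (vincl Y (etgt Y E) g ** x)) xs gone : gcar"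
  using Cons.IH Cons.prems by auto
 ultimately show ?case using tgt_in p by simp
qed simp

lemma nf_fold_snoc:
 assumes "!!E g. (E, g) : set xs ==> E : edges Y & g : carrier (VG (etgt Y E))" "E : edges Y" "g : carrier (VG (etgt Y E))"
 shows "foldr (%(E, g) x. stab Y E ** (vincl Y (etgt Y E) g ** x)) (xs @ [(E, g)]) gone =
  foldr (%(E, g) x. stab Y E ** (vincl Y (etgt Y E) g ** x)) xs gone ** (stab Y E ** vincl Y (etgt Y E) g)"
 using assms
proof (induction xs)
 case Nil
 thus ?case using tgt_in by simp
next
 case (Cons p xs)
 obtain E' g' where p: "p = (E', g')" by (cases p)
 have "E' : edges Y" "g' : carrier (VG (etgt Y E'))" using Cons.prems(1)[of E' g'] p by auto
 moreover have "foldr (%(E, g) x. stab Y E ** (vincl Y (etgt Y E) g ** x)) xs gone : gcar"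
  using nf_fold_closed Cons.prems by auto
 moreover have "foldr (%(E, g) x. stab Y E ** (vincl Y (etgt Y E) g ** x)) (xs @ [(E, g)]) gone =
  foldr (%(E, g) x. stab Y E ** (vincl Y (etgt Y E) g ** x)) xs gone ** (stab Y E ** vincl Y (etgt Y E) g)"
  by (rule Cons.IH) (use Cons.prems in auto)
 ultimately show ?case using p tgt_in Cons.prems(2,3) by (simp add: G.m_assoc del: foldr_append)
qed

lemma nf_letters: "is_normal_form Y g0 xs ==> (E, g) : set xs ==> E : edges Y & g : carrier (VG (etgt Y E))"
 by (force simp: is_normal_form_def edge_path_def)

lemma nf_value_snoc:
 assumes "is_normal_form Y g0 (xs @ [(E, g)])"
 shows "nf_value Y g0 (xs @ [(E, g)]) = nf_value Y g0 xs ** stab Y E ** vincl Y (etgt Y E) g"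
proof -
 have xs: "is_normal_form Y g0 xs" and E: "E : edges Y" "g : carrier (VG (etgt Y E))" "g0 : carrier (VG (base Y))"
  using assms is_normal_form_snoc by (auto simp: is_normal_form_def)
 show ?thesis unfolding nf_value_def
  using nf_fold_snoc[OF nf_letters[OF xs] E(1,2)] nf_fold_closed[OF nf_letters[OF xs]] E tgt_in base_in by (simp add: G.m_assoc)
qed

text \<open>The normal forms of the definition allow arbitrary vertex elements, stacks only coset
  representatives; the discrepancy moves into the entry element \<open>h\<close>. The last edge and
  the last element are carried along because they govern backtracking at the next edge.\<close>

lemma nf_to_Cs:
 assumes "is_normal_form Y g0 xs"
 shows "\<exists>rho h k. h : Cs rho & k : carrier (VG (endv rho)) & nf_value Y g0 xs = h ** vincl Y (endv rho) k \<and>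
  endv rho = path_end Y (base Y) (map fst xs) \<and>
  topo rho = (if xs = [] then None else Some (fst (last xs))) & (xs ~= [] --> k = snd (last xs))"
 using assms
proof (induction xs rule: rev_induct)
 case Nil
 hence "g0 : carrier (VG (base Y))" by (simp add: is_normal_form_def)
 thus ?case using base_in by (intro exI[of _ "[]"] exI[of _ gone] exI[of _ g0]) (auto simp: Cs_Nil nf_value_def)
next
 case (snoc p xs)
 obtain E g where p: "p = (E, g)" by (cases p)
 note nf = snoc.prems[unfolded p]
 have f: "is_normal_form Y g0 xs" "E : edges Y" "esrc Y E = path_end Y (base Y) (map fst xs)" "g : carrier (VG (etgt Y E))"
  "xs ~= [] ==> E = erev Y (fst (last xs)) ==> snd (last xs) \<notin> bd1 Y (fst (last xs)) ` FG (fst (last xs))"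
  using nf is_normal_form_snoc by auto
 obtain rho h k where IH: "h : Cs rho" "k : carrier (VG (endv rho))" "nf_value Y g0 xs = h ** vincl Y (endv rho) k"
  "endv rho = path_end Y (base Y) (map fst xs)"
  "topo rho = (if xs = [] then None else Some (fst (last xs)))" "xs ~= [] --> k = snd (last xs)"
  using snoc.IH[OF f(1)] by blast
 note c = CsD[OF IH(1)]
 have "nbt (topo rho) (vincl Y (endv rho) k) E"
  unfolding nbt_def
 proof
  assume "\<exists>E1. topo rho = Some E1 & E = erev Y E1 & vincl Y (endv rho) k : Fs (topo rho)"
  then obtain E1 where E1: "topo rho = Some E1" "E = erev Y E1" "vincl Y (endv rho) k : Fs (topo rho)" by auto
  hence "xs ~= []" "E1 = fst (last xs)" using IH(5) by (auto split: if_splits)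
  moreover have "k : Fb (topo rho)" using vincl_Fs_iff[OF c(4), unfolded dtv_simps(3), OF IH(2)] E1(3) by simp
  ultimately show False using f(5) E1 IH(6) by (simp add: Fb_def)
 qed
 then obtain s where s: "h ** vincl Y (endv rho) k ** stab Y E : Cs ((s, E) # rho)"
  using Cs_push[OF IH(1) _ f(2)] f(3) IH(2,4) by auto
 show ?case unfolding p nf_value_snoc[OF nf] IH(3)
  using s f(4) by (intro exI[of _ "(s, E) # rho"] exI[of _ "h ** vincl Y (endv rho) k ** stab Y E"] exI[of _ g]) auto
qed

text \<open>Reads a normal form off the stack by going back to the parent with
  \<open>Cs_parent\<close>.\<close>

lemma Cs_to_nf:
 assumes "h : Cs rho" "k : carrier (VG (endv rho))"
 shows "\<exists>g0 xs. is_normal_form Y g0 xs & nf_value Y g0 xs = h ** vincl Y (endv rho) k \<and>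
  endv rho = path_end Y (base Y) (map fst xs) \<and>
  topo rho = (if xs = [] then None else Some (fst (last xs))) & (xs ~= [] --> k = snd (last xs))"
 using assms
proof (induction rho arbitrary: h k)
 case Nil
 hence "h = gone" "k : carrier (VG (base Y))" by (auto simp: Cs_Nil)
 thus ?case using base_in by (intro exI[of _ k] exI[of _ "[]"]) (auto simp: nf_value_def is_normal_form_def)
next
 case (Cons p rho)
 obtain s E where p: "p = (s, E)" by (cases p)
 note h1 = Cons.prems(1)[unfolded p]
 obtain h0 where h0: "h0 : Cs rho" using Cs_parent_ex[OF h1] by blast
 obtain g where g: "g : GV (endv rho)" "h = h0 ** g ** stab Y E" "nbt (topo rho) g E"
  using Cs_parent(5)[OF h1 h0] by blast
 obtain k0 where k0: "k0 : carrier (VG (endv rho))" "g = vincl Y (endv rho) k0" using g by auto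
 obtain g0 xs where IH: "is_normal_form Y g0 xs" "nf_value Y g0 xs = h0 ** g" "endv rho = path_end Y (base Y) (map fst xs)"
  "topo rho = (if xs = [] then None else Some (fst (last xs)))" "xs ~= [] --> k0 = snd (last xs)"
  using Cons.IH[OF h0 k0(1)] k0(2) by blast
 have nf: "is_normal_form Y g0 (xs @ [(E, k)])"
  unfolding is_normal_form_snoc
 proof (intro conjI impI)
  show "is_normal_form Y g0 xs" "E : edges Y" "esrc Y E = path_end Y (base Y) (map fst xs)"
   using IH Cs_parent(1,2)[OF h1] by auto
  show "k : carrier (VG (etgt Y E))" using Cons.prems(2) p by simp
  assume x: "xs ~= []" "E = erev Y (fst (last xs))"
  hence t: "topo rho = Some (fst (last xs))" using IH by simp
  hence "g \<notin> Fs (topo rho)" using g(3) x unfolding nbt_def by auto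
  hence "k0 \<notin> Fb (topo rho)" using k0 by (auto simp: Fs_def)
  thus "snd (last xs) \<notin> bd1 Y (fst (last xs)) ` FG (fst (last xs))" using t IH(5) x by (simp add: Fb_def)
 qed
 show ?case unfolding p
  by (rule exI[of _ g0], rule exI[of _ "xs @ [(E, k)]"]) (use nf nf_value_snoc[OF nf] IH(2) g(2) in simp)
qed

lemma Gcal_iff: "h : Gcal Y E \<longleftrightarrow> (\<exists>s rho. h : Cs ((s, E) # rho))"
proof
 assume "h : Gcal Y E"
 then obtain g0 xs where x: "is_normal_form Y g0 xs" "nf_value Y g0 xs = h" "xs ~= []" "fst (last xs) = E"
  "snd (last xs) : bd1 Y E ` FG E" by (auto simp: Gcal_def)
 obtain rho h0 k where rho: "h0 : Cs rho" "nf_value Y g0 xs = h0 ** vincl Y (endv rho) k"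
  "topo rho = (if xs = [] then None else Some (fst (last xs)))" "xs ~= [] --> k = snd (last xs)"
  using nf_to_Cs[OF x(1)] by blast
 have t: "topo rho = Some E" using rho x by simp
 then obtain s rho' where e: "rho = (s, E) # rho'" by (cases rho) (auto simp: topo_def)
 have "vincl Y (endv rho) k : Fs (topo rho)" unfolding Fs_def dtv_simps using t rho x by (auto simp: Fb_def)
 hence "h : Cs rho" using Cs_mult[OF rho(1)] rho(2) x(2) by simp
 thus "\<exists>s rho. h : Cs ((s, E) # rho)" using e by blast
next
 assume "\<exists>s rho. h : Cs ((s, E) # rho)"
 then obtain s rho where h: "h : Cs ((s, E) # rho)" by blast
 note c = CsD[OF h]
 have E: "E : edges Y" using c(4) by simp
 have one: "\<one>\<^bsub>VG (etgt Y E)\<^esub> : bd1 Y E ` FG E"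
  using subgroup.one_closed[OF Fb_subgroup[OF c(4)]] by (simp add: Fb_def)
 hence "\<one>\<^bsub>VG (etgt Y E)\<^esub> : carrier (VG (endv ((s, E) # rho)))" using bd1_closed[OF E] by auto
 from Cs_to_nf[OF h this] show "h : Gcal Y E"
  unfolding Gcal_def using one vincl_one[OF tgt_in[OF E]] c(1) by (fastforce split: if_splits)
qed

text \<open>Allows deployments to be indexed by a stack together with an element of its entry
  coset.\<close>

lemma deploy_dom_iff: "(x, h) : deploy_dom Y \<longleftrightarrow> (\<exists>rho. x = topo rho & h : Cs rho)"
proof
 assume "(x, h) : deploy_dom Y"
 then consider "x = None" "h = gone" | E where "x = Some E" "h : Gcal Y E" by (auto simp: deploy_dom_def)
 thus "\<exists>rho. x = topo rho & h : Cs rho"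
 proof cases
  case 1
  thus ?thesis by (intro exI[of _ "[]"]) (simp add: Cs_Nil)
 next
  case 2
  then obtain s rho where "h : Cs ((s, E) # rho)" using Gcal_iff by blast
  thus ?thesis using 2 by (intro exI[of _ "(s, E) # rho"]) simp
 qed
next
 assume "\<exists>rho. x = topo rho & h : Cs rho"
 then obtain rho where r: "x = topo rho" "h : Cs rho" by blast
 show "(x, h) : deploy_dom Y"
 proof (cases rho)
  case Nil
  thus ?thesis using r by (simp add: deploy_dom_def Cs_Nil)
 next
  case (Cons p rho')
  then obtain s E where p: "rho = (s, E) # rho'" by (cases p) auto
  hence "h : Gcal Y E" "E : edges Y" using r Gcal_iff CsD(4)[OF r(2)] by auto
  thus ?thesis using r p by (auto simp: deploy_dom_def)
 qed
qed

end

section \<open>Vertex groups and normal-form languages\<close>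

context lettered_group
begin

text \<open>\<open>u\<close> is read completely before \<open>v\<close>. This crude traversal is
  sufficient when all positions lie in a bounded region.\<close>

lemma af_box:
 assumes l: "u : lists A" "v : lists A" and x: "x : carrier G"
  and S: "!!u1 v1. prefix u1 u ==> prefix v1 v ==> inv (val u1) \<otimes> (x \<otimes> val v1) : S"
 shows "af S x u v"
proof -
 have "af S x u []"
  by (rule af_prefixL[OF l(1) x]) (use S[of _ "[]"] x in simp)
 moreover have "af S (inv (val u) \<otimes> (x \<otimes> val [])) [] v"
 proof (rule af_prefixR[OF l(2)])
  fix v1 assume p: "prefix v1 v"
  have "v1 : lists A" using prefix_lists[OF p l(2)] .
  thus "inv val u \<otimes> (x \<otimes> val []) \<otimes> val v1 : S" using S[of u v1] p l x by (simp add: grp_simps)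
 qed (use l x in simp)
 ultimately have "af S x (u @ []) ([] @ v)" by (rule af_append)
 thus ?thesis by simp
qed

lemma inv_mult_inv: "x : carrier G ==> y : carrier G ==> inv (inv x \<otimes> y) = inv y \<otimes> x"
 by (simp add: grp_simps)

end

context alphabet_group
begin

lemma fel_ball1I:
 assumes L: "L <= lists A" and onto: "val ` L = carrier G" and S: "finite S"
  "!!u v. u : L ==> v : L ==> inv (val u) \<otimes> val v : ball 1 ==> af S \<one> u v"
 shows "fel \<one> L L"
 unfolding fel_def
proof (intro allI impI)
 fix D :: "'x set" assume D: "finite D"
 have "\<exists>S. finite S & (\<forall>u\<in>L. \<forall>v\<in>L. inv (val u) \<otimes> val v : D --> af S \<one> u v)"
 proof (rule chain[OF onto L _ _ D])
  show "\<exists>S. finite S & (\<forall>u\<in>L. \<forall>v\<in>L. inv (val u) \<otimes> val v : ball 1 --> af S \<one> u v)"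
   using S by (intro exI[of _ S]) simp
  show "af (S <#> T) \<one> u w" if "af S \<one> u v" "af T \<one> v w" for S T u v w
   using af_trans[OF that] by simp
 qed
 moreover have "\<one> \<otimes> val v = val v" if "v : L" for v using val_closed[OF subsetD[OF L that]] by simp
 ultimately show "\<exists>S. finite S & (\<forall>u\<in>L. \<forall>v\<in>L. inv val u \<otimes> (\<one> \<otimes> val v) : D --> af S \<one> u v)" by simp
qed

end

section \<open>Vertex groups inside the fundamental group\<close>

context cgog
begin

lemma V_af1:
 assumes V: "V : verts Y" and a: "lettered_group.af (VG V) (VA V) (vev Y ev V) S x u v"
 shows "af (vincl Y V ` S) (vincl Y V x) u v"
proof -
 interpret Vg: alphabet_group "VG V" "VA V" ainv "vev Y ev V" by (rule V_alphabet[OF V])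
 interpret h: group_hom "VG V" "pi1 Y" "vincl Y V" by (rule vincl_group_hom[OF V])
 have A: "a : A" if "a : VA V" for a using that VA_sub by blast
 show ?thesis using a
 proof (induction rule: Vg.af.induct)
  case (af_Nil x)
  thus ?case by (intro af.af_Nil) auto
 next
  case (af_left x a u v)
  have "vincl Y V (inv\<^bsub>VG V\<^esub> vev Y ev V a *[V] x) = iv (ev a) ** vincl Y V x"
   using af_left vev[OF V af_left(3)] by simp
  thus ?case using af_left A by (intro af.af_left) auto
 next
  case (af_right x a u v)
  have "vincl Y V (x *[V] vev Y ev V a) = vincl Y V x ** ev a"
   using af_right vev[OF V af_right(3)] by simp
  thus ?case using af_right A by (intro af.af_right) auto
 qed
qed

lemma V_af2:
 assumes V: "V : verts Y" and a: "af S (vincl Y V x) u v" and x: "x : carrier (VG V)"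
  and l: "u : lists (VA V)" "v : lists (VA V)"
 shows "lettered_group.af (VG V) (VA V) (vev Y ev V) {k : carrier (VG V). vincl Y V k : S} x u v"
proof -
 interpret Vg: alphabet_group "VG V" "VA V" ainv "vev Y ev V" by (rule V_alphabet[OF V])
 interpret h: group_hom "VG V" "pi1 Y" "vincl Y V" by (rule vincl_group_hom[OF V])
 have "Vg.af {k : carrier (VG V). vincl Y V k : S} x u v" if "af S y u v" "y = vincl Y V x" "x : carrier (VG V)"
  "u : lists (VA V)" "v : lists (VA V)" for y
  using that
 proof (induction arbitrary: x rule: af.induct)
  case (af_Nil y)
  thus ?case by (intro Vg.af.af_Nil) auto
 next
  case (af_left y a u v)
  hence a: "a : VA V" by simp
  have "iv (ev a) ** y = vincl Y V (inv\<^bsub>VG V\<^esub> vev Y ev V a *[V] x)"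
   using af_left vev[OF V a] by simp
  thus ?case using af_left a vev[OF V a] by (intro Vg.af.af_left) auto
 next
  case (af_right y a u v)
  hence a: "a : VA V" by simp
  have "y ** ev a = vincl Y V (x *[V] vev Y ev V a)"
   using af_right vev[OF V a] by simp
  thus ?case using af_right a vev[OF V a] by (intro Vg.af.af_right) auto
 qed
 thus ?thesis using a x l by blast
qed

lemma finite_vincl_vimage: "V : verts Y ==> finite D ==> finite {k : carrier (VG V). vincl Y V k : D}"
proof -
 assume V: "V : verts Y" and D: "finite D"
 have "inj_on (vincl Y V) (carrier (VG V))" using vincl_inj[OF V] by (auto simp: inj_on_def)
 from finite_vimage_IntI[OF D this] show ?thesis by (auto elim!: rev_finite_subset)
qed

text \<open>Finite sets correspond to each other under the embedding of the vertex group, so the two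
  word metrics need not be compared.\<close>

lemma V_fel_iff:
 assumes V: "V : verts Y" and x: "x : carrier (VG V)" and l: "M <= lists (VA V)" "N <= lists (VA V)"
 shows "lettered_group.fel (VG V) (VA V) (vev Y ev V) x M N \<longleftrightarrow> fel (vincl Y V x) M N"
proof -
 interpret Vg: alphabet_group "VG V" "VA V" ainv "vev Y ev V" by (rule V_alphabet[OF V])
 interpret h: group_hom "VG V" "pi1 Y" "vincl Y V" by (rule vincl_group_hom[OF V])
 have d: "vincl Y V (inv\<^bsub>VG V\<^esub> Vg.val u *[V] (x *[V] Vg.val v)) = iv (val u) ** (vincl Y V x ** val v)"
  "inv\<^bsub>VG V\<^esub> Vg.val u *[V] (x *[V] Vg.val v) : carrier (VG V)"
  if "u : M" "v : N" for u v
 proof -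
  have "u : lists (VA V)" "v : lists (VA V)" using that l by auto
  thus "vincl Y V (inv\<^bsub>VG V\<^esub> Vg.val u *[V] (x *[V] Vg.val v)) = iv (val u) ** (vincl Y V x ** val v)"
   "inv\<^bsub>VG V\<^esub> Vg.val u *[V] (x *[V] Vg.val v) : carrier (VG V)"
   using vincl_val[OF V] x by auto
 qed
 show ?thesis
 proof
  assume f: "Vg.fel x M N"
  show "fel (vincl Y V x) M N" unfolding fel_def
  proof (intro allI impI)
   fix D :: "('v,'e,'g) pi1elt set" assume D: "finite D"
   obtain S where S: "finite S" "!!u v. u : M ==> v : N ==>
    inv\<^bsub>VG V\<^esub> Vg.val u *[V] (x *[V] Vg.val v) : {k : carrier (VG V). vincl Y V k : D} ==> Vg.af S x u v"
    by (rule Vg.felE[OF f finite_vincl_vimage[OF V D]]) auto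
   have "af (vincl Y V ` S) (vincl Y V x) u v" if "u : M" "v : N" "iv (val u) ** (vincl Y V x ** val v) : D" for u v
    using V_af1[OF V S(2)[OF that(1,2)]] d[OF that(1,2)] that(3) by simp
   thus "\<exists>S. finite S & (\<forall>u\<in>M. \<forall>v\<in>N. iv (val u) ** (vincl Y V x ** val v) : D --> af S (vincl Y V x) u v)"
    using S(1) by (intro exI[of _ "vincl Y V ` S"]) simp
  qed
 next
  assume f: "fel (vincl Y V x) M N"
  show "Vg.fel x M N" unfolding Vg.fel_def
  proof (intro allI impI)
   fix D :: "'g set" assume D: "finite D"
   obtain S where S: "finite S" "!!u v. u : M ==> v : N ==>
    iv (val u) ** (vincl Y V x ** val v) : vincl Y V ` D ==> af S (vincl Y V x) u v"
    by (rule felE[OF f finite_imageI[OF D, of "vincl Y V"]]) auto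
   let ?T = "{k : carrier (VG V). vincl Y V k : S}"
   have "Vg.af ?T x u v" if uv: "u : M" "v : N" "inv\<^bsub>VG V\<^esub> Vg.val u *[V] (x *[V] Vg.val v) : D" for u v
   proof (rule V_af2[OF V S(2)[OF uv(1,2)] x])
    show "iv (val u) ** (vincl Y V x ** val v) : vincl Y V ` D" using d(1)[OF uv(1,2)] uv(3) by (metis imageI)
   qed (use uv l in auto)
   thus "\<exists>S. finite S & (\<forall>u\<in>M. \<forall>v\<in>N. inv\<^bsub>VG V\<^esub> Vg.val u *[V] (x *[V] Vg.val v) : D --> Vg.af S x u v)"
    using finite_vincl_vimage[OF V S(1)] by (intro exI[of _ ?T]) simp
  qed
 qed
qed

lemma V_sfel_iff:
 assumes V: "V : verts Y" and l: "M <= lists (VA V)"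
 shows "lettered_group.sfel (VG V) (vev Y ev V) M \<longleftrightarrow> sfel M"
proof -
 interpret Vg: alphabet_group "VG V" "VA V" ainv "vev Y ev V" by (rule V_alphabet[OF V])
 interpret h: group_hom "VG V" "pi1 Y" "vincl Y V" by (rule vincl_group_hom[OF V])
 have d: "vincl Y V (inv\<^bsub>VG V\<^esub> Vg.val u *[V] Vg.val v) = iv (val u) ** val v"
  "inv\<^bsub>VG V\<^esub> Vg.val u *[V] Vg.val v : carrier (VG V)"
  if "u : lists (VA V)" "v : lists (VA V)" for u v
  using vincl_val[OF V] that by auto
 have t: "take n u : lists (VA V)" "u : lists (VA V)" if "u : M" for n u
  using subsetD[OF l that] Vg.take_lists by auto
 show ?thesis
 proof
  assume f: "Vg.sfel M"
  show "sfel M" unfolding sfel_def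
  proof (intro allI impI)
   fix D :: "('v,'e,'g) pi1elt set" assume D: "finite D"
   obtain S where S: "finite S" "!!u v n. u : M ==> v : M ==>
    inv\<^bsub>VG V\<^esub> Vg.val u *[V] Vg.val v : {k : carrier (VG V). vincl Y V k : D} ==>
    inv\<^bsub>VG V\<^esub> Vg.val (take n u) *[V] Vg.val (take n v) : S"
    by (rule Vg.sfelE[OF f finite_vincl_vimage[OF V D]]) auto
   have "iv (val (take n u)) ** val (take n v) : vincl Y V ` S" if uv: "u : M" "v : M" "iv (val u) ** val v : D" for u v n
   proof -
    have "inv\<^bsub>VG V\<^esub> Vg.val (take n u) *[V] Vg.val (take n v) : S"
     by (rule S(2)[OF uv(1,2)]) (use d[OF t(2)[OF uv(1)] t(2)[OF uv(2)]] uv(3) in simp)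
    thus ?thesis using d(1)[OF t(1)[OF uv(1)] t(1)[OF uv(2)], of n n] by (metis imageI)
   qed
   thus "\<exists>S. finite S & (\<forall>u\<in>M. \<forall>v\<in>M. iv (val u) ** val v : D --> (\<forall>n. iv (val (take n u)) ** val (take n v) : S))"
    using S(1) by (intro exI[of _ "vincl Y V ` S"]) simp
  qed
 next
  assume f: "sfel M"
  show "Vg.sfel M" unfolding Vg.sfel_def
  proof (intro allI impI)
   fix D :: "'g set" assume D: "finite D"
   obtain S where S: "finite S" "!!u v n. u : M ==> v : M ==>
    iv (val u) ** val v : vincl Y V ` D ==> iv (val (take n u)) ** val (take n v) : S"
    by (rule sfelE[OF f finite_imageI[OF D, of "vincl Y V"]]) auto
   let ?T = "{k : carrier (VG V). vincl Y V k : S}"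
   have "inv\<^bsub>VG V\<^esub> Vg.val (take n u) *[V] Vg.val (take n v) : ?T"
    if uv: "u : M" "v : M" "inv\<^bsub>VG V\<^esub> Vg.val u *[V] Vg.val v : D" for u v n
   proof -
    have "iv (val u) ** val v : vincl Y V ` D" using d(1)[OF t(2)[OF uv(1)] t(2)[OF uv(2)]] uv(3) by (metis imageI)
    hence "iv (val (take n u)) ** val (take n v) : S" using S(2) uv by blast
    thus ?thesis using d[OF t(1)[OF uv(1)] t(1)[OF uv(2)], of n n] by simp
   qed
   thus "\<exists>S. finite S & (\<forall>u\<in>M. \<forall>v\<in>M. inv\<^bsub>VG V\<^esub> Vg.val u *[V] Vg.val v : D -->
     (\<forall>n. inv\<^bsub>VG V\<^esub> Vg.val (take n u) *[V] Vg.val (take n v) : S))"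
    using finite_vincl_vimage[OF V S(1)] by (intro exI[of _ ?T]) simp
  qed
 qed
qed

definition vlang :: "'v => 'a list set => bool" where
 "vlang V M \<longleftrightarrow> M <= lists (VA V) & val ` M = GV V"

lemma vlangD: assumes "vlang V M" shows "M <= lists (VA V)" "M <= lists A" "val ` M = GV V"
 using assms lists_mono[OF VA_sub] by (auto simp: vlang_def)

abbreviation "VCl V \<equiv> AClasses (VG V) (VA V) (vev Y ev V)"
abbreviation "vcls V L \<equiv> aclass (VG V) (VA V) (vev Y ev V) L"

lemma V_onto_iff:
 assumes V: "V : verts Y" and l: "M <= lists (VA V)"
 shows "word_eval (VG V) (vev Y ev V) ` M = carrier (VG V) \<longleftrightarrow> val ` M = GV V"
proof -
 have e: "val ` M = vincl Y V ` word_eval (VG V) (vev Y ev V) ` M"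
  unfolding image_image by (rule image_cong[OF HOL.refl]) (simp add: vincl_val(2)[OF V subsetD[OF l]])
 have s: "word_eval (VG V) (vev Y ev V) ` M <= carrier (VG V)" using vincl_val(1)[OF V subsetD[OF l]] by blast
 have i: "inj_on (vincl Y V) (carrier (VG V))" using vincl_inj[OF V] by (auto simp: inj_on_def)
 show ?thesis unfolding e inj_on_image_eq_iff[OF i s subset_refl] ..
qed

lemma V_async_iff:
 assumes V: "V : verts Y"
 shows "async_aut (VG V) (VA V) (vev Y ev V) M \<longleftrightarrow> vlang V M & regular_lang (VA V) M & fel gone M M"
proof -
 interpret Vg: alphabet_group "VG V" "VA V" ainv "vev Y ev V" by (rule V_alphabet[OF V])
 show ?thesis
 proof (cases "M <= lists (VA V)")
  case True
  thus ?thesis unfolding Vg.async_aut_iff Vg.apre_def vlang_def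
   using V_onto_iff[OF V True] V_fel_iff[OF V Vg.one_closed True True] vincl_one[OF V] by argo
 qed (simp add: Vg.async_aut_iff Vg.apre_def vlang_def)
qed

lemma V_sync_iff:
 assumes V: "V : verts Y"
 shows "sync_aut (VG V) (VA V) (vev Y ev V) M \<longleftrightarrow> vlang V M & regular_lang (VA V) M & sfel M"
proof -
 interpret Vg: alphabet_group "VG V" "VA V" ainv "vev Y ev V" by (rule V_alphabet[OF V])
 show ?thesis
 proof (cases "M <= lists (VA V)")
  case True
  thus ?thesis unfolding Vg.sync_aut_iff vlang_def
   using V_onto_iff[OF V True] V_sfel_iff[OF V True] by argo
 qed (simp add: Vg.sync_aut_iff vlang_def)
qed

lemma V_class:
 assumes V: "V : verts Y" and c: "c : VCl V" and L: "L : c"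
 shows "vlang V L" "regular_lang (VA V) L" "fel gone L L" "c = vcls V L"
proof -
 interpret Vg: alphabet_group "VG V" "VA V" ainv "vev Y ev V" by (rule V_alphabet[OF V])
 show "vlang V L" "regular_lang (VA V) L" "fel gone L L" "c = vcls V L"
  using Vg.AClassesD[OF c L] V_async_iff[OF V] by auto
qed

lemma V_vcls_iff:
 assumes V: "V : verts Y" and L: "vlang V L" "fel gone L L"
 shows "M : vcls V L \<longleftrightarrow> vlang V M & regular_lang (VA V) M & fel gone M M & fel gone L M"
proof -
 interpret Vg: alphabet_group "VG V" "VA V" ainv "vev Y ev V" by (rule V_alphabet[OF V])
 have "Vg.apre L" unfolding Vg.apre_def
  using V_onto_iff[OF V] V_fel_iff[OF V Vg.one_closed] vincl_one[OF V] L unfolding vlang_def by simp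
 from Vg.aclass_iff[OF this] show ?thesis
  using V_async_iff[OF V, of M] V_fel_iff[OF V Vg.one_closed, of L M] vincl_one[OF V] L vlangD(1)[of V] by auto
qed

lemma V_vcls_eq:
 assumes V: "V : verts Y" and L: "vlang V L" "fel gone L L" and M: "vlang V M" "fel gone M M" and f: "fel gone L M"
 shows "vcls V L = vcls V M"
proof -
 interpret Vg: alphabet_group "VG V" "VA V" ainv "vev Y ev V" by (rule V_alphabet[OF V])
 have "Vg.apre L" "Vg.apre M" "Vg.fel \<one>\<^bsub>VG V\<^esub> L M" unfolding Vg.apre_def
  using V_onto_iff[OF V] V_fel_iff[OF V Vg.one_closed] vincl_one[OF V] L M f unfolding vlang_def by simp_all
 from Vg.aclass_eqI[OF this] show ?thesis .
qed

lemma V_vcls_VCl: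
 assumes V: "V : verts Y" and L: "vlang V L" "regular_lang (VA V) L" "fel gone L L"
 shows "vcls V L : VCl V" "L : vcls V L"
 using V_async_iff[OF V] V_vcls_iff[OF V] L by (auto simp: AClasses_def)

lemma V_class_ex: assumes V: "V : verts Y" and c: "c : VCl V" shows "\<exists>L. L : c"
proof -
 interpret Vg: alphabet_group "VG V" "VA V" ainv "vev Y ev V" by (rule V_alphabet[OF V])
 show ?thesis by (rule Vg.AClasses_ex[OF c])
qed

lemma V_act_iff:
 assumes V: "V : verts Y" and c: "c : VCl V" "L : c" and d: "d : VCl V" "M : d" and g: "g : carrier (VG V)"
 shows "c = act_class (VG V) (VA V) (vev Y ev V) g d \<longleftrightarrow> fel (vincl Y V g) L M"
proof -
 interpret Vg: alphabet_group "VG V" "VA V" ainv "vev Y ev V" by (rule V_alphabet[OF V])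
 have l: "L <= lists (VA V)" "M <= lists (VA V)" using V_class[OF V c] V_class[OF V d] vlangD by blast+
 show ?thesis unfolding Vg.act_class_eq_iff[OF c d g] by (rule V_fel_iff[OF V g l])
qed

lemma V_cover:
 assumes V: "V : verts Y" and x: "x : GV V" and M: "vlang V M" and u: "val u : GV V"
 shows "\<exists>v\<in>M. val u = x ** val v"
proof -
 have "iv x ** val u : val ` M" using GV_ops[OF V] x u vlangD(3)[OF M] by simp
 then obtain v where v: "v : M" "val v = iv x ** val u" by auto
 hence "val u = x ** val v" using inv_cancel2 GV_closed[OF V x] GV_closed[OF V u] by simp
 thus ?thesis using v by blast
qed

lemma V_fel_trans:
 assumes V: "V : verts Y" and f: "fel x L M" "fel y M N" and l: "L <= lists (VA V)" "vlang V M" "N <= lists (VA V)"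
  and xy: "x : GV V" "y : GV V"
 shows "fel (x ** y) L N"
proof (rule fel_trans[OF f])
 show "L <= lists A" "M <= lists A" "N <= lists A" using l vlangD[OF l(2)] lists_mono[OF VA_sub, of V] by auto
 show "x : gcar" "y : gcar" using xy GV_closed[OF V] by auto
 show "\<exists>v\<in>M. val u = x ** val v" if "u : L" for u
  by (rule V_cover[OF V xy(1) l(2) val_GV[OF V subsetD[OF l(1) that]]])
qed

subsection \<open>Prefixes of the words of \<open>L\<^sub>\<psi>\<close>\<close>

definition chc :: "('e option => ('v,'e,'g) pi1elt => 'a list set) => bool" where
 "chc Lc \<longleftrightarrow> (\<forall>rho h. h : Cs rho --> vlang (endv rho) (Lc (topo rho) h))"

text \<open>Parses a prefix ending just after an edge, together with the stack it reaches; the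
  segment following it is kept apart. The representative \<open>s\<close> is dictated by the value
  of the prefix.\<close>

inductive pre :: "('e option => ('v,'e,'g) pi1elt => 'a list set) => ('g \<times> 'e) list => 'a list => bool" for Lc where
 pre_Nil: "pre Lc [] []"
| pre_Cons: "pre Lc rho p ==> u : Lc (topo rho) (val p) ==> E : edges Y ==> esrc Y E = endv rho ==>
  nbt (topo rho) (val u) E ==> val (p @ u @ tw E) : Cs ((s, E) # rho) ==> pre Lc ((s, E) # rho) (p @ u @ tw E)"

inductive_cases pre_ConsE: "pre Lc ((s, E) # rho) q"

lemma pre_facts: assumes "chc Lc" "pre Lc rho p" shows "p : lists A" "val p : Cs rho"
proof -
 have "p : lists A & val p : Cs rho" using assms(2)
 proof (induction rule: pre.induct)
  case pre_Nil
  thus ?case by (simp add: Cs_Nil)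
 next
  case (pre_Cons rho p u E s)
  have "vlang (endv rho) (Lc (topo rho) (val p))" using assms(1) pre_Cons by (auto simp: chc_def)
  hence "u : lists A" using vlangD(2) pre_Cons(2) by blast
  thus ?case using pre_Cons tw_facts by simp
 qed
 thus "p : lists A" "val p : Cs rho" by auto
qed

lemma chcD: assumes "chc Lc" "h : Cs rho" shows "vlang (endv rho) (Lc (topo rho) h)"
  "u : Lc (topo rho) h ==> u : lists A" "u : Lc (topo rho) h ==> u : lists (VA (endv rho))" "u : Lc (topo rho) h ==> val u : GV (endv rho)"
proof -
 show v: "vlang (endv rho) (Lc (topo rho) h)" using assms by (auto simp: chc_def)
 show "u : Lc (topo rho) h ==> u : lists A" "u : Lc (topo rho) h ==> u : lists (VA (endv rho))"
  "u : Lc (topo rho) h ==> val u : GV (endv rho)"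
  using vlangD[OF v] by blast+
qed

lemma pre_extend:
 assumes "chc Lc" "pre Lc rho p" "u : Lc (topo rho) (val p)" "E : edges Y" "esrc Y E = endv rho" "nbt (topo rho) (val u) E"
 shows "\<exists>s. pre Lc ((s, E) # rho) (p @ u @ tw E)"
proof -
 note p = pre_facts[OF assms(1,2)]
 note u = chcD(2,4)[OF assms(1) p(2) assms(3)]
 obtain s where "val p ** val u ** stab Y E : Cs ((s, E) # rho)" using Cs_push[OF p(2) u(2) assms(4-6)] by blast
 hence "val (p @ u @ tw E) : Cs ((s, E) # rho)" using p u tw_facts[OF assms(4)] stab_closed[OF assms(4)] by (simp add: G.m_assoc)
 thus ?thesis using assms by (blast intro: pre_Cons)
qed

text \<open>Lifts the chain of parents of \<open>h\<close> to a word, using at each vertex that its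
  language is onto the vertex group.\<close>

lemma pre_ex: assumes "chc Lc" "h : Cs rho" shows "\<exists>p. pre Lc rho p & val p = h"
 using assms(2)
proof (induction rho arbitrary: h)
 case Nil
 thus ?case by (intro exI[of _ "[]"]) (auto simp: Cs_Nil intro: pre_Nil)
next
 case (Cons a rho)
 obtain s E where a: "a = (s, E)" by (cases a)
 note h1 = Cons.prems[unfolded a]
 obtain h0 where h0: "h0 : Cs rho" using Cs_parent_ex[OF h1] by blast
 obtain p where p: "pre Lc rho p" "val p = h0" using Cons.IH[OF h0] by blast
 obtain g where g: "g : GV (endv rho)" "h = h0 ** g ** stab Y E" "nbt (topo rho) g E" using Cs_parent(5)[OF h1 h0] by blast
 obtain u where u: "u : Lc (topo rho) h0" "val u = g" using vlangD(3)[OF chcD(1)[OF assms(1) h0]] g(1) by (metis imageE)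
 note E = Cs_parent(1,2)[OF h1]
 have v: "val (p @ u @ tw E) = h"
  using p u g pre_facts(1)[OF assms(1) p(1)] chcD(2)[OF assms(1) h0 u(1)] tw_facts[OF E(1)] CsD(1)[OF h0]
   GV_closed[OF CsD(5)[OF h0] g(1)] stab_closed[OF E(1)] by (simp add: G.m_assoc)
 have "pre Lc ((s, E) # rho) (p @ u @ tw E)"
  by (rule pre_Cons[OF p(1) _ E]) (use p u g v h1 in simp_all)
 thus ?case using v a by blast
qed

abbreviation "LP Lc \<equiv> Lpsi Y ev tlet Lc"

definition cc :: "('e \<times> 'a list) list => 'a list" where
 "cc xs = concat (map (%(E, u). tw E @ u) xs)"

lemma lpsi_ok_snoc:
 "lpsi_ok Y ev tlet Lc u0 (xs @ [(E, u)]) \<longleftrightarrow> lpsi_ok Y ev tlet Lc u0 xs & E : edges Y \<and>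
   esrc Y E = path_end Y (base Y) (map fst xs) & u : Lc (Some E) (val (u0 @ cc xs @ tw E)) \<and>
   (xs ~= [] --> E = erev Y (fst (last xs)) --> val (snd (last xs)) \<notin> Fs (Some (fst (last xs))))"
proof -
 let ?P = "%xs. \<forall>i<length xs. snd (xs ! i) : Lc (Some (fst (xs ! i))) (val (u0 @ cc (take i xs) @ tw (fst (xs ! i))))"
 let ?Q = "%xs. \<forall>i. Suc i < length xs --> fst (xs ! Suc i) = erev Y (fst (xs ! i)) -->
    val (snd (xs ! i)) \<notin> Fs (Some (fst (xs ! i)))"
 have P: "?P (xs @ [(E, u)]) \<longleftrightarrow> ?P xs & u : Lc (Some E) (val (u0 @ cc xs @ tw E))"
  by (auto simp: nth_append less_Suc_eq)
 have Q: "?Q (xs @ [(E, u)]) \<longleftrightarrow> ?Q xs & (xs ~= [] --> E = erev Y (fst (last xs)) --> val (snd (last xs)) \<notin> Fs (Some (fst (last xs))))"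
  (is "?l \<longleftrightarrow> ?r1 & ?r2")
 proof
  assume l: ?l
  show "?r1 & ?r2"
  proof
   show ?r1
   proof (intro allI impI)
    fix i assume "Suc i < length xs" "fst (xs ! Suc i) = erev Y (fst (xs ! i))"
    thus "val (snd (xs ! i)) \<notin> Fs (Some (fst (xs ! i)))"
     using l[rule_format, of i] by (simp add: nth_append)
   qed
   show ?r2
   proof (intro impI)
    assume "xs ~= []" "E = erev Y (fst (last xs))"
    thus "val (snd (last xs)) \<notin> Fs (Some (fst (last xs)))"
     using l[rule_format, of "length xs - 1"] by (simp add: nth_append last_conv_nth)
   qed
  qed
 next
  assume r: "?r1 & ?r2"
  show ?l
  proof (intro allI impI)
   fix i assume i: "Suc i < length (xs @ [(E, u)])" "fst ((xs @ [(E, u)]) ! Suc i) = erev Y (fst ((xs @ [(E, u)]) ! i))"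
   show "val (snd ((xs @ [(E, u)]) ! i)) \<notin> Fs (Some (fst ((xs @ [(E, u)]) ! i)))"
   proof (cases "Suc i < length xs")
    case True
    thus ?thesis using i r by (simp add: nth_append)
   next
    case False
    hence "Suc i = length xs" using i by simp
    hence "xs ~= []" "i = length xs - 1" "i < length xs" by auto
    thus ?thesis using i r by (simp add: nth_append last_conv_nth)
   qed
  qed
 qed
 have F: "Fs (Some E) = vincl Y (etgt Y E) ` bd1 Y E ` FG E" for E by (simp add: Fs_def Fb_def)
 show ?thesis unfolding lpsi_ok_def F[symmetric] cc_def[symmetric] P Q by (auto simp: edge_path_snoc)
qed

lemma cc_snoc: "cc (xs @ [(E, u)]) = cc xs @ tw E @ u" and cc_Nil: "cc [] = []"
 by (auto simp: cc_def)

text \<open>Replaces the indexed conditions of \<open>lpsi_ok\<close> by the recursion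
  \<open>pre\<close>. Both inclusions carry along the last edge and the last segment, on which the
  backtracking condition for the next edge depends.\<close>

lemma Lpsi_eq: assumes chc: "chc Lc"
 shows "LP Lc = {p @ u | p u. \<exists>rho. pre Lc rho p & u : Lc (topo rho) (val p)}"
proof (intro equalityI subsetI)
 fix w assume "w : LP Lc"
 then obtain u0 xs where ok: "lpsi_ok Y ev tlet Lc u0 xs" and w: "w = u0 @ cc xs" by (auto simp: Lpsi_def cc_def)
 have "\<exists>rho p u. pre Lc rho p & u : Lc (topo rho) (val p) & p @ u = u0 @ cc xs \<and>
   topo rho = (if xs = [] then None else Some (fst (last xs))) & (xs ~= [] --> u = snd (last xs)) \<and>
   endv rho = path_end Y (base Y) (map fst xs)" using ok
 proof (induction xs rule: rev_induct)
  case Nil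
  hence "u0 : Lc None gone" by (simp add: lpsi_ok_def)
  thus ?case using pre_Nil by (intro exI[of _ "[]"] exI[of _ u0]) (auto simp: cc_Nil)
 next
  case (snoc a xs)
  obtain E u where a: "a = (E, u)" by (cases a)
  note f = snoc.prems[unfolded a lpsi_ok_snoc]
  obtain rho p v where IH: "pre Lc rho p" "v : Lc (topo rho) (val p)" "p @ v = u0 @ cc xs"
   "topo rho = (if xs = [] then None else Some (fst (last xs)))" "xs ~= [] --> v = snd (last xs)"
   "endv rho = path_end Y (base Y) (map fst xs)" using snoc.IH f by blast
  have "nbt (topo rho) (val v) E"
   unfolding nbt_def using IH(4,5) f by (auto split: if_splits)
  then obtain s where s: "pre Lc ((s, E) # rho) (p @ v @ tw E)" using pre_extend[OF chc IH(1,2)] f IH(6) by auto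
  have e: "p @ v @ tw E = u0 @ cc xs @ tw E" using IH(3) by (metis append.assoc)
  show ?case unfolding a
   by (rule exI[of _ "(s, E) # rho"], rule exI[of _ "p @ v @ tw E"], rule exI[of _ u])
    (use s f e[symmetric] in \<open>simp add: cc_snoc\<close>)
 qed
 thus "w : {p @ u | p u. \<exists>rho. pre Lc rho p & u : Lc (topo rho) (val p)}" using w by (smt (verit) mem_Collect_eq)
next
 fix w assume "w : {p @ u | p u. \<exists>rho. pre Lc rho p & u : Lc (topo rho) (val p)}"
 then obtain rho p u where r: "pre Lc rho p" "u : Lc (topo rho) (val p)" "w = p @ u" by blast
 have "\<exists>u0 xs. lpsi_ok Y ev tlet Lc u0 xs & p @ u = u0 @ cc xs \<and>
   topo rho = (if xs = [] then None else Some (fst (last xs))) & (xs ~= [] --> u = snd (last xs)) \<and>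
   endv rho = path_end Y (base Y) (map fst xs)" using r(1,2)
 proof (induction arbitrary: u rule: pre.induct)
  case pre_Nil
  thus ?case by (intro exI[of _ u] exI[of _ "[]"]) (auto simp: lpsi_ok_def cc_Nil)
 next
  case (pre_Cons rho p v E s)
  obtain u0 xs where IH: "lpsi_ok Y ev tlet Lc u0 xs" "p @ v = u0 @ cc xs"
   "topo rho = (if xs = [] then None else Some (fst (last xs)))" "xs ~= [] --> v = snd (last xs)"
   "endv rho = path_end Y (base Y) (map fst xs)" using pre_Cons.IH[OF pre_Cons(2)] by blast
  have e: "p @ v @ tw E = u0 @ cc xs @ tw E" using IH(2) by (metis append.assoc)
  have "u : Lc (Some E) (val (u0 @ cc xs @ tw E))" using pre_Cons.prems unfolding e by simp
  hence "lpsi_ok Y ev tlet Lc u0 (xs @ [(E, u)])"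
   unfolding lpsi_ok_snoc using IH pre_Cons.hyps(3,4,5) by (auto simp: nbt_def)
  thus ?case using e by (intro exI[of _ u0] exI[of _ "xs @ [(E, u)]"]) (simp add: cc_snoc)
 qed
 then obtain u0 xs where "lpsi_ok Y ev tlet Lc u0 xs" "w = u0 @ cc xs" using r(3) by blast
 thus "w : LP Lc" unfolding Lpsi_def cc_def by blast
qed

lemma LpsiE: assumes "chc Lc" "w : LP Lc"
 obtains rho p u where "pre Lc rho p" "u : Lc (topo rho) (val p)" "w = p @ u"
 using assms(2) unfolding Lpsi_eq[OF assms(1)] by blast

lemma LpsiI: assumes "chc Lc" "pre Lc rho p" "u : Lc (topo rho) (val p)" shows "p @ u : LP Lc"
 unfolding Lpsi_eq[OF assms(1)] using assms(2,3) by blast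

lemma Lpsi_lists: assumes "chc Lc" shows "LP Lc <= lists A"
proof
 fix w assume "w : LP Lc"
 then obtain rho p u where r: "pre Lc rho p" "u : Lc (topo rho) (val p)" "w = p @ u" by (rule LpsiE[OF assms])
 thus "w : lists A" using pre_facts[OF assms r(1)] chcD(2)[OF assms pre_facts(2)[OF assms r(1)] r(2)] by simp
qed

lemma Lpsi_onto: assumes "chc Lc" shows "val ` LP Lc = gcar"
proof (intro equalityI subsetI)
 fix x assume x: "x : gcar"
 obtain h g where h: "h : Cs (stk x (base Y))" "g : GV (base Y)" "x = h ** g" using Cs_entry[OF x base_in] by blast
 have e: "endv (stk x (base Y)) = base Y" using Fam_stk(2)[OF x base_in] .
 obtain p where p: "pre Lc (stk x (base Y)) p" "val p = h" using pre_ex[OF assms h(1)] by blast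
 obtain u where u: "u : Lc (topo (stk x (base Y))) h" "val u = g" using vlangD(3)[OF chcD(1)[OF assms h(1)]] h(2) e by (metis imageE)
 have "val (p @ u) = x" using p u h(3) pre_facts(1)[OF assms p(1)] chcD(2)[OF assms h(1) u(1)] by simp
 moreover have "p @ u : LP Lc" by (rule LpsiI[OF assms p(1)]) (use u p in simp)
 ultimately show "x : val ` LP Lc" by blast
next
 fix x assume "x : val ` LP Lc"
 thus "x : gcar" using Lpsi_lists[OF assms] val_closed by blast
qed

end

section \<open>Asynchronous fellow travelling of normal-form languages\<close>

context cgog
begin

definition FF :: "('v,'e,'g) pi1elt set" where "FF = (\<Union>x\<in>EO. Fs x)"

lemma finite_FF: "finite FF"
 by (simp add: FF_def finite_EO finite_Fs)

lemma FF_closed: "FF <= gcar"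
 using Fs_ops(4) by (auto simp: FF_def)

lemma Cs_diff_FF: "x : Cs rho ==> y : Cs rho ==> iv x ** y : FF"
 unfolding FF_def by (intro UN_I[of "topo rho"]) (simp_all add: CsD(4) Cs_diff)

text \<open>What uniform constants require of a choice of languages: finitely many of them, and
  compatibility along each entry coset. Deployments are not mentioned, so the notion also applies to
  unions of two choices.\<close>

definition ugood :: "('e option => ('v,'e,'g) pi1elt => 'a list set) => bool" where
 "ugood Lc \<longleftrightarrow> chc Lc & finite {Lc (topo rho) h | rho h. h : Cs rho} \<and>
   (\<forall>rho h h'. h : Cs rho --> h' : Cs rho --> fel (iv h ** h') (Lc (topo rho) h) (Lc (topo rho) h'))"

text \<open>Only finitely many triples of a difference in \<open>FF\<close> and two languages occur,
  so one finite set serves all entry cosets.\<close>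

lemma ugood_fel:
 assumes "ugood Lc" "finite D"
 obtains S where "finite S" "!!rho h h' u u'. h : Cs rho ==> h' : Cs rho ==> u : Lc (topo rho) h ==> u' : Lc (topo rho) h' ==>
  iv (val u) ** (iv h ** h' ** val u') : D ==> af S (iv h ** h') u u'"
proof -
 define R where "R = {Lc (topo rho) h | rho h. h : Cs rho}"
 define K where "K = {k : FF \<times> R \<times> R. fel (fst k) (fst (snd k)) (snd (snd k))}"
 have finR: "finite R" using assms(1) by (simp add: ugood_def R_def)
 have finK: "finite K" unfolding K_def using finite_FF finR by simp
 have "\<forall>k\<in>K. \<exists>S. finite S & (\<forall>u\<in>fst (snd k). \<forall>v\<in>snd (snd k). iv (val u) ** (fst k ** val v) : D --> af S (fst k) u v)"
  using assms(2) unfolding K_def fel_def by blast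
 then obtain T where T: "\<forall>k\<in>K. finite (T k) & (\<forall>u\<in>fst (snd k). \<forall>v\<in>snd (snd k). iv (val u) ** (fst k ** val v) : D --> af (T k) (fst k) u v)"
  by metis
 define S where "S = (\<Union>k\<in>K. T k)"
 have "finite S" unfolding S_def using finK T by simp
 moreover have "af S (iv h ** h') u u'" if a: "h : Cs rho" "h' : Cs rho" "u : Lc (topo rho) h" "u' : Lc (topo rho) h'"
  "iv (val u) ** (iv h ** h' ** val u') : D" for rho h h' u u'
 proof -
  have k: "(iv h ** h', Lc (topo rho) h, Lc (topo rho) h') : K"
   unfolding K_def R_def using Cs_diff_FF[OF a(1,2)] assms(1) a(1,2) by (auto simp: ugood_def)
  hence "af (T (iv h ** h', Lc (topo rho) h, Lc (topo rho) h')) (iv h ** h') u u'" using T a(3-5) by fastforce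
  thus ?thesis by (rule af_mono) (use k in \<open>auto simp: S_def\<close>)
 qed
 ultimately show ?thesis using that by blast
qed

lemma ugood_wander:
 assumes "ugood Lc" "finite D"
 obtains S where "finite S" "!!rho h u u1. h : Cs rho ==> u : Lc (topo rho) h ==> val u : D ==> prefix u1 u ==> val u1 : S"
proof -
 define R where "R = {Lc (topo rho) h | rho h. h : Cs rho}"
 have finR: "finite R" using assms(1) by (simp add: ugood_def R_def)
 have "\<exists>S. finite S & (\<forall>u\<in>M. \<forall>u1. val u : D --> prefix u1 u --> val u1 : S)" if M: "M : R" for M
 proof -
  obtain rho h where h: "h : Cs rho" "M = Lc (topo rho) h" using M by (auto simp: R_def)
  have "fel (iv h ** h) M M" using assms(1) h by (simp add: ugood_def)
  hence f: "fel gone M M" using CsD(1)[OF h(1)] by simp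
  have "chc Lc" using assms(1) by (simp add: ugood_def)
  hence "M <= lists A" using vlangD(2)[OF chcD(1)] h by blast
  thus ?thesis by (rule fel_finite_values[OF f _ assms(2)])
 qed
 then obtain T where T: "\<forall>M\<in>R. finite (T M) & (\<forall>u\<in>M. \<forall>u1. val u : D --> prefix u1 u --> val u1 : T M)" by metis
 have "finite (\<Union>M\<in>R. T M)" using T finR by simp
 moreover have "val u1 : (\<Union>M\<in>R. T M)" if "h : Cs rho" "u : Lc (topo rho) h" "val u : D" "prefix u1 u" for rho h u u1
  using that T by (intro UN_I[of "Lc (topo rho) h"]) (auto simp: R_def)
 ultimately show ?thesis using that by blast
qed

text \<open>Both prefixes pass the same entry cosets, where they differ by elements of finite edge
  groups. Vertex segments are handled by \<open>ugood_fel\<close> and edge letters by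
  \<open>af_box\<close>; as the difference is bounded anew at every edge, the set does not grow with
  the number of segments.\<close>

lemma pre_same:
 assumes "ugood Lc"
 obtains S where "finite S" "!!rho p p'. pre Lc rho p ==> pre Lc rho p' ==> af S gone p p'"
proof -
 have chc: "chc Lc" using assms by (simp add: ugood_def)
 \<comment> \<open>The differences just before the letter of \<open>E\<close>: its edge group, moved
   back across the edge.\<close>
 define D where "D = (\<Union>E\<in>edges Y. (%f. stab Y E ** f ** iv (stab Y E)) ` Fs (Some E))"
 have finD: "finite D" unfolding D_def using fin_edges finite_Fs by simp
 obtain S0 where S0: "finite S0" "!!rho h h' u u'. h : Cs rho ==> h' : Cs rho ==> u : Lc (topo rho) h ==> u' : Lc (topo rho) h' ==>
  iv (val u) ** (iv h ** h' ** val u') : D ==> af S0 (iv h ** h') u u'" using ugood_fel[OF assms finD] by blast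
 define T where "T = (\<Union>E\<in>edges Y. \<Union>d\<in>D. (%(a, b). iv (val a) ** (d ** val b)) ` (set (prefixes (tw E)) \<times> set (prefixes (tw E))))"
 have finT: "finite T" unfolding T_def using fin_edges finD by simp
 define S where "S = insert gone (S0 \<union> T)"
 have sub: "S0 <= S" "T <= S" by (auto simp: S_def)
 have "af S gone p p'" if "pre Lc rho p" "pre Lc rho p'" for rho p p'
  using that
 proof (induction arbitrary: p' rule: pre.induct)
  case pre_Nil
  from pre_Nil have "p' = []" by (cases rule: pre.cases) auto
  thus ?case by (auto intro!: af.af_Nil simp: S_def)
 next
  case (pre_Cons rho p u E s)
  from pre_Cons.prems obtain q v where q: "p' = q @ v @ tw E" "pre Lc rho q" "v : Lc (topo rho) (val q)"
   "val (q @ v @ tw E) : Cs ((s, E) # rho)" by (cases rule: pre_ConsE) auto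
  note P = pre_facts[OF chc pre_Cons(1)] and Q = pre_facts[OF chc q(2)]
  note u = chcD(2)[OF chc P(2) pre_Cons(2)] and v = chcD(2)[OF chc Q(2) q(3)]
  note E = tw_facts[OF pre_Cons(3)] stab_closed[OF pre_Cons(3)]
  note c = P(1) Q(1) u v E
  let ?d = "iv (val u) ** (iv (val p) ** val q ** val v)"
  have "iv (val (p @ u @ tw E)) ** val (q @ v @ tw E) : Fs (Some E)" using Cs_diff[OF pre_Cons(6) q(4)] by simp
  moreover have "iv (val (p @ u @ tw E)) ** val (q @ v @ tw E) = iv (stab Y E) ** ?d ** stab Y E"
   using c by (simp add: grp_simps)
  moreover have "?d = stab Y E ** (iv (stab Y E) ** ?d ** stab Y E) ** iv (stab Y E)" using c by (simp add: grp_simps)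
  ultimately have d: "?d : D" 
   unfolding D_def by (intro UN_I[OF pre_Cons(3)] image_eqI[of _ _ "iv (stab Y E) ** ?d ** stab Y E"]) simp_all
  have 1: "af S gone p q" by (rule pre_Cons.IH[OF q(2)])
  have "af S0 (iv (val p) ** val q) u v" by (rule S0(2)[OF P(2) Q(2) pre_Cons(2) q(3) d])
  hence "af S (iv (val p) ** (gone ** val q)) u v" using af_mono[OF _ sub(1)] c by simp
  from af_append[OF 1 this] have 2: "af S gone (p @ u) (q @ v)" .
  have "af T ?d (tw E) (tw E)"
  proof (rule af_box[OF E(1) E(1)])
   fix a b assume "prefix a (tw E)" "prefix b (tw E)"
   thus "iv (val a) ** (?d ** val b) : T" unfolding T_def
    by (intro UN_I[OF pre_Cons(3)] UN_I[OF d] image_eqI[of _ _ "(a, b)"]) auto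
  qed (use c in simp)
  moreover have "?d = iv (val (p @ u)) ** (gone ** val (q @ v))" using c by (simp add: grp_simps)
  ultimately have "af S (iv (val (p @ u)) ** (gone ** val (q @ v))) (tw E) (tw E)"
   using af_mono[OF _ sub(2)] by simp
  from af_append[OF 2 this] show ?case unfolding q(1) by simp
 qed
 moreover have "finite S" using S0(1) finT by (simp add: S_def)
 ultimately show ?thesis using that by blast
qed

text \<open>If positions just after an edge lie in \<open>D\<close>, those just before it lie in a
  translate by an inverse stable letter; the unit is there for the end of the word.\<close>

definition tailD :: "('v,'e,'g) pi1elt set => ('v,'e,'g) pi1elt set" where
 "tailD D = insert gone (D \<union> (\<Union>E\<in>edges Y. (%d. d ** iv (stab Y E)) ` D))"

text \<open>The possible values of a vertex segment leading from a position in \<open>D\<close> to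
  one in \<open>tailD D\<close>.\<close>

definition tailV :: "('v,'e,'g) pi1elt set => ('v,'e,'g) pi1elt set" where
 "tailV D = iv ` D ## tailD D"

lemma finite_tail: "finite D ==> finite (tailD D)" "finite D ==> finite (tailV D)"
 by (auto simp: tailD_def tailV_def fin_edges intro!: finite_set_mult)

text \<open>Closure under passing to the parent. The splitting argument thereby applies to all
  prefixes and also to the restricted prefixes built from cross-sections.\<close>

definition hered where
 "hered Lc Q \<longleftrightarrow> (\<forall>rho p. Q rho p --> pre Lc rho p) \<and>
   (\<forall>s E rho p. Q ((s, E) # rho) p --> (\<exists>p1 u1. Q rho p1 & u1 : Lc (topo rho) (val p1) & p = p1 @ u1 @ tw E))"

lemma heredD:
 assumes "hered Lc Q"
 shows "Q rho p ==> pre Lc rho p"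
  "Q ((s, E) # rho) p ==> \<exists>p1 u1. Q rho p1 & u1 : Lc (topo rho) (val p1) & p = p1 @ u1 @ tw E"
 using assms unfolding hered_def by blast+

lemma hered_pre: "hered Lc (pre Lc)"
 unfolding hered_def by (intro conjI allI impI, assumption, erule pre_ConsE) blast

definition LQ where
 "LQ Lc Q = {p @ u | p u. \<exists>rho. Q rho p & u : Lc (topo rho) (val p)}"

text \<open>The last clause bounds the length of \<open>r\<close> for languages in which a finite
  set of values allows only short words, as the synchronous argument requires.\<close>

definition tsplit where
 "tsplit Lc Q D S (tau :: ('g \<times> 'e) list) rhoc p u x pc uc r \<longleftrightarrow> p @ u = pc @ uc @ r & Q rhoc pc & uc : Lc (topo rhoc) (val pc) & r : lists A \<and>
    (\<forall>r1. prefix r1 r --> iv x ** val (pc @ uc @ r1) : S) \<and>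
    (\<forall>N. (\<forall>rho h u. h : Cs rho --> u : Lc (topo rho) h --> val u : tailV D --> length u <= N) --> length r <= length tau * (N + 1))"

text \<open>Beyond \<open>rhoc\<close> every entry coset on the way is close to \<open>x\<close>, so
  each segment of the rest joins two nearby positions and stays nearby in between by
  \<open>ugood_wander\<close>. Peeling one edge of \<open>tau\<close> per step also counts the
  segments for the length bound.\<close>

lemma tail_split:
 assumes ug: "ugood Lc" and her: "hered Lc Q" and D: "finite D" "D <= gcar"
 obtains S where "finite S" "S <= gcar"
  "!!tau rhoc p u x. Q (tau @ rhoc) p ==> u : Lc (topo (tau @ rhoc)) (val p) ==> x : gcar ==>
   (!!tau1 tau2 h. tau = tau1 @ tau2 ==> tau2 ~= [] ==> h : Cs (tau2 @ rhoc) ==> iv x ** h : D) ==>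
   iv x ** val (p @ u) : tailD D ==>
   \<exists>pc uc r. tsplit Lc Q D S tau rhoc p u x pc uc r"
proof -
 have chc: "chc Lc" using ug by (simp add: ugood_def)
 obtain S3 where S3: "finite S3" "!!rho h u u1. h : Cs rho ==> u : Lc (topo rho) h ==> val u : tailV D ==> prefix u1 u ==> val u1 : S3"
  using ugood_wander[OF ug finite_tail(2)[OF D(1)]] by blast
 define S where "S = (tailD D \<union> (D ## S3)) \<inter> gcar"
 have *: "\<exists>pc uc r. tsplit Lc Q D S tau rhoc p u x pc uc r"
  if "Q (tau @ rhoc) p" "u : Lc (topo (tau @ rhoc)) (val p)" "x : gcar"
   "!!tau1 tau2 h. tau = tau1 @ tau2 ==> tau2 ~= [] ==> h : Cs (tau2 @ rhoc) ==> iv x ** h : D"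
   "iv x ** val (p @ u) : tailD D" for tau rhoc p u x
  using that
 proof (induction tau arbitrary: p u)
  case Nil
  note P = pre_facts[OF chc heredD(1)[OF her Nil(1)]]
  have "u : lists A" using chcD(2)[OF chc P(2) Nil(2)] .
  hence "iv x ** val (p @ u) : S" using Nil(5) Nil(3) P by (simp add: S_def)
  hence "tsplit Lc Q D S [] rhoc p u x p u []" using Nil unfolding tsplit_def by auto
  thus ?case by blast
 next
  case (Cons a tau)
  obtain s E where a: "a = (s, E)" by (cases a)
  have Qp: "Q ((s, E) # tau @ rhoc) p" using Cons.prems(1) a by simp
  obtain p1 u1 where p1: "Q (tau @ rhoc) p1" "u1 : Lc (topo (tau @ rhoc)) (val p1)" "p = p1 @ u1 @ tw E"
   using heredD(2)[OF her Qp] by blast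
  note P = pre_facts[OF chc heredD(1)[OF her Cons.prems(1)]] and P1 = pre_facts[OF chc heredD(1)[OF her p1(1)]]
  have pC: "val p : Cs ((s, E) # tau @ rhoc)" using P(2) a by simp
  have p: "p = p1 @ u1 @ tw E" "Q (tau @ rhoc) p1" "u1 : Lc (topo (tau @ rhoc)) (val p1)"
   "E : edges Y" "val p : Cs (a # tau @ rhoc)" using p1 pC Cs_parent(1)[OF pC] a by auto
  note u = chcD(2)[OF chc P(2) Cons.prems(2)] and u1 = chcD(2)[OF chc P1(2) p(3)]
  note E = tw_facts[OF p(4)] stab_closed[OF p(4)]
  note x = Cons.prems(3)
  have hD: "iv x ** val p : D" using Cons.prems(4)[of "[]" "a # tau" "val p"] p(5) by simp
  have "iv x ** val (p1 @ u1) = iv x ** val p ** iv (stab Y E)" using p(1) P1(1) u1 E x by (simp add: grp_simps)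
  hence D1: "iv x ** val (p1 @ u1) : tailD D" unfolding tailD_def using hD p(4) by auto
  have IHp: "iv x ** h : D" if "tau = tau1 @ tau2" "tau2 ~= []" "h : Cs (tau2 @ rhoc)" for tau1 tau2 h
   using Cons.prems(4)[of "a # tau1" tau2 h] that by simp
  have "\<exists>pc uc r. tsplit Lc Q D S tau rhoc p1 u1 x pc uc r"
   by (rule Cons.IH[OF p(2,3) x _ D1]) (rule IHp; assumption)
  then obtain pc uc r where "tsplit Lc Q D S tau rhoc p1 u1 x pc uc r" by blast
  hence
   IH: "p1 @ u1 = pc @ uc @ r" "Q rhoc pc" "uc : Lc (topo rhoc) (val pc)" "r : lists A"
    "!!r1. prefix r1 r ==> iv x ** val (pc @ uc @ r1) : S"
    "\<forall>N. (\<forall>rho h u. h : Cs rho --> u : Lc (topo rho) h --> val u : tailV D --> length u <= N) --> length r <= length tau * (N + 1)"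
   unfolding tsplit_def by auto
  have "val u = iv (iv x ** val p) ** (iv x ** val (p @ u))" using P(1) u x by (simp add: grp_simps)
  hence uV: "val u : tailV D" 
   unfolding tailV_def using set_multI[OF imageI[OF hD, of "m_inv (pi1 Y)"] Cons.prems(5)] by simp
  have pp: "pc @ uc @ r @ tw E = p" using arg_cong[OF IH(1), of "%l. l @ tw E"] p(1) by simp
  have "iv x ** val (pc @ uc @ r1) : S" if pr: "prefix r1 (r @ tw E @ u)" for r1
  proof -
   consider "prefix r1 r" | t where "r1 = r @ t" "prefix t (tw E)" | u2 where "r1 = r @ tw E @ u2" "prefix u2 u"
    using pr by (auto simp: prefix_append)
   thus ?thesis
   proof cases
    case 1
    thus ?thesis by (rule IH(5))
   next
    case 2
    show ?thesis
    proof (cases "t = []")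
     case True
     thus ?thesis using IH(5)[of r] 2 by simp
    next
     case False
     hence "t = tw E" using 2 E(3) by (cases "tw E") (auto simp: prefix_Cons)
     hence "iv x ** val (pc @ uc @ r1) = iv x ** val p" using 2 pp by simp
     thus ?thesis using hD D(2) by (auto simp: S_def tailD_def)
    qed
   next
    case 3
    have u2: "u2 : lists A" using prefix_lists[OF 3(2) u] .
    have "pc @ uc @ r1 = p @ u2" using 3 pp by (metis append.assoc)
    hence e: "iv x ** val (pc @ uc @ r1) = iv x ** val p ** val u2" using P(1) u2 x by (simp add: G.m_assoc)
    have "val u2 : S3" by (rule S3(2)[OF P(2) Cons.prems(2) uV 3(2)])
    hence "iv x ** val p ** val u2 : D ## S3" using hD set_multI by blast
    thus ?thesis using e x P u2 by (simp add: S_def)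
   qed
  qed
  moreover have "length (r @ tw E @ u) <= length (a # tau) * (N + 1)"
   if N: "\<forall>rho h u. h : Cs rho --> u : Lc (topo rho) h --> val u : tailV D --> length u <= N" for N
  proof -
   have "length r <= length tau * (N + 1)" using IH(6) N by blast
   moreover have "length u <= N" using N P(2) Cons.prems(2) uV by blast
   ultimately show ?thesis using E(3) by simp
  qed
  moreover have "p @ u = pc @ uc @ r @ tw E @ u" using pp by (metis append.assoc)
  ultimately have "tsplit Lc Q D S (a # tau) rhoc p u x pc uc (r @ tw E @ u)" unfolding tsplit_def using IH(2,3,4) E(1) u by simp
  thus ?case by blast
 qed
 show ?thesis
 proof (rule that[of S])
  show "finite S" "S <= gcar"
   using finite_tail(1)[OF D(1)] finite_set_mult[OF D(1) S3(1)] by (simp_all add: S_def)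
  show "\<exists>pc uc r. tsplit Lc Q D S tau rhoc p u x pc uc r"
   if a: "Q (tau @ rhoc) p" "u : Lc (topo (tau @ rhoc)) (val p)" "x : gcar"
    "!!tau1 tau2 h. tau = tau1 @ tau2 ==> tau2 ~= [] ==> h : Cs (tau2 @ rhoc) ==> iv x ** h : D"
    "iv x ** val (p @ u) : tailD D" for tau rhoc p u x
   by (rule *[OF a(1-3) _ a(5)]) (rule a(4); assumption)
 qed
qed

text \<open>The two balls come from the letter joining the neighbours, seen from either end;
  \<open>FF\<close> moves within the entry coset that was met.\<close>

definition nearD :: "('v,'e,'g) pi1elt set" where
 "nearD = ((iv ` ball 1 ## ball 1) ## FF)"

lemma ball_closed: "ball n <= gcar"
 by (auto simp: ball_def)

lemma nearD: "finite nearD" "nearD <= gcar"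
 unfolding nearD_def using finite_FF finite_ball FF_closed ball_closed
 by (auto intro!: finite_set_mult simp: set_mult_def) blast+

text \<open>Two neighbouring elements \<open>x\<close>, \<open>x'\<close>: beyond the common part of their stacks all entry cosets
 contain \<open>x\<close> or \<open>x'\<close>, and there are boundedly many of them.\<close>

lemma near_split:
 assumes x: "x : gcar" and z: "z : lists A" "length z <= 1" and W: "W : verts Y" "W' : verts Y"
 obtains tau tau' rhoc where "stk x W = tau @ rhoc" "stk (x ** val z) W' = tau' @ rhoc"
  "!!tau1 tau2 h. tau = tau1 @ tau2 ==> tau2 ~= [] ==> h : Cs (tau2 @ rhoc) ==> iv x ** h : nearD"
  "!!tau1 tau2 h. tau' = tau1 @ tau2 ==> tau2 ~= [] ==> h : Cs (tau2 @ rhoc) ==> iv (x ** val z) ** h : nearD"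
  "length tau <= 2 * card (verts Y)" "length tau' <= 2 * card (verts Y)"
proof -
 obtain rhoc tau tau' where t: "stk x W = tau @ rhoc" "stk (x ** val z) W' = tau' @ rhoc" "tau = [] \<or> tau' = [] \<or> last tau ~= last tau'"
  using longest_common_suffix[of "stk x W" "stk (x ** val z) W'"] by blast
 have zb: "val z1 : ball 1" if "prefix z1 z" for z1
 proof -
  have "z1 : lists A" "length z1 <= 1" using that z prefix_lists[OF that] prefix_length_le[OF that] by auto
  thus ?thesis by (auto simp: ball_def)
 qed
 have hit: "\<exists>z1. prefix z1 z & x ** val z1 : Cs (tau2 @ rhoc)"
  if a: "(tau = tau1 @ tau2) \<or> (tau' = tau1 @ tau2)" "tau2 ~= []" for tau1 tau2
 proof -
  have n: "suffix (tau2 @ rhoc) (stk x W) ~= suffix (tau2 @ rhoc) (stk (x ** val z) W')"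
  proof -
   have *: "suffix (tau2 @ rhoc) (\<upsilon> @ rhoc) \<longleftrightarrow> suffix tau2 \<upsilon>" for \<upsilon> by simp
   have **: "suffix tau2 \<upsilon> ==> \<upsilon> ~= [] & last \<upsilon> = last tau2" for \<upsilon> using a(2) by (auto simp: suffix_def)
   show ?thesis unfolding t(1,2) * using a(1) t(3) **[of tau] **[of tau'] by (auto simp: suffix_def)
  qed
  obtain z1 z2 where "z = z1 @ z2" "x ** val z1 : Cs (tau2 @ rhoc)"
   using bottleneck[OF x z(1) W _ n] a(2) by auto
  thus ?thesis by (intro exI[of _ z1]) auto
 qed
 have one: "gone : iv ` ball 1" using zb[of "[]"] by (intro image_eqI[of _ _ gone]) auto
 have 1: "iv x ** h : nearD" if a: "tau = tau1 @ tau2" "tau2 ~= []" "h : Cs (tau2 @ rhoc)" for tau1 tau2 h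
 proof -
  obtain z1 where z1: "prefix z1 z" "x ** val z1 : Cs (tau2 @ rhoc)" using hit a by blast
  have "z1 : lists A" using prefix_lists[OF z1(1) z(1)] .
  hence "iv x ** h = gone ** val z1 ** (iv (x ** val z1) ** h)" using x CsD(1)[OF a(3)] by (simp add: grp_simps)
  thus ?thesis unfolding nearD_def
   using set_multI[OF set_multI[OF one zb[OF z1(1)]] Cs_diff_FF[OF z1(2) a(3)]] by simp
 qed
 have 2: "iv (x ** val z) ** h : nearD" if a: "tau' = tau1 @ tau2" "tau2 ~= []" "h : Cs (tau2 @ rhoc)" for tau1 tau2 h
 proof -
  obtain z1 where z1: "prefix z1 z" "x ** val z1 : Cs (tau2 @ rhoc)" using hit a by blast
  have "z1 : lists A" using prefix_lists[OF z1(1) z(1)] .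
  hence "iv (x ** val z) ** h = iv (val z) ** val z1 ** (iv (x ** val z1) ** h)" using x CsD(1)[OF a(3)] z by (simp add: grp_simps)
  thus ?thesis unfolding nearD_def
   using set_multI[OF set_multI[OF imageI[OF zb[of z], of "m_inv (pi1 Y)"] zb[OF z1(1)]] Cs_diff_FF[OF z1(2) a(3)]] by simp
 qed
 have len: "length \<upsilon> <= 2 * card (verts Y)" if u: "\<upsilon> = tau \<or> \<upsilon> = tau'" for \<upsilon>
 proof -
  \<comment> \<open>A stack beyond \<open>rhoc\<close> is the stack of one of the two elements at
    some vertex, and there are at most two of these for each vertex.\<close>
  let ?Z = "(%(y, V). stk y V) ` ({x, x ** val z} \<times> verts Y)"
  have "(%i. drop i \<upsilon> @ rhoc) ` {..<length \<upsilon>} <= ?Z"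
  proof
   fix \<sigma> assume "\<sigma> : (%i. drop i \<upsilon> @ rhoc) ` {..<length \<upsilon>}"
   then obtain i where i: "i < length \<upsilon>" "\<sigma> = drop i \<upsilon> @ rhoc" by auto
   obtain z1 where z1: "prefix z1 z" "x ** val z1 : Cs \<sigma>"
    using hit[of "take i \<upsilon>" "drop i \<upsilon>"] u i by auto
   have "z1 = [] \<or> z1 = z" using z1(1) z(2) by (cases z) (auto simp: prefix_Cons)
   hence "x ** val z1 : {x, x ** val z}" using x by auto
   moreover have "\<sigma> = stk (x ** val z1) (endv \<sigma>)" "endv \<sigma> : verts Y" using CsD(2,5)[OF z1(2)] by auto
   ultimately show "\<sigma> : ?Z" by force
  qed
  moreover have "inj_on (%i. drop i \<upsilon> @ rhoc) {..<length \<upsilon>}"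
   by (rule inj_onI) (metis append_same_eq diff_diff_cancel length_drop lessThan_iff less_imp_le_nat)
  moreover have fin: "finite ({x, x ** val z} \<times> verts Y)" using fin_verts by simp
  ultimately have "card {..<length \<upsilon>} <= card ?Z" by (intro card_inj_on_le) auto
  also have "\<dots> <= card ({x, x ** val z} \<times> verts Y)" by (rule card_image_le[OF fin])
  also have "\<dots> <= 2 * card (verts Y)" unfolding card_cartesian_product by (intro mult_le_mono1) (simp add: card_insert_if)
  finally show ?thesis by simp
 qed
 show ?thesis by (rule that[OF t(1,2) 1 2 len len]) auto
qed

lemma pre_stk:
 assumes "chc Lc" "pre Lc rho p" "u : Lc (topo rho) (val p)"
 shows "stk (val (p @ u)) (endv rho) = rho" "endv rho : verts Y" "p @ u : lists A"
proof -
 note p = pre_facts[OF assms(1,2)]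
 note u = chcD(2,4)[OF assms(1) p(2) assms(3)]
 show "endv rho : verts Y" "p @ u : lists A" using CsD(5)[OF p(2)] p u by auto
 show "stk (val (p @ u)) (endv rho) = rho"
  using stk_GV[OF _ CsD(5)[OF p(2)] u(2), of "val p"] CsD(2)[OF p(2)] p u by simp
qed

definition psplit where
 "psplit Lc Q S w w' rhoc p u r p' u' r' \<longleftrightarrow> w = p @ u @ r & w' = p' @ u' @ r' & Q rhoc p & Q rhoc p' \<and>
    u : Lc (topo rhoc) (val p) & u' : Lc (topo rhoc) (val p') & r : lists A & r' : lists A \<and>
    (\<forall>r1 r1'. prefix r1 r --> prefix r1' r' --> iv (val (p @ u @ r1)) ** val (p' @ u' @ r1') : S) \<and>
    (\<forall>N. (\<forall>rho h u. h : Cs rho --> u : Lc (topo rho) h --> val u : tailV nearD --> length u <= N) -->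
      length r <= 2 * card (verts Y) * (N + 1) & length r' <= 2 * card (verts Y) * (N + 1))"

text \<open>Both words are cut at the largest common part of their stacks: the prefixes reach the
  same stack, the middle segments belong to languages of one entry coset, and the rests stay near
  the common end.\<close>

lemma Lpsi_pair:
 assumes ug: "ugood Lc" and her: "hered Lc Q"
 obtains S where "finite S" "S <= gcar"
  "!!w w'. w : LQ Lc Q ==> w' : LQ Lc Q ==> iv (val w) ** val w' : ball 1 ==>
   \<exists>rhoc p u r p' u' r'. psplit Lc Q S w w' rhoc p u r p' u' r'"
proof -
 have chc: "chc Lc" using ug by (simp add: ugood_def)
 obtain S4 where S4: "finite S4" "S4 <= gcar" "!!tau rhoc p u x. Q (tau @ rhoc) p ==> u : Lc (topo (tau @ rhoc)) (val p) ==> x : gcar ==>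
   (!!tau1 tau2 h. tau = tau1 @ tau2 ==> tau2 ~= [] ==> h : Cs (tau2 @ rhoc) ==> iv x ** h : nearD) ==>
   iv x ** val (p @ u) : tailD nearD ==>
   \<exists>pc uc r. tsplit Lc Q nearD S4 tau rhoc p u x pc uc r"
  using tail_split[OF ug her nearD] by blast
 define S where "S = ((iv ` S4 ## ball 1) ## S4) \<inter> gcar"
 show ?thesis
 proof (rule that[of S])
  show "finite S" using S4(1) finite_ball by (auto simp: S_def intro!: finite_set_mult)
  show "S <= gcar" by (simp add: S_def)
  fix w w' assume w: "w : LQ Lc Q" "w' : LQ Lc Q" "iv (val w) ** val w' : ball 1"
  obtain rho q v where q: "Q rho q" "v : Lc (topo rho) (val q)" "w = q @ v" using w(1) unfolding LQ_def by blast
  obtain rho' q' v' where q': "Q rho' q'" "v' : Lc (topo rho') (val q')" "w' = q' @ v'" using w(2) unfolding LQ_def by blast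
  note s = pre_stk[OF chc heredD(1)[OF her q(1)] q(2), folded q(3)] and s' = pre_stk[OF chc heredD(1)[OF her q'(1)] q'(2), folded q'(3)]
  obtain z where z: "z : lists A" "length z <= 1" "val z = iv (val w) ** val w'" using ballD[OF w(3)] by blast
  have x: "val w : gcar" "val w' : gcar" using s s' by auto
  have x': "val w ** val z = val w'" using z(3) inv_cancel2[OF x] by simp
  obtain tau tau' rhoc where t: "rho = tau @ rhoc" "rho' = tau' @ rhoc"
   "!!tau1 tau2 h. tau = tau1 @ tau2 ==> tau2 ~= [] ==> h : Cs (tau2 @ rhoc) ==> iv (val w) ** h : nearD"
   "!!tau1 tau2 h. tau' = tau1 @ tau2 ==> tau2 ~= [] ==> h : Cs (tau2 @ rhoc) ==> iv (val w') ** h : nearD"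
   "length tau <= 2 * card (verts Y)" "length tau' <= 2 * card (verts Y)"
   by (rule near_split[OF x(1) z(1,2) s(2) s'(2), unfolded x' s(1) s'(1)]) blast
  have g: "gone : tailD nearD" by (simp add: tailD_def)
  obtain p u r where d: "w = p @ u @ r" "Q rhoc p" "u : Lc (topo rhoc) (val p)" "r : lists A"
   "!!r1. prefix r1 r ==> iv (val w) ** val (p @ u @ r1) : S4"
   "\<forall>N. (\<forall>rho h u. h : Cs rho --> u : Lc (topo rho) h --> val u : tailV nearD --> length u <= N) --> length r <= length tau * (N + 1)"
  proof -
   have "\<exists>pc uc r. tsplit Lc Q nearD S4 tau rhoc q v (val w) pc uc r"
    by (rule S4(3)[of tau rhoc q v "val w"]) (use q t(1,3) x(1) g in \<open>auto simp flip: q(3)\<close>)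
   thus ?thesis unfolding tsplit_def q(3)[symmetric] by (elim exE conjE) (rule that, auto)
  qed
  obtain p' u' r' where d': "w' = p' @ u' @ r'" "Q rhoc p'" "u' : Lc (topo rhoc) (val p')" "r' : lists A"
   "!!r1. prefix r1 r' ==> iv (val w') ** val (p' @ u' @ r1) : S4"
   "\<forall>N. (\<forall>rho h u. h : Cs rho --> u : Lc (topo rho) h --> val u : tailV nearD --> length u <= N) --> length r' <= length tau' * (N + 1)"
  proof -
   have "\<exists>pc uc r. tsplit Lc Q nearD S4 tau' rhoc q' v' (val w') pc uc r"
    by (rule S4(3)[of tau' rhoc q' v' "val w'"]) (use q' t(2,4) x(2) g in \<open>auto simp flip: q'(3)\<close>)
   thus ?thesis unfolding tsplit_def q'(3)[symmetric] by (elim exE conjE) (rule that, auto)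
  qed
  have B1: "iv (val (p @ u @ r1)) ** val (p' @ u' @ r1') : S" if pr: "prefix r1 r" "prefix r1' r'" for r1 r1'
  proof -
   have "p @ u @ r1 : lists A" "p' @ u' @ r1' : lists A"
    using s(3) s'(3) d(1) d'(1) prefix_lists[OF pr(1) d(4)] prefix_lists[OF pr(2) d'(4)] by auto
   hence c: "val (p @ u @ r1) : gcar" "val (p' @ u' @ r1') : gcar" using val_closed by blast+
   have "iv (val (p @ u @ r1)) ** val (p' @ u' @ r1') =
    iv (iv (val w) ** val (p @ u @ r1)) ** (iv (val w) ** val w') ** (iv (val w') ** val (p' @ u' @ r1'))"
    using c x by (simp add: grp_simps)
   moreover have "iv (iv (val w) ** val (p @ u @ r1)) : iv ` S4" using d(5)[OF pr(1)] by (rule imageI)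
   ultimately have "iv (val (p @ u @ r1)) ** val (p' @ u' @ r1') : (iv ` S4 ## ball 1) ## S4"
    using set_multI[OF set_multI[OF _ w(3)] d'(5)[OF pr(2)]] by simp
   thus ?thesis using c by (simp add: S_def)
  qed
  have B2: "length r <= 2 * card (verts Y) * (N + 1) & length r' <= 2 * card (verts Y) * (N + 1)"
   if "\<forall>rho h u. h : Cs rho --> u : Lc (topo rho) h --> val u : tailV nearD --> length u <= N" for N
  proof -
   have "length r <= length tau * (N + 1)" "length r' <= length tau' * (N + 1)" using d(6) d'(6) that by blast+
   thus ?thesis using mult_le_mono1[OF t(5), of "N + 1"] mult_le_mono1[OF t(6), of "N + 1"] by linarith
  qed
  have "psplit Lc Q S w w' rhoc p u r p' u' r'"
   unfolding psplit_def
   by (intro conjI allI impI)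
    (rule d(1-4) d'(1-4) | (rule B1, assumption, assumption) | (rule B2[THEN conjunct1], assumption) |
     (rule B2[THEN conjunct2], assumption))+
  thus "\<exists>rhoc p u r p' u' r'. psplit Lc Q S w w' rhoc p u r p' u' r'" by blast
 qed
qed

text \<open>The three parts given by \<open>Lpsi_pair\<close> are traversed one after the other, by
  \<open>pre_same\<close>, \<open>ugood_fel\<close> and \<open>af_box\<close>.\<close>

lemma Lpsi_apre: assumes ug: "ugood Lc" shows "apre (LP Lc)"
proof -
 have chc: "chc Lc" using ug by (simp add: ugood_def)
 obtain S where S: "finite S" "S <= gcar" "!!w w'. w : LP Lc ==> w' : LP Lc ==> iv (val w) ** val w' : ball 1 ==>
   \<exists>rhoc p u r p' u' r'. psplit Lc (pre Lc) S w w' rhoc p u r p' u' r'"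
  by (rule Lpsi_pair[OF ug hered_pre, unfolded LQ_def, folded Lpsi_eq[OF chc]], rule that, assumption, assumption, blast)
 obtain S1 where S1: "finite S1" "!!rho p p'. pre Lc rho p ==> pre Lc rho p' ==> af S1 gone p p'" using pre_same[OF ug] by blast
 obtain S2 where S2: "finite S2" "!!rho h h' u u'. h : Cs rho ==> h' : Cs rho ==> u : Lc (topo rho) h ==> u' : Lc (topo rho) h' ==>
  iv (val u) ** (iv h ** h' ** val u') : S ==> af S2 (iv h ** h') u u'" using ugood_fel[OF ug S(1)] by blast
 let ?T = "S \<union> S1 \<union> S2"
 have "af ?T gone w w'" if w: "w : LP Lc" "w' : LP Lc" "iv (val w) ** val w' : ball 1" for w w'
 proof -
  obtain rhoc p u r p' u' r' where "psplit Lc (pre Lc) S w w' rhoc p u r p' u' r'" using S(3)[OF w] by blast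
  hence d: "w = p @ u @ r" "w' = p' @ u' @ r'" "pre Lc rhoc p" "pre Lc rhoc p'"
    "u : Lc (topo rhoc) (val p)" "u' : Lc (topo rhoc) (val p')" "r : lists A" "r' : lists A"
    "!!r1 r1'. prefix r1 r ==> prefix r1' r' ==> iv (val (p @ u @ r1)) ** val (p' @ u' @ r1') : S"
   unfolding psplit_def by auto
  note P = pre_facts[OF chc d(3)] and P' = pre_facts[OF chc d(4)]
  note c = P(1) P'(1) chcD(2)[OF chc P(2) d(5)] chcD(2)[OF chc P'(2) d(6)] d(7,8)
  have 1: "af ?T gone p p'" by (rule af_mono[OF S1(2)[OF d(3,4)]]) auto
  have "iv (val u) ** (iv (val p) ** val p' ** val u') : S" using d(9)[of "[]" "[]"] c by (simp add: grp_simps)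
  hence "af S2 (iv (val p) ** val p') u u'" by (rule S2(2)[OF P(2) P'(2) d(5,6)])
  hence "af ?T (iv (val p) ** val p') u u'" by (rule af_mono) auto
  hence "af ?T (iv (val p) ** (gone ** val p')) u u'" using c by simp
  from af_append[OF 1 this] have 2: "af ?T gone (p @ u) (p' @ u')" .
  have "af S (iv (val (p @ u)) ** (gone ** val (p' @ u'))) r r'"
  proof (rule af_box[OF d(7,8)])
   fix r1 r1' assume pr: "prefix r1 r" "prefix r1' r'"
   have "r1 : lists A" "r1' : lists A" using prefix_lists[OF pr(1) d(7)] prefix_lists[OF pr(2) d(8)] by auto
   thus "iv (val r1) ** (iv (val (p @ u)) ** (gone ** val (p' @ u')) ** val r1') : S"
    using d(9)[OF pr] c by (simp add: grp_simps)
  qed (use c in simp)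
  hence "af ?T (iv (val (p @ u)) ** (gone ** val (p' @ u'))) r r'" by (rule af_mono) auto
  from af_append[OF 2 this] show ?thesis using d(1,2) by simp
 qed
 moreover have "finite ?T" using S S1 S2 by simp
 ultimately have "fel gone (LP Lc) (LP Lc)" by (intro fel_ball1I[OF Lpsi_lists[OF chc] Lpsi_onto[OF chc], of ?T])
 thus ?thesis using Lpsi_lists[OF chc] Lpsi_onto[OF chc] by (simp add: apre_def)
qed

lemma pre_mono: assumes "pre Lc rho p" "!!x h. Lc x h <= Lc' x h" shows "pre Lc' rho p"
 using assms(1) by (induction rule: pre.induct) (use assms(2) in \<open>auto intro!: pre.intros\<close>)

lemma Lpsi_mono: assumes "chc Lc" "chc Lc'" "!!x h. Lc x h <= Lc' x h" shows "LP Lc <= LP Lc'"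
proof
 fix w assume "w : LP Lc"
 then obtain rho p u where r: "pre Lc rho p" "u : Lc (topo rho) (val p)" "w = p @ u" by (rule LpsiE[OF assms(1)])
 have "u : Lc' (topo rho) (val p)" using r(2) assms(3) by blast
 thus "w : LP Lc'" unfolding r(3) by (rule LpsiI[OF assms(2) pre_mono[OF r(1) assms(3)]])
qed

text \<open>Restricts the comparison to words with two fixed prefixes of value \<open>h\<close> and
  deletes these prefixes; the vertex language at \<open>h\<close> is thus recovered, up to
  equivalence, from the global language.\<close>

lemma Lpsi_drop:
 assumes chc: "chc Lc" "chc Lc'" and f: "fel gone (LP Lc) (LP Lc')" and h: "h : Cs rho"
 shows "fel gone (Lc (topo rho) h) (Lc' (topo rho) h)"
proof -
 obtain p p' where p: "pre Lc rho p" "val p = h" "pre Lc' rho p'" "val p' = h" using pre_ex[OF chc(1) h] pre_ex[OF chc(2) h] by blast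
 note l = pre_facts(1)[OF chc(1) p(1)] pre_facts(1)[OF chc(2) p(3)]
 have hc: "h : gcar" using CsD(1)[OF h] .
 show ?thesis unfolding fel_def
 proof (intro allI impI)
  fix D :: "('v,'e,'g) pi1elt set" assume D: "finite D"
  obtain S where S: "finite S" "!!u v. u : LP Lc ==> v : LP Lc' ==> iv (val u) ** (gone ** val v) : D ==> af S gone u v"
   by (rule felE[OF f D]) auto
  let ?T = "(iv ` drop_set p ## S) ## drop_set p'"
  have "af ?T gone u v" if uv: "u : Lc (topo rho) h" "v : Lc' (topo rho) h" "iv (val u) ** (gone ** val v) : D" for u v
  proof -
   have m: "p @ u : LP Lc" "p' @ v : LP Lc'"
    using LpsiI[OF chc(1) p(1)] LpsiI[OF chc(2) p(3)] uv p by simp_all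
   have l2: "u : lists A" "v : lists A" using chcD(2)[OF chc(1) h uv(1)] chcD(2)[OF chc(2) h uv(2)] by auto
   have "iv (val (p @ u)) ** (gone ** val (p' @ v)) = iv (val u) ** (gone ** val v)"
    using l l2 p hc by (simp add: grp_simps)
   hence "af S gone (p @ u) (p' @ v)" using S(2)[OF m] uv(3) by simp
   from af_drop_prefixes[OF this] show ?thesis using p hc by simp
  qed
  moreover have "finite ?T" using S(1) by (simp add: finite_set_mult finite_drop_set)
  ultimately show "\<exists>S. finite S & (\<forall>u\<in>Lc (topo rho) h. \<forall>v\<in>Lc' (topo rho) h. iv (val u) ** (gone ** val v) : D --> af S gone u v)"
   by (intro exI[of _ ?T] conjI ballI impI)
 qed
qed

end

section \<open>Length bounds and cross-sections\<close>

lemma regular_conc: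
 assumes "regular_lang A L" "regular_lang A M"
 shows "regular_lang A {u @ v | u v. u : L & v : M}"
proof -
 define Lab where "Lab s s' = (if \<not> s & s' then L else {})" for s s' :: bool
 define Fin where "Fin s = (if s then M else {})" for s :: bool
 have "regular_lang A {w. (False, w) : paths Lab Fin UNIV}"
  by (rule regular_paths) (use assms in \<open>auto simp: Lab_def Fin_def\<close>)
 also have "{w. (False, w) : paths Lab Fin UNIV} = {u @ v | u v. u : L & v : M}"
 proof -
  have t: "(True, w) : paths Lab Fin UNIV \<longleftrightarrow> w : M" for w
   by (subst paths.simps) (auto simp: Lab_def Fin_def)
  have "(False, w) : paths Lab Fin UNIV \<longleftrightarrow> (\<exists>u v. w = u @ v & u : L & v : M)" for w
   by (subst paths.simps) (auto simp: Lab_def Fin_def t split: if_splits)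
  thus ?thesis by blast
 qed
 finally show ?thesis .
qed

lemma regular_single: assumes "y : lists A" shows "regular_lang A {y}"
proof -
 have "quot w {y} : insert {} ((%v. {v}) ` set (suffixes y))" for w
 proof (cases "prefix w y")
  case True
  then obtain v where "y = w @ v" by (auto simp: prefix_def)
  thus ?thesis by (auto simp: quot_def suffix_def)
 next
  case False
  hence "quot w {y} = {}" by (auto simp: quot_def)
  thus ?thesis by simp
 qed
 hence "(%w. quot w {y}) ` lists A <= insert {} ((%v. {v}) ` set (suffixes y))" by blast
 hence "finite ((%w. quot w {y}) ` lists A)" by (rule finite_subset) simp
 thus ?thesis using assms by (simp add: regular_iff)
qed

section \<open>Length control in synchronous languages\<close>

context alphabet_group
begin

definition nice :: "'a list set => bool" where
 "nice L \<longleftrightarrow> (\<forall>D. finite D --> (\<exists>N. \<forall>u\<in>L. \<forall>v\<in>L. inv (val u) \<otimes> val v : D --> length u <= length v + N))"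

text \<open>Interpolation as in \<open>chain\<close>, with a cost of at most \<open>N\<close>
  letters for each step of distance one.\<close>

lemma nice_chain:
 assumes onto: "val ` L = carrier G" and L: "L <= lists A"
  and base: "!!u v. u : L ==> v : L ==> inv (val u) \<otimes> val v : ball 1 ==> length u <= length v + N"
 shows "nice L"
 unfolding nice_def
proof (intro allI impI)
 fix D :: "'x set" assume D: "finite D"
 have *: "\<forall>u\<in>L. \<forall>v\<in>L. inv (val u) \<otimes> val v : ball n --> length u <= length v + (n + 1) * N" for n
 proof (induction n)
  case 0
  have "ball 0 <= ball 1" by (rule ball_mono) simp
  thus ?case using base by auto
 next
  case (Suc n)
  show ?case
  proof (intro ballI impI)
   fix u v assume uv: "u : L" "v : L" "inv (val u) \<otimes> val v : ball (Suc n)"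
   have l: "u : lists A" "v : lists A" using uv L by auto
   obtain z where z: "z : lists A" "length z <= Suc n" "val z = inv (val u) \<otimes> val v"
    using ballD[OF uv(3)] by blast
   let ?a = "take 1 z" and ?b = "drop 1 z"
   have ab: "?a : lists A" "?b : lists A" using z take_lists drop_lists by auto
   have "val u \<otimes> val ?a : carrier G" using l ab by simp
   then obtain w where w: "w : L" "val w = val u \<otimes> val ?a" using onto_ex[OF onto] by blast
   have wl: "w : lists A" using w L by blast
   have "inv (val u) \<otimes> val w = val ?a" using w l ab by (simp add: inv_cancel1)
   moreover have "val ?a : ball 1" using ab by (auto simp: ball_def)
   ultimately have 1: "length u <= length w + N" using base uv w by simp
   have "val v = val u \<otimes> val (?a @ ?b)" using z l by (simp add: inv_cancel2)
   hence "val v = val w \<otimes> val ?b" using w ab l by (simp del: append_take_drop_id add: grp_simps)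
   hence "inv (val w) \<otimes> val v = val ?b" using wl ab by (simp add: inv_cancel1)
   moreover have "val ?b : ball n" using ab z by (auto simp: ball_def)
   ultimately have "length w <= length v + (n + 1) * N" using Suc uv w by simp
   thus "length u <= length v + (Suc n + 1) * N" using 1 by simp
  qed
 qed
 obtain n where n: "D \<inter> carrier G <= ball n" using finite_sub_ball[of "D \<inter> carrier G"] D by auto
 have "length u <= length v + (n + 1) * N" if uv: "u : L" "v : L" "inv (val u) \<otimes> val v : D" for u v
 proof -
  have "inv (val u) \<otimes> val v : carrier G" using uv subsetD[OF L] by simp
  thus ?thesis using *[rule_format, OF uv(1,2)] n uv(3) by blast
 qed
 thus "\<exists>N. \<forall>u\<in>L. \<forall>v\<in>L. inv (val u) \<otimes> val v : D --> length u <= length v + N" by blast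
qed

text \<open>Deleting the words that contain a short loop, in the group and in the minimal automaton
 at the same time, bounds the time that a word can spend near a point.\<close>

lemma trim:
 assumes s: "sync_aut G A ev L"
 obtains L' where "L' <= L" "sync_aut G A ev L'" "nice L'"
proof -
 have L: "L <= lists A" "val ` L = carrier G" "sfel L" "regular_lang A L" using s by (auto simp: sync_aut_iff)
 obtain S where S: "finite S" "!!u v n. u : L ==> v : L ==> inv (val u) \<otimes> val v : ball 1 ==>
  inv (val (take n u)) \<otimes> val (take n v) : S" by (rule sfelE[OF L(3) finite_ball[of 1]]) auto
 define Q where "Q = (%w. quot w L) ` lists A"
 have Q: "finite Q" unfolding Q_def by (rule regular_finite_quots[OF L(4)])
 \<comment> \<open>The number of pairs of a state of the minimal automaton and a difference of
   positions; a word exceeding its neighbour by more than \<open>M\<close> letters has to repeat a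
   pair.\<close>
 define M where "M = card (Q \<times> S)"
 define Yw where "Yw = {y : lists A. y ~= [] & length y <= M & val y = \<one>}"
 have "finite {y. set y <= A & length y <= M}" by (rule finite_lists_length_le[OF finite_A])
 hence finY: "finite Yw" by (rule rev_finite_subset) (auto simp: Yw_def in_lists_conv_set)
 define pc where "pc q y = {u @ v | u v. u : {x : lists A. quot (x @ []) L = q} & v : {u @ v | u v. u : {y} & v : lists A}}" for q y
 define Bad where "Bad = (\<Union>k\<in>{k : Q \<times> Yw. quot (snd k) (fst k) = fst k}. pc (fst k) (snd k))"
 have regBad: "regular_lang A Bad"
  unfolding Bad_def
 proof (rule regular_UN)
  show "finite {k : Q \<times> Yw. quot (snd k) (fst k) = fst k}" using Q finY by simp
  fix k assume k: "k : {k : Q \<times> Yw. quot (snd k) (fst k) = fst k}"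
  hence "snd k : lists A" by (auto simp: Yw_def)
  thus "regular_lang A (pc (fst k) (snd k))" unfolding pc_def
   by (intro regular_conc regular_quot_eq[OF L(4)] regular_single regular_lists) simp_all
 qed
 have BadI: "x @ y @ z : Bad" if "x : lists A" "y : Yw" "z : lists A" "quot (x @ y) L = quot x L" for x y z
 proof -
  have "x @ y @ z : pc (quot x L) y" unfolding pc_def using that by auto
  thus ?thesis unfolding Bad_def
   using that by (intro UN_I[of "(quot x L, y)"]) (auto simp: Q_def quot_append)
 qed
 have BadD: "\<exists>x y z. w = x @ y @ z & x : lists A & y : Yw & z : lists A & quot (x @ y) L = quot x L" if "w : Bad" for w
  using that unfolding Bad_def pc_def by (auto simp: quot_append)
 define L' where "L' = L - Bad"
 have sub: "L' <= L" by (auto simp: L'_def)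
 have L'A: "L' <= lists A" using sub L by auto
 have onto: "val ` L' = carrier G"
 proof
  show "val ` L' <= carrier G" using L'A by auto
  show "carrier G <= val ` L'"
  proof
   fix g assume "g : carrier G"
   hence "\<exists>w. w : L & val w = g" using onto_ex[OF L(2)] by blast
   from exists_least_lemma[of "%n. \<exists>w. w : L & val w = g & length w = n"]
   obtain w where w: "w : L" "val w = g" and min: "!!w'. w' : L ==> val w' = g ==> length w <= length w'"
    using ex_has_least_nat[of "%w. w : L & val w = g" _ length] \<open>\<exists>w. w : L & val w = g\<close> by blast
   \<comment> \<open>A shortest word with value \<open>g\<close> contains no such loop, because
     removing one preserves membership in \<open>L\<close> as well as the value.\<close>
   have "w \<notin> Bad"
   proof
    assume "w : Bad"
    then obtain x y z where d: "w = x @ y @ z" "x : lists A" "y : Yw" "z : lists A" "quot (x @ y) L = quot x L"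
     using BadD by blast
    have "z : quot x L" using w(1) d by (auto simp: quot_iff simp flip: d(5))
    hence "x @ z : L" by (simp add: quot_iff)
    moreover have "val (x @ z) = g" using w d by (auto simp: Yw_def)
    ultimately have "length w <= length (x @ z)" using min by blast
    thus False using d by (auto simp: Yw_def)
   qed
   thus "g : val ` L'" using w by (auto simp: L'_def)
  qed
 qed
 have sfel': "sfel L'" unfolding sfel_def
 proof (intro allI impI)
  fix D :: "'x set" assume D: "finite D"
  obtain S where "finite S" "!!u v n. u : L ==> v : L ==> inv (val u) \<otimes> val v : D ==>
   inv (val (take n u)) \<otimes> val (take n v) : S" by (rule sfelE[OF L(3) D]) auto
  thus "\<exists>S. finite S & (\<forall>u\<in>L'. \<forall>v\<in>L'. inv (val u) \<otimes> val v : D --> (\<forall>n. inv (val (take n u)) \<otimes> val (take n v) : S))"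
   using sub by (intro exI[of _ S]) auto
 qed
 have len: "length u <= length v + M" if uv: "u : L'" "v : L'" "inv (val u) \<otimes> val v : ball 1" for u v
 proof (rule ccontr)
  assume "\<not> length u <= length v + M"
  hence long: "length v + M < length u" by simp
  have l: "u : lists A" "v : lists A" "u : L" "v : L" using uv L'A sub by auto
  \<comment> \<open>Past the end of \<open>v\<close> only the position on \<open>u\<close> changes,
    so equal pairs at two times enclose a subword of trivial value that is a loop of the
    automaton.\<close>
  define st where "st n = (quot (take n u) L, inv (val (take n u)) \<otimes> val v)" for n
  have "st ` {length v..length v + M} <= Q \<times> S"
  proof
   fix p assume "p : st ` {length v..length v + M}"
   then obtain n where n: "length v <= n" "p = st n" by auto
   have "inv (val (take n u)) \<otimes> val (take n v) : S" by (rule S(2)[OF l(3,4) uv(3)])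
   thus "p : Q \<times> S" using n take_lists[OF l(1)] by (auto simp: st_def Q_def)
  qed
  moreover have "finite (Q \<times> S)" using Q S by simp
  ultimately have "card (st ` {length v..length v + M}) <= M" unfolding M_def by (intro card_mono)
  hence "card (st ` {length v..length v + M}) < card {length v..length v + M}" by simp
  hence "\<not> inj_on st {length v..length v + M}" by (rule pigeonhole)
  then obtain i j where ij: "length v <= i" "i < j" "j <= length v + M" "st i = st j"
   unfolding inj_on_def by (metis atLeastAtMost_iff linorder_neqE_nat)
  define x y z where "x = take i u" and "y = take (j - i) (drop i u)" and "z = drop j u"
  have xy: "x @ y = take j u" unfolding x_def y_def using ij take_add[of i "j - i" u] by simp
  have w: "u = x @ y @ z" using xy by (metis append.assoc append_take_drop_id z_def)
  have c: "x : lists A" "y : lists A" "z : lists A" using l(1) w by auto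
  have q: "quot (x @ y) L = quot x L" using ij(4) xy by (simp add: st_def x_def)
  have "inv (val x) \<otimes> val v = inv (val (x @ y)) \<otimes> val v" using ij(4) xy by (simp add: st_def x_def)
  hence "inv (val x) = inv (val (x @ y))" using c l by (metis append_in_lists_conv inv_closed r_cancel val_closed)
  hence "val x \<otimes> \<one> = val x \<otimes> val y" using c by (metis append_in_lists_conv inv_inv r_one val_append val_closed)
  hence "val y = \<one>" using c by (metis l_cancel one_closed val_closed)
  moreover have "length y = j - i" unfolding y_def using ij long by simp
  ultimately have "y : Yw" using c ij by (auto simp: Yw_def)
  hence "u : Bad" using BadI[OF c(1) _ c(3) q] w by blast
  thus False using uv by (simp add: L'_def)
 qed
 have "sync_aut G A ev L'" unfolding sync_aut_iff using L'A onto sfel' regular_Diff[OF L(4) regBad] by (simp add: L'_def)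
 thus ?thesis using that sub nice_chain[OF onto L'A len] by blast
qed

end

context lettered_group
begin

text \<open>The shortlex-least word of every coset; the comparison is made by a synchronous automaton
 reading both words, the shorter one padded by blanks.\<close>

lemma cross_section:
 assumes L: "regular_lang B L" and B: "B <= A" and sf: "sfel L" and F: "subgroup F G" "finite F"
 obtains C where "C <= L" "regular_lang B C" "!!u. u : L ==> \<exists>u'\<in>C. inv (val u) \<otimes> val u' : F"
  "!!u u'. u : C ==> u' : C ==> inv (val u) \<otimes> val u' : F ==> u = u'"
proof -
 have LB: "L <= lists B" using regular_subset[OF L] .
 have finB: "finite B" using finite_A B finite_subset by blast
 obtain f :: "'a => nat" where f: "inj_on f B" using finite_imp_inj_to_nat_seg[OF finB] by blast
 have LA: "u : lists A" if "u : L" for u using that LB lists_mono[OF B] by blast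
 define lt where "lt u v \<longleftrightarrow> (map f u, map f v) : lenlex less_than" for u v
 obtain S where S: "finite S" "!!u v n. u : L ==> v : L ==> inv (val u) \<otimes> val v : F ==>
  inv (val (take n u)) \<otimes> val (take n v) : S" by (rule sfelE[OF sf F(2)]) auto
 \<comment> \<open>Each letter pairs a letter of the word, which \<open>\<beta>\<close> outputs,
   with a letter of the competing word, which \<open>\<alpha>\<close> reads; \<open>None\<close> is
   the blank after its end.\<close>
 define P where "P = B \<times> (insert None (Some ` B))"
 define \<alpha> :: "'a \<times> 'a option => 'a list" where "\<alpha> = (%(a, b). case b of None => [] | Some c => [c])"
 define \<beta> :: "'a \<times> 'a option => 'a list" where "\<beta> = (%(a, b). [a])"
 define st1 where "st1 = (%d (a, b). inv (ev a) \<otimes> (d \<otimes> val (\<alpha> (a, b))))"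
 \<comment> \<open>States: 0 for equal so far, 1 for a smaller and 2 for a larger competitor, 3 once
   a blank has shown it to be shorter. Acceptance in 1 and 3 means that the competitor precedes the
   word.\<close>
 define st2 where "st2 = (%(n::nat) (a, b). if n = 3 then 3 else case b of None => 3 | Some c =>
   if n = 0 then (if f c < f a then 1 else if f c = f a then 0 else 2) else n)"
 define Z where "Z = {z : lists P. walk st1 (S \<inter> carrier G) F \<one> z} \<inter> {z : lists P. walk st2 {..3} {1, 3} 0 z}"
 define R where "R = {concat (map \<beta> z) | z. z : lists P & concat (map \<alpha> z) : L & z : Z}"
 have finP: "finite P" using finB by (simp add: P_def)
 have regR: "regular_lang B R" unfolding R_def
 proof (rule regular_transduction[OF L finP])
  show "regular_lang P Z" unfolding Z_def by (intro regular_Int regular_walk) (use S in auto)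
 qed (auto simp: P_def \<alpha>_def \<beta>_def)
 have \<alpha>A: "\<alpha> p : lists A" if "p : P" for p using that B by (auto simp: P_def \<alpha>_def)
 have w1: "walk st1 (S \<inter> carrier G) F d z ==> inv (val (map fst z)) \<otimes> (d \<otimes> val (concat (map \<alpha> z))) : F" if "z : lists P" for z d
  using that
 proof (induction z arbitrary: d rule: list.induct)
  case Nil
  thus ?case by simp
 next
  case (Cons p z)
  obtain a b where p: "p = (a, b)" by (cases p)
  have d: "d : carrier G" using Cons.prems by simp
  have a: "a : A" "p : P" "z : lists P" using Cons.prems p B by (auto simp: P_def)
  have zA: "map fst z : lists A" "concat (map \<alpha> z) : lists A"
   using a(3) B \<alpha>A by (induction z rule: list.induct) (auto simp: P_def)
  have "inv (val (map fst z)) \<otimes> ((inv (ev a) \<otimes> (d \<otimes> val (\<alpha> p))) \<otimes> val (concat (map \<alpha> z))) : F"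
   using Cons.IH[of "st1 d p"] Cons.prems p a by (simp add: st1_def)
  thus ?case using d a zA \<alpha>A[OF a(2)] p by (simp add: grp_simps)
 qed
 have st2_3: "walk st2 {..3} {1, 3} 3 z" for z
  by (induction z) (auto simp: st2_def)
 have st2_1: "walk st2 {..3} {1, 3} 1 z" for z
  using st2_3 by (induction z) (auto simp: st2_def split: option.splits)
 have st2_2: "walk st2 {..3} {1, 3} 2 z \<longleftrightarrow> None : snd ` set z" for z
  using st2_3 by (induction z) (auto simp: st2_def split: option.splits)
 have w2: "walk st2 {..3} {1, 3} 0 z \<longleftrightarrow> None : snd ` set z \<or> (map (f \<circ> the \<circ> snd) z, map (f \<circ> fst) z) : lex less_than" for z
 proof (induction z)
  case (Cons p z)
  obtain a b where p: "p = (a, b)" by (cases p)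
  show ?case
  proof (cases b)
   case None
   thus ?thesis using st2_3 p by (simp add: st2_def)
  next
   case (Some c)
   thus ?thesis using p Cons st2_1 st2_2 by (auto simp: st2_def)
  qed
 qed simp
 have len_a: "length (concat (map \<alpha> z)) <= length z & (None : snd ` set z --> length (concat (map \<alpha> z)) < length z) \<and>
  (None \<notin> snd ` set z --> concat (map \<alpha> z) = map (the \<circ> snd) z)" for z
  by (induction z) (auto simp: \<alpha>_def split: option.splits)
 have R_eq: "L \<inter> R = {u : L. \<exists>u'\<in>L. lt u' u & inv (val u) \<otimes> val u' : F}"
 proof (intro equalityI subsetI)
  fix u assume u: "u : L \<inter> R"
  then obtain z where z: "u = concat (map \<beta> z)" "z : lists P" "concat (map \<alpha> z) : L" "z : Z" by (auto simp: R_def)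
  have uz: "u = map fst z" unfolding z(1) by (induction z) (auto simp: \<beta>_def)
  have "inv (val u) \<otimes> (\<one> \<otimes> val (concat (map \<alpha> z))) : F" using w1[OF z(2)] z(4) uz by (simp add: Z_def)
  hence "inv (val u) \<otimes> val (concat (map \<alpha> z)) : F" using LA[OF z(3)] by simp
  moreover have "lt (concat (map \<alpha> z)) u"
  proof (cases "None : snd ` set z")
   case True
   thus ?thesis using len_a[of z] uz by (simp add: lt_def lenlex_conv)
  next
   case False
   hence "(map (f \<circ> the \<circ> snd) z, map (f \<circ> fst) z) : lex less_than" using w2[of z] z(4) by (simp add: Z_def)
   moreover have "concat (map \<alpha> z) = map (the \<circ> snd) z" using len_a[of z] False by blast
   ultimately show ?thesis using uz by (simp add: lt_def lenlex_conv comp_assoc)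
  qed
  ultimately show "u : {u : L. \<exists>u'\<in>L. lt u' u & inv (val u) \<otimes> val u' : F}" using u z(3) by blast
 next
  fix u assume "u : {u : L. \<exists>u'\<in>L. lt u' u & inv (val u) \<otimes> val u' : F}"
  then obtain u' where u: "u : L" "u' : L" "lt u' u" "inv (val u) \<otimes> val u' : F" by blast
  have len: "length u' <= length u" using u(3) by (auto simp: lt_def lenlex_conv)
  define z where "z = zip u (map Some u' @ replicate (length u - length u') None)"
  have fz: "map fst z = u" using len by (simp add: z_def)
  have sz: "map snd z = map Some u' @ replicate (length u - length u') None" using len by (simp add: z_def)
  have \<alpha>s: "concat (map \<alpha> z) = concat (map (%b. case b of None => [] | Some c => [c]) (map snd z))" for z
   by (induction z) (auto simp: \<alpha>_def)
  have c1: "concat (map (%b. case b of None => [] | Some c => [c]) (map Some w @ replicate n None)) = w" for w :: "'a list" and n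
  proof -
   have "concat (map (%b. case b of None => [] | Some c => [c]) (replicate n None)) = ([] :: 'a list)" by (induction n) auto
   moreover have "concat (map (%b. case b of None => [] | Some c => [c]) (map Some w)) = w" by (induction w) auto
   ultimately show ?thesis by simp
  qed
  have az: "concat (map \<alpha> z) = u'" unfolding \<alpha>s sz by (rule c1)
  have zP: "z : lists P"
  proof -
   have "set u <= B" "set u' <= B" using u LB by (auto simp: in_lists_conv_set)
   hence "set (map fst z) <= B" "set (map snd z) <= insert None (Some ` B)"
    unfolding fz sz by (auto simp: set_replicate_conv_if)
   moreover have "set z <= set (map fst z) \<times> set (map snd z)" by force
   ultimately have "set z <= P" unfolding P_def by (meson Sigma_mono order_trans)
   thus ?thesis by (auto simp: in_lists_conv_set)
  qed
  have walk1: "walk st1 (S \<inter> carrier G) F d z"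
   if "z : lists P" "d : carrier G" "!!n. inv (val (map fst (take n z))) \<otimes> (d \<otimes> val (concat (map \<alpha> (take n z)))) : S"
    "inv (val (map fst z)) \<otimes> (d \<otimes> val (concat (map \<alpha> z))) : F" for z d
   using that
  proof (induction z arbitrary: d rule: list.induct)
   case Nil
   thus ?case using Nil.prems(3)[of 0] by simp
  next
   case (Cons p z)
   obtain a b where p: "p = (a, b)" by (cases p)
   have a: "a : A" "p : P" "z : lists P" using Cons.prems p B by (auto simp: P_def)
   have zA: "map fst z : lists A" "concat (map \<alpha> z) : lists A" if "z : lists P" for z
    using that B \<alpha>A by (induction z rule: list.induct) (auto simp: P_def)
   have tP: "take n z : lists P" for n using a(3) by (metis append_in_lists_conv append_take_drop_id)
   have s1: "st1 d p = inv (ev a) \<otimes> (d \<otimes> val (\<alpha> p))" by (simp add: st1_def p)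
   have "walk st1 (S \<inter> carrier G) F (st1 d p) z"
   proof (rule Cons.IH[OF a(3)])
    show "st1 d p : carrier G" unfolding s1 using a \<alpha>A Cons.prems by simp
    show "inv (val (map fst (take n z))) \<otimes> (st1 d p \<otimes> val (concat (map \<alpha> (take n z)))) : S" for n
     using Cons.prems(3)[of "Suc n"] zA[OF tP, of n] a \<alpha>A[OF a(2)] Cons.prems(2) unfolding s1 by (simp add: p grp_simps)
    show "inv (val (map fst z)) \<otimes> (st1 d p \<otimes> val (concat (map \<alpha> z))) : F"
     using Cons.prems(4) zA[OF a(3)] a \<alpha>A[OF a(2)] Cons.prems(2) unfolding s1 by (simp add: p grp_simps)
   qed
   thus ?case using Cons.prems(3)[of 0] Cons.prems(2) by simp
  qed
  have "walk st1 (S \<inter> carrier G) F \<one> z"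
  proof (rule walk1[OF zP one_closed])
   fix n
   have "map snd (take n z) = take n (map Some u') @ take (n - length u') (replicate (length u - length u') None)"
    by (simp add: take_map[symmetric] sz)
   hence t: "map snd (take n z) = map Some (take n u') @ replicate (min (n - length u') (length u - length u')) None"
    by (simp add: take_map)
   have "concat (map \<alpha> (take n z)) = take n u'" unfolding \<alpha>s t by (rule c1)
   moreover have "map fst (take n z) = take n u" using fz by (simp add: take_map[symmetric])
   ultimately show "inv (val (map fst (take n z))) \<otimes> (\<one> \<otimes> val (concat (map \<alpha> (take n z)))) : S"
    using S(2)[OF u(1,2,4), of n] take_lists[OF LA[OF u(2)]] by simp
  next
   show "inv (val (map fst z)) \<otimes> (\<one> \<otimes> val (concat (map \<alpha> z))) : F" using u(4) fz az LA[OF u(2)] by simp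
  qed
  moreover have "walk st2 {..3} {1, 3} 0 z" unfolding w2
  proof (cases "length u' = length u")
   case True
   hence "(map f u', map f u) : lex less_than" using u(3) by (simp add: lt_def lenlex_conv)
   moreover have "map (f \<circ> the \<circ> snd) z = map (f \<circ> the) (map snd z)" "map (f \<circ> fst) z = map f (map fst z)" by simp_all
   hence "map (f \<circ> the \<circ> snd) z = map f u'" "map (f \<circ> fst) z = map f u" unfolding sz fz using True by simp_all
   ultimately show "None : snd ` set z \<or> (map (f \<circ> the \<circ> snd) z, map (f \<circ> fst) z) : lex less_than" by simp
  next
   case False
   hence "None : set (map snd z)" unfolding sz using len by simp
   thus "None : snd ` set z \<or> (map (f \<circ> the \<circ> snd) z, map (f \<circ> fst) z) : lex less_than" by simp
  qed
  ultimately have "z : Z" using zP by (simp add: Z_def)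
  moreover have "u = concat (map \<beta> z)" unfolding fz[symmetric] by (induction z) (auto simp: \<beta>_def)
  ultimately have "u : R" unfolding R_def using zP az u(2) by blast
  thus "u : L \<inter> R" using u by blast
 qed
 define C where "C = L - (L \<inter> R)"
 have C_eq: "u : C \<longleftrightarrow> u : L & (\<forall>u'\<in>L. inv (val u) \<otimes> val u' : F --> \<not> lt u' u)" for u
  unfolding C_def R_eq by blast
 have wf: "wf {(u, v). lt u v}"
 proof -
  have "{(u, v). lt u v} = inv_image (lenlex less_than) (map f)" by (auto simp: lt_def)
  thus ?thesis using wf_lenlex[OF wf_less_than] by simp
 qed
 show ?thesis
 proof (rule that[of C])
  show "C <= L" by (auto simp: C_def)
  show "regular_lang B C" unfolding C_def by (intro regular_Diff regular_Int L regR)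
  show "\<exists>u'\<in>C. inv (val u) \<otimes> val u' : F" if u: "u : L" for u
  proof -
   let ?K = "{u' : L. inv (val u) \<otimes> val u' : F}"
   have "u : ?K" using u LA[OF u] subgroup.one_closed[OF F(1)] by simp
   then obtain m where m: "m : ?K" "\<forall>v. lt v m --> v \<notin> ?K"
    using wf[unfolded wf_eq_minimal, rule_format, of u ?K] by (auto simp del: mem_Collect_eq simp: mem_Collect_eq[of _ "%(u, v). lt u v"])
   have "m : C" unfolding C_eq
   proof (intro conjI ballI impI)
    show "m : L" using m by simp
    fix v assume v: "v : L" "inv (val m) \<otimes> val v : F"
    have "inv (val u) \<otimes> val v = (inv (val u) \<otimes> val m) \<otimes> (inv (val m) \<otimes> val v)"
     using LA[OF u] LA[OF v(1)] LA[of m] m(1) by (simp add: grp_simps)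
    hence "v : ?K" using m(1) v subgroup.m_closed[OF F(1)] by simp
    thus "\<not> lt v m" using m(2) by blast
   qed
   thus ?thesis using m(1) by blast
  qed
  show "u = u'" if a: "u : C" "u' : C" "inv (val u) \<otimes> val u' : F" for u u'
  proof -
   have l: "u : L" "u' : L" using a by (auto simp: C_eq)
   have "inv (val u') \<otimes> val u = inv (inv (val u) \<otimes> val u')" using LA[OF l(1)] LA[OF l(2)] by (simp add: grp_simps)
   hence "inv (val u') \<otimes> val u : F" using subgroup.m_inv_closed[OF F(1) a(3)] by simp
   hence n: "\<not> lt u u'" "\<not> lt u' u" using a l C_eq by blast+
   have "total (lenlex less_than)" by (rule total_lenlex) (rule total_less_than)
   hence "map f u = map f u'" using n unfolding lt_def total_on_def by blast
   moreover have "set u <= B" "set u' <= B" using l LB by (auto simp: in_lists_conv_set)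
   ultimately show ?thesis using inj_on_map_eq_map[of f u u'] inj_on_subset[OF f, of "set u \<union> set u'"] by simp
  qed
 qed
qed

end

section \<open>Deployments and their languages\<close>

context lettered_group
begin

lemma af_end: "af S x u v ==> inv (val u) \<otimes> (x \<otimes> val v) : S"
proof (induction rule: af.induct)
 case (af_left x a u v)
 thus ?case using afD[OF af_left(4)] by (simp add: grp_simps)
next
 case (af_right x a u v)
 thus ?case using afD[OF af_right(4)] by (simp add: grp_simps)
qed simp

end

context cgog
begin

lemma dep_class: assumes "deployment Y A ev \<psi>" "h : Cs rho" shows "\<psi> (topo rho) h : VCl (endv rho)"
proof -
 have "(topo rho, h) : deploy_dom Y" using assms(2) deploy_dom_iff by blast
 hence "\<psi> (topo rho) h : AClasses (VG (dtv Y (topo rho))) (VA (dtv Y (topo rho))) (vev Y ev (dtv Y (topo rho)))"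
  using assms(1) unfolding deployment_def by fast
 thus ?thesis by simp
qed

text \<open>The equivariance condition of a deployment in the form given by
  \<open>V_act_iff\<close>. On the empty stack the entry coset is a point, and both languages lie in
  one class.\<close>

lemma dep_fel:
 assumes d: "deployment Y A ev \<psi>" and h: "h : Cs rho" "h' : Cs rho" and L: "L : \<psi> (topo rho) h" "L' : \<psi> (topo rho) h'"
 shows "fel (iv h ** h') L L'"
proof (cases rho)
 case Nil
 hence e: "h = gone" "h' = gone" using h by (auto simp: Cs_Nil)
 note V = CsD(5)[OF h(1)]
 note c = V_class[OF V dep_class[OF d h(1)] L(1)]
 have "L' : vcls (endv rho) L" using c(4) L(2) e by simp
 hence "fel gone L L'" using V_vcls_iff[OF V c(1,3)] by blast
 thus ?thesis using e by simp
next
 case (Cons a rho')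
 then obtain s E where r: "rho = (s, E) # rho'" by (cases a) auto
 note V = CsD(5)[OF h(1)]
 have E: "E : edges Y" using CsD(4)[OF h(1)] r by simp
 have "iv h ** h' : Fs (Some E)" using Cs_diff[OF h] r by simp
 then obtain f where f: "f : FG E" "iv h ** h' = vincl Y (etgt Y E) (bd1 Y E f)" by (auto simp: Fs_def Fb_def)
 hence h': "h' = h ** vincl Y (etgt Y E) (bd1 Y E f)" using inv_cancel2[OF CsD(1)[OF h(1)] CsD(1)[OF h(2)]] by simp
 have hG: "h : Gcal Y E" using h(1) r Gcal_iff by blast
 have "\<forall>E\<in>edges Y. \<forall>h\<in>Gcal Y E. \<forall>f\<in>carrier (egrp Y E).
    \<psi> (Some E) h = act_class (VG (etgt Y E)) (VA (etgt Y E)) (vev Y ev (etgt Y E))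
     (bd1 Y E f) (\<psi> (Some E) (h ** vincl Y (etgt Y E) (bd1 Y E f)))"
  using d unfolding deployment_def by fast
 hence "\<psi> (Some E) h = act_class (VG (etgt Y E)) (VA (etgt Y E)) (vev Y ev (etgt Y E)) (bd1 Y E f) (\<psi> (Some E) h')"
  using E hG f(1) h' by simp
 moreover have "\<psi> (Some E) h : VCl (etgt Y E)" "\<psi> (Some E) h' : VCl (etgt Y E)"
  using dep_class[OF d h(1)] dep_class[OF d h(2)] r by simp_all
 ultimately have "fel (vincl Y (etgt Y E) (bd1 Y E f)) L L'"
  using V_act_iff[OF tgt_in[OF E] _ _ _ _ bd1_closed[OF E f(1)], of "\<psi> (Some E) h" L "\<psi> (Some E) h'" L'] L r by simp
 thus ?thesis using f(2) by simp
qed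

definition choice :: "('e option => ('v,'e,'g) pi1elt => 'a list set set) => ('e option => ('v,'e,'g) pi1elt => 'a list set) => bool" where
 "choice \<psi> Lc \<longleftrightarrow> (\<forall>rho h. h : Cs rho --> Lc (topo rho) h : \<psi> (topo rho) h)"

lemma choice_iff: "(\<forall>(x, h)\<in>deploy_dom Y. Lc x h : \<psi> x h) \<longleftrightarrow> choice \<psi> Lc"
proof -
 have "(\<forall>(x, h)\<in>deploy_dom Y. Lc x h : \<psi> x h) \<longleftrightarrow> (\<forall>x h. (x, h) : deploy_dom Y --> Lc x h : \<psi> x h)" by auto
 also have "\<dots> \<longleftrightarrow> choice \<psi> Lc" unfolding choice_def deploy_dom_iff by auto
 finally show ?thesis .
qed

lemma choice_chc: assumes "deployment Y A ev \<psi>" "choice \<psi> Lc" shows "chc Lc"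
 unfolding chc_def
proof (intro allI impI)
 fix rho h assume h: "h : Cs rho"
 hence "Lc (topo rho) h : \<psi> (topo rho) h" using assms(2) by (simp add: choice_def)
 thus "vlang (endv rho) (Lc (topo rho) h)" using V_class(1)[OF CsD(5)[OF h] dep_class[OF assms(1) h]] by blast
qed

lemma vlang_Un: "vlang V M ==> vlang V N ==> vlang V (M \<union> N)"
 unfolding vlang_def by (simp add: image_Un)

text \<open>The languages of two choices thus sit inside one fellow-travelling language, which
  yields independence of the choice.\<close>

lemma choice_Un_ugood:
 assumes d: "deployment Y A ev \<psi>" and c: "choice \<psi> Lc" "choice \<psi> Lc'"
  and fin: "finite {Lc (topo rho) h | rho h. h : Cs rho}" "finite {Lc' (topo rho) h | rho h. h : Cs rho}"
 shows "ugood (%x h. Lc x h \<union> Lc' x h)"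
 unfolding ugood_def
proof (intro conjI allI impI)
 show "chc (%x h. Lc x h \<union> Lc' x h)"
  using choice_chc[OF d c(1)] choice_chc[OF d c(2)] vlang_Un unfolding chc_def by blast
 have "{Lc (topo rho) h \<union> Lc' (topo rho) h | rho h. h : Cs rho} \<subseteq>
  (%(a, b). a \<union> b) ` ({Lc (topo rho) h | rho h. h : Cs rho} \<times> {Lc' (topo rho) h | rho h. h : Cs rho})"
 proof
  fix z assume "z : {Lc (topo rho) h \<union> Lc' (topo rho) h | rho h. h : Cs rho}"
  then obtain rho h where z: "z = Lc (topo rho) h \<union> Lc' (topo rho) h" "h : Cs rho" by (elim CollectE exE conjE)
  thus "z : (%(a, b). a \<union> b) ` ({Lc (topo rho) h | rho h. h : Cs rho} \<times> {Lc' (topo rho) h | rho h. h : Cs rho})"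
   by (intro image_eqI[of _ _ "(Lc (topo rho) h, Lc' (topo rho) h)"] SigmaI CollectI) auto
 qed
 thus "finite {Lc (topo rho) h \<union> Lc' (topo rho) h | rho h. h : Cs rho}" by (rule finite_subset) (use fin in simp)
 fix rho h h' assume h: "h : Cs rho" "h' : Cs rho"
 note m = c[unfolded choice_def, rule_format, OF h(1)] c[unfolded choice_def, rule_format, OF h(2)]
 show "fel (iv h ** h') (Lc (topo rho) h \<union> Lc' (topo rho) h) (Lc (topo rho) h' \<union> Lc' (topo rho) h')"
  by (intro fel_Un_left fel_Un_right dep_fel[OF d h] m)
qed

text \<open>A prefix \<open>p\<close> of a word of \<open>L\<^sub>\<psi>\<close> may be parsed in several ways since letters for tree edges are
 invisible; nevertheless the continuations of \<open>p\<close> inside a vertex group determine \<open>\<psi>\<close>.\<close>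

lemma quot_fel:
 assumes d: "deployment Y A ev \<psi>" and c: "choice \<psi> Lc"
  and p: "p : lists A" "val p : Cs \<sigma>"
 shows "fel gone {w : lists (VA (endv \<sigma>)). p @ w : LP Lc} (Lc (topo \<sigma>) (val p))"
proof -
 define V h where "V = endv \<sigma>" and "h = val p"
 have chc: "chc Lc" by (rule choice_chc[OF d c])
 have h: "h : Cs \<sigma>" using p by (simp add: h_def)
 have V: "V : verts Y" using CsD(5)[OF h] by (simp add: V_def)
 have hc: "h : gcar" "stk h V = \<sigma>" using CsD[OF h] by (auto simp: V_def)
 \<comment> \<open>Words written in letters of two different vertices have values in these finite
   intersections.\<close>
 define I where "I = (\<Union>U\<in>verts Y - {V}. GV V \<inter> GV U)"
 have finI: "finite I" unfolding I_def using fin_verts finite_GV_Int[OF V] by (intro finite_UN_I) auto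
 have inI: "val w : I" if "w : lists (VA V)" "w : lists (VA U)" "U : verts Y" "U ~= V" for w U
  unfolding I_def using that val_GV[OF V that(1)] val_GV[OF that(3,2)] by (intro UN_I[of U]) auto
 define TT where "TT = insert gone (stab Y ` edges Y)"
 have finT: "finite TT" unfolding TT_def using fin_edges by simp
 have inT: "val t : TT" if "prefix t (tw E)" "E : edges Y" for t E
 proof -
  have "t = [] \<or> t = tw E" using that(1) tw_facts(3)[OF that(2)] by (cases "tw E") (auto simp: prefix_Cons)
  thus ?thesis using tw_facts(2)[OF that(2)] that(2) by (auto simp: TT_def)
 qed
 \<comment> \<open>Either \<open>w\<close> stays in a bounded set or it follows the tail of a word
   of a language at \<open>\<sigma>\<close>. The depth condition rules out the second alternative
   for stacks shorter than \<open>\<sigma>\<close>; this is used when the parse ends at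
   \<open>\<sigma>\<close> itself and its earlier part must be bounded.\<close>
 define alt where "alt S w rho' \<longleftrightarrow> (\<forall>w1. prefix w1 w --> val w1 : S) \<or>
  (length \<sigma> <= length rho' & (\<exists>h' y v. h' : Cs \<sigma> & y : set (suffixes p) & y @ v : Lc (topo \<sigma>) h' & af S (iv h ** h' ** val y) w v))"
  for S w and rho' :: "('g \<times> 'e) list"
 \<comment> \<open>Recursion on the depth of the parse; the set may grow with the depth, which is
   bounded afterwards by \<open>n0\<close>.\<close>
 have altn: "\<exists>S. finite S & (\<forall>rho' pm um w. length rho' < n --> pre Lc rho' pm --> um : Lc (topo rho') (val pm) -->
   w : lists (VA V) --> p @ w = pm @ um --> alt S w rho')" for n
 proof (induction n)
  case 0
  thus ?case by (intro exI[of _ "{}"]) simp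
 next
  case (Suc n)
  then obtain S where S: "finite S" "!!rho' pm um w. length rho' < n ==> pre Lc rho' pm ==> um : Lc (topo rho') (val pm) ==>
   w : lists (VA V) ==> p @ w = pm @ um ==> alt S w rho'" by blast
  define S0 where "S0 = S \<union> (S ## TT)"
  define S1 where "S1 = S0 \<union> (S0 ## I)"
  define S2 where "S2 = iv ` S0 ## S0"
  define S3 where "S3 = iv ` (TT \<union> (TT ## I)) ## S"
  define S' where "S' = S \<union> I \<union> step_set \<union> S1 \<union> S2 \<union> S3"
  have finS': "finite S'"
   unfolding S'_def S3_def S2_def S1_def S0_def using S(1) finI finT finite_step_set by (intro finite_UnI finite_set_mult finite_imageI) auto
  have "alt S' w rho'" if a: "length rho' < Suc n" "pre Lc rho' pm" "um : Lc (topo rho') (val pm)" "w : lists (VA V)" "p @ w = pm @ um" for rho' pm um w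
  proof -
   note P = pre_facts[OF chc a(2)]
   note um = chcD(2,3)[OF chc P(2) a(3)]
   note st = pre_stk[OF chc a(2,3)]
   have wA: "w : lists A" using VA_lists[OF a(4)] .
   have vw: "val w : GV V" by (rule val_GV[OF V a(4)])
   have x: "val (pm @ um) = h ** val w" using a(5)[symmetric] p(1) wA by (simp add: h_def)
   have sx: "stk (val (pm @ um)) V = \<sigma>" unfolding x using stk_GV[OF hc(1) V vw] hc(2) by simp
   have same: "rho' = \<sigma>" if "endv rho' = V" using st(1) sx that by simp
   show ?thesis
   proof (cases "length pm <= length p")
    case True
    then obtain y where y: "p = pm @ y" "um = y @ w" using a(5) by (auto simp: append_eq_append_conv2)
    show ?thesis
    proof (cases "endv rho' = V")
     case eq: True
     note r = same[OF eq]
     have "iv h ** val pm ** val y = gone" using y(1) p(1) hc(1) by (simp add: h_def G.m_assoc)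
     moreover have "af S' gone w w" by (rule af_mono[OF af_refl[OF wA]]) (auto simp: S'_def)
     moreover have "y @ w : Lc (topo \<sigma>) (val pm)" using a(3) y(2) r by simp
     moreover have "y : set (suffixes p)" using y(1) by (simp add: suffix_def)
     ultimately show ?thesis unfolding alt_def using P(2) r by (intro disjI2 conjI exI[of _ "val pm"] exI[of _ y] exI[of _ w]) simp_all
    next
     case False
     have "val w1 : S'" if pr: "prefix w1 w" for w1
     proof -
      have "w1 : lists (VA V)" "w1 : lists (VA (endv rho'))"
       using pr a(4) um(2) y(2) by (auto simp: prefix_def)
      hence "val w1 : I" using inI st(2) False by blast
      thus ?thesis by (simp add: S'_def)
     qed
     thus ?thesis unfolding alt_def by blast
    qed
   next
    case False
    then obtain w0 where w0: "pm = p @ w0" "w = w0 @ um" "w0 ~= []" using a(5) by (auto simp: append_eq_append_conv2)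
    from a(2) obtain s E rho1 p1 u1 where r: "rho' = (s, E) # rho1" "pm = p1 @ u1 @ tw E" "pre Lc rho1 p1" "u1 : Lc (topo rho1) (val p1)" "E : edges Y"
    proof (cases rule: pre.cases)
     case pre_Nil
     thus ?thesis using w0 by simp
    qed blast
    note t = tw_facts[OF r(5)]
    have "length p <= length (p1 @ u1)"
    proof -
     have "length p + length w0 = length (p1 @ u1) + length (tw E)" using w0(1) r(2) by (metis append.assoc length_append)
     moreover have "length w0 > 0" using w0(3) by simp
     ultimately show ?thesis using t(3) by linarith
    qed
    moreover have pw: "p @ w0 = (p1 @ u1) @ tw E" using w0(1) r(2) by simp
    ultimately have "prefix p (p1 @ u1)" using prefix_length_prefix[of p "p @ w0" "p1 @ u1"] by (metis prefixI)
    then obtain w00 where w00: "p1 @ u1 = p @ w00" by (auto simp: prefix_def)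
    have "w0 = w00 @ tw E" using pw unfolding w00 by simp
    note w00 = w00 this
    have wl: "w00 : lists (VA V)" "um : lists (VA V)" using a(4) w0(2) w00(2) by auto
    have wlA: "w00 : lists A" "w0 : lists A" using VA_lists wl(1) w00(2) t(1) by auto
    have alt: "alt S w00 rho1" by (rule S(2)[OF _ r(3,4) wl(1)]) (use a(1) r(1) w00(1) in auto)
    have B0: "val w1 : S0" if "\<forall>w1. prefix w1 w00 --> val w1 : S" "prefix w1 w0" for w1
    proof -
     consider "prefix w1 w00" | t1 where "w1 = w00 @ t1" "prefix t1 (tw E)" using \<open>prefix w1 w0\<close> unfolding w00(2) prefix_append by blast
     thus ?thesis
     proof cases
      case 1
      thus ?thesis using that(1) by (simp add: S0_def)
     next
      case 2
      have "t1 : lists A" using prefix_lists[OF 2(2) t(1)] .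
      hence "val w1 = val w00 ** val t1" using 2(1) wlA by simp
      moreover have "val w00 : S" using that(1) by simp
      ultimately show ?thesis unfolding S0_def using inT[OF 2(2) r(5)] set_multI[of "val w00" S "val t1" TT] by simp
     qed
    qed
    show ?thesis
    proof (cases "endv rho' = V")
     case eq: True
     note r' = same[OF eq]
     hence "\<not> length \<sigma> <= length rho1" using r(1) by auto
     hence B: "\<forall>w1. prefix w1 w00 --> val w1 : S" using alt by (simp add: alt_def)
     have e: "iv h ** val pm ** val [] = val w0" using w0(1) p(1) wlA hc(1) by (simp add: h_def inv_cancel1)
     have "af S2 (val w0) w0 []"
     proof (rule af_prefixL[OF wlA(2)])
      fix u assume "prefix u w0"
      thus "iv (val u) ** val w0 : S2" unfolding S2_def
       using set_multI[OF imageI[OF B0[OF B], of u "m_inv (pi1 Y)"] B0[OF B, of w0]] by simp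
     qed (use wlA in simp)
     hence "af S' (val w0) w0 []" by (rule af_mono) (auto simp: S'_def)
     moreover have "af S' (iv (val w0) ** (val w0 ** val [])) um um"
      using wlA by (auto intro!: af_mono[OF af_refl[OF um(1)]] simp: S'_def)
     ultimately have "af S' (val w0) (w0 @ um) ([] @ um)" by (rule af_append)
     hence "af S' (iv h ** val pm ** val []) w um" unfolding e w0(2) by simp
     moreover have "[] @ um : Lc (topo \<sigma>) (val pm)" using a(3) r' by simp
     ultimately show ?thesis unfolding alt_def using P(2) r'
      by (intro disjI2 conjI exI[of _ "val pm"] exI[of _ "[]"] exI[of _ um]) simp_all
    next
     case ne: False
     have uI: "val u1 : I" if "prefix u1 um" for u1
     proof -
      have "u1 : lists (VA V)" "u1 : lists (VA (endv rho'))" using that wl(2) um(2) by (auto simp: prefix_def)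
      thus ?thesis using inI st(2) ne by blast
     qed
     from alt consider (B) "\<forall>w1. prefix w1 w00 --> val w1 : S"
      | (F) h' y v where "length \<sigma> <= length rho1" "h' : Cs \<sigma>" "y : set (suffixes p)" "y @ v : Lc (topo \<sigma>) h'" "af S (iv h ** h' ** val y) w00 v"
      unfolding alt_def by blast
     thus ?thesis
     proof cases
      case B
      have "val w1 : S'" if pw: "prefix w1 w" for w1
      proof -
       consider "prefix w1 w0" | u2 where "w1 = w0 @ u2" "prefix u2 um" using pw unfolding w0(2) prefix_append by blast
       thus ?thesis
       proof cases
        case 1
        thus ?thesis using B0[OF B] by (simp add: S'_def S1_def)
       next
        case 2
        have "u2 : lists A" using prefix_lists[OF 2(2) um(1)] .
        hence "val w1 = val w0 ** val u2" using 2(1) wlA by simp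
        hence "val w1 : S1" unfolding S1_def using set_multI[OF B0[OF B, of w0] uI[OF 2(2)]] by simp
        thus ?thesis by (simp add: S'_def)
       qed
      qed
      thus ?thesis unfolding alt_def by blast
     next
      \<comment> \<open>The edge letter and the last segment have values in a finite set here, so
        \<open>v\<close> waits while they are read.\<close>
      case F
      let ?x = "iv h ** h' ** val y" and ?r = "tw E @ um"
      have rA: "?r : lists A" using t(1) um(1) by simp
      have xc: "?x : gcar" "v : lists A" using afD[OF F(5)] by auto
      let ?d = "iv (val w00) ** (?x ** val v)"
      have dS: "?d : S" by (rule af_end[OF F(5)])
      have dc: "?d : gcar" by (intro G.m_closed G.inv_closed val_closed xc wlA)
      have "af S3 ?d ?r []"
      proof (rule af_prefixL[OF rA])
       fix r1 assume "prefix r1 ?r"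
       then consider "prefix r1 (tw E)" | u2 where "r1 = tw E @ u2" "prefix u2 um" unfolding prefix_append by blast
       hence "val r1 : TT \<union> (TT ## I)"
       proof cases
        case 1
        thus ?thesis using inT r(5) by blast
       next
        case 2
        have "u2 : lists A" using prefix_lists[OF 2(2) um(1)] .
        hence "val r1 = val (tw E) ** val u2" using 2(1) t(1) by simp
        thus ?thesis using set_multI[OF inT[of "tw E" E] uI[OF 2(2)]] r(5) by simp
       qed
       thus "iv (val r1) ** ?d : S3" unfolding S3_def using dS by (intro set_multI imageI)
      qed (rule dc)
      hence "af S' ?d ?r []" by (rule af_mono) (auto simp: S'_def)
      moreover have "af S' ?x w00 v" by (rule af_mono[OF F(5)]) (auto simp: S'_def)
      ultimately have "af S' ?x (w00 @ ?r) (v @ [])" using af_append by blast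
      hence "af S' ?x w v" using w0(2) w00(2) by simp
      thus ?thesis unfolding alt_def using F(1-4) r(1)
       by (intro disjI2 conjI exI[of _ h'] exI[of _ y] exI[of _ v]) simp_all
     qed
    qed
   qed
  qed
  thus ?case using finS' by blast
 qed
 \<comment> \<open>The parse ends at a stack of an element that also has the stack
   \<open>\<sigma>\<close>; \<open>near_split\<close> with the empty word bounds the excess depth by
   twice the number of vertices.\<close>
 define n0 where "n0 = Suc (length \<sigma> + 2 * card (verts Y))"
 obtain S where S: "finite S" "!!rho' pm um w. length rho' < n0 ==> pre Lc rho' pm ==> um : Lc (topo rho') (val pm) ==>
   w : lists (VA V) ==> p @ w = pm @ um ==> alt S w rho'" using altn[of n0] by blast
 have alt: "\<exists>rho'. alt S w rho'" if w: "w : lists (VA V)" "p @ w : LP Lc" for w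
 proof -
  obtain rho' pm um where r: "pre Lc rho' pm" "um : Lc (topo rho') (val pm)" "p @ w = pm @ um" by (rule LpsiE[OF chc w(2)])
  note st = pre_stk[OF chc r(1,2)]
  have vw: "val w : GV V" by (rule val_GV[OF V w(1)])
  have x: "val (pm @ um) = h ** val w" using r(3)[symmetric] p(1) VA_lists[OF w(1)] by (simp add: h_def)
  have xc: "val (pm @ um) : gcar" using st(3) val_closed by blast
  have sx: "stk (val (pm @ um)) V = \<sigma>" unfolding x using stk_GV[OF hc(1) V vw] hc(2) by simp
  have z0: "[] : lists A" "length ([] :: 'a list) <= 1" by simp_all
  obtain tau tau' rhoc where t: "rho' = tau @ rhoc" "\<sigma> = tau' @ rhoc" "length tau <= 2 * card (verts Y)"
  proof (rule near_split[OF xc z0 st(2) V])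
   fix tau tau' rhoc
   assume "stk (val (pm @ um)) (endv rho') = tau @ rhoc" "stk (val (pm @ um) ** val []) V = tau' @ rhoc" "length tau <= 2 * card (verts Y)"
   thus ?thesis using that[of tau rhoc tau'] st(1) sx xc by (metis G.r_one val_Nil)
  qed
  hence "length rho' < n0" by (simp add: n0_def)
  thus ?thesis using S(2)[OF _ r(1,2) w(1) r(3)] by blast
 qed
 let ?L = "Lc (topo \<sigma>) h"
 have Lm: "Lc (topo \<sigma>) h' : \<psi> (topo \<sigma>) h'" if "h' : Cs \<sigma>" for h' using c that by (simp add: choice_def)
 have "fel gone {w : lists (VA V). p @ w : LP Lc} ?L"
  unfolding fel_def
 proof (intro allI impI)
  fix D :: "('v,'e,'g) pi1elt set" assume D: "finite D"
  have "fel (iv h ** h) ?L ?L" by (rule dep_fel[OF d h h Lm[OF h] Lm[OF h]])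
  hence fL: "fel gone ?L ?L" using hc by simp
  have LA: "?L <= lists A" using vlangD(2)[OF chcD(1)[OF chc h]] .
  have "finite (S ## D)" by (rule finite_set_mult[OF S(1) D])
  from fel_finite_values[OF fL LA this] obtain S5 where S5: "finite S5"
   "!!u u1. u : ?L ==> val u : S ## D ==> prefix u1 u ==> val u1 : S5" by blast
  define D6 where "D6 = iv ` S ## D"
  have finD6: "finite D6" unfolding D6_def using S(1) D by (intro finite_set_mult) auto
  have "\<forall>h'\<in>Cs \<sigma>. \<exists>S. finite S & (\<forall>u\<in>Lc (topo \<sigma>) h'. \<forall>v\<in>?L. iv (val u) ** ((iv h' ** h) ** val v) : D6 --> af S (iv h' ** h) u v)"
   using dep_fel[OF d _ h Lm Lm[OF h]] finD6 unfolding fel_def by blast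
  then obtain S6 where S6: "\<forall>h'\<in>Cs \<sigma>. finite (S6 h') & (\<forall>u\<in>Lc (topo \<sigma>) h'. \<forall>v\<in>?L. iv (val u) ** ((iv h' ** h) ** val v) : D6 --> af (S6 h') (iv h' ** h) u v)"
   by metis
  define S7 where "S7 h' y = (iv ` drop_set y ## S6 h') ## drop_set []" for h' y
  define S8 where "S8 = (\<Union>h'\<in>Cs \<sigma>. \<Union>y\<in>set (suffixes p). S ## S7 h' y)"
  define T where "T = S8 \<union> (iv ` S ## S5)"
  have "finite (S7 h' y)" if "h' : Cs \<sigma>" for h' y unfolding S7_def using S6 that by (intro finite_set_mult finite_imageI finite_drop_set) auto
  hence finT: "finite T" unfolding T_def S8_def using S(1) S5(1) finite_Cs by (intro finite_UnI finite_UN_I finite_set_mult finite_imageI) auto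
  have "af T gone w v0" if w: "w : lists (VA V)" "p @ w : LP Lc" and v0: "v0 : ?L" "iv (val w) ** (gone ** val v0) : D" for w v0
  proof -
   have wA: "w : lists A" using VA_lists[OF w(1)] .
   have v0A: "v0 : lists A" using LA v0(1) by blast
   have v0D: "iv (val w) ** val v0 : D" using v0(2) v0A by simp
   obtain rho' where "alt S w rho'" using alt[OF w] by blast
   then consider (B) "\<forall>w1. prefix w1 w --> val w1 : S"
    | (F) h' y v where "h' : Cs \<sigma>" "y : set (suffixes p)" "y @ v : Lc (topo \<sigma>) h'" "af S (iv h ** h' ** val y) w v"
    unfolding alt_def by blast
   thus ?thesis
   proof cases
    case B
    have "val v0 = val w ** (iv (val w) ** val v0)" using wA v0A by (simp add: inv_cancel2)
    hence "val v0 : S ## D" using set_multI[OF _ v0D, of "val w" S] B by (metis prefix_order.refl)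
    note S5' = S5(2)[OF v0(1) this]
    show ?thesis
    proof (rule af_box[OF wA v0A G.one_closed])
     fix u1 v1 assume pr: "prefix u1 w" "prefix v1 v0"
     have "v1 : lists A" using prefix_lists[OF pr(2) v0A] .
     thus "iv (val u1) ** (gone ** val v1) : T"
      unfolding T_def using set_multI[OF imageI[of "val u1" S "m_inv (pi1 Y)"] S5'[OF pr(2)]] B pr(1) by simp
    qed
   next
    case F
    have hc': "h' : gcar" using CsD(1)[OF F(1)] .
    have vA: "v : lists A" "y : lists A" using chcD(2)[OF chc F(1,3)] by auto
    let ?e = "iv (val w) ** ((iv h ** h' ** val y) ** val v)"
    have "?e : S" by (rule af_end[OF F(4)])
    hence "iv ?e ** (iv (val w) ** val v0) : D6" unfolding D6_def using v0D by (intro set_multI imageI)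
    moreover have "iv ?e ** (iv (val w) ** val v0) = iv (val (y @ v)) ** ((iv h' ** h) ** val v0)"
     using hc hc' vA wA v0A by (simp add: grp_simps)
    ultimately have "af (S6 h') (iv h' ** h) (y @ v) ([] @ v0)" using S6 F(1,3) v0(1) by simp
    from af_drop_prefixes[OF this] have "af (S7 h' y) (iv (val y) ** ((iv h' ** h) ** val [])) v v0" by (simp add: S7_def)
    from af_trans[OF F(4) this] have "af (S ## S7 h' y) ((iv h ** h' ** val y) ** (iv (val y) ** ((iv h' ** h) ** val []))) w v0" .
    moreover have "(iv h ** h' ** val y) ** (iv (val y) ** ((iv h' ** h) ** val [])) = gone" using hc hc' vA by (simp add: grp_simps)
    ultimately have "af (S ## S7 h' y) gone w v0" by simp
    thus ?thesis by (rule af_mono) (use F(1,2) in \<open>unfold T_def S8_def, blast\<close>)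
   qed
  qed
  thus "\<exists>S. finite S & (\<forall>u\<in>{w : lists (VA V). p @ w : LP Lc}. \<forall>v\<in>?L. iv (val u) ** (gone ** val v) : D --> af S gone u v)"
   using finT by (intro exI[of _ T]) simp
 qed
 thus ?thesis by (simp add: V_def h_def)
qed

end

section \<open>Canonical synchronous representatives, independence of choices and
  injectivity\<close>

context cgog
begin

abbreviation "SAC V \<equiv> SAClasses (VG V) (VA V) (vev Y ev V)"

definition bounded_fibres :: "'a list set => bool" where
 "bounded_fibres L \<longleftrightarrow> (\<forall>D. finite D --> (\<exists>N. \<forall>u\<in>L. val u : D --> length u <= N))"

definition good :: "'v => 'a list set => bool" where
 "good V N \<longleftrightarrow> vlang V N & regular_lang (VA V) N & sfel N & bounded_fibres N"

lemma good_fel: assumes "good V N" shows "fel gone N N"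
 using sfel_imp_fel[of N] vlangD(2)[of V N] assms by (simp add: good_def)

text \<open>Trimming a synchronous representative keeps its class, and lengths are bounded on fibres
  by comparison with one word of trivial value.\<close>

lemma good_ex: assumes V: "V : verts Y" and c: "c : SAC V" shows "\<exists>N\<in>c. good V N"
proof -
 interpret H: alphabet_group "VG V" "VA V" ainv "vev Y ev V" by (rule V_alphabet[OF V])
 have cV: "c : VCl V" using c by (simp add: SAClasses_def)
 obtain L where L: "L : c" "sync_aut (VG V) (VA V) (vev Y ev V) L" using c by (auto simp: SAClasses_def)
 obtain L' where L': "L' <= L" "sync_aut (VG V) (VA V) (vev Y ev V) L'" "H.nice L'" by (rule H.trim[OF L(2)])
 note cl = V_class[OF V cV L(1)]
 have s: "vlang V L'" "regular_lang (VA V) L'" "sfel L'" using L'(2) V_sync_iff[OF V] by auto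
 have "fel gone L' L'" "fel gone L L'" using fel_mono[OF cl(3)] L'(1) by blast+
 hence "L' : vcls V L" using V_vcls_iff[OF V cl(1,3)] s by blast
 hence "L' : c" using cl(4) by simp
 moreover have "bounded_fibres L'" unfolding bounded_fibres_def
 proof (intro allI impI)
  fix D :: "('v,'e,'g) pi1elt set" assume D: "finite D"
  have "gone : val ` L'" using vlangD(3)[OF s(1)] GV_ops(1)[OF V] by simp
  then obtain v where v: "v : L'" "val v = gone" by auto
  let ?D = "{k : carrier (VG V). vincl Y V k : iv ` D}"
  have "finite (iv ` D)" using D by simp
  hence fD: "finite ?D" by (rule finite_vincl_vimage[OF V])
  from L'(3)[unfolded H.nice_def, THEN spec, THEN mp, OF fD]
  obtain N where N: "\<forall>u\<in>L'. \<forall>v\<in>L'. inv\<^bsub>VG V\<^esub> (H.val u) *[V] H.val v : ?D --> length u <= length v + N"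
   by (elim exE)
  have "length u <= length v + N" if u: "u : L'" "val u : D" for u
  proof (rule N[THEN bspec, THEN bspec, THEN mp, OF u(1) v(1)])
   have uV: "u : lists (VA V)" "v : lists (VA V)" using vlangD(1)[OF s(1)] u v by auto
   note wu = vincl_val[OF V uV(1)] and wv = vincl_val[OF V uV(2)]
   have "vincl Y V (H.val v) = vincl Y V \<one>\<^bsub>VG V\<^esub>" using wv(2) v(2) vincl_one[OF V] by simp
   hence e: "H.val v = \<one>\<^bsub>VG V\<^esub>" using vincl_inj[OF V wv(1)] H.one_closed by blast
   have "vincl Y V (inv\<^bsub>VG V\<^esub> (H.val u)) = iv (val u)" using group_hom.hom_inv[OF vincl_group_hom[OF V] wu(1)] wu(2) by simp
   thus "inv\<^bsub>VG V\<^esub> (H.val u) *[V] H.val v : ?D" using e wu(1) u(2) by simp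
  qed
  thus "\<exists>N. \<forall>u\<in>L'. val u : D --> length u <= N" by blast
 qed
 ultimately show ?thesis using s by (auto simp: good_def)
qed

text \<open>Chosen from the vertex and the class alone, so a deployment with finite image leads to
  finitely many languages.\<close>

definition Lg :: "'v => 'a list set set => 'a list set" where
 "Lg V c = (SOME N. N : c & good V N)"

lemma Lg: assumes "V : verts Y" "c : SAC V" shows "Lg V c : c" "good V (Lg V c)"
proof -
 have "\<exists>N. N : c & good V N" using good_ex[OF assms] by blast
 from someI_ex[OF this] show "Lg V c : c" "good V (Lg V c)" by (simp_all add: Lg_def)
qed

text \<open>With \<open>V\<close> the source of \<open>E\<close>: one word for each coset of the
  edge group, that is, for each neighbouring vertex of the tree across an edge of type
  \<open>E\<close>.\<close>

definition is_xs :: "'v => 'a list set set => 'e => 'a list set => bool" where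
 "is_xs V c E C \<longleftrightarrow> C <= Lg V c & regular_lang (VA V) C \<and>
   (\<forall>u\<in>Lg V c. \<exists>u'\<in>C. iv (val u) ** val u' : Fs (Some (erev Y E))) \<and>
   (\<forall>u\<in>C. \<forall>u'\<in>C. iv (val u) ** val u' : Fs (Some (erev Y E)) --> u = u')"

definition Xs :: "'v => 'a list set set => 'e => 'a list set" where
 "Xs V c E = (SOME C. is_xs V c E C)"

lemma Xs:
 assumes V: "V : verts Y" and c: "c : SAC V" and E: "E : edges Y"
 shows "Xs V c E <= Lg V c" "regular_lang (VA V) (Xs V c E)"
  "u : Lg V c ==> \<exists>u'\<in>Xs V c E. iv (val u) ** val u' : Fs (Some (erev Y E))"
  "u : Xs V c E ==> u' : Xs V c E ==> iv (val u) ** val u' : Fs (Some (erev Y E)) ==> u = u'"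
proof -
 note g = Lg(2)[OF V c, unfolded good_def]
 have x: "Some (erev Y E) : EO" using rev_in[OF E] by simp
 obtain C where C: "C <= Lg V c" "regular_lang (VA V) C" "!!u. u : Lg V c ==> \<exists>u'\<in>C. iv (val u) ** val u' : Fs (Some (erev Y E))"
  "!!u u'. u : C ==> u' : C ==> iv (val u) ** val u' : Fs (Some (erev Y E)) ==> u = u'"
  by (rule cross_section[of "VA V" "Lg V c" "Fs (Some (erev Y E))"])
   (use g VA_sub Fs_subgroup[OF x] finite_Fs[OF x] in auto)
 have "\<exists>C. is_xs V c E C" unfolding is_xs_def
  by (rule exI[of _ C]) (intro conjI ballI impI C(1,2); rule C(3,4); assumption)
 from someI_ex[OF this] have xs: "is_xs V c E (Xs V c E)" by (simp add: Xs_def)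
 note xs = xs[unfolded is_xs_def]
 show "Xs V c E <= Lg V c" "regular_lang (VA V) (Xs V c E)" using xs by blast+
 show "u : Lg V c ==> \<exists>u'\<in>Xs V c E. iv (val u) ** val u' : Fs (Some (erev Y E))" using xs by blast
 show "u : Xs V c E ==> u' : Xs V c E ==> iv (val u) ** val u' : Fs (Some (erev Y E)) ==> u = u'" using xs by blast
qed

lemma Fs_Some: "Fs (Some E) = (%f. vincl Y (etgt Y E) (bd1 Y E f)) ` FG E"
 by (auto simp: Fs_def Fb_def)

lemma Fs_rev: assumes E: "E : edges Y" shows "Fs (Some (erev Y E)) = (%f. vincl Y (esrc Y E) (bd0 Y E f)) ` FG E"
 unfolding Fs_Some using bd1_rev[OF E] tgt_rev[OF E] egrp_rev[OF E] by (auto simp: image_iff)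

lemma Fs_conj:
 assumes E: "E : edges Y"
 shows "f : Fs (Some (erev Y E)) ==> iv (stab Y E) ** (f ** stab Y E) : Fs (Some E)"
  "f : Fs (Some E) ==> stab Y E ** (f ** iv (stab Y E)) : Fs (Some (erev Y E))"
proof -
 note s = stab_closed[OF E]
 have *: "iv (stab Y E) ** (vincl Y (esrc Y E) (bd0 Y E k) ** stab Y E) = vincl Y (etgt Y E) (bd1 Y E k)"
  "stab Y E ** (vincl Y (etgt Y E) (bd1 Y E k) ** iv (stab Y E)) = vincl Y (esrc Y E) (bd0 Y E k)" if k: "k : FG E" for k
 proof -
  note cl = vincl_closed[OF src_in[OF E] bd0_closed[OF E k]] vincl_closed[OF tgt_in[OF E] bd1_closed[OF E k]]
  note c = stab_conj[OF E k]
  show "iv (stab Y E) ** (vincl Y (esrc Y E) (bd0 Y E k) ** stab Y E) = vincl Y (etgt Y E) (bd1 Y E k)"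
   unfolding c using s cl by (simp add: inv_cancel1)
  have "stab Y E ** (vincl Y (etgt Y E) (bd1 Y E k) ** iv (stab Y E)) = (stab Y E ** vincl Y (etgt Y E) (bd1 Y E k)) ** iv (stab Y E)"
   using s cl by (simp add: G.m_assoc)
  also have "\<dots> = vincl Y (esrc Y E) (bd0 Y E k)" unfolding c[symmetric] using s cl by (simp add: G.m_assoc)
  finally show "stab Y E ** (vincl Y (etgt Y E) (bd1 Y E k) ** iv (stab Y E)) = vincl Y (esrc Y E) (bd0 Y E k)" .
 qed
 show "f : Fs (Some (erev Y E)) ==> iv (stab Y E) ** (f ** stab Y E) : Fs (Some E)"
  unfolding Fs_rev[OF E] unfolding Fs_Some using * by auto
 show "f : Fs (Some E) ==> stab Y E ** (f ** iv (stab Y E)) : Fs (Some (erev Y E))"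
  unfolding Fs_rev[OF E] unfolding Fs_Some using * by auto
qed

text \<open>Backtracking concerns values in a finite set only, which \<open>regular_val_in\<close>
  can detect.\<close>

lemma regular_nbt:
 assumes r: "regular_lang A N" "fel gone N N" and x: "x : EO"
 shows "regular_lang A {u : N. nbt x (val u) E}"
proof (cases "\<exists>E1. x = Some E1 & E = erev Y E1")
 case True
 hence "{u : N. nbt x (val u) E} = N - {u : N. val u : Fs x}" by (auto simp: nbt_def)
 thus ?thesis using regular_Diff[OF r(1) regular_val_in[OF r finite_Fs[OF x]]] by simp
next
 case False
 hence "{u : N. nbt x (val u) E} = N" by (auto simp: nbt_def)
 thus ?thesis using r by simp
qed

lemma choice_ugood:
 assumes "deployment Y A ev \<psi>" "choice \<psi> Lc" "finite {Lc (topo rho) h | rho h. h : Cs rho}"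
 shows "ugood Lc"
 using choice_Un_ugood[OF assms(1,2,2,3,3)] by simp

lemma dep_finite:
 assumes "deployment Y A ev \<psi>" shows "finite {(topo rho, \<psi> (topo rho) h) | rho h. h : Cs rho}"
proof -
 let ?I = "(%(x, h). \<psi> x h) ` deploy_dom Y"
 have "{(topo rho, \<psi> (topo rho) h) | rho h. h : Cs rho} <= EO \<times> ?I"
 proof
  fix z assume "z : {(topo rho, \<psi> (topo rho) h) | rho h. h : Cs rho}"
  then obtain rho h where z: "z = (topo rho, \<psi> (topo rho) h)" "h : Cs rho" by (elim CollectE exE conjE)
  have "(topo rho, h) : deploy_dom Y" using z(2) deploy_dom_iff by blast
  hence "\<psi> (topo rho) h : ?I" by (rule image_eqI[rotated]) simp
  thus "z : EO \<times> ?I" using z CsD(4)[OF z(2)] by simp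
 qed
 moreover have "finite ?I" using assms unfolding deployment_def by blast
 ultimately show ?thesis using finite_EO by (meson finite_SigmaI finite_subset)
qed

lemma dep_range_finite:
 assumes "deployment Y A ev \<psi>" "!!rho h. h : Cs rho ==> Lc (topo rho) h = k (topo rho) (\<psi> (topo rho) h)"
 shows "finite {Lc (topo rho) h | rho h. h : Cs rho}"
proof (rule finite_subset)
 show "{Lc (topo rho) h | rho h. h : Cs rho} <= (%(x, c). k x c) ` {(topo rho, \<psi> (topo rho) h) | rho h. h : Cs rho}"
 proof
  fix z assume "z : {Lc (topo rho) h | rho h. h : Cs rho}"
  then obtain rho h where z: "z = Lc (topo rho) h" "h : Cs rho" by (elim CollectE exE conjE)
  thus "z : (%(x, c). k x c) ` {(topo rho, \<psi> (topo rho) h) | rho h. h : Cs rho}"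
   by (intro image_eqI[of _ _ "(topo rho, \<psi> (topo rho) h)"] CollectI) (use assms(2) in auto)
 qed
 show "finite ((%(x, c). k x c) ` {(topo rho, \<psi> (topo rho) h) | rho h. h : Cs rho})" using dep_finite[OF assms(1)] by simp
qed

abbreviation "Sm \<psi> \<equiv> (%x h. SOME L. L : \<psi> x h)"

text \<open>\<open>Sm \<psi>\<close> is the choice hidden in \<open>deploy_class\<close>. Equal
  classes receive equal languages, so its range is finite although the choice is arbitrary.\<close>

lemma Sm:
 assumes d: "deployment Y A ev \<psi>"
 shows "choice \<psi> (Sm \<psi>)" "finite {Sm \<psi> (topo rho) h | rho h. h : Cs rho}" "apre (LP (Sm \<psi>))"
proof -
 show c: "choice \<psi> (Sm \<psi>)" unfolding choice_def
 proof (intro allI impI)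
  fix rho h assume h: "h : Cs rho"
  show "(SOME L. L : \<psi> (topo rho) h) : \<psi> (topo rho) h" using V_class_ex[OF CsD(5)[OF h] dep_class[OF d h]] by (rule someI_ex)
 qed
 show f: "finite {Sm \<psi> (topo rho) h | rho h. h : Cs rho}" by (rule dep_range_finite[OF d, of _ "%x c. SOME L. L : c"]) simp
 show "apre (LP (Sm \<psi>))" by (rule Lpsi_apre[OF choice_ugood[OF d c f]])
qed

text \<open>Both languages lie in the language of the union of the two choices, and this one
  fellow-travels by \<open>Lpsi_apre\<close>.\<close>

lemma deploy_class_fel:
 assumes d: "deployment Y A ev \<psi>" and c: "choice \<psi> Lc" "finite {Lc (topo rho) h | rho h. h : Cs rho}"
 shows "fel gone (LP (Sm \<psi>)) (LP Lc)"
proof -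
 let ?U = "%x h. Sm \<psi> x h \<union> Lc x h"
 have u: "ugood ?U" by (rule choice_Un_ugood[OF d Sm(1)[OF d] c(1) Sm(2)[OF d] c(2)])
 have chU: "chc ?U" using u by (simp add: ugood_def)
 have "fel gone (LP ?U) (LP ?U)" using apreD(3)[OF Lpsi_apre[OF u]] .
 thus ?thesis
  by (rule fel_mono) (rule Lpsi_mono[OF choice_chc[OF d Sm(1)[OF d]] chU], simp, rule Lpsi_mono[OF choice_chc[OF d c(1)] chU], simp)
qed

text \<open>\<open>Lpsi_drop\<close> recovers the vertex classes once the two reference languages
  are comparable. The common member \<open>L\<close> supplies this comparison; an equality of empty
  classes would give none.\<close>

lemma deploy_class_inj:
 assumes d: "deployment Y A ev \<psi>" "deployment Y A ev \<phi>"
  and e: "deploy_class Y A ev tlet \<psi> = deploy_class Y A ev tlet \<phi>" and ne: "L : deploy_class Y A ev tlet \<psi>"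
 shows "\<psi> = \<phi>"
proof (intro ext)
 fix x h
 show "\<psi> x h = \<phi> x h"
 proof (cases "(x, h) : deploy_dom Y")
  case False
  thus ?thesis using d unfolding deployment_def by metis
 next
  case True
  then obtain rho where r: "x = topo rho" "h : Cs rho" using deploy_dom_iff by blast
  note P = Sm(3)[OF d(1)] and Q = Sm(3)[OF d(2)]
  have L: "async_aut (pi1 Y) A ev L" "fel gone (LP (Sm \<psi>)) L" "fel gone (LP (Sm \<phi>)) L"
   using ne e aclass_iff[OF P] aclass_iff[OF Q] unfolding deploy_class_def by blast+
  note L' = apreD[OF conjunct1[OF L(1)[unfolded async_aut_iff]]]
  have "fel gone L (LP (Sm \<phi>))" by (rule fel_sym1[OF L(3) apreD(1)[OF Q] L'(1)])
  from fel_transG[OF L(2) this apreD(1)[OF P] L'(1) apreD(1)[OF Q] G.one_closed G.one_closed L'(2)]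
  have f: "fel gone (LP (Sm \<psi>)) (LP (Sm \<phi>))" by simp
  have f2: "fel gone (Sm \<psi> x h) (Sm \<phi> x h)" unfolding r(1)
   by (rule Lpsi_drop[OF choice_chc[OF d(1) Sm(1)[OF d(1)]] choice_chc[OF d(2) Sm(1)[OF d(2)]] f r(2)])
  note V = CsD(5)[OF r(2)]
  have m: "Sm \<psi> x h : \<psi> x h" "Sm \<phi> x h : \<phi> x h" using Sm(1)[OF d(1)] Sm(1)[OF d(2)] r unfolding choice_def by blast+
  have c: "\<psi> x h : VCl (endv rho)" "\<phi> x h : VCl (endv rho)" using dep_class[OF d(1) r(2)] dep_class[OF d(2) r(2)] r(1) by simp_all
  note C = V_class[OF V c(1) m(1)] and C' = V_class[OF V c(2) m(2)]
  have "vcls (endv rho) (Sm \<psi> x h) = vcls (endv rho) (Sm \<phi> x h)" by (rule V_vcls_eq[OF V C(1,3) C'(1,3) f2])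
  thus ?thesis using C(4) C'(4) by simp
 qed
qed

end

section \<open>A synchronous structure from a deployment\<close>

text \<open>\<open>Lc\<close> is the choice with regular language. It serves as a source of
  information about \<open>\<psi>\<close>, while the words of the new structure are taken from
  trimmed synchronous languages.\<close>

locale sdep = cgog Y A ainv ev tlet
 for Y :: "('v,'e,'g,'f) gog" and A :: "'a set" and ainv and ev and tlet +
 fixes \<psi> :: "'e option => ('v,'e,'g) pi1elt => 'a list set set"
  and Lc :: "'e option => ('v,'e,'g) pi1elt => 'a list set"
 assumes dep: "deployment Y A ev \<psi>" and cho: "choice \<psi> Lc" and regR: "regular_lang A (LP Lc)"
  and syn: "h : Cs rho ==> \<psi> (topo rho) h : SAC (endv rho)"
begin

lemma chcLc: "chc Lc" by (rule choice_chc[OF dep cho])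

definition Lgood :: "'e option => ('v,'e,'g) pi1elt => 'a list set" where
 "Lgood x h = Lg (dtv Y x) (\<psi> x h)"

lemma Lgood: assumes h: "h : Cs rho" shows "Lgood (topo rho) h : \<psi> (topo rho) h" "good (endv rho) (Lgood (topo rho) h)"
 using Lg[OF CsD(5)[OF h] syn[OF h]] by (simp_all add: Lgood_def)

lemma choice_Lgood: "choice \<psi> Lgood"
 unfolding choice_def using Lgood(1) by blast

lemma finite_Lgood: "finite {Lgood (topo rho) h | rho h. h : Cs rho}"
 by (rule dep_range_finite[OF dep, of _ "%x. Lg (dtv Y x)"]) (simp add: Lgood_def)

lemma ugood_Lgood: "ugood Lgood"
 by (rule choice_ugood[OF dep choice_Lgood finite_Lgood])

lemma chc_Lgood: "chc Lgood"
 by (rule choice_chc[OF dep choice_Lgood])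

text \<open>Like \<open>pre Lgood\<close>, but each completed segment belongs to the cross-section
  for the edge that follows it.\<close>

inductive preX :: "('g \<times> 'e) list => 'a list => bool" where
 preX_Nil: "preX [] []"
| preX_Cons: "preX rho p ==> u : Xs (endv rho) (\<psi> (topo rho) (val p)) E ==> E : edges Y ==> esrc Y E = endv rho ==>
  nbt (topo rho) (val u) E ==> val (p @ u @ tw E) : Cs ((s, E) # rho) ==> preX ((s, E) # rho) (p @ u @ tw E)"

inductive_cases preX_NilE: "preX [] p"
inductive_cases preX_ConsE: "preX ((s, E) # rho) p"

lemma Xs_Lgood: assumes h: "h : Cs rho" and E: "E : edges Y" and u: "u : Xs (endv rho) (\<psi> (topo rho) h) E"
 shows "u : Lgood (topo rho) h"
 using Xs(1)[OF CsD(5)[OF h] syn[OF h] E] u by (auto simp: Lgood_def)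

lemma preX_pre: "preX rho p ==> pre Lgood rho p"
proof (induction rule: preX.induct)
 case preX_Nil
 show ?case by (rule pre_Nil)
next
 case (preX_Cons rho p u E s)
 have "val p : Cs rho" by (rule pre_facts(2)[OF chc_Lgood preX_Cons(7)])
 hence "u : Lgood (topo rho) (val p)" by (rule Xs_Lgood[OF _ preX_Cons(3,2)])
 thus ?case by (rule pre_Cons[OF preX_Cons(7) _ preX_Cons(3-6)])
qed

lemma preX_facts: assumes "preX rho p" shows "p : lists A" "val p : Cs rho"
 using pre_facts[OF chc_Lgood preX_pre[OF assms]] by auto

lemma hered_preX: "hered Lgood preX"
 unfolding hered_def
proof (intro conjI allI impI)
 show "preX rho p ==> pre Lgood rho p" for rho p by (rule preX_pre)
 fix s E rho p assume "preX ((s, E) # rho) p"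
 then obtain p1 u1 where p: "p = p1 @ u1 @ tw E" "preX rho p1" "u1 : Xs (endv rho) (\<psi> (topo rho) (val p1)) E" "E : edges Y"
  by (cases rule: preX_ConsE) auto
 have "u1 : Lgood (topo rho) (val p1)" by (rule Xs_Lgood[OF preX_facts(2)[OF p(2)] p(4,3)])
 thus "\<exists>p1 u1. preX rho p1 & u1 : Lgood (topo rho) (val p1) & p = p1 @ u1 @ tw E" using p by blast
qed

text \<open>Two segments leading to the same stack differ by the edge group at the source of the
  edge, and the cross-section contains only one of them.\<close>

lemma preX_unique: "preX rho p ==> preX rho p' ==> p = p'"
proof (induction arbitrary: p' rule: preX.induct)
 case preX_Nil
 thus ?case by (auto elim: preX_NilE)
next
 case (preX_Cons rho p u E s)
 from preX_Cons.prems obtain p1 u1 where p1: "p' = p1 @ u1 @ tw E" "preX rho p1" "u1 : Xs (endv rho) (\<psi> (topo rho) (val p1)) E"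
  "val (p1 @ u1 @ tw E) : Cs ((s, E) # rho)" by (cases rule: preX_ConsE) auto
 have e: "p1 = p" using preX_Cons.IH[OF p1(2)] by simp
 note P = preX_facts[OF preX_Cons(1)]
 note E = tw_facts[OF preX_Cons(3)] stab_closed[OF preX_Cons(3)]
 have u: "u : lists A" "u1 : lists A"
  using Xs_Lgood[OF P(2) preX_Cons(3,2)] Xs_Lgood[OF P(2) preX_Cons(3) p1(3)[unfolded e]] chcD(2)[OF chc_Lgood P(2)] by auto
 let ?x = "iv (val (p @ u @ tw E)) ** val (p1 @ u1 @ tw E)"
 have "?x : Fs (Some E)" using Cs_diff[OF preX_Cons(6) p1(4)] by simp
 from Fs_conj(2)[OF preX_Cons(3) this] have "stab Y E ** (?x ** iv (stab Y E)) : Fs (Some (erev Y E))" .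
 moreover have "stab Y E ** (?x ** iv (stab Y E)) = iv (val u) ** val u1"
  using P(1) u E by (simp add: e grp_simps)
 ultimately have "iv (val u) ** val u1 : Fs (Some (erev Y E))" by simp
 hence "u = u1"
  by (rule Xs(4)[OF CsD(5)[OF P(2)] syn[OF P(2)] preX_Cons(3,2) p1(3)[unfolded e]])
 thus ?case using p1(1) e by simp
qed

definition R where "R = LP Lc"

definition M :: "'e option => 'a list set => 'a list set" where
 "M x q = {w : lists (VA (dtv Y x)). w : q}"

definition cl :: "'e option => 'a list set => 'a list set set" where
 "cl x q = vcls (dtv Y x) (M x q)"

text \<open>A state consists of a guessed last edge and the quotient of \<open>R\<close> by a hidden
  word. The conditions retain the states from which a synchronous class can be read off.\<close>

definition \<Sigma> :: "('e option \<times> 'a list set) set" where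
 "\<Sigma> = {(x, q). x : EO & q : (%w. quot w R) ` lists A & vlang (dtv Y x) (M x q) & cl x q : SAC (dtv Y x) \<and>
   fel gone (M x q) (Lg (dtv Y x) (cl x q))}"

lemma regR': "regular_lang A R" using regR by (simp add: R_def)

lemma finite_Sigma: "finite \<Sigma>"
proof (rule finite_subset)
 show "\<Sigma> <= EO \<times> ((%w. quot w R) ` lists A)" by (auto simp: \<Sigma>_def)
 show "finite (EO \<times> ((%w. quot w R) ` lists A))" using finite_EO regular_finite_quots[OF regR'] by simp
qed

lemma SigmaD: assumes "(x, q) : \<Sigma>"
 shows "x : EO" "dtv Y x : verts Y" "regular_lang A q" "vlang (dtv Y x) (M x q)" "cl x q : SAC (dtv Y x)"
  "fel gone (M x q) (Lg (dtv Y x) (cl x q))"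
 using assms EO_verts regular_quot[OF regR'] by (auto simp: \<Sigma>_def)

text \<open>Every word with value \<open>h\<close> that has enough continuations in \<open>L\<^sub>\<psi>\<close> knows the class \<open>\<psi>(h)\<close>.\<close>

lemma M_fel:
 assumes p: "p : lists A" "val p : Cs rho" and v: "vlang (endv rho) (M (topo rho) (quot p R))"
 shows "M (topo rho) (quot p R) : \<psi> (topo rho) (val p)"
proof -
 let ?M = "M (topo rho) (quot p R)" and ?L = "Lc (topo rho) (val p)"
 note V = CsD(5)[OF p(2)]
 have "fel gone {w : lists (VA (endv rho)). p @ w : LP Lc} ?L" by (rule quot_fel[OF dep cho p])
 hence f: "fel gone ?M ?L" by (simp add: M_def quot_iff R_def)
 have L: "?L : \<psi> (topo rho) (val p)" using cho p(2) by (simp add: choice_def)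
 note C = V_class[OF V dep_class[OF dep p(2)] L]
 have f': "fel gone ?L ?M" by (rule fel_sym1[OF f vlangD(2)[OF v] vlangD(2)[OF C(1)]])
 have "fel (gone ** gone) ?M ?M"
  by (rule V_fel_trans[OF V f f' vlangD(1)[OF v] C(1) vlangD(1)[OF v]]) (simp_all add: GV_ops[OF V])
 hence f2: "fel gone ?M ?M" by simp
 have "?M = quot p R \<inter> lists (VA (endv rho))" by (auto simp: M_def)
 hence "regular_lang (VA (endv rho)) ?M" using regular_sublists[OF regular_quot[OF regR' p(1)] VA_sub] by simp
 hence "?M : vcls (endv rho) ?L" using V_vcls_iff[OF V C(1,3)] v f2 f' by blast
 thus ?thesis using C(4) by simp
qed

lemma cl_eq:
 assumes p: "p : lists A" "val p : Cs rho" and v: "vlang (endv rho) (M (topo rho) (quot p R))"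
 shows "cl (topo rho) (quot p R) = \<psi> (topo rho) (val p)" "(topo rho, quot p R) : \<Sigma>"
proof -
 note V = CsD(5)[OF p(2)]
 note m = M_fel[OF p v]
 note C = V_class[OF V dep_class[OF dep p(2)] m]
 show e: "cl (topo rho) (quot p R) = \<psi> (topo rho) (val p)" using C(4) by (simp add: cl_def)
 have "Lgood (topo rho) (val p) : vcls (endv rho) (M (topo rho) (quot p R))" using Lgood(1)[OF p(2)] C(4) by simp
 hence "fel gone (M (topo rho) (quot p R)) (Lgood (topo rho) (val p))" using V_vcls_iff[OF V C(1,3)] by blast
 hence "fel gone (M (topo rho) (quot p R)) (Lg (dtv Y (topo rho)) (cl (topo rho) (quot p R)))" unfolding e by (simp add: Lgood_def)
 moreover have "cl (topo rho) (quot p R) : SAC (endv rho)" unfolding e by (rule syn[OF p(2)])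
 ultimately show "(topo rho, quot p R) : \<Sigma>" unfolding \<Sigma>_def using v p(1) CsD(4)[OF p(2)] by simp
qed

lemma Sigma_cl: assumes "p : lists A" "val p : Cs rho" "(topo rho, quot p R) : \<Sigma>"
 shows "cl (topo rho) (quot p R) = \<psi> (topo rho) (val p)"
 by (rule cl_eq(1)[OF assms(1,2)]) (use SigmaD(4)[OF assms(3)] in simp)

text \<open>A genuine prefix may be continued by every word of its vertex language, which is onto
  the vertex group; hence its state is admissible.\<close>

lemma pre_Sigma: assumes p: "pre Lc rho p"
 shows "(topo rho, quot p R) : \<Sigma>" "u : Lc (topo rho) (val p) ==> u : M (topo rho) (quot p R)"
proof -
 note P = pre_facts[OF chcLc p]
 have sub: "Lc (topo rho) (val p) <= M (topo rho) (quot p R)"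
  using LpsiI[OF chcLc p] chcD(3)[OF chcLc P(2)] by (auto simp: M_def quot_iff R_def)
 thus "u : Lc (topo rho) (val p) ==> u : M (topo rho) (quot p R)" by blast
 have "vlang (endv rho) (M (topo rho) (quot p R))" unfolding vlang_def
 proof
  show MV: "M (topo rho) (quot p R) <= lists (VA (endv rho))" by (auto simp: M_def)
  show "val ` M (topo rho) (quot p R) = GV (endv rho)"
  proof
   show "val ` M (topo rho) (quot p R) <= GV (endv rho)" using MV val_GV[OF CsD(5)[OF P(2)]] by blast
   show "GV (endv rho) <= val ` M (topo rho) (quot p R)"
    using vlangD(3)[OF chcD(1)[OF chcLc P(2)]] image_mono[OF sub, of val] by simp
  qed
 qed
 thus "(topo rho, quot p R) : \<Sigma>" by (rule cl_eq(2)[OF P])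
qed

text \<open>One set for all of the finitely many states, which makes following a hidden word a
  finite-state condition.\<close>

definition S0 :: "('v,'e,'g) pi1elt set" where
 "S0 = (SOME S. finite S & (\<forall>(x, q)\<in>\<Sigma>. \<forall>v\<in>M x q. \<forall>u\<in>Lg (dtv Y x) (cl x q). val v = val u --> af S gone v u))"

lemma S0: "finite S0" "(x, q) : \<Sigma> ==> v : M x q ==> u : Lg (dtv Y x) (cl x q) ==> val v = val u ==> af S0 gone v u"
proof -
 have "\<exists>S. finite S & (\<forall>v\<in>M (fst z) (snd z). \<forall>u\<in>Lg (dtv Y (fst z)) (cl (fst z) (snd z)). val v = val u --> af S gone v u)" if z: "z : \<Sigma>" for z
 proof -
  obtain x q where e: "z = (x, q)" by (cases z)
  note D = SigmaD[OF z[unfolded e]]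
  obtain S where S: "finite S" "!!v u. v : M x q ==> u : Lg (dtv Y x) (cl x q) ==> iv (val v) ** (gone ** val u) : {gone} ==> af S gone v u"
   by (rule felE[OF D(6), of "{gone}"]) auto
  have "af S gone v u" if v: "v : M x q" "u : Lg (dtv Y x) (cl x q)" "val v = val u" for u v
  proof (rule S(2)[OF v(1,2)])
   have "v : lists A" using vlangD(2)[OF D(4)] v(1) by blast
   hence "val v : gcar" by simp
   thus "iv (val v) ** (gone ** val u) : {gone}" using v(3) by simp
  qed
  thus ?thesis using S(1) e by auto
 qed
 hence "\<forall>z\<in>\<Sigma>. \<exists>S. finite S & (\<forall>v\<in>M (fst z) (snd z). \<forall>u\<in>Lg (dtv Y (fst z)) (cl (fst z) (snd z)). val v = val u --> af S gone v u)" by blast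
 then obtain Sf where Sf: "\<forall>z\<in>\<Sigma>. finite (Sf z) & (\<forall>v\<in>M (fst z) (snd z). \<forall>u\<in>Lg (dtv Y (fst z)) (cl (fst z) (snd z)). val v = val u --> af (Sf z) gone v u)"
  by (rule bchoice[THEN exE])
 have "\<exists>S. finite S & (\<forall>(x, q)\<in>\<Sigma>. \<forall>v\<in>M x q. \<forall>u\<in>Lg (dtv Y x) (cl x q). val v = val u --> af S gone v u)"
 proof (intro exI[of _ "\<Union>z\<in>\<Sigma>. Sf z"] conjI ballI)
  show "finite (\<Union>z\<in>\<Sigma>. Sf z)" using finite_Sigma Sf by blast
  fix z assume z: "z : \<Sigma>"
  have "af (\<Union>z\<in>\<Sigma>. Sf z) gone v u" if a: "v : M (fst z) (snd z)" "u : Lg (dtv Y (fst z)) (cl (fst z) (snd z))" "val v = val u" for u v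
  proof (rule af_mono)
   show "af (Sf z) gone v u" using Sf z a by blast
   show "Sf z <= (\<Union>z\<in>\<Sigma>. Sf z)" using z by blast
  qed
  thus "case z of (x, q) => \<forall>v\<in>M x q. \<forall>u\<in>Lg (dtv Y x) (cl x q). val v = val u --> af (\<Union>z\<in>\<Sigma>. Sf z) gone v u"
   by (cases z) simp
 qed
 from someI_ex[OF this] have *: "finite S0 & (\<forall>(x, q)\<in>\<Sigma>. \<forall>v\<in>M x q. \<forall>u\<in>Lg (dtv Y x) (cl x q). val v = val u --> af S0 gone v u)"
  unfolding S0_def .
 thus "finite S0" by blast
 show "(x, q) : \<Sigma> ==> v : M x q ==> u : Lg (dtv Y x) (cl x q) ==> val v = val u ==> af S0 gone v u" using * by blast
qed

text \<open>The automaton reads \<open>u\<close> from a cross-section, while a hidden word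
  \<open>v\<close> of the same value, followed within \<open>S0\<close>, updates the quotient of
  \<open>R\<close>.\<close>

definition lab1 :: "'e option => 'a list set => 'e => 'a list set => 'a list set" where
 "lab1 x q E q' = {u : Xs (dtv Y x) (cl x q) E. nbt x (val u) E \<and>
   (\<exists>v\<in>lists (VA (dtv Y x)). quot (v @ tw E) q = q' & af S0 gone v u & val v = val u)}"

definition Lab :: "'e option \<times> 'a list set => 'e option \<times> 'a list set => 'a list set" where
 "Lab s s' = (\<Union>E\<in>{E : edges Y. fst s' = Some E & esrc Y E = dtv Y (fst s)}. {u @ v | u v. u : lab1 (fst s) (snd s) E (snd s') & v : {tw E}})"

definition Fin :: "'e option \<times> 'a list set => 'a list set" where
 "Fin s = Lg (dtv Y (fst s)) (cl (fst s) (snd s))"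

definition Star :: "'a list set" where
 "Star = {w. ((None, R), w) : paths Lab Fin \<Sigma>}"

lemma R_Sigma: "(None, R) : \<Sigma>"
 using pre_Sigma(1)[OF pre_Nil] by simp

lemma regular_lab1:
 assumes s: "(x, q) : \<Sigma>" and E: "E : edges Y"
 shows "regular_lang A (lab1 x q E q')"
proof -
 note D = SigmaD[OF s]
 let ?X = "Xs (dtv Y x) (cl x q) E" and ?V = "dtv Y x"
 note XX = Xs[OF D(2,5) E]
 note g = Lg(2)[OF D(2,5)]
 have rX: "regular_lang A ?X" by (rule regular_mono_alphabet[OF XX(2) VA_sub])
 have fX: "fel gone ?X ?X" by (rule fel_mono[OF good_fel[OF g] XX(1) XX(1)])
 define N where "N = {u : ?X. nbt x (val u) E}"
 have rN: "regular_lang A N" unfolding N_def by (rule regular_nbt[OF rX fX D(1)])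
 define Q where "Q = {v : lists A. quot (v @ tw E) q = q'} \<inter> lists (VA ?V)"
 have rQ: "regular_lang A Q" unfolding Q_def
  by (rule regular_Int[OF regular_quot_eq[OF D(3) tw_facts(1)[OF E]] regular_mono_alphabet[OF regular_lists VA_sub]])
 define T where "T = {u : lists A. \<exists>v\<in>Q. af S0 gone v u & iv (val v) ** (gone ** val u) = gone}"
 have rT: "regular_lang A T" unfolding T_def by (rule regular_af[OF rQ S0(1) order_refl])
 have "lab1 x q E q' = N \<inter> T"
 proof (intro equalityI subsetI)
  fix u assume u: "u : lab1 x q E q'"
  then obtain v where v: "v : lists (VA ?V)" "quot (v @ tw E) q = q'" "af S0 gone v u" "val v = val u" "u : N"
   unfolding lab1_def N_def by blast
  have uA: "u : lists A" "v : lists A" using afD(4,3)[OF v(3)] .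
  hence "iv (val v) ** (gone ** val u) = gone" using v(4) val_closed[of u] by simp
  moreover have "v : Q" using v uA by (simp add: Q_def)
  ultimately show "u : N \<inter> T" using v(3,5) uA unfolding T_def by blast
 next
  fix u assume u: "u : N \<inter> T"
  then obtain v where v: "v : Q" "af S0 gone v u" "iv (val v) ** (gone ** val u) = gone" unfolding T_def by blast
  have uA: "u : lists A" "v : lists A" using afD(4,3)[OF v(2)] .
  hence "val v = val u" using v(3) inv_mult_eq_iff[of "val v" "val u" gone] by simp
  thus "u : lab1 x q E q'" using v u unfolding lab1_def N_def Q_def by blast
 qed
 thus ?thesis using regular_Int[OF rN rT] by simp
qed

lemma regular_Star: "regular_lang A Star"
 unfolding Star_def
proof (rule regular_paths[OF finite_Sigma _ _ R_Sigma])
 fix s s' assume s: "s : \<Sigma>" "s' : \<Sigma>"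
 hence s1: "(fst s, snd s) : \<Sigma>" by simp
 show "regular_lang A (Fin s)" unfolding Fin_def
  by (rule regular_mono_alphabet[OF _ VA_sub[of "dtv Y (fst s)"]]) (use Lg(2)[OF SigmaD(2,5)[OF s1]] in \<open>simp add: good_def\<close>)
 show "regular_lang A (Lab s s')" unfolding Lab_def
 proof (rule regular_UN)
  show "finite {E : edges Y. fst s' = Some E & esrc Y E = dtv Y (fst s)}" using fin_edges by simp
  fix E assume "E : {E : edges Y. fst s' = Some E & esrc Y E = dtv Y (fst s)}"
  hence E: "E : edges Y" by simp
  show "regular_lang A {u @ v | u v. u : lab1 (fst s) (snd s) E (snd s') & v : {tw E}}"
   by (rule regular_conc[OF regular_lab1[OF s1 E] regular_single[OF tw_facts(1)[OF E]]])
 qed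
qed

text \<open>\<open>p\<close> is the hidden word and \<open>p'\<close> the word read; they share
  their value but not their letters. A hidden word need not be a prefix in the sense of
  \<open>pre\<close>, which is why classes are read off quotients by arbitrary words.\<close>

lemma paths_LQ:
 "(s, w) : paths Lab Fin \<Sigma> ==> s = (topo rho, quot p R) ==> preX rho p' ==> p : lists A ==> val p = val p' ==>
  p' @ w : LQ Lgood preX"
proof (induction arbitrary: rho p p' rule: paths.induct)
 case (final s w)
 note P = preX_facts[OF final.prems(2)]
 have "cl (topo rho) (quot p R) = \<psi> (topo rho) (val p)"
  by (rule Sigma_cl[OF final.prems(3)]) (use final P in auto)
 hence "w : Lgood (topo rho) (val p')" using final by (simp add: Fin_def Lgood_def)
 thus ?case unfolding LQ_def using final.prems(2) by blast
next
 case (step s u' s' w)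
 note P = preX_facts[OF step.prems(2)]
 have e: "cl (topo rho) (quot p R) = \<psi> (topo rho) (val p')"
  using Sigma_cl[OF step.prems(3), of rho] step P by simp
 obtain E u where u: "E : edges Y" "fst s' = Some E" "esrc Y E = endv rho" "u : lab1 (topo rho) (quot p R) E (snd s')" "u' = u @ tw E"
  using step(2) unfolding Lab_def step.prems(1) by auto
 then obtain v where v: "u : Xs (endv rho) (\<psi> (topo rho) (val p')) E" "nbt (topo rho) (val u) E" "v : lists (VA (endv rho))"
  "quot (v @ tw E) (quot p R) = snd s'" "af S0 gone v u" "val v = val u" unfolding lab1_def e dtv_simps by blast
 have uA: "u : lists A" "v : lists A" using afD(4,3)[OF v(5)] .
 note t = tw_facts[OF u(1)]
 have ug: "val u : GV (endv rho)" using val_GV[OF CsD(5)[OF P(2)] v(3)] v(6) by simp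
 obtain s1 where s1: "val p' ** val u ** stab Y E : Cs ((s1, E) # rho)" using Cs_push[OF P(2) ug u(1,3) v(2)] by blast
 hence "val (p' @ u @ tw E) : Cs ((s1, E) # rho)" using P uA t stab_closed[OF u(1)] by (simp add: G.m_assoc)
 hence "preX ((s1, E) # rho) (p' @ u @ tw E)" by (rule preX_Cons[OF step.prems(2) v(1) u(1,3) v(2)])
 moreover have "s' = (topo ((s1, E) # rho), quot (p @ v @ tw E) R)" using u(2) v(4) by (simp add: prod_eq_iff quot_append)
 moreover have "p @ v @ tw E : lists A" using step.prems(3) uA t by simp
 moreover have "val (p @ v @ tw E) = val (p' @ u @ tw E)" using step.prems(3,4) uA t P v(6) by simp
 ultimately have "(p' @ u @ tw E) @ w : LQ Lgood preX" using step.IH by blast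
 thus ?case using u(5) by simp
qed

lemma Star_LQ: "Star <= LQ Lgood preX"
proof
 fix w assume "w : Star"
 hence "((None, R), w) : paths Lab Fin \<Sigma>" by (simp add: Star_def)
 from paths_LQ[OF this _ preX_Nil, of "[]"] show "w : LQ Lgood preX" by simp
qed

lemma LQ_LP: "LQ Lgood preX <= LP Lgood"
 unfolding LQ_def Lpsi_eq[OF chc_Lgood] by (intro Collect_mono) (use preX_pre in blast)

text \<open>Here the hidden word is a genuine prefix. Passing to the cross-section may change the
  entry element within its coset, so every stack is reached, though perhaps not at \<open>h\<close>
  itself.\<close>

lemma Star_reach:
 assumes "h : Cs rho"
 shows "\<exists>p' p. preX rho p' & pre Lc rho p & val p = val p' \<and>
  (\<forall>w. ((topo rho, quot p R), w) : paths Lab Fin \<Sigma> --> p' @ w : Star)"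
 using assms
proof (induction rho arbitrary: h)
 case Nil
 show ?case by (intro exI[of _ "[]"] conjI preX_Nil pre_Nil) (auto simp: Star_def)
next
 case (Cons a rho)
 obtain s E where a: "a = (s, E)" by (cases a)
 have h: "h : Cs ((s, E) # rho)" using Cons.prems a by simp
 obtain h0 where h0: "h0 : Cs rho" using Cs_parent_ex[OF h] by blast
 obtain p' p where p: "preX rho p'" "pre Lc rho p" "val p = val p'"
  "\<forall>w. ((topo rho, quot p R), w) : paths Lab Fin \<Sigma> --> p' @ w : Star" using Cons.IH[OF h0] by blast
 note P = preX_facts[OF p(1)] and P1 = pre_facts[OF chcLc p(2)]
 note par = Cs_parent[OF h]
 obtain g where g: "g : GV (endv rho)" "h = val p' ** g ** stab Y E" "nbt (topo rho) g E" using par(5)[OF P(2)] by blast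
 note E = tw_facts[OF par(1)] stab_closed[OF par(1)]
 note V = CsD(5)[OF P(2)]
 have gc: "g : gcar" by (rule GV_closed[OF V g(1)])
 let ?N = "Lgood (topo rho) (val p')"
 have "g : val ` ?N" using vlangD(3) Lgood(2)[OF P(2)] g(1) unfolding good_def by blast
 then obtain u0 where u0: "u0 : ?N" "val u0 = g" by blast
 obtain u where u: "u : Xs (endv rho) (\<psi> (topo rho) (val p')) E" "iv (val u0) ** val u : Fs (Some (erev Y E))"
  using Xs(3)[OF V syn[OF P(2)] par(1), of u0] u0(1) by (auto simp: Lgood_def)
 have uN: "u : ?N" by (rule Xs_Lgood[OF P(2) par(1) u(1)])
 note uf = chcD(2,3,4)[OF chc_Lgood P(2) uN]
 \<comment> \<open>The error in the edge group made by passing to the cross-section;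
   \<open>Fs_conj\<close> carries it across the edge.\<close>
 define f where "f = iv g ** val u"
 have f: "f : Fs (Some (erev Y E))" using u(2) u0(2) by (simp add: f_def)
 have vu: "val u = g ** f" using gc uf(1) by (simp add: f_def inv_cancel2)
 have xr: "Some (erev Y E) : EO" using rev_in[OF par(1)] by simp
 have fc: "f : gcar" by (rule Fs_ops(4)[OF xr f])
 have nb: "nbt (topo rho) (val u) E" unfolding nbt_def
 proof (intro notI, elim exE conjE)
  fix E1 assume E1: "topo rho = Some E1" "E = erev Y E1" "val u : Fs (topo rho)"
  have "E1 : edges Y" using CsD(4)[OF P(2)] E1(1) by simp
  hence "erev Y E = E1" using rev_rev E1(2) by simp
  hence "f : Fs (topo rho)" using f E1(1) by simp
  hence "val u ** iv f : Fs (topo rho)" using Fs_ops(2,3)[OF CsD(4)[OF P(2)]] E1(3) by blast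
  hence "g : Fs (topo rho)" unfolding vu using gc fc by (simp add: G.m_assoc)
  thus False using g(3) E1 unfolding nbt_def by blast
 qed
 have "h ** (iv (stab Y E) ** (f ** stab Y E)) : Cs ((s, E) # rho)" using Cs_mult[OF h, of "iv (stab Y E) ** (f ** stab Y E)"] Fs_conj(1)[OF par(1) f] by simp
 moreover have "h ** (iv (stab Y E) ** (f ** stab Y E)) = val (p' @ u @ tw E)"
  unfolding g(2) using P(1) uf(1) E gc fc by (simp add: vu grp_simps)
 ultimately have hC: "val (p' @ u @ tw E) : Cs ((s, E) # rho)" by simp
 have "val u : val ` Lc (topo rho) (val p)" using vlangD(3)[OF chcD(1)[OF chcLc P1(2)]] uf(3) by simp
 then obtain v where v: "v : Lc (topo rho) (val p)" "val v = val u" by auto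
 note vf = chcD(2,3)[OF chcLc P1(2) v(1)]
 have "val (p @ v @ tw E) = val (p' @ u @ tw E)" using P1(1) P(1) vf uf E p(3) v(2) by simp
 hence pn: "pre Lc ((s, E) # rho) (p @ v @ tw E)" "val (p @ v @ tw E) = val (p' @ u @ tw E)"
  using pre_Cons[OF p(2) v(1) par(1,2), of s] nb v(2) hC by auto
 have pX: "preX ((s, E) # rho) (p' @ u @ tw E)" by (rule preX_Cons[OF p(1) u(1) par(1,2) nb hC])
 have sg: "(topo rho, quot p R) : \<Sigma>" by (rule pre_Sigma(1)[OF p(2)])
 have ce: "cl (topo rho) (quot p R) = \<psi> (topo rho) (val p')" using Sigma_cl[OF P1 sg] p(3) by simp
 have "af S0 gone v u"
  by (rule S0(2)[OF sg pre_Sigma(2)[OF p(2) v(1)]]) (use uN v(2) in \<open>simp_all add: ce Lgood_def\<close>)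
 hence "u : lab1 (topo rho) (quot p R) E (quot (p @ v @ tw E) R)"
  unfolding lab1_def ce using u(1) nb vf v(2) by (auto simp: quot_append)
 hence lab: "u @ tw E : Lab (topo rho, quot p R) (topo ((s, E) # rho), quot (p @ v @ tw E) R)"
  unfolding Lab_def using par(1,2) by auto
 have "(p' @ u @ tw E) @ w : Star" if "((topo ((s, E) # rho), quot (p @ v @ tw E) R), w) : paths Lab Fin \<Sigma>" for w
  using p(4) paths.step[OF sg lab that] by simp
 thus ?case unfolding a using pX pn by blast
qed

text \<open>The error within the last entry coset is absorbed by the final segment, which ranges
  over a language onto the whole vertex group.\<close>

lemma Star_onto: "val ` Star = gcar"
proof
 have SA: "Star <= lists A" by (rule regular_subset[OF regular_Star])
 show "val ` Star <= gcar" using SA val_closed by blast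
 show "gcar <= val ` Star"
 proof
  fix x assume x: "x : gcar"
  obtain h g where h: "h : Cs (stk x (base Y))" "g : GV (base Y)" "x = h ** g" using Cs_entry[OF x base_in] by blast
  let ?rho = "stk x (base Y)"
  obtain p' p where p: "preX ?rho p'" "pre Lc ?rho p" "val p = val p'"
   "\<forall>w. ((topo ?rho, quot p R), w) : paths Lab Fin \<Sigma> --> p' @ w : Star" using Star_reach[OF h(1)] by blast
  note P = preX_facts[OF p(1)] and P1 = pre_facts[OF chcLc p(2)]
  have e: "endv ?rho = base Y" using Fam_stk(2)[OF x base_in] .
  have "iv (val p') ** h : GV (base Y)" using Fs_GV[OF CsD(4)[OF P(2)] Cs_diff[OF P(2) h(1)]] e by simp
  hence g: "iv (val p') ** h ** g : GV (base Y)" using GV_ops(2)[OF base_in] h(2) by blast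
  have "vlang (base Y) (Lgood (topo ?rho) (val p'))" using Lgood(2)[OF P(2)] e by (simp add: good_def)
  hence "iv (val p') ** h ** g : val ` Lgood (topo ?rho) (val p')" using vlangD(3) g by blast
  then obtain u where u: "u : Lgood (topo ?rho) (val p')" "val u = iv (val p') ** h ** g" by auto
  have uA: "u : lists A" by (rule chcD(2)[OF chc_Lgood P(2) u(1)])
  have sg: "(topo ?rho, quot p R) : \<Sigma>" by (rule pre_Sigma(1)[OF p(2)])
  have "u : Fin (topo ?rho, quot p R)" using u(1) Sigma_cl[OF P1 sg] p(3) by (simp add: Fin_def Lgood_def)
  hence "p' @ u : Star" using p(4) paths.final[OF sg] by blast
  moreover have "val (p' @ u) = x" using P(1) uA u(2) h(3) CsD(1)[OF h(1)] GV_closed[OF base_in h(2)]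
   by (simp add: grp_simps)
  ultimately show "x : val ` Star" by (metis imageI)
 qed
qed

end

section \<open>Synchronous fellow travelling of the new language\<close>

context sdep
begin

lemma Lgood_bounded:
 assumes D: "finite D"
 obtains N where "\<forall>rho h u. h : Cs rho --> u : Lgood (topo rho) h --> val u : D --> length u <= N"
proof -
 let ?F = "{Lgood (topo rho) h | rho h. h : Cs rho}"
 have "\<forall>L\<in>?F. \<exists>N. \<forall>u\<in>L. val u : D --> length u <= N"
 proof
  fix L assume "L : ?F"
  then obtain rho h where L: "L = Lgood (topo rho) h" "h : Cs rho" by (elim CollectE exE conjE)
  have "bounded_fibres L" using Lgood(2)[OF L(2)] L(1) by (simp add: good_def)
  thus "\<exists>N. \<forall>u\<in>L. val u : D --> length u <= N" using D by (simp add: bounded_fibres_def)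
 qed
 then obtain f where f: "\<forall>L\<in>?F. \<forall>u\<in>L. val u : D --> length u <= f L" by (rule bchoice[THEN exE])
 have "length u <= sum f ?F" if u: "h : Cs rho" "u : Lgood (topo rho) h" "val u : D" for rho h u
 proof -
  have L: "Lgood (topo rho) h : ?F" using u(1) by blast
  hence "length u <= f (Lgood (topo rho) h)" using f u by blast
  also have "\<dots> <= sum f ?F" by (rule member_le_sum[OF L _ finite_Lgood]) simp
  finally show ?thesis .
 qed
 thus ?thesis using that[of "sum f ?F"] by blast
qed

lemma Lgood_sync:
 assumes D: "finite D"
 obtains S where "finite S" "!!rho h u v n. h : Cs rho ==> u : Lgood (topo rho) h ==> v : Lgood (topo rho) h ==>
  iv (val u) ** val v : D ==> iv (val (take n u)) ** val (take n v) : S"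
proof -
 let ?F = "{Lgood (topo rho) h | rho h. h : Cs rho}"
 have "\<forall>L\<in>?F. \<exists>S. finite S & (\<forall>u\<in>L. \<forall>v\<in>L. iv (val u) ** val v : D --> (\<forall>n. iv (val (take n u)) ** val (take n v) : S))"
 proof
  fix L assume "L : ?F"
  then obtain rho h where L: "L = Lgood (topo rho) h" "h : Cs rho" by (elim CollectE exE conjE)
  have "sfel L" using Lgood(2)[OF L(2)] L(1) by (simp add: good_def)
  thus "\<exists>S. finite S & (\<forall>u\<in>L. \<forall>v\<in>L. iv (val u) ** val v : D --> (\<forall>n. iv (val (take n u)) ** val (take n v) : S))"
   using D by (simp add: sfel_def)
 qed
 then obtain f where f: "\<forall>L\<in>?F. finite (f L) & (\<forall>u\<in>L. \<forall>v\<in>L. iv (val u) ** val v : D --> (\<forall>n. iv (val (take n u)) ** val (take n v) : f L))"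
  by (rule bchoice[THEN exE])
 show ?thesis
 proof (rule that[of "\<Union>L\<in>?F. f L"])
  show "finite (\<Union>L\<in>?F. f L)" by (rule finite_UN_I[OF finite_Lgood]) (use f in blast)
  fix rho h u v n assume u: "h : Cs rho" "u : Lgood (topo rho) h" "v : Lgood (topo rho) h" "iv (val u) ** val v : D"
  have L: "Lgood (topo rho) h : ?F" using u(1) by blast
  hence "iv (val (take n u)) ** val (take n v) : f (Lgood (topo rho) h)" using f u by blast
  thus "iv (val (take n u)) ** val (take n v) : (\<Union>L\<in>?F. f L)" using L by blast
 qed
qed

text \<open>By \<open>preX_unique\<close> the two words agree literally up to their common stack, so
  they enter the same synchronous vertex language at the same time. What remains after this segment
  has at most \<open>B\<close> letters, whence the time lag is harmless.\<close>

lemma sfel_Star: "sfel Star"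
proof -
 have SA: "Star <= lists A" by (rule regular_subset[OF regular_Star])
 obtain S where S: "finite S" "S <= gcar" "!!w w'. w : LQ Lgood preX ==> w' : LQ Lgood preX ==> iv (val w) ** val w' : ball 1 ==>
   \<exists>rhoc p u r p' u' r'. psplit Lgood preX S w w' rhoc p u r p' u' r'"
  by (rule Lpsi_pair[OF ugood_Lgood hered_preX], rule that, assumption, assumption, blast)
 obtain N where N: "\<forall>rho h u. h : Cs rho --> u : Lgood (topo rho) h --> val u : tailV nearD --> length u <= N"
  using Lgood_bounded[OF finite_tail(2)[OF nearD(1)]] by blast
 obtain S2 where S2: "finite S2" "!!rho h u v n. h : Cs rho ==> u : Lgood (topo rho) h ==> v : Lgood (topo rho) h ==>
  iv (val u) ** val v : S ==> iv (val (take n u)) ** val (take n v) : S2" using Lgood_sync[OF S(1)] by blast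
 define B where "B = 2 * card (verts Y) * (N + 1)"
 define T where "T = insert gone ((iv ` ball B ## S2) ## ball B)"
 have finT: "finite T" unfolding T_def using S2(1) finite_ball by (intro finite.insertI finite_set_mult finite_imageI) auto
 have base: "iv (val (take n w)) ** val (take n w') : T" if w: "w : Star" "w' : Star" "iv (val w) ** val w' : ball 1" for w w' n
 proof -
  obtain rhoc p u r p' u' r' where "psplit Lgood preX S w w' rhoc p u r p' u' r'" using S(3) w Star_LQ by blast
  hence d: "w = p @ u @ r" "w' = p' @ u' @ r'" "preX rhoc p" "preX rhoc p'"
    "u : Lgood (topo rhoc) (val p)" "u' : Lgood (topo rhoc) (val p')" "r : lists A" "r' : lists A"
   and dS: "\<forall>r1 r1'. prefix r1 r --> prefix r1' r' --> iv (val (p @ u @ r1)) ** val (p' @ u' @ r1') : S"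
   and dN: "\<forall>N. (\<forall>rho h u. h : Cs rho --> u : Lgood (topo rho) h --> val u : tailV nearD --> length u <= N) -->
      length r <= 2 * card (verts Y) * (N + 1) & length r' <= 2 * card (verts Y) * (N + 1)"
   unfolding psplit_def by - (elim conjE, assumption)+
  have e: "p' = p" by (rule preX_unique[OF d(4,3)])
  note P = preX_facts[OF d(3)]
  have lr: "length r <= B" "length r' <= B" using dN N unfolding B_def by blast+
  have uA: "u : lists A" "u' : lists A" using chcD(2)[OF chc_Lgood P(2)] d(5,6) e by auto
  have "iv (val (p @ u @ [])) ** val (p' @ u' @ []) : S" using dS[THEN spec[of _ "[]"], THEN spec[of _ "[]"]] by simp
  hence uS: "iv (val u) ** val u' : S" using uA P(1) by (simp add: e grp_simps)
  show ?thesis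
  proof (cases "n <= length p")
   case True
   hence "take n w = take n p" "take n w' = take n p" using d(1,2) e by simp_all
   thus ?thesis using take_lists[OF P(1), of n] by (simp add: T_def)
  next
   case False
   define m where "m = n - length p"
   let ?a = "take m u" and ?b = "take (m - length u) r" and ?a' = "take m u'" and ?b' = "take (m - length u') r'"
   have t: "take n w = p @ ?a @ ?b" "take n w' = p @ ?a' @ ?b'" using False d(1,2) e by (simp_all add: m_def)
   have l: "?a : lists A" "?a' : lists A" "?b : lists A" "?b' : lists A" using take_lists uA d(7,8) by auto
   have "iv (val (take n w)) ** val (take n w') = iv (val ?b) ** (iv (val ?a) ** val ?a') ** val ?b'"
    unfolding t using P(1) l by (simp add: grp_simps)
   moreover have "iv (val ?a) ** val ?a' : S2" using S2(2)[OF P(2) d(5) _ uS] d(6) e by simp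
   moreover have "val ?b : ball B" "val ?b' : ball B" unfolding ball_def using l lr by auto
   ultimately have "iv (val (take n w)) ** val (take n w') : (iv ` ball B ## S2) ## ball B"
    using set_multI[OF set_multI[OF imageI[of "val ?b" "ball B" "m_inv (pi1 Y)"]]] by simp
   thus ?thesis by (simp add: T_def)
  qed
 qed
 show ?thesis unfolding sfel_def
 proof (intro allI impI)
  fix D :: "('v,'e,'g) pi1elt set" assume D: "finite D"
  show "\<exists>S. finite S & (\<forall>u\<in>Star. \<forall>v\<in>Star. iv (val u) ** val v : D --> (\<forall>n. iv (val (take n u)) ** val (take n v) : S))"
  proof (rule chain[OF Star_onto SA _ _ D])
   show "\<exists>S. finite S & (\<forall>u\<in>Star. \<forall>v\<in>Star. iv (val u) ** val v : ball 1 --> (\<forall>n. iv (val (take n u)) ** val (take n v) : S))"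
    by (intro exI[of _ T] conjI finT ballI impI allI) (rule base)
   fix S T u v w assume a: "u : Star" "v : Star" "w : Star" "\<forall>n. iv (val (take n u)) ** val (take n v) : S" "\<forall>n. iv (val (take n v)) ** val (take n w) : T"
   show "\<forall>n. iv (val (take n u)) ** val (take n w) : S ## T"
   proof
    fix n
    have l: "take n u : lists A" "take n v : lists A" "take n w : lists A" using take_lists SA a(1-3) by blast+
    have "iv (val (take n u)) ** val (take n w) = (iv (val (take n u)) ** val (take n v)) ** (iv (val (take n v)) ** val (take n w))"
     using l by (simp add: grp_simps)
    thus "iv (val (take n u)) ** val (take n w) : S ## T" using set_multI[OF a(4)[rule_format] a(5)[rule_format], of n n] by simp
   qed
  qed
 qed
qed

lemma deploy_class_SA: "deploy_class Y A ev tlet \<psi> : SAClasses (pi1 Y) A ev"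
proof -
 have SA: "Star <= lists A" by (rule regular_subset[OF regular_Star])
 have sy: "sync_aut (pi1 Y) A ev Star" unfolding sync_aut_iff using SA Star_onto sfel_Star regular_Star by simp
 note as = sync_imp_async[OF sy]
 have aS: "apre Star" using as by (simp add: async_aut_iff)
 have "fel gone (LP (Sm \<psi>)) Star"
  by (rule fel_mono[OF deploy_class_fel[OF dep choice_Lgood finite_Lgood] order_refl order_trans[OF Star_LQ LQ_LP]])
 hence "deploy_class Y A ev tlet \<psi> = aclass (pi1 Y) A ev Star"
  unfolding deploy_class_def by (rule aclass_eqI[OF Sm(3)[OF dep] aS])
 moreover have "aclass (pi1 Y) A ev Star : AClasses (pi1 Y) A ev" using as by (simp add: AClasses_def)
 ultimately show ?thesis using aclass_self[OF as] sy by (auto simp: SAClasses_def)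
qed

end

section \<open>Quasi-convexity of vertex groups\<close>

context lettered_group
begin

definition ext_set :: "'a list set => 'x set" where
 "ext_set W = step_set \<union> (\<Union>e\<in>W. val ` set (prefixes e))"

lemma finite_ext_set: "finite W ==> finite (ext_set W)"
 by (simp add: ext_set_def finite_step_set)

lemma af_ext:
 assumes "u : lists A" "e : lists A" "e : W" shows "af (ext_set W) \<one> u (u @ e)"
proof -
 have 1: "af (ext_set W) \<one> u u" by (rule af_mono[OF af_refl[OF assms(1)]]) (simp add: ext_set_def)
 have "af (ext_set W) \<one> [] e"
 proof (rule af_prefixR[OF assms(2) one_closed])
  fix v1 assume v: "prefix v1 e"
  hence "v1 : lists A" by (rule prefix_lists[OF _ assms(2)])
  thus "\<one> \<otimes> val v1 : ext_set W" unfolding ext_set_def using v assms(3)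
   by (intro UnI2 UN_I[of e]) (auto intro: imageI)
 qed
 hence "af (ext_set W) (inv (val u) \<otimes> (\<one> \<otimes> val u)) [] e" using assms(1) by simp
 from af_append[OF 1 this] show ?thesis by simp
qed

text \<open>Endings taken from a fixed finite set can be removed at finite cost.\<close>

lemma af_cut:
 assumes a: "af S d (y @ e) (y' @ e')" and e: "e : W" "e' : W"
 shows "af ((ext_set W <#> S) <#> m_inv G ` ext_set W) d y y'"
proof -
 have l: "y : lists A" "e : lists A" "y' : lists A" "e' : lists A" "d : carrier G" using afD[OF a] by auto
 have "af (m_inv G ` ext_set W) (inv \<one>) (y' @ e') y'" by (rule af_sym[OF af_ext[OF l(3,4) e(2)]])
 from af_trans[OF af_trans[OF af_ext[OF l(1,2) e(1)] a] this] show ?thesis using l by simp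
qed

end

locale sonto = cgog Y A ainv ev tlet
 for Y :: "('v,'e,'g,'f) gog" and A :: "'a set" and ainv and ev and tlet +
 fixes L :: "'a list set"
 assumes syncL: "sync_aut (pi1 Y) A ev L"
begin

lemma L_facts: "L <= lists A" "val ` L = gcar" "sfel L" "regular_lang A L" "fel gone L L"
 using syncL sfel_imp_fel unfolding sync_aut_iff by blast+

text \<open>The prefixes of words of \<open>L\<close>; fellow-traveller bounds reach them through
  short completions.\<close>

definition pf :: "'a list => bool" where
 "pf p \<longleftrightarrow> p : lists A & quot p L ~= {}"

lemma pf_append: assumes "pf (p @ y)" shows "pf p" "p : lists A" "y : lists A" "quot y (quot p L) ~= {}"
 using assms by (auto simp: pf_def quot_def)

lemma pf_word: "p @ y : L ==> pf (p @ y)"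
 using L_facts(1) by (auto simp: pf_def quot_def intro!: exI[of _ "[]"])

abbreviation "QL \<equiv> (%w. quot w L) ` lists A"

lemma finite_QL: "finite QL" by (rule regular_finite_quots[OF L_facts(4)])

text \<open>One completion is picked for each of the finitely many non-empty quotients.\<close>

lemma pf_ext: obtains W where "finite W" "W <= lists A" "!!p. pf p ==> \<exists>e\<in>W. p @ e : L"
proof
 let ?W = "(%q. SOME e. e : q) ` (QL - {{}})"
 have *: "(SOME e. e : q) : q" if "q ~= {}" for q :: "'a list set" using that some_in_eq by blast
 show "finite ?W" using finite_QL by simp
 show "?W <= lists A"
 proof
  fix e assume "e : ?W"
  then obtain w where w: "w : lists A" "quot w L ~= {}" "e = (SOME e. e : quot w L)" by auto
  hence "w @ e : L" using *[OF w(2)] by (simp add: quot_iff)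
  thus "e : lists A" using L_facts(1) by auto
 qed
 fix p assume p: "pf p"
 hence "quot p L : QL - {{}}" by (simp add: pf_def)
 hence "(SOME e. e : quot p L) : ?W" by (rule imageI)
 moreover have "p @ (SOME e. e : quot p L) : L" using *[of "quot p L"] p by (simp add: quot_iff pf_def)
 ultimately show "\<exists>e\<in>?W. p @ e : L" by (rule bexI[rotated])
qed

text \<open>Only the difference of the base points and the two quotients matter, so that finitely many
 pairs of base points suffice.\<close>

lemma QF:
 assumes D: "finite D"
 obtains S where "finite S" "!!p p' y y'. pf (p @ y) ==> pf (p' @ y') ==> iv (val p) ** val p' : D ==>
  iv (val (p @ y)) ** val (p' @ y') : D ==> af S (iv (val p) ** val p') y y'"
proof -
 obtain W where W: "finite W" "W <= lists A" "!!p. pf p ==> \<exists>e\<in>W. p @ e : L" using pf_ext by blast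
 define D1 where "D1 = (iv ` val ` W ## D) ## val ` W"
 have "finite D1" unfolding D1_def using W D by (intro finite_set_mult) auto
 then obtain S1 where S1: "finite S1" "!!u v. u : L ==> v : L ==> iv (val u) ** (gone ** val v) : D1 ==> af S1 gone u v"
  by (rule felE[OF L_facts(5)]) auto
 define rep where "rep k pp \<longleftrightarrow> pf (fst pp) & pf (snd pp) & k = (iv (val (fst pp)) ** val (snd pp), quot (fst pp) L, quot (snd pp) L)" for k pp
 \<comment> \<open>Fixed base words with the same difference and the same quotients. The
   continuations remain legal after them, and the prefixes to be deleted now come from a finite
   list.\<close>
 define P where "P k = (SOME pp. rep k pp)" for k
 define Sk where "Sk k = (iv ` drop_set (fst (P k)) ## S1) ## drop_set (snd (P k))" for k
 define S where "S = (\<Union>k\<in>D \<times> QL \<times> QL. (ext_set W ## Sk k) ## iv ` ext_set W)"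
 have finS: "finite S" unfolding S_def
 proof (rule finite_UN_I)
  show "finite (D \<times> QL \<times> QL)" using D finite_QL by simp
  show "finite ((ext_set W ## Sk k) ## iv ` ext_set W)" for k
   unfolding Sk_def by (intro finite_set_mult finite_imageI finite_ext_set finite_drop_set W(1) S1(1))
 qed
 have "af S (iv (val p) ** val p') y y'" if a: "pf (p @ y)" "pf (p' @ y')" "iv (val p) ** val p' : D" "iv (val (p @ y)) ** val (p' @ y') : D" for p p' y y'
 proof -
  note p = pf_append[OF a(1)] and p' = pf_append[OF a(2)]
  define k where "k = (iv (val p) ** val p', quot p L, quot p' L)"
  have kK: "k : D \<times> QL \<times> QL" using a(3) p(2) p'(2) by (simp add: k_def)
  have "rep k (p, p')" using p p' by (simp add: rep_def k_def)
  hence "rep k (P k)" unfolding P_def by (rule someI)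
  then obtain r r' where r: "P k = (r, r')" "pf r" "pf r'" "iv (val r) ** val r' = iv (val p) ** val p'" "quot r L = quot p L" "quot r' L = quot p' L"
   by (cases "P k") (auto simp: rep_def k_def)
  have rA: "r : lists A" "r' : lists A" using r(2,3) by (auto simp: pf_def)
  obtain e where e: "e : W" "(p @ y) @ e : L" using W(3)[OF a(1)] by blast
  obtain e' where e': "e' : W" "(p' @ y') @ e' : L" using W(3)[OF a(2)] by blast
  have eA: "e : lists A" "e' : lists A" using W(2) e(1) e'(1) by auto
  have "y @ e : quot r L" "y' @ e' : quot r' L" unfolding r(5,6) using e(2) e'(2) by (simp_all add: quot_iff)
  hence m: "r @ y @ e : L" "r' @ y' @ e' : L" by (simp_all add: quot_iff)
  have "iv (val (r @ y @ e)) ** (gone ** val (r' @ y' @ e')) = iv (val e) ** (iv (val y) ** (iv (val r) ** val r') ** val y') ** val e'"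
   using rA p p' eA by (simp add: grp_simps)
  also have "\<dots> = iv (val e) ** (iv (val (p @ y)) ** val (p' @ y')) ** val e'"
   unfolding r(4) using p p' eA by (simp add: grp_simps)
  also have "\<dots> : D1" unfolding D1_def using a(4) e(1) e'(1) by (intro set_multI imageI)
  finally have "af S1 gone (r @ y @ e) (r' @ y' @ e')" by (rule S1(2)[OF m])
  from af_drop_prefixes[OF this] have "af (Sk k) (iv (val r) ** (gone ** val r')) (y @ e) (y' @ e')" by (simp add: Sk_def r(1))
  hence "af (Sk k) (iv (val p) ** val p') (y @ e) (y' @ e')" using r(4) rA by simp
  from af_cut[OF this e(1) e'(1)] show ?thesis by (rule af_mono) (use kK in \<open>unfold S_def, blast\<close>)
 qed
 thus ?thesis using that[OF finS] by blast
qed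

text \<open>The continuation \<open>y\<close> of \<open>p\<close> is compared by \<open>QF\<close>
  with the empty continuation of the same \<open>p\<close>.\<close>

lemma loop:
 obtains S where "finite S" "!!p y y1. pf (p @ y) ==> val y : FF ==> prefix y1 y ==> val y1 : S"
proof -
 let ?D = "insert gone (iv ` FF)"
 have "finite ?D" using finite_FF by simp
 then obtain S where S: "finite S" "!!p p' y y'. pf (p @ y) ==> pf (p' @ y') ==> iv (val p) ** val p' : ?D ==>
  iv (val (p @ y)) ** val (p' @ y') : ?D ==> af S (iv (val p) ** val p') y y'" using QF by blast
 have "val y1 : iv ` S" if a: "pf (p @ y)" "val y : FF" "prefix y1 y" for p y y1
 proof -
  note p = pf_append[OF a(1)]
  have y1: "y1 : lists A" by (rule prefix_lists[OF a(3) p(3)])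
  have "iv (val (p @ y)) ** val (p @ []) = iv (val y)" using p by (simp add: grp_simps)
  hence "af S (iv (val p) ** val p) y []" using S(2)[OF a(1), of p "[]"] p a(2) by simp
  from af_prefixD[OF this a(3)] have "iv (val y1) : S" using p y1 by simp
  hence "iv (iv (val y1)) : iv ` S" by (rule imageI)
  thus ?thesis using y1 by simp
 qed
 thus ?thesis using that[of "iv ` S"] S(1) by blast
qed

text \<open>A word that crosses the last edge of \<open>rho\<close> and returns meets the entry
  coset twice; the part \<open>b\<close>, \<open>c\<close> in between is a loop up to a finite edge
  group.\<close>

lemma bridge:
 assumes p: "p @ y1 @ y2 : L" and V: "V : verts Y" and r: "rho ~= []"
  and s: "suffix rho (stk (val p) V) ~= suffix rho (stk (val (p @ y1)) V)" "suffix rho (stk (val (p @ y1)) V) ~= suffix rho (stk (val (p @ y1 @ y2)) V)"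
 obtains a b c where "y1 = a @ b" "val (p @ a) : Cs rho" "val (b @ c) : FF" "pf ((p @ a) @ b @ c)"
proof -
 have l: "p : lists A" "y1 : lists A" "y2 : lists A" using p L_facts(1) by auto
 have "\<exists>w1 w2. y1 = w1 @ w2 & val p ** val w1 : Cs rho"
  by (rule bottleneck[OF _ l(2) V V r]) (use s(1) l in simp_all)
 then obtain a b where ab: "y1 = a @ b" "val p ** val a : Cs rho" by blast
 have "\<exists>w1 w2. y2 = w1 @ w2 & val (p @ y1) ** val w1 : Cs rho"
  by (rule bottleneck[OF _ l(3) V V r]) (use s(2) l in \<open>simp_all add: G.m_assoc\<close>)
 then obtain c d where cd: "y2 = c @ d" "val (p @ y1) ** val c : Cs rho" by blast
 have l2: "a : lists A" "b : lists A" "c : lists A" "d : lists A" using l ab cd by auto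
 have "iv (val p ** val a) ** (val (p @ y1) ** val c) : FF" by (rule Cs_diff_FF[OF ab(2) cd(2)])
 moreover have "iv (val p ** val a) ** (val (p @ y1) ** val c) = val (b @ c)" using l l2 by (simp add: ab(1) grp_simps)
 ultimately have "val (b @ c) : FF" by simp
 moreover have "pf (((p @ a) @ b @ c) @ d)" by (rule pf_word) (use p ab cd in simp)
 hence "pf ((p @ a) @ b @ c)" by (rule pf_append(1))
 ultimately show ?thesis using that[of a b c] ab l l2 by simp
qed

text \<open>Quasi-convexity of vertex groups. A position off the vertex lies either across the last
  edge of \<open>rho\<close> or in the branch of one child. In both cases it is on an excursion that
  starts and ends at a single edge, and \<open>loop\<close> bounds such excursions.\<close>

lemma QC:
 obtains S where "finite S" "S <= gcar" "gone : S"
  "!!p rho y y1. val p : Cs rho ==> p @ y : L ==> val y : GV (endv rho) ==> prefix y1 y ==>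
   \<exists>g\<in>GV (endv rho). iv (val y1) ** g : S"
proof -
 obtain S1 where S1: "finite S1" "!!p y y1. pf (p @ y) ==> val y : FF ==> prefix y1 y ==> val y1 : S1" using loop by blast
 define S where "S = (insert gone (iv ` S1 \<union> (iv ` S1 ## (%E. iv (stab Y E)) ` edges Y))) \<inter> gcar"
 have "finite S" unfolding S_def using S1(1) fin_edges by (intro finite_Int disjI1 finite.insertI finite_UnI finite_set_mult finite_imageI)
 moreover have "\<exists>g\<in>GV (endv rho). iv (val y1) ** g : S" if a: "val p : Cs rho" "p @ y : L" "val y : GV (endv rho)" "prefix y1 y" for p rho y y1
 proof -
  obtain y2 where y: "y = y1 @ y2" using a(4) by (auto simp: prefix_def)
  have l: "p : lists A" "y1 : lists A" "y2 : lists A" using a(2) L_facts(1) y by auto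
  note V = CsD(5)[OF a(1)]
  have s0: "stk (val p) (endv rho) = rho" by (rule CsD(2)[OF a(1)])
  have s2: "stk (val (p @ y1 @ y2)) (endv rho) = rho"
   using stk_GV[OF CsD(1)[OF a(1)] V a(3)] s0 l by (simp add: y G.m_assoc)
  let ?k = "stk (val (p @ y1)) (endv rho)"
  consider (A) "\<not> suffix rho ?k" | (B) "?k = rho" | (C) "suffix rho ?k" "?k ~= rho" by blast
  thus ?thesis
  proof cases
   case A
   hence r: "rho ~= []" by auto
   obtain u b c where b: "y1 = u @ b" "val (p @ u) : Cs rho" "val (b @ c) : FF" "pf ((p @ u) @ b @ c)"
    by (rule bridge[OF a(2)[unfolded y] V r]) (use A s0 s2 in simp_all)
   have l2: "u : lists A" "b : lists A" using b l by auto
   have "val b : S1" by (rule S1(2)[OF b(4,3)]) simp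
   moreover have "iv (val p) ** val (p @ u) = val u" using l l2 by (simp add: inv_cancel1)
   hence "val u : GV (endv rho)" using Fs_GV[OF CsD(4)[OF a(1)] Cs_diff[OF a(1) b(2)]] by simp
   moreover have "iv (val y1) ** val u = iv (val b)" using l2 by (simp add: b(1) grp_simps)
   ultimately show ?thesis using l2 by (intro bexI[of _ "val u"]) (simp_all add: S_def)
  next
   case B
   have "iv (val p) ** val (p @ y1) : GV (endv rho)" by (rule stk_eq[OF CsD(1)[OF a(1)] _ V]) (use B s0 l in simp_all)
   hence "val y1 : GV (endv rho)" using l by (simp add: inv_cancel1)
   thus ?thesis using l by (intro bexI[of _ "val y1"]) (simp_all add: S_def)
  next
   case C
   then obtain tau where t: "?k = tau @ rho" "tau ~= []" by (auto simp: suffix_def)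
   then obtain tau' s E where t': "?k = tau' @ (s, E) # rho" by (metis append.assoc append_Cons append_Nil append_butlast_last_id surj_pair)
   let ?rho = "(s, E) # rho"
   have n: "\<not> suffix ?rho rho" by (auto simp: suffix_def)
   have k: "suffix ?rho ?k" unfolding t' by (simp add: suffix_def)
   obtain u b c where b: "y1 = u @ b" "val (p @ u) : Cs ?rho" "val (b @ c) : FF" "pf ((p @ u) @ b @ c)"
    by (rule bridge[OF a(2)[unfolded y] V, of ?rho]) (use k n s0 s2 in simp_all)
   have l2: "u : lists A" "b : lists A" using b l by auto
   have "val b : S1" by (rule S1(2)[OF b(4,3)]) simp
   moreover obtain g where g: "g : GV (endv rho)" "val (p @ u) = val p ** g ** stab Y E" using Cs_parent(5)[OF b(2) a(1)] by blast
   have E: "E : edges Y" by (rule Cs_parent(1)[OF b(2)])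
   note cl = GV_closed[OF V g(1)] stab_closed[OF E]
   have "val p ** val u = val p ** (g ** stab Y E)" using g(2) l l2 cl by (simp add: G.m_assoc)
   hence "val u = g ** stab Y E" using l l2 cl by simp
   hence "iv (val y1) ** g = iv (val b) ** iv (stab Y E)" using l2 cl by (simp add: b(1) grp_simps)
   ultimately have "iv (val y1) ** g : iv ` S1 ## (%E. iv (stab Y E)) ` edges Y"
    using E by (simp add: set_multI)
   thus ?thesis using g(1) l cl by (intro bexI[of _ g]) (simp_all add: S_def)
  qed
 qed
 ultimately show ?thesis using that[of S] by (simp add: S_def)
qed

text \<open>Padding with the letter of trivial value gives all blocks one common length, which is
  what keeps the speed constant.\<close>

lemma blocks:
 assumes B: "finite B"
 obtains N where "!!V k. V : verts Y ==> k : GV V ==> k : B ==> \<exists>b\<in>lists (VA V). length b = N & val b = k" "N > 0"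
proof -
 obtain e where e: "e : A" "ev e = gone" "\<forall>V\<in>verts Y. e : VA V" using e_letter by blast
 have "\<forall>z\<in>{z : verts Y \<times> B. snd z : GV (fst z)}. \<exists>b. b : lists (VA (fst z)) & val b = snd z"
 proof
  fix z assume "z : {z : verts Y \<times> B. snd z : GV (fst z)}"
  hence "fst z : verts Y" "snd z : GV (fst z)" by (simp_all add: mem_Times_iff)
  from GV_onto[OF this] show "\<exists>b. b : lists (VA (fst z)) & val b = snd z" by blast
 qed
 then obtain w where w: "\<forall>z\<in>{z : verts Y \<times> B. snd z : GV (fst z)}. w z : lists (VA (fst z)) & val (w z) = snd z"
  by (rule bchoice[THEN exE])
 define N where "N = Suc (\<Sum>z\<in>verts Y \<times> B. length (w z))"
 have "\<exists>b\<in>lists (VA V). length b = N & val b = k" if k: "V : verts Y" "k : GV V" "k : B" for V k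
 proof -
  have z: "(V, k) : verts Y \<times> B" using k by simp
  have wz: "w (V, k) : lists (VA V)" "val (w (V, k)) = k" using w k by auto
  have le: "length (w (V, k)) <= N" unfolding N_def
   by (rule le_SucI, rule member_le_sum[OF z]) (use fin_verts B in simp_all)
  let ?r = "replicate (N - length (w (V, k))) e"
  have r: "?r : lists (VA V)" using e(3) k(1) by (simp add: in_lists_conv_set)
  have "val (replicate n e) = gone" for n by (induction n) (use e in simp_all)
  hence "val (w (V, k) @ ?r) = k" using wz VA_lists[OF wz(1)] VA_lists[OF r] GV_closed[OF k(1,2)] by simp
  thus ?thesis using wz r le by (intro bexI[of _ "w (V, k) @ ?r"]) auto
 qed
 thus ?thesis using that[of N] by (simp add: N_def)
qed

end

section \<open>A deployment from a synchronous structure\<close>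

text \<open>\<open>SS\<close> is the quasi-convexity set. \<open>N\<close> is the common length of
  the blocks leading from a point of the vertex group near one position to a point near the
  next.\<close>

locale strk = sonto Y A ainv ev tlet L
 for Y :: "('v,'e,'g,'f) gog" and A :: "'a set" and ainv and ev and tlet and L +
 fixes SS :: "('v,'e,'g) pi1elt set" and N :: nat
 assumes finSS: "finite SS" and SSc: "SS <= gcar" and SS1: "gone : SS"
  and qc: "[| val p : Cs rho; p @ y : L; val y : GV (endv rho); prefix y1 y |] ==>
   \<exists>g\<in>GV (endv rho). iv (val y1) ** g : SS"
  and blk: "[| V : verts Y; k : GV V; k : (iv ` SS ## ev ` A) ## SS |] ==>
   \<exists>b\<in>lists (VA V). length b = N & val b = k"
  and N_pos: "N > 0"
begin

definition Blk :: "'v => ('a \<times> 'a list) set" where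
 "Blk V = A \<times> {b : lists (VA V). length b = N}"

definition st :: "('v,'e,'g) pi1elt => 'a \<times> 'a list => ('v,'e,'g) pi1elt" where
 "st s p = iv (ev (fst p)) ** (s ** val (snd p))"

text \<open>\<open>z\<close> pairs each letter of \<open>y\<close> with a block of \<open>v\<close>,
  so that following \<open>y\<close> within \<open>SS\<close> becomes a finite walk ending at
  difference \<open>gone\<close>.\<close>

definition trk :: "'v => 'a list => 'a list => bool" where
 "trk V y v \<longleftrightarrow> (\<exists>z\<in>lists (Blk V). walk st SS {gone} gone z & y = map fst z & v = concat (map snd z))"

text \<open>Also contains the differences that occur while a block is being read.\<close>

definition SA :: "('v,'e,'g) pi1elt set" where
 "SA = SS \<union> ((iv ` ev ` A ## SS) ## ball N)"

lemma finite_SA: "finite SA"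
 unfolding SA_def using finSS finite_A finite_ball by (intro finite_UnI finite_set_mult finite_imageI) auto

lemma finite_Blk: "finite (Blk V)"
proof -
 have "finite (VA V)" using finite_A VA_sub by (rule rev_finite_subset)
 hence "finite {b. set b <= VA V & length b = N}" by (rule finite_lists_length_eq)
 moreover have "{b. set b <= VA V & length b = N} = {b : lists (VA V). length b = N}" by (auto simp: in_lists_conv_set)
 ultimately show ?thesis using finite_A by (simp add: Blk_def)
qed

lemma Blk_lists: assumes "z : lists (Blk V)"
 shows "map fst z : lists A" "concat (map snd z) : lists (VA V)" "concat (map snd z) : lists A"
proof -
 show "map fst z : lists A" using assms by (induction z rule: list.induct) (auto simp: Blk_def)
 show "concat (map snd z) : lists (VA V)" using assms by (induction z rule: list.induct) (auto simp: Blk_def)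
 thus "concat (map snd z) : lists A" by (rule VA_lists)
qed

lemma walk_af:
 assumes "z : lists (Blk V)" "walk st SS {gone} s z"
 shows "af SA s (map fst z) (concat (map snd z)) & iv (val (map fst z)) ** (s ** val (concat (map snd z))) = gone"
 using assms
proof (induction z arbitrary: s rule: list.induct)
 case Nil
 thus ?case using SSc by (auto simp: SA_def intro!: af_Nil)
next
 case (Cons p z)
 obtain a b where p: "p = (a, b)" by (cases p)
 have ab: "a : A" "b : lists (VA V)" "length b = N" "z : lists (Blk V)" "s : SS" "walk st SS {gone} (st s p) z"
  using Cons.prems p by (auto simp: Blk_def)
 have bA: "b : lists A" by (rule VA_lists[OF ab(2)])
 have sc: "s : gcar" using ab(5) SSc by blast
 note z = Blk_lists[OF ab(4)]
 note IH = Cons.IH[OF ab(4,6)]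
 have st: "st s p = iv (ev a) ** (s ** val b)" by (simp add: st_def p)
 have "af SA (iv (ev a) ** s) [] b"
 proof (rule af_prefixR[OF bA])
  show "iv (ev a) ** s : gcar" using ab sc by simp
  fix v1 assume v: "prefix v1 b"
  have "v1 : lists A" "length v1 <= N" using prefix_lists[OF v bA] prefix_length_le[OF v] ab(3) by auto
  hence "val v1 : ball N" by (auto simp: ball_def)
  thus "iv (ev a) ** s ** val v1 : SA" unfolding SA_def using ab(1,5) by (intro UnI2 set_multI imageI)
 qed
 hence "af SA s [a] b" by (rule af_left[rotated 3]) (use ab sc in \<open>simp_all add: SA_def\<close>)
 moreover have "iv (val [a]) ** (s ** val b) = st s p" using ab(1) by (simp add: st)
 ultimately have "af SA s ([a] @ map fst z) (b @ concat (map snd z))" using af_append[of SA s "[a]" b] IH by simp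
 moreover have "iv (val (a # map fst z)) ** (s ** val (b @ concat (map snd z))) = iv (val (map fst z)) ** (st s p ** val (concat (map snd z)))"
  using z ab(1) bA sc by (simp add: st grp_simps)
 ultimately show ?case using IH by (simp add: p)
qed

lemma trkD:
 assumes "trk V y v"
 shows "y : lists A" "v : lists (VA V)" "v : lists A" "af SA gone y v" "val v = val y"
proof -
 obtain z where z: "z : lists (Blk V)" "walk st SS {gone} gone z" "y = map fst z" "v = concat (map snd z)" using assms by (auto simp: trk_def)
 show l: "y : lists A" "v : lists (VA V)" "v : lists A" using Blk_lists[OF z(1)] z(3,4) by auto
 have w: "af SA gone y v" "iv (val y) ** (gone ** val v) = gone" using walk_af[OF z(1,2)] z(3,4) by auto
 show "af SA gone y v" by (rule w(1))
 have "val y ** (iv (val y) ** val v) = val y ** gone" using w(2) l by simp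
 thus "val v = val y" using l inv_cancel2[of "val y" "val v"] by simp
qed

lemma walk_pos:
 assumes "z : lists (Blk V)" "walk st SS {gone} s z"
 shows "iv (val (map fst (take n z))) ** (s ** val (concat (map snd (take n z)))) : SS"
 using assms
proof (induction z arbitrary: s n rule: list.induct)
 case Nil
 thus ?case using SSc by auto
next
 case (Cons p z)
 obtain a b where p: "p = (a, b)" by (cases p)
 have ab: "a : A" "b : lists (VA V)" "z : lists (Blk V)" "s : SS" "walk st SS {gone} (st s p) z"
  using Cons.prems p by (auto simp: Blk_def)
 have bA: "b : lists A" by (rule VA_lists[OF ab(2)])
 have sc: "s : gcar" using ab(4) SSc by blast
 show ?case
 proof (cases n)
  case 0
  thus ?thesis using ab(4) sc by simp
 next
  case (Suc m)
  have "take m z : lists (Blk V)" using ab(3) by (metis append_in_lists_conv append_take_drop_id)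
  note t = Blk_lists[OF this]
  have "iv (val (map fst (take m z))) ** (st s p ** val (concat (map snd (take m z)))) : SS" by (rule Cons.IH[OF ab(3,5)])
  thus ?thesis using t ab(1) bA sc by (simp add: Suc p st_def grp_simps)
 qed
qed

lemma Blk_take: "z : lists (Blk V) ==> concat (map snd (take n z)) = take (n * N) (concat (map snd z))"
proof (induction z arbitrary: n rule: list.induct)
 case (Cons p z)
 hence "length (snd p) = N" "z : lists (Blk V)" by (auto simp: Blk_def)
 thus ?case using Cons.IH by (cases n) simp_all
qed simp

lemma trk_pos: assumes "trk V y v" shows "iv (val (take n y)) ** val (take (n * N) v) : SS"
proof -
 obtain z where z: "z : lists (Blk V)" "walk st SS {gone} gone z" "y = map fst z" "v = concat (map snd z)" using assms by (auto simp: trk_def)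
 have "take (n * N) v : lists A" by (rule take_lists[OF trkD(3)[OF assms]])
 thus ?thesis using walk_pos[OF z(1,2), of n] Blk_take[OF z(1), of n] z(3,4) by (simp add: take_map)
qed

text \<open>The coset \<open>c G\<^sub>V\<close> is the vertex group seen from the current point of the path.\<close>

lemma walk_build:
 assumes V: "V : verts Y"
 shows "y : lists A ==> c : gcar ==> g0 : GV V ==> c ** g0 : SS ==>
  (!!y1. prefix y1 y ==> \<exists>g\<in>GV V. iv (val y1) ** (c ** g) : SS) ==> iv c ** val y : GV V ==>
  (y = [] ==> c ** g0 = gone) ==> \<exists>z\<in>lists (Blk V). walk st SS {gone} (c ** g0) z & y = map fst z"
proof (induction y arbitrary: c g0 rule: list.induct)
 case Nil
 thus ?case by (intro bexI[of _ "[]"]) simp_all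
next
 case (Cons a y)
 have a: "a : A" "y : lists A" using Cons.prems(1) by auto
 note c = Cons.prems(2) and g0 = Cons.prems(3)
 have g0c: "g0 : gcar" by (rule GV_closed[OF V g0])
 obtain g1 where g1: "g1 : GV V" "iv (ev a) ** (c ** g1) : SS" "y = [] ==> iv (ev a) ** (c ** g1) = gone"
 proof (cases "y = []")
  case True
  have e: "iv (ev a) ** (c ** (iv c ** ev a)) = gone" using a c by (simp add: grp_simps)
  have "iv c ** ev a : GV V" using Cons.prems(6) True a by simp
  thus ?thesis using that[of "iv c ** ev a"] e SS1 by simp
 next
  case False
  have "prefix [a] (a # y)" by simp
  from Cons.prems(5)[OF this] obtain g where "g : GV V" "iv (val [a]) ** (c ** g) : SS" by blast
  thus ?thesis using that[of g] False a by simp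
 qed
 have g1c: "g1 : gcar" by (rule GV_closed[OF V g1(1)])
 have kV: "iv g0 ** g1 : GV V" by (rule GV_ops(2)[OF V GV_ops(3)[OF V g0] g1(1)])
 have "iv g0 ** g1 = iv (c ** g0) ** ev a ** (iv (ev a) ** (c ** g1))"
  using c g0c g1c ev_closed[OF a(1)] by (simp add: grp_simps)
 also have "\<dots> : (iv ` SS ## ev ` A) ## SS" using Cons.prems(4) a(1) g1(2) by (intro set_multI imageI)
 finally obtain b where b: "b : lists (VA V)" "length b = N" "val b = iv g0 ** g1" using blk[OF V kV] by blast
 let ?c = "iv (ev a) ** c"
 have e: "?c ** g1 = iv (ev a) ** (c ** g1)" using a c g1c by (simp add: G.m_assoc)
 have "\<exists>z\<in>lists (Blk V). walk st SS {gone} (?c ** g1) z & y = map fst z"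
 proof (rule Cons.IH[OF a(2) _ g1(1)])
  show "?c : gcar" using a c by simp
  show "?c ** g1 : SS" unfolding e by (rule g1(2))
  show "y = [] ==> ?c ** g1 = gone" unfolding e by (rule g1(3))
  have "iv ?c ** val y = iv c ** val (a # y)" using a c by (simp add: grp_simps)
  thus "iv ?c ** val y : GV V" using Cons.prems(6) by simp
  fix y1 assume y1: "prefix y1 y"
  hence "prefix (a # y1) (a # y)" by simp
  from Cons.prems(5)[OF this] obtain g where g: "g : GV V" "iv (val (a # y1)) ** (c ** g) : SS" by blast
  have "iv (val (a # y1)) ** (c ** g) = iv (val y1) ** (?c ** g)"
   using a c GV_closed[OF V g(1)] prefix_lists[OF y1 a(2)] by (simp add: grp_simps)
  thus "\<exists>g\<in>GV V. iv (val y1) ** (?c ** g) : SS" using g by auto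
 qed
 then obtain z where z: "z : lists (Blk V)" "walk st SS {gone} (?c ** g1) z" "y = map fst z" by blast
 have "st (c ** g0) (a, b) = ?c ** g1" using a c g0c g1c b(3) by (simp add: st_def grp_simps)
 hence "walk st SS {gone} (c ** g0) ((a, b) # z)" using z(2) Cons.prems(4) by simp
 moreover have "(a, b) # z : lists (Blk V)" using z(1) a(1) b by (simp add: Blk_def)
 ultimately show ?case using z(3) by (intro bexI[of _ "(a, b) # z"]) simp_all
qed

lemma trk_ex:
 assumes p: "val p : Cs rho" "p @ y : L" "val y : GV (endv rho)"
 shows "\<exists>v. trk (endv rho) y v"
proof -
 note V = CsD(5)[OF p(1)]
 have y: "y : lists A" using p(2) L_facts(1) by auto
 have "\<exists>z\<in>lists (Blk (endv rho)). walk st SS {gone} (gone ** gone) z & y = map fst z"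
 proof (rule walk_build[OF V y G.one_closed GV_ops(1)[OF V]])
  fix y1 assume "prefix y1 y"
  from qc[OF p this] obtain g where g: "g : GV (endv rho)" "iv (val y1) ** g : SS" by blast
  thus "\<exists>g\<in>GV (endv rho). iv (val y1) ** (gone ** g) : SS" using GV_closed[OF V g(1)] by (intro bexI[of _ g]) simp_all
 qed (use SS1 y p(3) in simp_all)
 thus ?thesis unfolding trk_def by auto
qed

definition bf :: "'e option => ('v,'e,'g) pi1elt => 'a list" where
 "bf x f = (SOME w. w : lists (VA (dtv Y x)) & val w = f)"

lemma bf: assumes "x : EO" "f : Fs x" shows "bf x f : lists (VA (dtv Y x))" "val (bf x f) = f" "bf x f : lists A"
proof -
 have "\<exists>w. w : lists (VA (dtv Y x)) & val w = f" using GV_onto[OF EO_verts[OF assms(1)] Fs_GV[OF assms]] by blast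
 from someI_ex[OF this] show b: "bf x f : lists (VA (dtv Y x))" and "val (bf x f) = f" by (simp_all add: bf_def)
 show "bf x f : lists A" by (rule VA_lists[OF b])
qed

text \<open>The leading word \<open>bf x f\<close> moves from the reference point of the entry coset
  to the actual entry point, from which the tracked word starts.\<close>

definition Lang :: "'e option => (('v,'e,'g) pi1elt \<times> 'a list set) set => 'a list set" where
 "Lang x T = (\<Union>(f, q)\<in>T. {u @ v | u v. u : {bf x f} & v : {v. \<exists>y\<in>q. trk (dtv Y x) y v}})"

lemma regular_trk: assumes "regular_lang A q" shows "regular_lang (VA V) {v. \<exists>y\<in>q. trk V y v}"
proof -
 have "regular_lang (VA V) {concat (map snd z) | z. z : lists (Blk V) & concat (map (%p. [fst p]) z) : q \<and>
  z : {z : lists (Blk V). walk st SS {gone} gone z}}"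
  by (rule regular_transduction[OF assms finite_Blk _ _ regular_walk[OF finSS]]) (auto simp: Blk_def)
 moreover have "concat (map (%p. [fst p]) z) = map fst z" for z :: "('a \<times> 'a list) list" by (induction z) simp_all
 hence "{concat (map snd z) | z. z : lists (Blk V) & concat (map (%p. [fst p]) z) : q \<and>
  z : {z : lists (Blk V). walk st SS {gone} gone z}} = {v. \<exists>y\<in>q. trk V y v}"
  unfolding trk_def by auto
 ultimately show ?thesis by simp
qed

text \<open>Words of \<open>L\<close> may enter the vertex at any point \<open>h ** f\<close> of the
  entry coset. The pairs record the entry point relative to \<open>h\<close> and the quotient
  reached, and only finitely many sets of such pairs exist.\<close>

definition Tt :: "'e option => ('v,'e,'g) pi1elt => (('v,'e,'g) pi1elt \<times> 'a list set) set" where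
 "Tt x h = {(f, q). f : Fs x & q ~= {} & (\<exists>p\<in>lists A. val p = h ** f & q = quot p L)}"

lemma Tt_sub: "Tt x h <= Fs x \<times> QL"
 by (auto simp: Tt_def)

lemma finite_Tt: "x : EO ==> finite (Tt x h)"
 using finite_subset[OF Tt_sub] finite_Fs finite_QL by blast

lemma TtI: assumes "pf p" "f : Fs x" "val p = h ** f" shows "(f, quot p L) : Tt x h"
 using assms by (auto simp: Tt_def pf_def)

definition Lt :: "'e option => ('v,'e,'g) pi1elt => 'a list set" where
 "Lt x h = Lang x (Tt x h)"

lemma regular_Lt: assumes x: "x : EO" shows "regular_lang (VA (dtv Y x)) (Lt x h)"
 unfolding Lt_def Lang_def
proof (rule regular_UN[OF finite_Tt[OF x]])
 fix fq assume fq: "fq : Tt x h"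
 obtain f q where e: "fq = (f, q)" by (cases fq)
 have "q : QL" "f : Fs x" using fq e Tt_sub by auto
 hence "regular_lang A q" using regular_quot[OF L_facts(4)] by auto
 thus "regular_lang (VA (dtv Y x)) (case fq of (f, q) => {u @ v | u v. u : {bf x f} & v : {v. \<exists>y\<in>q. trk (dtv Y x) y v}})"
  unfolding e prod.case by (intro regular_conc regular_single regular_trk bf(1)[OF x \<open>f : Fs x\<close>])
qed

lemma LtE:
 assumes "u : Lt x h"
 obtains f p y v where "f : Fs x" "p : lists A" "val p = h ** f" "p @ y : L" "trk (dtv Y x) y v" "u = bf x f @ v" "(f, quot p L) : Tt x h"
proof -
 obtain f q y v where a: "(f, q) : Tt x h" "y : q" "trk (dtv Y x) y v" "u = bf x f @ v" using assms unfolding Lt_def Lang_def by auto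
 from a(1) obtain p where p: "f : Fs x" "p : lists A" "val p = h ** f" "q = quot p L" unfolding Tt_def by auto
 have "p @ y : L" using a(2) p(4) by (simp add: quot_iff)
 thus ?thesis using that[of f p y v] a p by simp
qed

lemma LtI: assumes "(f, q) : Tt x h" "y : q" "trk (dtv Y x) y v" shows "bf x f @ v : Lt x h"
 unfolding Lt_def Lang_def using assms by (intro UN_I[OF assms(1)]) auto

text \<open>A word of \<open>L\<close> with value \<open>h ** g\<close> passes the entry coset by
  \<open>bottleneck_from_one\<close>; the part after it has its value in the vertex group and can be
  tracked.\<close>

lemma Lt_vlang: assumes h: "h : Cs rho" shows "vlang (endv rho) (Lt (topo rho) h)"
proof -
 note V = CsD(5)[OF h] and x = CsD(4)[OF h] and hc = CsD(1)[OF h]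
 have sub: "Lt (topo rho) h <= lists (VA (endv rho))" using regular_subset[OF regular_Lt[OF x, of h]] by simp
 have "GV (endv rho) <= val ` Lt (topo rho) h"
 proof
  fix g assume g: "g : GV (endv rho)"
  have gc: "g : gcar" by (rule GV_closed[OF V g])
  obtain w where w: "w : L" "val w = h ** g" using onto_ex[OF L_facts(2), of "h ** g"] hc gc by auto
  have wA: "w : lists A" using w(1) L_facts(1) by blast
  have "stk (val w) (endv rho) = rho" unfolding w(2) using stk_GV[OF hc V g] CsD(2)[OF h] by simp
  then obtain p y where p: "w = p @ y" "val p : Cs rho" using bottleneck_from_one[OF wA V, of rho] by auto
  have l: "p : lists A" "y : lists A" using wA p(1) by auto
  define f where "f = iv h ** val p"
  have f: "f : Fs (topo rho)" unfolding f_def by (rule Cs_diff[OF h p(2)])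
  have fc: "f : gcar" using hc l by (simp add: f_def)
  have vp: "val p = h ** f" using hc l by (simp add: f_def inv_cancel2)
  have "h ** (f ** val y) = h ** g" using w(2) p(1) l vp hc fc by (simp add: G.m_assoc)
  hence fy: "f ** val y = g" using hc fc gc l by simp
  have fV: "f : GV (endv rho)" using Fs_GV[OF x f] by simp
  have "val y = iv f ** g" unfolding fy[symmetric] using fc l by (simp add: inv_cancel1)
  hence yV: "val y : GV (endv rho)" using GV_ops(2,3)[OF V] fV g by simp
  obtain v where v: "trk (endv rho) y v" using trk_ex[OF p(2) _ yV] w(1) p(1) by blast
  have "pf p" using pf_append(1)[OF pf_word] w(1) p(1) by blast
  from TtI[OF this f vp] have "bf (topo rho) f @ v : Lt (topo rho) h"
   by (rule LtI) (use w(1) p(1) v in \<open>simp_all add: quot_iff\<close>)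
  moreover have "val (bf (topo rho) f @ v) = g" using bf[OF x f] trkD(3,5)[OF v] fy by simp
  ultimately show "g : val ` Lt (topo rho) h" by (metis imageI)
 qed
 moreover have "val ` Lt (topo rho) h <= GV (endv rho)" using sub val_GV[OF V] by blast
 ultimately show ?thesis using sub by (simp add: vlang_def)
qed

lemma chc_Lt: "chc Lt"
 unfolding chc_def using Lt_vlang by blast

text \<open>\<open>u\<close> arises from a continuation \<open>y0\<close> of \<open>L\<close>,
  possibly different from \<open>y\<close>. \<open>QF\<close> compares \<open>y\<close> with
  \<open>y0\<close>, and the tracked word with its short beginning follows
  \<open>y0\<close>.\<close>

lemma KL:
 assumes D: "finite D"
 obtains S where "finite S" "!!x h f p y u. x : EO ==> h : gcar ==> f : Fs x ==> val p = h ** f ==> pf (p @ y) ==>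
  u : Lt x h ==> iv (f ** val y) ** val u : D ==> af S (iv f) y u"
proof -
 define DF where "DF = D \<union> FF"
 have "finite DF" using D finite_FF by (simp add: DF_def)
 then obtain S1 where S1: "finite S1" "!!p p' y y'. pf (p @ y) ==> pf (p' @ y') ==> iv (val p) ** val p' : DF ==>
  iv (val (p @ y)) ** val (p' @ y') : DF ==> af S1 (iv (val p) ** val p') y y'" using QF by blast
 define S2 where "S2 x f = iv ` drop_set (bf x f)" for x f
 define S where "S = (\<Union>x\<in>EO. \<Union>f\<in>Fs x. (S1 ## SA) ## S2 x f)"
 have finS: "finite S" unfolding S_def S2_def
  by (intro finite_UN_I finite_EO finite_Fs finite_set_mult finite_imageI finite_drop_set S1(1) finite_SA)
 have "af S (iv f) y u" if a: "x : EO" "h : gcar" "f : Fs x" "val p = h ** f" "pf (p @ y)" "u : Lt x h" "iv (f ** val y) ** val u : D"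
  for x h f p y u
 proof -
  obtain f0 p0 y0 v0 where b: "f0 : Fs x" "p0 : lists A" "val p0 = h ** f0" "p0 @ y0 : L" "trk (dtv Y x) y0 v0" "u = bf x f0 @ v0"
   by (rule LtE[OF a(6)])
  note t = trkD[OF b(5)] and bf0 = bf[OF a(1) b(1)] and p = pf_append[OF a(5)]
  note c = Fs_ops(4)[OF a(1,3)] Fs_ops(4)[OF a(1) b(1)] a(2)
  have d: "iv (val p) ** val p0 = iv f ** f0" unfolding a(4) b(3) using c by (simp add: grp_simps)
  have "iv f ** f0 : Fs x" by (rule Fs_ops(2)[OF a(1) Fs_ops(3)[OF a(1,3)] b(1)])
  hence dF: "iv (val p) ** val p0 : FF" unfolding d FF_def using a(1) by blast
  have "iv (val (p @ y)) ** val (p0 @ y0) = iv (f ** val y) ** val u"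
   using p b(2) t bf0 c by (simp add: a(4) b(3) b(6) grp_simps)
  hence dD: "iv (val (p @ y)) ** val (p0 @ y0) : D" using a(7) by simp
  have "iv (val p) ** val p0 : DF" "iv (val (p @ y)) ** val (p0 @ y0) : DF" using dF dD by (simp_all only: DF_def Un_iff simp_thms)
  hence 1: "af S1 (iv f ** f0) y y0" unfolding d[symmetric] by (rule S1(2)[OF a(5) pf_word[OF b(4)]])
  have "af (S2 x f0) (iv f0) v0 u" unfolding S2_def b(6) using af_sym[OF af_drop[OF bf0(3) t(3)]] bf0(2) by simp
  from af_trans[OF af_trans[OF 1 t(4)] this] have "af ((S1 ## SA) ## S2 x f0) (iv f ** f0 ** gone ** iv f0) y u" .
  moreover have "iv f ** f0 ** gone ** iv f0 = iv f" using c by (simp add: G.m_assoc)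
  ultimately have "af ((S1 ## SA) ## S2 x f0) (iv f) y u" by simp
  thus ?thesis by (rule af_mono) (use a(1) b(1) in \<open>unfold S_def, blast\<close>)
 qed
 thus ?thesis using that[OF finS] by blast
qed

text \<open>Both words are compared by \<open>KL\<close> with the continuation from which
  \<open>u\<close> was built.\<close>

lemma Lt_fel:
 assumes h: "h : Cs rho" "h' : Cs rho" shows "fel (iv h ** h') (Lt (topo rho) h) (Lt (topo rho) h')"
 unfolding fel_def
proof (intro allI impI)
 fix D :: "('v,'e,'g) pi1elt set" assume D: "finite D"
 let ?x = "topo rho"
 note x = CsD(4)[OF h(1)] and hc = CsD(1)[OF h(1)] CsD(1)[OF h(2)]
 define D1 where "D1 = insert gone D"
 have "finite D1" using D by (simp add: D1_def)
 then obtain S where S: "finite S" "!!x h f p y u. x : EO ==> h : gcar ==> f : Fs x ==> val p = h ** f ==> pf (p @ y) ==>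
  u : Lt x h ==> iv (f ** val y) ** val u : D1 ==> af S (iv f) y u" using KL by blast
 have "af (iv ` S ## S) (iv h ** h') u u'"
  if u: "u : Lt ?x h" "u' : Lt ?x h'" "iv (val u) ** (iv h ** h' ** val u') : D" for u u'
 proof -
  obtain f p y v where b: "f : Fs ?x" "p : lists A" "val p = h ** f" "p @ y : L" "trk (dtv Y ?x) y v" "u = bf ?x f @ v"
   by (rule LtE[OF u(1)])
  note t = trkD[OF b(5)] and bf0 = bf[OF x b(1)] and fc = Fs_ops(4)[OF x b(1)]
  have u'A: "u' : lists A" using chcD(2)[OF chc_Lt h(2) u(2)] .
  have vu: "val u = f ** val y" unfolding b(6) using bf0 t by simp
  have 1: "af S (iv f) y u" by (rule S(2)[OF x hc(1) b(1,3) pf_word[OF b(4)] u(1)]) (use vu fc t in \<open>simp add: D1_def\<close>)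
  let ?f = "iv h' ** h ** f"
  have f': "?f : Fs ?x" using Fs_ops(2)[OF x Cs_diff[OF h(2,1)] b(1)] .
  have "val p = h' ** ?f" unfolding b(3) using hc fc by (simp add: grp_simps)
  moreover have "iv (?f ** val y) ** val u' = iv (val u) ** (iv h ** h' ** val u')" unfolding vu using hc fc t u'A by (simp add: grp_simps)
  ultimately have 2: "af S (iv ?f) y u'" using S(2)[OF x hc(2) f' _ pf_word[OF b(4)] u(2)] u(3) by (simp add: D1_def)
  from af_trans[OF af_sym[OF 1] 2] have "af (iv ` S ## S) (iv (iv f) ** iv ?f) u u'" .
  moreover have "iv (iv f) ** iv ?f = iv h ** h'" using hc fc by (simp add: grp_simps)
  ultimately show ?thesis by simp
 qed
 moreover have "finite (iv ` S ## S)" using S(1) by (intro finite_set_mult) auto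
 ultimately show "\<exists>S. finite S & (\<forall>u\<in>Lt ?x h. \<forall>v\<in>Lt ?x h'. iv (val u) ** (iv h ** h' ** val v) : D --> af S (iv h ** h') u v)"
  by blast
qed

end

section \<open>Constant speed, synchronicity and the deployment \<open>psi\<close>\<close>

context alphabet_group
begin

lemma take_diff:
 assumes w: "w : lists A" and ij: "i <= j + K" "j <= i + K"
 shows "inv (val (take i w)) \<otimes> val (take j w) : ball K \<union> m_inv G ` ball K"
proof -
 have *: "inv (val (take i w)) \<otimes> val (take j w) : ball K" if "i <= j" "j <= i + K" for i j
 proof -
  have e: "take j w = take i w @ take (j - i) (drop i w)" using that(1) by (metis le_add_diff_inverse take_add)
  have l: "take i w : lists A" "take (j - i) (drop i w) : lists A" using w take_lists drop_lists by blast+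
  have "inv (val (take i w)) \<otimes> val (take j w) = val (take (j - i) (drop i w))" unfolding e using l by (simp add: inv_cancel1)
  moreover have "length (take (j - i) (drop i w)) <= K" using that by simp
  ultimately show ?thesis unfolding ball_def using l(2) by auto
 qed
 show ?thesis
 proof (cases "i <= j")
  case True
  thus ?thesis using *[OF _ ij(2)] by blast
 next
  case False
  hence "inv (val (take j w)) \<otimes> val (take i w) : ball K" using *[OF _ ij(1)] by simp
  hence "inv (inv (val (take j w)) \<otimes> val (take i w)) : m_inv G ` ball K" by (rule imageI)
  thus ?thesis using take_lists[OF w] by (simp add: inv_mult_inv)
 qed
qed

end

context strk
begin

text \<open>Time \<open>n\<close> on \<open>u\<close> corresponds to time \<open>n div N\<close> on
  a word of \<open>L\<close>. The prefix of that word is first replaced by one of finitely many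
  words with the same value and quotient, so that the initial shift is bounded.\<close>

lemma Lt_shadow:
 assumes h: "h : Cs rho"
 obtains C where "finite C" "!!u. u : Lt (topo rho) h ==> \<exists>w\<in>L. val w = h ** val u & (\<forall>n. iv (val (take n u)) ** (iv h ** val (take (n div N) w)) : C)"
proof -
 let ?x = "topo rho"
 note x = CsD(4)[OF h] and hc = CsD(1)[OF h]
 have "\<forall>z\<in>Tt ?x h. \<exists>p. p : lists A & val p = h ** fst z & snd z = quot p L" unfolding Tt_def by auto
 then obtain P where P: "\<forall>z\<in>Tt ?x h. P z : lists A & val (P z) = h ** fst z & snd z = quot (P z) L" by (rule bchoice[THEN exE])
 \<comment> \<open>Room for the substituted prefix, for the leading word \<open>bf\<close> and for
   one unfinished block.\<close>
 define K where "K = (\<Sum>z\<in>Tt ?x h. length (P z)) + (\<Sum>z\<in>Tt ?x h. length (bf ?x (fst z))) + N"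
 define B where "B = ball K \<union> iv ` ball K"
 define C where "C = (B ## iv ` SS) ## B"
 have finC: "finite C" unfolding C_def B_def by (intro finite_set_mult finite_UnI finite_imageI finite_ball finSS)
 have "\<exists>w\<in>L. val w = h ** val u & (\<forall>n. iv (val (take n u)) ** (iv h ** val (take (n div N) w)) : C)" if u: "u : Lt ?x h" for u
 proof -
  obtain f p y v where b: "f : Fs ?x" "p : lists A" "val p = h ** f" "p @ y : L" "trk (dtv Y ?x) y v" "u = bf ?x f @ v" "(f, quot p L) : Tt ?x h"
   by (rule LtE[OF u])
  note t = trkD[OF b(5)] and bf0 = bf[OF x b(1)] and fc = Fs_ops(4)[OF x b(1)]
  define r where "r = P (f, quot p L)"
  have r: "r : lists A" "val r = h ** f" "quot r L = quot p L" using P[THEN bspec, OF b(7)] by (auto simp: r_def)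
  have "y : quot r L" unfolding r(3) using b(4) by (simp add: quot_iff)
  hence w: "r @ y : L" by (simp add: quot_iff)
  have uA: "u : lists A" using b(6) bf0 t by simp
  have wA: "r @ y : lists A" using r t by simp
  have k1: "length r <= (\<Sum>z\<in>Tt ?x h. length (P z))" unfolding r_def by (rule member_le_sum[OF b(7) _ finite_Tt[OF x]]) simp
  have "length (bf ?x (fst (f, quot p L))) <= (\<Sum>z\<in>Tt ?x h. length (bf ?x (fst z)))" by (rule member_le_sum[OF b(7) _ finite_Tt[OF x]]) simp
  hence k: "length r <= K" "length (bf ?x f) + N <= K" using k1 by (simp_all add: K_def)
  have "iv (val (take n u)) ** (iv h ** val (take (n div N) (r @ y))) : C" for n
  proof -
   define m where "m = n div N"
   have mn: "m * N <= n" "n <= m * N + N" using N_pos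
    by (simp_all add: m_def) (metis add.commute div_mult_mod_eq less_imp_le mod_less_divisor nat_add_left_cancel_le)
   let ?i = "length (bf ?x f) + m * N" and ?j = "length r + m"
   have l: "take (m * N) v : lists A" "take m y : lists A" "take n u : lists A" "take m (r @ y) : lists A"
    using take_lists[OF t(3)] take_lists[OF t(1)] take_lists[OF uA] take_lists[OF wA] by auto
   have e: "take ?i u = bf ?x f @ take (m * N) v" "take ?j (r @ y) = r @ take m y" unfolding b(6) by simp_all
   have 1: "iv (val (take n u)) ** val (take ?i u) : B" unfolding B_def by (rule take_diff[OF uA]) (use mn k in linarith)+
   have 2: "iv (val (take ?j (r @ y))) ** val (take m (r @ y)) : B" unfolding B_def by (rule take_diff[OF wA]) (use k in linarith)+
   have "iv (iv (val (take m y)) ** val (take (m * N) v)) : iv ` SS" by (rule imageI[OF trk_pos[OF b(5)]])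
   moreover have "iv (iv (val (take m y)) ** val (take (m * N) v)) = iv (val (take ?i u)) ** (iv h ** val (take ?j (r @ y)))"
    unfolding e using l bf0 r fc hc by (simp add: grp_simps)
   ultimately have 3: "iv (val (take ?i u)) ** (iv h ** val (take ?j (r @ y))) : iv ` SS" by simp
   have c: "val (take ?i u) : gcar" "val (take ?j (r @ y)) : gcar"
    using take_lists[OF uA] take_lists[OF wA] val_closed by blast+
   have "iv (val (take n u)) ** (iv h ** val (take m (r @ y))) =
    (iv (val (take n u)) ** val (take ?i u)) ** (iv (val (take ?i u)) ** (iv h ** val (take ?j (r @ y)))) ** (iv (val (take ?j (r @ y))) ** val (take m (r @ y)))"
    using c val_closed[OF l(3)] val_closed[OF l(4)] hc by (simp add: grp_simps del: val_append take_append)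
   also have "\<dots> : C" unfolding C_def by (intro set_multI 1 2 3)
   finally show ?thesis by (simp only: m_def)
  qed
  moreover have "val (r @ y) = h ** val u" using r t bf0 fc hc by (simp add: b(6) G.m_assoc)
  ultimately show ?thesis using w by blast
 qed
 thus ?thesis using that[OF finC] by blast
qed

text \<open>Synchronicity of \<open>L\<close> at the common time \<open>n div N\<close> is
  transferred through the two shadows.\<close>

lemma Lt_sfel: assumes h: "h : Cs rho" shows "sfel (Lt (topo rho) h)"
 unfolding sfel_def
proof (intro allI impI)
 fix D :: "('v,'e,'g) pi1elt set" assume D: "finite D"
 note hc = CsD(1)[OF h]
 obtain C where C: "finite C" "!!u. u : Lt (topo rho) h ==> \<exists>w\<in>L. val w = h ** val u & (\<forall>n. iv (val (take n u)) ** (iv h ** val (take (n div N) w)) : C)"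
  by (rule Lt_shadow[OF h]) blast
 obtain S1 where S1: "finite S1" "!!u v n. u : L ==> v : L ==> iv (val u) ** val v : D ==> iv (val (take n u)) ** val (take n v) : S1"
  by (rule sfelE[OF L_facts(3) D]) blast
 define S where "S = (C ## S1) ## iv ` C"
 have finS: "finite S" unfolding S_def by (intro finite_set_mult finite_imageI C(1) S1(1))
 have "iv (val (take n u)) ** val (take n u') : S"
  if u: "u : Lt (topo rho) h" "u' : Lt (topo rho) h" "iv (val u) ** val u' : D" for u u' n
 proof -
  have uA: "u : lists A" "u' : lists A" using chcD(2)[OF chc_Lt h] u by auto
  obtain w where w: "w : L" "val w = h ** val u" "\<forall>n. iv (val (take n u)) ** (iv h ** val (take (n div N) w)) : C" using C(2)[OF u(1)] by blast
  obtain w' where w': "w' : L" "val w' = h ** val u'" "\<forall>n. iv (val (take n u')) ** (iv h ** val (take (n div N) w')) : C" using C(2)[OF u(2)] by blast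
  let ?m = "n div N"
  have l: "take n u : lists A" "take n u' : lists A" "take ?m w : lists A" "take ?m w' : lists A"
   using take_lists uA w(1) w'(1) L_facts(1) by blast+
  have "iv (val w) ** val w' = iv (val u) ** val u'" unfolding w(2) w'(2) using hc uA by (simp add: grp_simps)
  hence 1: "iv (val (take ?m w)) ** val (take ?m w') : S1" using S1(2)[OF w(1) w'(1)] u(3) by simp
  have "iv (val (take n u)) ** val (take n u') = (iv (val (take n u)) ** (iv h ** val (take ?m w))) ** (iv (val (take ?m w)) ** val (take ?m w')) **
   iv (iv (val (take n u')) ** (iv h ** val (take ?m w')))" using l hc by (simp add: grp_simps)
  also have "\<dots> : S" unfolding S_def by (intro set_multI imageI 1 w(3)[rule_format] w'(3)[rule_format])
  finally show ?thesis .
 qed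
 thus "\<exists>S. finite S & (\<forall>u\<in>Lt (topo rho) h. \<forall>v\<in>Lt (topo rho) h. iv (val u) ** val v : D --> (\<forall>n. iv (val (take n u)) ** val (take n v) : S))"
  using finS by blast
qed

lemma Lt_self_fel: assumes h: "h : Cs rho" shows "fel gone (Lt (topo rho) h) (Lt (topo rho) h)"
 using Lt_fel[OF h h] CsD(1)[OF h] by simp

definition psi :: "'e option => ('v,'e,'g) pi1elt => 'a list set set" where
 "psi x h = (if (x, h) : deploy_dom Y then vcls (dtv Y x) (Lt x h) else {})"

lemma psi_eq: "h : Cs rho ==> psi (topo rho) h = vcls (endv rho) (Lt (topo rho) h)"
 using deploy_dom_iff[of "topo rho" h] by (auto simp: psi_def)

lemma psi_facts: assumes h: "h : Cs rho"
 shows "psi (topo rho) h : VCl (endv rho)" "Lt (topo rho) h : psi (topo rho) h" "psi (topo rho) h : SAC (endv rho)"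
proof -
 note V = CsD(5)[OF h]
 have r: "regular_lang (VA (endv rho)) (Lt (topo rho) h)" using regular_Lt[OF CsD(4)[OF h], of h] by simp
 show a: "psi (topo rho) h : VCl (endv rho)" and b: "Lt (topo rho) h : psi (topo rho) h"
  unfolding psi_eq[OF h] by (rule V_vcls_VCl[OF V Lt_vlang[OF h] r Lt_self_fel[OF h]])+
 have "sync_aut (VG (endv rho)) (VA (endv rho)) (vev Y ev (endv rho)) (Lt (topo rho) h)"
  using V_sync_iff[OF V] Lt_vlang[OF h] r Lt_sfel[OF h] by blast
 thus "psi (topo rho) h : SAC (endv rho)" unfolding SAClasses_def using a b by blast
qed

text \<open>Contains every possible value of \<open>Tt\<close>; its finiteness gives the finite
  image of \<open>psi\<close> and finitely many states.\<close>

definition TTs :: "(('v,'e,'g) pi1elt \<times> 'a list set) set set" where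
 "TTs = Pow ((\<Union>x\<in>EO. Fs x) \<times> QL)"

lemma finite_TTs: "finite TTs"
 unfolding TTs_def using finite_EO finite_Fs finite_QL by simp

lemma Tt_TTs: "x : EO ==> Tt x h : TTs"
 unfolding TTs_def using Tt_sub[of x h] by blast

lemma finite_range_Lt: "finite {Lt (topo rho) h | rho h. h : Cs rho}"
proof (rule finite_subset)
 show "{Lt (topo rho) h | rho h. h : Cs rho} <= (%(x, T). Lang x T) ` (EO \<times> TTs)"
 proof
  fix z assume "z : {Lt (topo rho) h | rho h. h : Cs rho}"
  then obtain rho h where z: "z = Lt (topo rho) h" "h : Cs rho" by (elim CollectE exE conjE)
  show "z : (%(x, T). Lang x T) ` (EO \<times> TTs)"
   by (rule image_eqI[of _ _ "(topo rho, Tt (topo rho) h)"]) (use z CsD(4)[OF z(2)] Tt_TTs in \<open>simp_all add: Lt_def\<close>)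
 qed
 show "finite ((%(x, T). Lang x T) ` (EO \<times> TTs))" using finite_EO finite_TTs by simp
qed

lemma psi_deployment: "deployment Y A ev psi"
 unfolding deployment_def
proof (intro conjI)
 have dom: "\<exists>rho. fst z = topo rho & snd z : Cs rho" if "z : deploy_dom Y" for z
  using that deploy_dom_iff[of "fst z" "snd z"] by simp
 show "\<forall>(x, h)\<in>deploy_dom Y. psi x h : VCl (dtv Y x)"
 proof
  fix z assume "z : deploy_dom Y"
  then obtain rho where "fst z = topo rho" "snd z : Cs rho" using dom by blast
  thus "case z of (x, h) => psi x h : VCl (dtv Y x)" using psi_facts(1)[of "snd z" rho] by (simp add: case_prod_beta)
 qed
 show "\<forall>x h. (x, h) \<notin> deploy_dom Y --> psi x h = {}" by (simp add: psi_def)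
 show "finite ((%(x, h). psi x h) ` deploy_dom Y)"
 proof (rule finite_subset)
  show "(%(x, h). psi x h) ` deploy_dom Y <= (%(x, T). vcls (dtv Y x) (Lang x T)) ` (EO \<times> TTs)"
  proof (rule image_subsetI)
   fix z assume z: "z : deploy_dom Y"
   then obtain rho where r: "fst z = topo rho" "snd z : Cs rho" using dom by blast
   show "(case z of (x, h) => psi x h) : (%(x, T). vcls (dtv Y x) (Lang x T)) ` (EO \<times> TTs)"
    by (rule image_eqI[of _ _ "(topo rho, Tt (topo rho) (snd z))"])
     (use r psi_eq[OF r(2)] CsD(4)[OF r(2)] Tt_TTs in \<open>simp_all add: Lt_def case_prod_beta\<close>)
  qed
  show "finite ((%(x, T). vcls (dtv Y x) (Lang x T)) ` (EO \<times> TTs))" using finite_EO finite_TTs by simp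
 qed
 show "\<forall>E\<in>edges Y. \<forall>h\<in>Gcal Y E. \<forall>f\<in>FG E. psi (Some E) h = act_class (VG (etgt Y E)) (VA (etgt Y E)) (vev Y ev (etgt Y E)) (bd1 Y E f)
  (psi (Some E) (h ** vincl Y (etgt Y E) (bd1 Y E f)))"
 proof (intro ballI)
  fix E h f assume a: "E : edges Y" "h : Gcal Y E" "f : FG E"
  obtain s rho where h: "h : Cs ((s, E) # rho)" using a(2) Gcal_iff by blast
  let ?f = "vincl Y (etgt Y E) (bd1 Y E f)"
  have "?f : Fs (Some E)" unfolding Fs_Some using a(3) by blast
  hence h': "h ** ?f : Cs ((s, E) # rho)" using Cs_mult[OF h] by simp
  have fc: "?f : gcar" by (rule vincl_closed[OF tgt_in[OF a(1)] bd1_closed[OF a(1,3)]])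
  have "fel ?f (Lt (Some E) h) (Lt (Some E) (h ** ?f))" using Lt_fel[OF h h'] CsD(1)[OF h] fc by (simp add: inv_cancel1)
  thus "psi (Some E) h = act_class (VG (etgt Y E)) (VA (etgt Y E)) (vev Y ev (etgt Y E)) (bd1 Y E f) (psi (Some E) (h ** ?f))"
   using V_act_iff[OF tgt_in[OF a(1)], of "psi (Some E) h" "Lt (Some E) h" "psi (Some E) (h ** ?f)" "Lt (Some E) (h ** ?f)" "bd1 Y E f"]
    psi_facts(1,2)[OF h] psi_facts(1,2)[OF h'] bd1_closed[OF a(1,3)] by simp
 qed
qed

lemma psi_choice: "choice psi Lt"
 unfolding choice_def using psi_facts(2) by blast

lemma ugood_Lt: "ugood Lt"
 by (rule choice_ugood[OF psi_deployment psi_choice finite_range_Lt])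

definition nxt :: "(('v,'e,'g) pi1elt \<times> 'a list set) set => ('v,'e,'g) pi1elt => 'e => (('v,'e,'g) pi1elt \<times> 'a list set) set" where
 "nxt T g E = {(f', q'). f' : Fs (Some E) & q' ~= {} & (\<exists>z\<in>T. \<exists>y\<in>lists A. fst z ** val y = g ** (stab Y E ** f') & q' = quot y (snd z))}"

lemma nxtE:
 assumes "w : nxt T g E"
 obtains f' f q y where "w = (f', quot y q)" "f' : Fs (Some E)" "quot y q ~= {}" "(f, q) : T" "y : lists A" "f ** val y = g ** (stab Y E ** f')"
proof -
 obtain f' q' where w: "w = (f', q')" by (cases w)
 have "f' : Fs (Some E) & q' ~= {} & (\<exists>z\<in>T. \<exists>y\<in>lists A. fst z ** val y = g ** (stab Y E ** f') & q' = quot y (snd z))"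
  using assms by (simp add: nxt_def w)
 then obtain z y where z: "f' : Fs (Some E)" "q' ~= {}" "z : T" "y : lists A" "fst z ** val y = g ** (stab Y E ** f')" "q' = quot y (snd z)"
  by (elim conjE bexE)
 show ?thesis by (rule that[of f' y "snd z" "fst z"]) (use z w in simp_all)
qed

text \<open>A word of \<open>L\<close> arriving at the next entry coset has passed that of
  \<open>rho\<close> by the bottleneck property, so no quotient is missed. The new data thus depend
  on the old data and on the value of the segment only.\<close>

lemma nxt_eq:
 assumes h: "h : Cs rho" and g: "g : gcar" and h1: "h ** g ** stab Y E : Cs ((s, E) # rho)"
 shows "Tt (Some E) (h ** g ** stab Y E) = nxt (Tt (topo rho) h) g E"
proof (intro equalityI subsetI)
 note E = Cs_parent(1)[OF h1] and hc = CsD(1)[OF h] and x = CsD(4)[OF h]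
 note sc = stab_closed[OF E]
 have xE: "Some E : EO" using E by simp
 {
  fix z assume "z : Tt (Some E) (h ** g ** stab Y E)"
  then obtain f' p' where z: "z = (f', quot p' L)" "f' : Fs (Some E)" "quot p' L ~= {}" "p' : lists A" "val p' = h ** g ** stab Y E ** f'"
   unfolding Tt_def by auto
  note fc = Fs_ops(4)[OF xE z(2)]
  have "val p' : Cs ((s, E) # rho)" unfolding z(5) using Cs_mult[OF h1] z(2) by simp
  from CsD(2,5)[OF this] have "stk (val p') (etgt Y E) = (s, E) # rho" "etgt Y E : verts Y" by simp_all
  then obtain p y where p: "p' = p @ y" "val p : Cs rho" using bottleneck_from_one[OF z(4), of "etgt Y E" rho] by (auto simp: suffix_Cons)
  have l: "p : lists A" "y : lists A" using z(4) p(1) by auto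
  define f where "f = iv h ** val p"
  have f: "f : Fs (topo rho)" unfolding f_def by (rule Cs_diff[OF h p(2)])
  have vp: "val p = h ** f" using hc l by (simp add: f_def inv_cancel2)
  have "pf (p @ y)" using z(3,4) p(1) by (simp add: pf_def)
  note T = TtI[OF pf_append(1)[OF this] f vp]
  have "val p ** val y = h ** g ** stab Y E ** f'" using z(5) p(1) l by simp
  hence "f ** val y = g ** (stab Y E ** f')" unfolding f_def using hc g sc fc l by (simp add: grp_simps)
  thus "z : nxt (Tt (topo rho) h) g E"
   unfolding nxt_def using z(1,2,3) p(1) l(2) T by (auto simp: quot_append intro!: bexI[OF _ T])
 next
  fix z assume "z : nxt (Tt (topo rho) h) g E"
  then obtain f' f q y where z: "z = (f', quot y q)" "f' : Fs (Some E)" "quot y q ~= {}" "(f, q) : Tt (topo rho) h" "y : lists A"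
   "f ** val y = g ** (stab Y E ** f')" by (rule nxtE)
  from z(4) obtain p where p: "f : Fs (topo rho)" "p : lists A" "val p = h ** f" "q = quot p L" unfolding Tt_def by auto
  note fc = Fs_ops(4)[OF xE z(2)] Fs_ops(4)[OF x p(1)]
  have "val (p @ y) = h ** (f ** val y)" using p z(5) hc fc by (simp add: G.m_assoc)
  also have "\<dots> = h ** g ** stab Y E ** f'" unfolding z(6) using hc g sc fc by (simp add: G.m_assoc)
  finally have "val (p @ y) = h ** g ** stab Y E ** f'" .
  moreover have "quot y q = quot (p @ y) L" using p(4) by (simp add: quot_append)
  moreover have "p @ y : lists A" using p z(5) by simp
  ultimately show "z : Tt (Some E) (h ** g ** stab Y E)" unfolding Tt_def using z(1,2,3) by blast
 }
qed

text \<open>A continuation \<open>y\<close> witnessing the transition follows \<open>u\<close>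
  within a fixed set by \<open>KL\<close>, so its existence can be tested by the automaton of
  \<open>regular_af\<close>.\<close>

lemma regular_hit:
 assumes h: "h : Cs rho" and E: "E : edges Y" and f': "f' : Fs (Some E)"
 shows "regular_lang A {u : Lt (topo rho) h. (f', q') : nxt (Tt (topo rho) h) (val u) E}"
proof (cases "q' = {}")
 case True
 hence "{u : Lt (topo rho) h. (f', q') : nxt (Tt (topo rho) h) (val u) E} = {}" by (simp add: nxt_def)
 thus ?thesis by (simp only: regular_empty)
next
 case False
 let ?x = "topo rho" and ?d = "iv (stab Y E ** f')"
 note hc = CsD(1)[OF h] and x = CsD(4)[OF h]
 have "Some E : EO" using E by simp
 note fc' = Fs_ops(4)[OF this f'] stab_closed[OF E]
 obtain S where S: "finite S" "!!x h f p y u. x : EO ==> h : gcar ==> f : Fs x ==> val p = h ** f ==> pf (p @ y) ==>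
  u : Lt x h ==> iv (f ** val y) ** val u : {?d} ==> af S (iv f) y u" by (rule KL[of "{?d}"]) (simp, blast)
 have rL: "regular_lang A (Lt ?x h)" using regular_mono_alphabet[OF regular_Lt[OF x, of h] VA_sub] by simp
 define H where "H z = {u : lists A. \<exists>y\<in>{y : lists A. quot (y @ []) (snd z) = q'}. af S (iv (fst z)) y u & iv (val y) ** (iv (fst z) ** val u) = ?d}"
  for z :: "('v,'e,'g) pi1elt \<times> 'a list set"
 have rH: "regular_lang A (H z)" if z: "z : Tt ?x h" for z
 proof -
  have "snd z : QL" using subsetD[OF Tt_sub z] by (simp only: mem_Times_iff)
  hence "regular_lang A (snd z)" using regular_quot[OF L_facts(4)] by (elim imageE) simp
  thus ?thesis unfolding H_def by (intro regular_af regular_quot_eq S(1)) auto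
 qed
 have rU: "regular_lang A (Lt ?x h \<inter> (\<Union>z\<in>Tt ?x h. H z))" by (intro regular_Int rL regular_UN finite_Tt[OF x] rH)
 have eq: "f ** val y = val u ** (stab Y E ** f') \<longleftrightarrow> iv (val y) ** (iv f ** val u) = ?d"
  if "y : lists A" "u : lists A" "f : gcar" for f y u
 proof -
  have c: "f ** val y : gcar" "val u : gcar" "stab Y E ** f' : gcar" using that fc' by simp_all
  have e: "iv (val y) ** (iv f ** val u) = iv (f ** val y) ** val u" using that by (simp add: grp_simps)
  have "f ** val y = val u ** (stab Y E ** f') \<longleftrightarrow> iv (val u) ** (f ** val y) = stab Y E ** f'" using inv_mult_eq_iff[OF c(2,1,3)] by simp
  also have "\<dots> \<longleftrightarrow> iv (iv (val u) ** (f ** val y)) = ?d"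
  proof
   assume "iv (iv (val u) ** (f ** val y)) = ?d"
   hence "iv (iv (iv (val u) ** (f ** val y))) = iv ?d" by simp
   thus "iv (val u) ** (f ** val y) = stab Y E ** f'" using c by (simp del: G.inv_mult_group)
  qed simp
  also have "iv (iv (val u) ** (f ** val y)) = iv (f ** val y) ** val u" using inv_mult_inv[OF c(2,1)] .
  finally show ?thesis unfolding e .
 qed
 have "{u : Lt ?x h. (f', q') : nxt (Tt ?x h) (val u) E} = Lt ?x h \<inter> (\<Union>z\<in>Tt ?x h. H z)"
 proof (intro equalityI subsetI)
  fix u assume "u : {u : Lt ?x h. (f', q') : nxt (Tt ?x h) (val u) E}"
  hence u: "u : Lt ?x h" and n: "(f', q') : nxt (Tt ?x h) (val u) E" by simp_all
  from n have "\<exists>z\<in>Tt ?x h. \<exists>y\<in>lists A. fst z ** val y = val u ** (stab Y E ** f') & q' = quot y (snd z)"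
   by (simp add: nxt_def)
  then obtain z y where y: "z : Tt ?x h" "y : lists A" "fst z ** val y = val u ** (stab Y E ** f')" "q' = quot y (snd z)"
   by (elim bexE conjE)
  have uA: "u : lists A" by (rule chcD(2)[OF chc_Lt h u])
  have "fst z : Fs ?x & (\<exists>p\<in>lists A. val p = h ** fst z & snd z = quot p L)" using y(1) by (simp add: Tt_def case_prod_beta)
  then obtain p where p: "fst z : Fs ?x" "p : lists A" "val p = h ** fst z" "snd z = quot p L" by (elim conjE bexE)
  note fc = Fs_ops(4)[OF x p(1)]
  have "pf (p @ y)" unfolding pf_def using p y False by (simp add: quot_append)
  moreover have d: "iv (val y) ** (iv (fst z) ** val u) = ?d" using eq[OF y(2) uA fc] y(3) by simp
  moreover have "iv (fst z ** val y) ** val u = iv (val y) ** (iv (fst z) ** val u)" using y(2) uA fc by (simp add: grp_simps)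
  ultimately have "af S (iv (fst z)) y u" by (intro S(2)[OF x hc p(1,3) _ u]) simp_all
  hence "u : H z" unfolding H_def using uA y(2,4) d by (intro CollectI conjI bexI[of _ y]) simp_all
  thus "u : Lt ?x h \<inter> (\<Union>z\<in>Tt ?x h. H z)" using u y(1) by blast
 next
  fix u assume "u : Lt ?x h \<inter> (\<Union>z\<in>Tt ?x h. H z)"
  then obtain z where u: "u : Lt ?x h" "z : Tt ?x h" "u : H z" by blast
  then obtain y where y: "u : lists A" "y : lists A" "quot y (snd z) = q'" "iv (val y) ** (iv (fst z) ** val u) = ?d" unfolding H_def by auto
  have "fst z : Fs ?x" using u(2) by (simp add: Tt_def case_prod_beta)
  note fc = Fs_ops(4)[OF x this]
  have "fst z ** val y = val u ** (stab Y E ** f')" using eq[OF y(2,1) fc] y(4) by simp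
  hence "(f', q') : nxt (Tt ?x h) (val u) E" unfolding nxt_def using f' False u(2) y(2,3) by auto
  thus "u : {u : Lt ?x h. (f', q') : nxt (Tt ?x h) (val u) E}" using u(1) by simp
 qed
 thus ?thesis using rU by (simp only:)
qed

lemma nxt_sub: "nxt (Tt x h) g E <= Fs (Some E) \<times> QL"
proof
 fix w assume "w : nxt (Tt x h) g E"
 then obtain f' f q y where w: "w = (f', quot y q)" "f' : Fs (Some E)" "(f, q) : Tt x h" "y : lists A" by (rule nxtE)
 obtain p where "p : lists A" "q = quot p L" using w(3) unfolding Tt_def by auto
 hence "quot y q = quot (p @ y) L" "p @ y : lists A" using w(4) by (simp_all add: quot_append)
 hence "quot y q : QL" by (rule image_eqI)
 thus "w : Fs (Some E) \<times> QL" using w(1,2) by simp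
qed

definition lab :: "'e option => (('v,'e,'g) pi1elt \<times> 'a list set) set => 'e => (('v,'e,'g) pi1elt \<times> 'a list set) set => 'a list set" where
 "lab x T E T' = {u : Lang x T. nbt x (val u) E & nxt T (val u) E = T'}"

text \<open>Prescribing the whole set of new data is a Boolean combination of finitely many
  conditions covered by \<open>regular_hit\<close>.\<close>

lemma regular_lab:
 assumes h: "h : Cs rho" and E: "E : edges Y"
 shows "regular_lang A (lab (topo rho) (Tt (topo rho) h) E T')"
proof -
 let ?x = "topo rho" and ?L = "Lt (topo rho) h"
 let ?U = "Fs (Some E) \<times> QL"
 note x = CsD(4)[OF h]
 have rL: "regular_lang A ?L" using regular_mono_alphabet[OF regular_Lt[OF x, of h] VA_sub] by simp
 define N1 where "N1 = {u : ?L. nbt ?x (val u) E}"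
 have rN: "regular_lang A N1" unfolding N1_def by (rule regular_nbt[OF rL Lt_self_fel[OF h] x])
 define H where "H z = {u : ?L. z : nxt (Tt ?x h) (val u) E}" for z
 have rH: "regular_lang A (H z)" if "z : ?U" for z
  unfolding H_def using regular_hit[OF h E, of "fst z" "snd z"] that by auto
 have finU: "finite ?U" using finite_Fs[of "Some E"] E finite_QL by simp
 show ?thesis
 proof (cases "T' <= ?U")
  case True
  have "lab ?x (Tt ?x h) E T' = (N1 \<inter> (\<Inter>z\<in>T'. H z)) \<inter> (\<Inter>z\<in>?U - T'. ?L - H z)"
  proof (intro equalityI subsetI)
   fix u assume "u : lab ?x (Tt ?x h) E T'"
   thus "u : (N1 \<inter> (\<Inter>z\<in>T'. H z)) \<inter> (\<Inter>z\<in>?U - T'. ?L - H z)" by (auto simp: lab_def N1_def H_def Lt_def)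
  next
   fix u assume u: "u : (N1 \<inter> (\<Inter>z\<in>T'. H z)) \<inter> (\<Inter>z\<in>?U - T'. ?L - H z)"
   have uL: "u : ?L" using u by (simp add: N1_def)
   have "T' <= nxt (Tt ?x h) (val u) E" using u by (auto simp: H_def)
   moreover have "nxt (Tt ?x h) (val u) E <= T'"
   proof
    fix z assume z: "z : nxt (Tt ?x h) (val u) E"
    have "z : ?U" by (rule subsetD[OF nxt_sub z])
    moreover have "u : H z" using z uL by (simp add: H_def)
    ultimately show "z : T'" using u by blast
   qed
   ultimately have "nxt (Tt ?x h) (val u) E = T'" by (rule equalityI[rotated])
   thus "u : lab ?x (Tt ?x h) E T'" using u by (simp add: lab_def N1_def Lt_def)
  qed
  moreover have "regular_lang A ((N1 \<inter> (\<Inter>z\<in>T'. H z)) \<inter> (\<Inter>z\<in>?U - T'. ?L - H z))"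
  proof (rule regular_INT[OF _ _ regular_INT[OF _ _ rN]])
   show "finite (?U - T')" using finU by (rule finite_Diff)
   show "finite T'" using True finU by (rule finite_subset)
   show "regular_lang A (?L - H z)" if "z : ?U - T'" for z by (rule regular_Diff[OF rL rH[OF DiffD1[OF that]]])
   show "regular_lang A (H z)" if "z : T'" for z by (rule rH[OF subsetD[OF True that]])
  qed
  ultimately show ?thesis by (simp only:)
 next
  case False
  have "u \<notin> lab ?x (Tt ?x h) E T'" for u
  proof
   assume "u : lab ?x (Tt ?x h) E T'"
   hence "nxt (Tt ?x h) (val u) E = T'" by (simp add: lab_def)
   thus False using nxt_sub[of ?x h "val u" E] False by simp
  qed
  hence "lab ?x (Tt ?x h) E T' = {}" by blast
  thus ?thesis by simp
 qed
qed

end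

section \<open>The automaton for the new normal-form language, and its class\<close>

context strk
begin

text \<open>Only data that actually occur are states, because \<open>regular_lab\<close> provides
  regular labels for these.\<close>

definition \<Omega> :: "('e option \<times> (('v,'e,'g) pi1elt \<times> 'a list set) set) set" where
 "\<Omega> = {(topo rho, Tt (topo rho) h) | rho h. h : Cs rho}"

definition LabT where
 "LabT s s' = (\<Union>E\<in>{E : edges Y. fst s' = Some E & esrc Y E = dtv Y (fst s)}. {u @ v | u v. u : lab (fst s) (snd s) E (snd s') & v : {tw E}})"

definition FinT where
 "FinT s = Lang (fst s) (snd s)"

lemma OmegaI: "h : Cs rho ==> (topo rho, Tt (topo rho) h) : \<Omega>"
 unfolding \<Omega>_def by blast

lemma OmegaE: assumes "s : \<Omega>" obtains rho h where "s = (topo rho, Tt (topo rho) h)" "h : Cs rho"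
 using assms unfolding \<Omega>_def by blast

lemma finite_Omega: "finite \<Omega>"
proof (rule finite_subset)
 show "\<Omega> <= EO \<times> TTs"
 proof
  fix s assume "s : \<Omega>"
  then obtain rho h where s: "s = (topo rho, Tt (topo rho) h)" "h : Cs rho" by (rule OmegaE)
  show "s : EO \<times> TTs" unfolding s(1) by (rule SigmaI[OF CsD(4)[OF s(2)] Tt_TTs[OF CsD(4)[OF s(2)]]])
 qed
 show "finite (EO \<times> TTs)" using finite_EO finite_TTs by simp
qed

lemma LabTI:
 assumes "E : edges Y" "esrc Y E = dtv Y x" "u : lab x T E T'"
 shows "u @ tw E : LabT (x, T) (Some E, T')"
 unfolding LabT_def using assms by (intro UN_I[of E] CollectI conjI exI[of _ u] exI[of _ "tw E"]) simp_all

lemma LabTE: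
 assumes "w : LabT (x, T) s'"
 obtains E u where "E : edges Y" "fst s' = Some E" "esrc Y E = dtv Y x" "u : lab x T E (snd s')" "w = u @ tw E"
 using assms unfolding LabT_def by auto

lemma regular_paths_Lt: "regular_lang A {w. ((None, Tt None gone), w) : paths LabT FinT \<Omega>}"
proof (rule regular_paths[OF finite_Omega])
 have "gone : Cs []" by (simp add: Cs_Nil)
 from OmegaI[OF this] show "(None, Tt None gone) : \<Omega>" by simp
 fix s assume "s : \<Omega>"
 then obtain rho h where s: "s = (topo rho, Tt (topo rho) h)" "h : Cs rho" by (rule OmegaE)
 have "regular_lang A (Lt (topo rho) h)" by (rule regular_mono_alphabet[OF regular_Lt[OF CsD(4)[OF s(2)]] VA_sub])
 thus "regular_lang A (FinT s)" by (simp add: FinT_def s(1) Lt_def)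
 fix s' assume "s' : \<Omega>"
 show "regular_lang A (LabT s s')" unfolding LabT_def
 proof (rule regular_UN)
  show "finite {E : edges Y. fst s' = Some E & esrc Y E = dtv Y (fst s)}" using fin_edges by simp
  fix E assume "E : {E : edges Y. fst s' = Some E & esrc Y E = dtv Y (fst s)}"
  hence E: "E : edges Y" by simp
  have "regular_lang A (lab (fst s) (snd s) E (snd s'))" unfolding s(1) fst_conv snd_conv by (rule regular_lab[OF s(2) E])
  thus "regular_lang A {u @ v | u v. u : lab (fst s) (snd s) E (snd s') & v : {tw E}}"
   by (rule regular_conc[OF _ regular_single[OF tw_facts(1)[OF E]]])
 qed
qed

lemma pre_next:
 assumes p: "pre Lt rho p" "u : Lt (topo rho) (val p)" and E: "E : edges Y" and C: "val (p @ u @ tw E) : Cs ((s, E) # rho)"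
 shows "Tt (Some E) (val (p @ u @ tw E)) = nxt (Tt (topo rho) (val p)) (val u) E"
proof -
 note P = pre_facts[OF chc_Lt p(1)]
 note u = chcD(2)[OF chc_Lt P(2) p(2)]
 have "val (p @ u @ tw E) = val p ** val u ** stab Y E" using P(1) u tw_facts[OF E] stab_closed[OF E] by (simp add: G.m_assoc)
 thus ?thesis using nxt_eq[OF P(2) val_closed[OF u]] C by simp
qed

text \<open>By \<open>pre_next\<close> the state is a function of the prefix read so far, so paths
  of the automaton are parsings.\<close>

lemma paths_LP:
 "(s, w) : paths LabT FinT \<Omega> ==> pre Lt rho p ==> s = (topo rho, Tt (topo rho) (val p)) ==> p @ w : LP Lt"
proof (induction arbitrary: rho p rule: paths.induct)
 case (final s w)
 hence "w : Lt (topo rho) (val p)" by (simp add: FinT_def Lt_def)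
 thus ?case by (rule LpsiI[OF chc_Lt final.prems(1)])
next
 case (step s u' s' w)
 have "u' : LabT (topo rho, Tt (topo rho) (val p)) s'" using step(2) step.prems(2) by simp
 then obtain E u where u: "E : edges Y" "fst s' = Some E" "esrc Y E = dtv Y (topo rho)" "u : lab (topo rho) (Tt (topo rho) (val p)) E (snd s')" "u' = u @ tw E"
  by (rule LabTE)
 have l: "u : Lt (topo rho) (val p)" "nbt (topo rho) (val u) E" "nxt (Tt (topo rho) (val p)) (val u) E = snd s'" using u(4) by (simp_all add: lab_def Lt_def)
 have sv: "esrc Y E = endv rho" using u(3) by simp
 obtain s1 where s1: "pre Lt ((s1, E) # rho) (p @ u @ tw E)" using pre_extend[OF chc_Lt step.prems(1) l(1) u(1) sv l(2)] by blast
 have "s' = (topo ((s1, E) # rho), Tt (topo ((s1, E) # rho)) (val (p @ u @ tw E)))"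
  using pre_next[OF step.prems(1) l(1) u(1) pre_facts(2)[OF chc_Lt s1]] l(3) u(2) by (simp add: prod_eq_iff)
 from step.IH[OF s1 this] show ?case using u(5) by simp
qed

lemma LP_paths:
 "pre Lt rho p ==> ((topo rho, Tt (topo rho) (val p)), w) : paths LabT FinT \<Omega> ==> ((None, Tt None gone), p @ w) : paths LabT FinT \<Omega>"
proof (induction arbitrary: w rule: pre.induct)
 case pre_Nil
 thus ?case by simp
next
 case (pre_Cons rho p u E s)
 let ?T = "Tt (Some E) (val (p @ u @ tw E))"
 note P = pre_facts[OF chc_Lt pre_Cons(1)]
 have "u : lab (topo rho) (Tt (topo rho) (val p)) E ?T"
  using pre_Cons(2,5) pre_next[OF pre_Cons(1,2,3,6)] by (simp add: lab_def Lt_def)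
 hence "u @ tw E : LabT (topo rho, Tt (topo rho) (val p)) (Some E, ?T)"
  by (rule LabTI[OF pre_Cons(3), rotated]) (use pre_Cons(4) in simp)
 moreover have "((Some E, ?T), w) : paths LabT FinT \<Omega>" using pre_Cons.prems by simp
 ultimately have "((topo rho, Tt (topo rho) (val p)), (u @ tw E) @ w) : paths LabT FinT \<Omega>"
  by (rule paths.step[OF OmegaI[OF P(2)]])
 from pre_Cons.IH[OF this] show ?case by simp
qed

lemma regular_LP_Lt: "regular_lang A (LP Lt)"
proof -
 have "LP Lt = {w. ((None, Tt None gone), w) : paths LabT FinT \<Omega>}"
 proof (intro equalityI subsetI CollectI)
  fix w assume "w : LP Lt"
  then obtain rho p u where p: "pre Lt rho p" "u : Lt (topo rho) (val p)" "w = p @ u" by (rule LpsiE[OF chc_Lt])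
  have "((topo rho, Tt (topo rho) (val p)), u) : paths LabT FinT \<Omega>"
   by (rule paths.final[OF OmegaI[OF pre_facts(2)[OF chc_Lt p(1)]]]) (use p(2) in \<open>simp add: FinT_def Lt_def\<close>)
  thus "((None, Tt None gone), w) : paths LabT FinT \<Omega>" unfolding p(3) by (rule LP_paths[OF p(1)])
 next
  fix w assume "w : {w. ((None, Tt None gone), w) : paths LabT FinT \<Omega>}"
  hence "((None, Tt None gone), w) : paths LabT FinT \<Omega>" by simp
  from paths_LP[OF this pre_Nil] show "w : LP Lt" by simp
 qed
 thus ?thesis using regular_paths_Lt by simp
qed

text \<open>A prefix of \<open>L\<close> is cut at the entry cosets of its stack and rebuilt from
  vertex segments, each of which follows its piece by \<open>KL\<close>. The values agree again
  after every edge, so the set does not depend on the depth.\<close>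

lemma follow:
 obtains S where "finite S"
  "!!rho p y u. val p : Cs rho ==> pf (p @ y) ==> u : Lt (topo rho) (val p) ==> val u = val y ==> af S gone u y"
  "!!rho p. pf p ==> val p : Cs rho ==> \<exists>p'. pre Lt rho p' & val p' = val p & af S gone p' p"
proof -
 define D where "D = insert gone ((%E. iv (stab Y E)) ` edges Y)"
 have "finite D" unfolding D_def using fin_edges by simp
 then obtain S1 where S1: "finite S1" "!!x h f p y u. x : EO ==> h : gcar ==> f : Fs x ==> val p = h ** f ==> pf (p @ y) ==>
  u : Lt x h ==> iv (f ** val y) ** val u : D ==> af S1 (iv f) y u" by (rule KL) blast
 obtain S2 where S2: "finite S2" "!!p y y1. pf (p @ y) ==> val y : FF ==> prefix y1 y ==> val y1 : S2" by (rule loop) blast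
 define S where "S = iv ` S1 \<union> S2 \<union> insert gone (stab Y ` edges Y)"
 have finS: "finite S" unfolding S_def using S1(1) S2(1) fin_edges by simp
 have A: "af S gone u y" if a: "val p : Cs rho" "pf (p @ y)" "u : Lt (topo rho) (val p)" "iv (val y) ** val u : D" for rho p y u
 proof -
  note x = CsD(4)[OF a(1)] and pc = CsD(1)[OF a(1)]
  have y: "y : lists A" by (rule pf_append(3)[OF a(2)])
  have "af S1 (iv gone) y u"
   by (rule S1(2)[OF x pc Fs_ops(1)[OF x] _ a(2,3)]) (use pc y a(4) in simp_all)
  from af_sym[OF this] have "af (iv ` S1) gone u y" by simp
  thus ?thesis by (rule af_mono) (auto simp: S_def)
 qed
 have F1: "af S gone u y" if a: "val p : Cs rho" "pf (p @ y)" "u : Lt (topo rho) (val p)" "val u = val y" for rho p y u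
  by (rule A[OF a(1-3)]) (use a(4) pf_append(3)[OF a(2)] in \<open>simp add: D_def\<close>)
 have F2: "\<exists>p'. pre Lt rho p' & val p' = val p & af S gone p' p" if "pf p" "val p : Cs rho" for rho p
  using that
 proof (induction rho arbitrary: p)
  case Nil
  have vp: "val p = gone" using Nil(2) by (simp add: Cs_Nil)
  have pA: "p : lists A" using Nil(1) by (simp add: pf_def)
  have gF: "gone : FF" unfolding FF_def by (rule UN_I[of None]) simp_all
  have "af S gone [] p"
  proof (rule af_prefixR[OF pA G.one_closed])
   fix v1 assume v1: "prefix v1 p"
   have "val v1 : S2" by (rule S2(2)[of "[]" p, OF _ _ v1]) (use Nil(1) vp gF in simp_all)
   thus "gone ** val v1 : S" using prefix_lists[OF v1 pA] by (simp add: S_def)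
  qed
  thus ?case using pre_Nil vp by (intro exI[of _ "[]"]) simp
 next
  case (Cons a rho)
  obtain s E where a: "a = (s, E)" by (cases a)
  have pC: "val p : Cs ((s, E) # rho)" using Cons.prems(2) a by simp
  have pA: "p : lists A" using Cons.prems(1) by (simp add: pf_def)
  have "stk (val p) (etgt Y E) = (s, E) # rho" "etgt Y E : verts Y" using CsD(2,5)[OF pC] by simp_all
  then obtain p1 y where p1: "p = p1 @ y" "val p1 : Cs rho" using bottleneck_from_one[OF pA, of "etgt Y E" rho] by (auto simp: suffix_Cons)
  have pfy: "pf (p1 @ y)" using Cons.prems(1) p1(1) by simp
  note l = pf_append[OF pfy]
  obtain p' where p': "pre Lt rho p'" "val p' = val p1" "af S gone p' p1" using Cons.IH[OF l(1) p1(2)] by blast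
  note E = Cs_parent(1,2)[OF pC] and V = CsD(5)[OF p1(2)]
  note t = tw_facts[OF E(1)] stab_closed[OF E(1)]
  obtain g where g: "g : GV (endv rho)" "val p = val p1 ** g ** stab Y E" "nbt (topo rho) g E" using Cs_parent(5)[OF pC p1(2)] by blast
  have gc: "g : gcar" by (rule GV_closed[OF V g(1)])
  have "val p1 ** val y = val p1 ** (g ** stab Y E)" using g(2) p1(1) l t gc by (simp add: G.m_assoc)
  hence vy: "val y = g ** stab Y E" using l t gc by simp
  have "g : val ` Lt (topo rho) (val p1)" using vlangD(3)[OF Lt_vlang[OF p1(2)]] g(1) by simp
  then obtain u where u: "u : Lt (topo rho) (val p1)" "val u = g" by auto
  have uA: "u : lists A" by (rule chcD(2)[OF chc_Lt p1(2) u(1)])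
  have "iv (val y) ** val u = iv (stab Y E)" unfolding vy u(2) using gc t by (simp add: grp_simps)
  hence "iv (val y) ** val u : D" unfolding D_def using E(1) by simp
  hence 1: "af S gone u y" by (rule A[OF p1(2) pfy u(1)])
  have "af S (stab Y E) (tw E) []"
  proof (rule af_prefixL[OF t(1,4)])
   fix t1 assume "prefix t1 (tw E)"
   hence "t1 = [] \<or> t1 = tw E" using t(3) by (cases "tw E") (auto simp: prefix_Cons)
   thus "iv (val t1) ** stab Y E : S"
   proof
    assume "t1 = []"
    thus ?thesis using t(4) E(1) by (simp add: S_def)
   next
    assume "t1 = tw E"
    thus ?thesis using t(2,4) by (simp add: S_def)
   qed
  qed
  moreover have "iv (val u) ** (gone ** val y) = stab Y E" unfolding vy u(2) using gc t by (simp add: inv_cancel1)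
  ultimately have "af S gone (u @ tw E) (y @ [])" using af_append[OF 1, of "tw E" "[]"] by simp
  moreover have "iv (val p') ** (gone ** val p1) = gone" using p'(2) l by simp
  ultimately have "af S gone (p' @ u @ tw E) (p1 @ y)" using af_append[OF p'(3), of "u @ tw E" y] by simp
  moreover have vv: "val (p' @ u @ tw E) = val p" using pre_facts(1)[OF chc_Lt p'(1)] uA t p'(2) u(2) g(2) gc l by (simp add: G.m_assoc)
  moreover have "pre Lt ((s, E) # rho) (p' @ u @ tw E)"
   by (rule pre_Cons[OF p'(1) _ E]) (use u p'(2) g(3) vv pC in simp_all)
  ultimately show ?case unfolding a p1(1)[symmetric] by blast
 qed
 show ?thesis by (rule that[OF finS]) (rule F1 F2; assumption)+
qed

text \<open>Each word of \<open>L\<close> is followed by a word of \<open>LP Lt\<close> with the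
  same value; other words of \<open>LP Lt\<close> are compared with that one by
  \<open>Lpsi_apre\<close>.\<close>

lemma Lt_fel_L: "fel gone (LP Lt) L"
 unfolding fel_def
proof (intro allI impI)
 fix D :: "('v,'e,'g) pi1elt set" assume D: "finite D"
 obtain S where S: "finite S"
  "!!rho p y u. val p : Cs rho ==> pf (p @ y) ==> u : Lt (topo rho) (val p) ==> val u = val y ==> af S gone u y"
  "!!rho p. pf p ==> val p : Cs rho ==> \<exists>p'. pre Lt rho p' & val p' = val p & af S gone p' p"
  by (rule follow, rule that, assumption, blast, blast)
 note ap = apreD[OF Lpsi_apre[OF ugood_Lt]]
 obtain S2 where S2: "finite S2" "!!u v. u : LP Lt ==> v : LP Lt ==> iv (val u) ** (gone ** val v) : D ==> af S2 gone u v"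
  by (rule felE[OF ap(3) D]) blast
 have "af (S2 ## S) gone w v" if w: "w : LP Lt" "v : L" "iv (val w) ** (gone ** val v) : D" for w v
 proof -
  have vA: "v : lists A" using w(2) L_facts(1) by blast
  let ?rho = "stk (val v) (base Y)"
  have e: "endv ?rho = base Y" by (rule Fam_stk(2)[OF val_closed[OF vA] base_in])
  obtain p y where p: "v = p @ y" "val p : Cs ?rho" using bottleneck_from_one[OF vA base_in, of ?rho] by auto
  have pfy: "pf (p @ y)" using pf_word[of p y] w(2) p(1) by simp
  note l = pf_append[OF pfy]
  obtain p' where p': "pre Lt ?rho p'" "val p' = val p" "af S gone p' p" using S(3)[OF l(1) p(2)] by blast
  have "stk (val p) (base Y) = ?rho" using CsD(2)[OF p(2)] e by simp
  hence "iv (val p) ** val v : GV (base Y)" by (rule stk_eq[OF CsD(1)[OF p(2)] val_closed[OF vA] base_in])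
  hence "val y : GV (base Y)" using p(1) l by (simp add: inv_cancel1)
  hence "val y : val ` Lt (topo ?rho) (val p)" using vlangD(3)[OF Lt_vlang[OF p(2)]] e by simp
  then obtain u where u: "u : Lt (topo ?rho) (val p)" "val u = val y" by auto
  have uA: "u : lists A" by (rule chcD(2)[OF chc_Lt p(2) u(1)])
  have 1: "af S gone u y" by (rule S(2)[OF p(2) pfy u])
  have "iv (val p') ** (gone ** val p) = gone" using p'(2) l by simp
  hence 2: "af S gone (p' @ u) v" using af_append[OF p'(3), of u y] 1 p(1) by simp
  have m: "p' @ u : LP Lt" by (rule LpsiI[OF chc_Lt p'(1)]) (use u(1) p'(2) in simp)
  have "val (p' @ u) = val v" using pre_facts(1)[OF chc_Lt p'(1)] uA p'(2) u(2) p(1) l by simp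
  hence "af S2 gone w (p' @ u)" using S2(2)[OF w(1) m] w(3) by simp
  from af_trans[OF this 2] show ?thesis by simp
 qed
 moreover have "finite (S2 ## S)" by (rule finite_set_mult[OF S2(1) S(1)])
 ultimately show "\<exists>S. finite S & (\<forall>u\<in>LP Lt. \<forall>v\<in>L. iv (val u) ** (gone ** val v) : D --> af S gone u v)" by blast
qed

lemma psi_class: "deploy_class Y A ev tlet psi = aclass (pi1 Y) A ev L"
proof -
 note P = apreD[OF Sm(3)[OF psi_deployment]] and Q = apreD[OF Lpsi_apre[OF ugood_Lt]]
 have "fel (gone ** gone) (LP (Sm psi)) L"
  by (rule fel_transG[OF deploy_class_fel[OF psi_deployment psi_choice finite_range_Lt] Lt_fel_L P(1) Q(1) L_facts(1) G.one_closed G.one_closed Q(2)])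
 hence f: "fel gone (LP (Sm psi)) L" by simp
 have "apre L" using L_facts by (simp add: apre_def)
 thus ?thesis unfolding deploy_class_def using aclass_eqI[OF Sm(3)[OF psi_deployment] _ f] by blast
qed

end

lemma (in cgog) deployment_of_sync:
 assumes "sync_aut (pi1 Y) A ev L"
 obtains \<psi> where "regular_deployment Y A ev tlet \<psi>" "!!rho h. h : Cs rho ==> \<psi> (topo rho) h : SAC (endv rho)"
  "deploy_class Y A ev tlet \<psi> = aclass (pi1 Y) A ev L"
proof -
 interpret T: sonto Y A ainv ev tlet L by unfold_locales (rule assms)
 obtain SS where SS: "finite SS" "SS <= gcar" "gone : SS"
  "!!p rho y y1. val p : Cs rho ==> p @ y : L ==> val y : GV (endv rho) ==> prefix y1 y ==> \<exists>g\<in>GV (endv rho). iv (val y1) ** g : SS"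
  by (rule T.QC, rule that, assumption, assumption, assumption, assumption)
 have fB: "finite ((iv ` SS ## ev ` A) ## SS)"
  by (intro finite_set_mult finite_imageI SS(1) finite_A)
 obtain N where N: "!!V k. V : verts Y ==> k : GV V ==> k : (iv ` SS ## ev ` A) ## SS ==>
  \<exists>b\<in>lists (VA V). length b = N & val b = k" "N > 0" using T.blocks[OF fB] by metis
 interpret K: strk Y A ainv ev tlet L SS N
  by unfold_locales (rule SS(1), rule SS(2), rule SS(3), rule SS(4), assumption+, rule N(1), assumption+, rule N(2))
 have "regular_deployment Y A ev tlet K.psi" unfolding regular_deployment_def choice_iff
  using K.psi_deployment K.psi_choice K.regular_LP_Lt by blast
 thus ?thesis using that K.psi_facts(3) K.psi_class by blast
qed

theorem theorem3p8:
  fixes Y :: "('v,'e,'g,'f) gog" and A :: "'a set" and ainv :: "'a \<Rightarrow> 'a"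
    and ev :: "'a \<Rightarrow> ('v,'e,'g) pi1elt" and tlet :: "'e \<Rightarrow> 'a"
  assumes "graph_of_groups Y"
    and "convenient_alphabet Y A ainv ev tlet"
  shows "bij_betw (deploy_class Y A ev tlet)
           {\<psi>. regular_deployment Y A ev tlet \<psi> \<and>
                (\<forall>(x, h)\<in>deploy_dom Y.
                   \<psi> x h \<in> SAClasses (vgrp Y (dtv Y x)) (vletters Y A ev (dtv Y x)) (vev Y ev (dtv Y x)))}
           (SAClasses (pi1 Y) A ev)"
proof -
 interpret cgog Y A ainv ev tlet by unfold_locales (rule assms)+
 let ?P = "{\<psi>. regular_deployment Y A ev tlet \<psi> & (\<forall>(x, h)\<in>deploy_dom Y. \<psi> x h : SAC (dtv Y x))}"
 have dom: "(\<forall>(x, h)\<in>deploy_dom Y. \<psi> x h : SAC (dtv Y x)) \<longleftrightarrow> (\<forall>rho h. h : Cs rho --> \<psi> (topo rho) h : SAC (endv rho))"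
  for \<psi> :: "'e option => ('v,'e,'g) pi1elt => 'a list set set"
 proof -
  have "(\<forall>(x, h)\<in>deploy_dom Y. \<psi> x h : SAC (dtv Y x)) \<longleftrightarrow> (\<forall>x h. (x, h) : deploy_dom Y --> \<psi> x h : SAC (dtv Y x))" by auto
  also have "\<dots> \<longleftrightarrow> (\<forall>rho h. h : Cs rho --> \<psi> (topo rho) h : SAC (dtv Y (topo rho)))" unfolding deploy_dom_iff by blast
  finally show ?thesis by (simp only: dtv_simps)
 qed
 have d: "deployment Y A ev \<psi>" if "\<psi> : ?P" for \<psi> using that by (simp add: regular_deployment_def)
 have into: "deploy_class Y A ev tlet \<psi> : SAClasses (pi1 Y) A ev" if p: "\<psi> : ?P" for \<psi>
 proof -
  have s: "\<forall>rho h. h : Cs rho --> \<psi> (topo rho) h : SAC (endv rho)" using p dom[of \<psi>] by blast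
  obtain Lc where Lc: "choice \<psi> Lc" "regular_lang A (LP Lc)" using p unfolding regular_deployment_def choice_iff by blast
  interpret sdep Y A ainv ev tlet \<psi> Lc
   by unfold_locales (rule d[OF p], rule Lc(1), rule Lc(2), rule s[rule_format], assumption)
  show ?thesis by (rule deploy_class_SA)
 qed
 have "inj_on (deploy_class Y A ev tlet) ?P"
 proof (rule inj_onI)
  fix \<psi> \<phi> assume p: "\<psi> : ?P" "\<phi> : ?P" and e: "deploy_class Y A ev tlet \<psi> = deploy_class Y A ev tlet \<phi>"
  \<comment> \<open>Classes in the image have a synchronous member, which provides the witness that
    \<open>deploy_class_inj\<close> asks for.\<close>
  obtain L where "L : deploy_class Y A ev tlet \<psi>" using into[OF p(1)] by (auto simp: SAClasses_def)
  thus "\<psi> = \<phi>" by (rule deploy_class_inj[OF d[OF p(1)] d[OF p(2)] e])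
 qed
 moreover have "deploy_class Y A ev tlet ` ?P = SAClasses (pi1 Y) A ev"
 proof (intro equalityI subsetI)
  fix c assume "c : deploy_class Y A ev tlet ` ?P"
  thus "c : SAClasses (pi1 Y) A ev" using into by (elim imageE) simp
 next
  fix c assume "c : SAClasses (pi1 Y) A ev"
  then obtain L where L: "c : AClasses (pi1 Y) A ev" "L : c" "sync_aut (pi1 Y) A ev L" by (auto simp: SAClasses_def)
  obtain \<psi> where psi: "regular_deployment Y A ev tlet \<psi>" "!!rho h. h : Cs rho ==> \<psi> (topo rho) h : SAC (endv rho)"
   "deploy_class Y A ev tlet \<psi> = aclass (pi1 Y) A ev L" by (rule deployment_of_sync[OF L(3)]) blast
  have "\<psi> : ?P" using psi(1,2) dom[of \<psi>] by blast
  moreover have "c = deploy_class Y A ev tlet \<psi>" using psi(3) AClassesD(2)[OF L(1,2)] by simp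
  ultimately show "c : deploy_class Y A ev tlet ` ?P" by blast
 qed
 ultimately show ?thesis unfolding bij_betw_def by blast
qed

end
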